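(* Let $\xi_1,\xi_2\in L^2(\mathcal F_T)$ and let $f_1,f_2:\Omega\times[0,T]\times\mathbb R\times\mathbb R^N\to\mathbb R$ be predictable drivers such that, for $i=1,2$, the one-dimensional BSDE $$Y^{(i)}_t=\xi_i+\int_t^T f_i(s,Y^{(i)}_s,Z^{(i)}_s)\,ds-\int_t^T (Z^{(i)}_s)'\,dM_s,\qquad t\in[0,T],$$ has a unique solution $(Y^{(i)},Z^{(i)})$. Assume that there are constants $l_1,l_2>0$ such that for all $t\in[0,T]$, $y_1,y_2\in\mathbb R$, $z_1,z_2\in\mathbb R^N$, $$|f_1(t,y_1,z_1)-f_1(t,y_2,z_2)|\le l_1|y_1-y_2|+l_2\|z_1-z_2\|_{X_t},$$ and that $$l_2\,\|\Psi_t^\dagger\|_{N\times N}\sqrt{6m}\le 1\quad\text{for any }t\in[0,T].$$ If $\xi_1\le\xi_2$ a.s. and $f_1(t,Y^{(2)}_t,Z^{(2)}_t)\le f_2(t,Y^{(2)}_t,Z^{(2)}_t)$ a.e. (in $t$), a.s., then $$P\big(Y^{(1)}_t\le Y^{(2)}_t\ \text{for any }t\in[0,T]\big)=1.$$ Moreover, if in addition the strict inequality $l_2\|\Psi_t^\dagger\|_{N\times N}\sqrt{6m}<1$ holds for any $t\in[0,T]$, then $$Y^{(1)}_0=Y^{(2)}_0\iff \Big(f_1(t,Y^{(2)}_t,Z^{(2)}_t)=f_2(t,Y^{(2)}_t,Z^{(2)}_t)\ \text{a.e., a.s., and }\ \xi_1=\xi_2\ \text{a.s.}\Big).$$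
   Context: Setting: $X=\{X_t,t\ge0\}$ is a finite-state, right-continuous with left limits (RCLL) Markov chain on a probability space $(\Omega,\mathcal F,P)$ with state space the standard unit vectors $\{e_1,\dots,e_N\}\subset\mathbb R^N$, with rate matrix $A=\{A_t,t\ge0\}$ having bounded entries, so that $X_t=X_0+\int_0^tA_sX_s\,ds+M_t$, where $M$ is an $\mathbb R^N$-valued square-integrable martingale. $\mathcal F_t=\sigma\{X_s;0\le s\le t\}$, and $T>0$ is fixed. Prime denotes transpose. $|\cdot|_N$ is the Euclidean norm and $\|\psi\|_{N\times N}=\sqrt{\mathrm{Tr}(\psi'\psi)}$ for matrices. $m>0$ is a constant with $\|A_t\|_{N\times N}\le m$ for all $t\in[0,T]$. $\Psi_t=\mathrm{diag}(A_tX_t)-\mathrm{diag}(X_t)A_t'-A_t\,\mathrm{diag}(X_t)$ (so $d\langle X,X\rangle_t=\Psi_t\,dt$), $\Psi_t^\dagger$ is its Moore-Penrose pseudoinverse, and the semi-norm $\|\cdot\|_{X_t}$ on $\mathbb R^N$ is given by $\|C\|_{X_t}^2=C'\Psi_tC$. $L^2(\mathcal F_t)$ is the set of real-valued $\mathcal F_t$-measurable random variables $\xi$ with $E|\xi|^2<\infty$. A solution $(Y,Z)$ of a BSDE $Y_t=\xi+\int_t^Tf(s,Y_s,Z_s)ds-\int_t^TZ_s'dM_s$ consists of a real adapted RCLL process $Y$ with $E\int_0^T|Y_s|^2ds<\infty$ and a predictable $\mathbb R^N$-valued process $Z$ with $E\int_0^T\|Z_s\|^2_{X_s}ds<\infty$;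 uniqueness means up to indistinguishability for $Y$ and up to $d\langle M,M\rangle_t\times P$-a.s. equality for $Z$. *)

theory Defs
  imports "HOL-Probability.Probability"
begin

section \<open>Matrices\<close>

definition diag_mat :: "real ^ 'n \<Rightarrow> real ^ 'n ^ 'n" where
  "diag_mat v = (\<chi> i j. if i = j then v $ i else 0)"

definition frob_norm :: "real ^ 'n ^ 'n \<Rightarrow> real" where
  "frob_norm B = sqrt (trace (transpose B ** B))"

text \<open>The four Penrose equations determine the pseudoinverse uniquely.\<close>

definition is_pseudoinverse :: "real ^ 'n ^ 'n \<Rightarrow> real ^ 'n ^ 'n \<Rightarrow> bool" where
  "is_pseudoinverse B C \<longleftrightarrow>
     B ** C ** B = B \<and> C ** B ** C = C \<and>
     transpose (B ** C) = B ** C \<and> transpose (C ** B) = C ** B"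

definition pseudoinverse :: "real ^ 'n ^ 'n \<Rightarrow> real ^ 'n ^ 'n" where
  "pseudoinverse B = (THE C. is_pseudoinverse B C)"


section \<open>Paths, filtrations, martingales\<close>

definition rcll_on :: "real set \<Rightarrow> (real \<Rightarrow> 'a::topological_space) \<Rightarrow> bool" where
  "rcll_on S g \<longleftrightarrow>
     (\<forall>t\<in>S. continuous (at t within (S \<inter> {t..})) g \<and>
            (\<exists>l. (g \<longlongrightarrow> l) (at t within (S \<inter> {..<t}))))"

definition natural_filtration ::
  "'w measure \<Rightarrow> (real \<Rightarrow> 'w \<Rightarrow> 'a::topological_space) \<Rightarrow> real \<Rightarrow> 'w measure" where
  "natural_filtration P X t =
     sigma (space P) {X s -` B \<inter> space P | s B. 0 \<le> s \<and> s \<le> t \<and> B \<in> sets borel}"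

definition predictable_sigma :: "'w measure \<Rightarrow> (real \<Rightarrow> 'w measure) \<Rightarrow> real \<Rightarrow> (real \<times> 'w) measure" where
  "predictable_sigma P F T =
     sigma ({0..T} \<times> space P)
       ({{0} \<times> B | B. B \<in> sets (F 0)} \<union>
        {{s<..t} \<times> B | s t B. 0 \<le> s \<and> s \<le> t \<and> t \<le> T \<and> B \<in> sets (F s)})"

definition predictable_process ::
  "'w measure \<Rightarrow> (real \<Rightarrow> 'w measure) \<Rightarrow> real \<Rightarrow> (real \<Rightarrow> 'w \<Rightarrow> 'a::topological_space) \<Rightarrow> bool" where
  "predictable_process P F T Z \<longleftrightarrow>
     (\<lambda>(t, \<omega>). Z t \<omega>) \<in> borel_measurable (predictable_sigma P F T)"

definition predictable_driver ::
  "'w measure \<Rightarrow> (real \<Rightarrow> 'w measure) \<Rightarrow> real \<Rightarrow> ('w \<Rightarrow> real \<Rightarrow> real \<Rightarrow> real ^ 'n \<Rightarrow> real) \<Rightarrow> bool" where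
  "predictable_driver P F T f \<longleftrightarrow>
     (\<lambda>((t, \<omega>), y, z). f \<omega> t y z)
       \<in> borel_measurable (predictable_sigma P F T \<Otimes>\<^sub>M (borel \<Otimes>\<^sub>M borel))"

definition square_integrable_martingale ::
  "'w measure \<Rightarrow> (real \<Rightarrow> 'w measure) \<Rightarrow> (real \<Rightarrow> 'w \<Rightarrow> real ^ 'n) \<Rightarrow> bool" where
  "square_integrable_martingale P F V \<longleftrightarrow>
     (\<forall>t\<ge>0. V t \<in> borel_measurable (F t)) \<and>
     (\<forall>t\<ge>0. integrable P (\<lambda>\<omega>. (norm (V t \<omega>))\<^sup>2)) \<and>
     (\<forall>s t i. 0 \<le> s \<longrightarrow> s \<le> t \<longrightarrow>
        (AE \<omega> in P. real_cond_exp P (F s) (\<lambda>\<omega>. V t \<omega> $ i) \<omega> = V s \<omega> $ i))"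


section \<open>The Markov chain\<close>

text \<open>
  The chain evolves by \<open>dX = A X dt + dM\<close>, so \<open>A $ i $ j\<close> is the rate of jumping from
  state \<open>j\<close> to state \<open>i\<close> and it is the columns that sum to zero.
\<close>

definition rate_matrix :: "(real \<Rightarrow> real ^ 'n ^ 'n) \<Rightarrow> bool" where
  "rate_matrix A \<longleftrightarrow>
     set_borel_measurable borel {0..} A \<and>
     (\<forall>t\<ge>0. \<forall>i j. i \<noteq> j \<longrightarrow> 0 \<le> A t $ i $ j) \<and>
     (\<forall>t\<ge>0. \<forall>j. (\<Sum>i\<in>UNIV. A t $ i $ j) = 0) \<and>
     (\<exists>c. \<forall>t\<ge>0. \<forall>i j. \<bar>A t $ i $ j\<bar> \<le> c)"

definition chain_martingale ::
  "(real \<Rightarrow> 'w \<Rightarrow> real ^ 'n) \<Rightarrow> (real \<Rightarrow> real ^ 'n ^ 'n) \<Rightarrow> real \<Rightarrow> 'w \<Rightarrow> real ^ 'n" where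
  "chain_martingale X A t \<omega> = X t \<omega> - X 0 \<omega> - (LINT s:{0..t}|lborel. A s *v X s \<omega>)"

text \<open>
  The last assumption expresses that \<open>A\<close> is the family of rate matrices of the
  (time-inhomogeneous) Markov process \<open>X\<close>: taking conditional expectations it gives the
  forward equation for the conditional law of \<open>X t\<close> given the past up to time \<open>s\<close>.
\<close>

locale markov_chain = prob_space P for P :: "'w measure" +
  fixes X :: "real \<Rightarrow> 'w \<Rightarrow> real ^ 'n"
    and A :: "real \<Rightarrow> real ^ 'n ^ 'n"
  assumes X_measurable: "\<And>t. 0 \<le> t \<Longrightarrow> X t \<in> borel_measurable P"
    and X_states: "\<And>t \<omega>. 0 \<le> t \<Longrightarrow> \<omega> \<in> space P \<Longrightarrow> X t \<omega> \<in> range (\<lambda>i. axis i 1)"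
    and X_rcll: "\<And>\<omega>. \<omega> \<in> space P \<Longrightarrow> rcll_on {0..} (\<lambda>t. X t \<omega>)"
    and markov_property: "\<And>s t i. 0 \<le> s \<Longrightarrow> s \<le> t \<Longrightarrow>
          AE \<omega> in P. real_cond_exp P (natural_filtration P X s) (indicator {\<omega>. X t \<omega> = axis i 1}) \<omega>
                   = real_cond_exp P (vimage_algebra (space P) (X s) borel)
                       (indicator {\<omega>. X t \<omega> = axis i 1}) \<omega>"
    and rates: "rate_matrix A"
    and martingale: "square_integrable_martingale P (natural_filtration P X) (chain_martingale X A)"

definition Psi ::
  "(real \<Rightarrow> 'w \<Rightarrow> real ^ 'n) \<Rightarrow> (real \<Rightarrow> real ^ 'n ^ 'n) \<Rightarrow> real \<Rightarrow> 'w \<Rightarrow> real ^ 'n ^ 'n" where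
  "Psi X A t \<omega> = diag_mat (A t *v X t \<omega>) - diag_mat (X t \<omega>) ** transpose (A t)
                  - A t ** diag_mat (X t \<omega>)"

definition chain_seminorm ::
  "(real \<Rightarrow> 'w \<Rightarrow> real ^ 'n) \<Rightarrow> (real \<Rightarrow> real ^ 'n ^ 'n) \<Rightarrow> real \<Rightarrow> 'w \<Rightarrow> real ^ 'n \<Rightarrow> real" where
  "chain_seminorm X A t \<omega> C = sqrt (C \<bullet> (Psi X A t \<omega> *v C))"

definition mean_energy ::
  "'w measure \<Rightarrow> (real \<Rightarrow> 'w \<Rightarrow> real ^ 'n) \<Rightarrow> (real \<Rightarrow> real ^ 'n ^ 'n) \<Rightarrow> real
    \<Rightarrow> (real \<Rightarrow> 'w \<Rightarrow> real ^ 'n) \<Rightarrow> ennreal" where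
  "mean_energy P X A T Z =
     (\<integral>\<^sup>+\<omega>. (\<integral>\<^sup>+s\<in>{0..T}. ennreal ((chain_seminorm X A s \<omega> (Z s \<omega>))\<^sup>2) \<partial>lborel) \<partial>P)"


section \<open>The stochastic integral with respect to the chain martingale\<close>

text \<open>
  Elementary integrands are \<open>\<Sum>k<n. \<zeta> k * 1_(p k, p (k + 1)]\<close> with \<open>\<zeta> k\<close> bounded and
  measurable with respect to the filtration at time \<open>p k\<close>.
\<close>

definition elementary_data ::
  "(real \<Rightarrow> 'w measure) \<Rightarrow> real \<Rightarrow> nat \<Rightarrow> (nat \<Rightarrow> real) \<Rightarrow> (nat \<Rightarrow> 'w \<Rightarrow> real ^ 'n) \<Rightarrow> bool" where
  "elementary_data F T n p \<zeta> \<longleftrightarrow>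
     0 \<le> p 0 \<and> p n \<le> T \<and>
     (\<forall>k<n. p k \<le> p (Suc k) \<and> \<zeta> k \<in> borel_measurable (F (p k)) \<and>
            (\<exists>c. \<forall>\<omega>\<in>space (F (p k)). norm (\<zeta> k \<omega>) \<le> c))"

definition elementary_process ::
  "nat \<Rightarrow> (nat \<Rightarrow> real) \<Rightarrow> (nat \<Rightarrow> 'w \<Rightarrow> real ^ 'n) \<Rightarrow> real \<Rightarrow> 'w \<Rightarrow> real ^ 'n" where
  "elementary_process n p \<zeta> t \<omega> = (\<Sum>k<n. indicator {p k<..p (Suc k)} t *\<^sub>R \<zeta> k \<omega>)"

definition elementary_integral ::
  "(real \<Rightarrow> 'w \<Rightarrow> real ^ 'n) \<Rightarrow> nat \<Rightarrow> (nat \<Rightarrow> real) \<Rightarrow> (nat \<Rightarrow> 'w \<Rightarrow> real ^ 'n)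
    \<Rightarrow> real \<Rightarrow> 'w \<Rightarrow> real" where
  "elementary_integral V n p \<zeta> t \<omega> =
     (\<Sum>k<n. \<zeta> k \<omega> \<bullet> (V (min t (p (Suc k))) \<omega> - V (min t (p k)) \<omega>))"

text \<open>
  \<open>I\<close> is (a version with almost surely RCLL paths of) the Ito integral process
  \<open>I t = \<integral>\<^sub>0\<^sup>t Z' dM\<close>, i.e. the \<open>L\<^sup>2\<close>-limit of integrals of elementary integrands that approximate
  \<open>Z\<close> in \<open>L\<^sup>2\<close> of \<open>d<M,M> \<times> P\<close>. It is determined by \<open>Z\<close> up to indistinguishability.
\<close>

definition is_stochastic_integral ::
  "'w measure \<Rightarrow> (real \<Rightarrow> 'w \<Rightarrow> real ^ 'n) \<Rightarrow> (real \<Rightarrow> real ^ 'n ^ 'n) \<Rightarrow> real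
    \<Rightarrow> (real \<Rightarrow> 'w \<Rightarrow> real ^ 'n) \<Rightarrow> (real \<Rightarrow> 'w \<Rightarrow> real) \<Rightarrow> bool" where
  "is_stochastic_integral P X A T Z I \<longleftrightarrow>
     (\<forall>t\<in>{0..T}. I t \<in> borel_measurable P) \<and>
     (AE \<omega> in P. rcll_on {0..T} (\<lambda>t. I t \<omega>)) \<and>
     (\<exists>n p \<zeta>.
        (\<forall>j. elementary_data (natural_filtration P X) T (n j) (p j) (\<zeta> j)) \<and>
        (\<lambda>j. mean_energy P X A T (\<lambda>t \<omega>. elementary_process (n j) (p j) (\<zeta> j) t \<omega> - Z t \<omega>))
          \<longlonglongrightarrow> 0 \<and>
        (\<forall>t\<in>{0..T}.
          (\<lambda>j. \<integral>\<^sup>+\<omega>. ennreal ((elementary_integral (chain_martingale X A) (n j) (p j) (\<zeta> j) t \<omega>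
                                - I t \<omega>)\<^sup>2) \<partial>P) \<longlonglongrightarrow> 0))"


section \<open>Backward stochastic differential equations\<close>

definition bsde_solution ::
  "'w measure \<Rightarrow> (real \<Rightarrow> 'w \<Rightarrow> real ^ 'n) \<Rightarrow> (real \<Rightarrow> real ^ 'n ^ 'n) \<Rightarrow> real
    \<Rightarrow> ('w \<Rightarrow> real \<Rightarrow> real \<Rightarrow> real ^ 'n \<Rightarrow> real) \<Rightarrow> ('w \<Rightarrow> real)
    \<Rightarrow> (real \<Rightarrow> 'w \<Rightarrow> real) \<Rightarrow> (real \<Rightarrow> 'w \<Rightarrow> real ^ 'n) \<Rightarrow> bool" where
  "bsde_solution P X A T f \<xi> Y Z \<longleftrightarrow>
     (\<forall>t\<in>{0..T}. Y t \<in> borel_measurable (natural_filtration P X t)) \<and>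
     (AE \<omega> in P. rcll_on {0..T} (\<lambda>t. Y t \<omega>)) \<and>
     (\<integral>\<^sup>+\<omega>. (\<integral>\<^sup>+s\<in>{0..T}. ennreal (\<bar>Y s \<omega>\<bar>\<^sup>2) \<partial>lborel) \<partial>P) < \<infinity> \<and>
     predictable_process P (natural_filtration P X) T Z \<and>
     mean_energy P X A T Z < \<infinity> \<and>
     (AE \<omega> in P. set_integrable lborel {0..T} (\<lambda>s. f \<omega> s (Y s \<omega>) (Z s \<omega>))) \<and>
     (\<exists>I. is_stochastic_integral P X A T Z I \<and>
        (AE \<omega> in P. \<forall>t\<in>{0..T}.
           Y t \<omega> = \<xi> \<omega> + (LINT s:{t..T}|lborel. f \<omega> s (Y s \<omega>) (Z s \<omega>)) - (I T \<omega> - I t \<omega>)))"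

text \<open>
  \<open>d<M,M> = \<Psi> dt\<close> is matrix valued, so two integrands agree almost everywhere with respect to
  \<open>d<M,M> \<times> P\<close> iff their difference \<open>D\<close> satisfies \<open>D' \<Psi> D = 0\<close> almost everywhere with respect
  to \<open>dt \<times> P\<close>. (\<open>Z\<close> itself is never unique: adding multiples of \<open>(1,...,1)\<close> changes nothing.)
\<close>

definition bsde_unique_solution ::
  "'w measure \<Rightarrow> (real \<Rightarrow> 'w \<Rightarrow> real ^ 'n) \<Rightarrow> (real \<Rightarrow> real ^ 'n ^ 'n) \<Rightarrow> real
    \<Rightarrow> ('w \<Rightarrow> real \<Rightarrow> real \<Rightarrow> real ^ 'n \<Rightarrow> real) \<Rightarrow> ('w \<Rightarrow> real)
    \<Rightarrow> (real \<Rightarrow> 'w \<Rightarrow> real) \<Rightarrow> (real \<Rightarrow> 'w \<Rightarrow> real ^ 'n) \<Rightarrow> bool" where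
  "bsde_unique_solution P X A T f \<xi> Y Z \<longleftrightarrow>
     bsde_solution P X A T f \<xi> Y Z \<and>
     (\<forall>Y' Z'. bsde_solution P X A T f \<xi> Y' Z' \<longrightarrow>
        (AE \<omega> in P. \<forall>t\<in>{0..T}. Y' t \<omega> = Y t \<omega>) \<and>
        (AE (t, \<omega>) in lborel \<Otimes>\<^sub>M P.
           t \<in> {0..T} \<longrightarrow> chain_seminorm X A t \<omega> (Z' t \<omega> - Z t \<omega>) = 0))"

end

theory Submission
  imports Defs
begin

text \<open>
  The difference \<open>y = Y1 - Y2\<close> ends in \<open>\<xi>1 - \<xi>2 \<le> 0\<close>. By the Lipschitz condition and the sign condition
  on the drivers along the second solution, it satisfies
  \<open>y\<^sub>b \<ge> y\<^sub>a - \<integral> (l1 |y| + l2 |z|) dr + \<integral> z' dM\<close> on every interval, where \<open>z = Z1 - Z2\<close>. To show \<open>y \<le> 0\<close>, one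
  wants an increasing function \<open>\<phi>\<close> for which \<open>exp (\<kappa> t) E \<phi> (y\<^sub>t)\<close> increases in \<open>t\<close>, as then its final
  value bounds all others. The process \<open>y\<close> jumps by \<open>d\<^sub>j = z \<bullet> (e\<^sub>j - X)\<close> when the chain jumps to \<open>e\<^sub>j\<close>,
  at a rate \<open>a\<^sub>j\<close>, so by Ito's formula this monotonicity holds if, for all \<open>v\<close> and \<open>z\<close>,
  \<open>\<Sum>\<^sub>j a\<^sub>j (\<phi> (v + d\<^sub>j) - \<phi> v - \<phi>' v d\<^sub>j) \<ge> \<phi>' v (l1 |v| + l2 |z|) - \<kappa> \<phi> v\<close>.
  The locale \<open>drift_test\<close> states this condition, strengthened by a gain \<open>\<gamma> |z|\<close> on the right, and
  \<open>weighted_mean_increases\<close> draws the conclusion. It replaces Ito's formula by an expansion over short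
  intervals, where all that is used about the stochastic integral is that its increments are
  orthogonal to the past and have mean squares bounded by the energy of the integrand.

  The smallness condition is what makes the jumps beat the drift. Since \<open>|z|\<^sup>2 = \<Sum>\<^sub>j a\<^sub>j d\<^sub>j\<^sup>2\<close> by
  \<open>chain_seminorm_eq\<close>, one has \<open>|z| \<le> \<Sum>\<^sub>j sqrt a\<^sub>j |d\<^sub>j|\<close>. Evaluating \<open>\<Psi> \<Psi>\<^sup>\<dagger> \<Psi> = \<Psi>\<close> at \<open>e\<^sub>j\<close> gives
  \<open>1 \<le> 2 a\<^sub>j |\<Psi>\<^sup>\<dagger>|\<close> for every possible jump (\<open>rate_pseudoinverse\<close>), so a small \<open>l2 |\<Psi>\<^sup>\<dagger>|\<close> means that all
  positive rates are large: \<open>l2\<^sup>2 \<le> 2/3 a\<^sub>j\<close>. Together, \<open>l2 |z|\<close> is at most \<open>sqrt (2/3)\<close> times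
  \<open>\<Sum>\<^sub>j a\<^sub>j |d\<^sub>j|\<close> (\<open>small_imp_dominated\<close>), with a constant strictly below one even if the smallness condition
  holds with equality.

  For the comparison, take for \<open>\<phi> v\<close> the square of the positive part of \<open>v\<close>, whose final mean is zero
  (\<open>nonpositive\<close>). For the strict part, let \<open>y\<^sub>0 = 0\<close> and take \<open>\<phi> v = - sqrt (\<epsilon> - v)\<close> on \<open>v \<le> 0\<close>. The condition
  holds with a \<open>\<kappa>\<close> independent of \<open>\<epsilon>\<close>, because the square root changes its slope by any given factor
  over distances comparable to \<open>\<epsilon> - v\<close>. Hence \<open>E sqrt (\<epsilon> - y\<^sub>t)\<close> is at most a constant times \<open>sqrt \<epsilon>\<close>, and
  \<open>y = 0\<close> (\<open>zero_if_zero_at_start\<close>). With \<open>y = 0\<close> the gain is of order \<open>|z| / sqrt \<epsilon>\<close>, while the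
  means stay of order \<open>sqrt \<epsilon>\<close>, so \<open>|z| = 0\<close> (\<open>rigid_if_zero_at_start\<close>). Then the Lipschitz bounds vanish
  and the two drivers agree along the second solution. Conversely, if drivers and terminal values
  agree there, then the second solution also solves the first equation, and uniqueness applies.
\<close>

section \<open>Symmetric matrices and their pseudoinverse\<close>

lemma inner_matrix_vector_transpose:
  fixes B :: "real ^ 'n ^ 'n"
  shows "x \<bullet> (B *v y) = (transpose B *v x) \<bullet> y"
  by (metis dot_lmul_matrix transpose_matrix_vector inner_commute)

lemma frob_norm_eq_L2: "frob_norm B = sqrt (\<Sum>i\<in>UNIV. \<Sum>j\<in>UNIV. (B $ i $ j)\<^sup>2)"
proof -
  have "trace (transpose B ** B) = (\<Sum>j\<in>UNIV. \<Sum>i\<in>UNIV. (B $ i $ j)\<^sup>2)"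
    by (simp add: trace_def matrix_matrix_mult_def transpose_def power2_eq_square)
  also have "\<dots> = (\<Sum>i\<in>UNIV. \<Sum>j\<in>UNIV. (B $ i $ j)\<^sup>2)" by (rule sum.swap)
  finally show ?thesis by (simp add: frob_norm_def)
qed

lemma frob_norm_nonneg: "0 \<le> frob_norm B"
  by (simp add: frob_norm_eq_L2 sum_nonneg)

lemma entry_le_frob_norm: "\<bar>B $ i $ j\<bar> \<le> frob_norm B"
proof -
  have "(B $ i $ j)\<^sup>2 \<le> (\<Sum>j\<in>UNIV. (B $ i $ j)\<^sup>2)"
    by (rule member_le_sum) auto
  also have "\<dots> \<le> (\<Sum>i\<in>UNIV. \<Sum>j\<in>UNIV. (B $ i $ j)\<^sup>2)"
    by (rule member_le_sum[of i UNIV "\<lambda>i. \<Sum>j\<in>UNIV. (B $ i $ j)\<^sup>2"]) (auto intro: sum_nonneg)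
  finally show ?thesis
    by (metis frob_norm_eq_L2 real_sqrt_abs real_sqrt_le_iff)
qed

lemma matrix_vector_norm_le_frob_norm:
  fixes B :: "real ^ 'n ^ 'n"
  shows "norm (B *v x) \<le> frob_norm B * norm x"
proof -
  have row: "((B *v x) $ i)\<^sup>2 \<le> (\<Sum>j\<in>UNIV. (B $ i $ j)\<^sup>2) * (\<Sum>j\<in>UNIV. (x $ j)\<^sup>2)" for i
    unfolding matrix_vector_mult_def by (simp add: Cauchy_Schwarz_ineq_sum)
  have nx: "(norm x)\<^sup>2 = (\<Sum>j\<in>UNIV. (x $ j)\<^sup>2)" for x :: "real ^ 'n"
    by (simp add: norm_vec_def L2_set_def sum_nonneg)
  have "(norm (B *v x))\<^sup>2 = (\<Sum>i\<in>UNIV. ((B *v x) $ i)\<^sup>2)" by (rule nx)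
  also have "\<dots> \<le> (\<Sum>i\<in>UNIV. (\<Sum>j\<in>UNIV. (B $ i $ j)\<^sup>2) * (norm x)\<^sup>2)"
    unfolding nx[of x] by (intro sum_mono row)
  also have "\<dots> = (frob_norm B * norm x)\<^sup>2"
    by (simp add: frob_norm_eq_L2 power_mult_distrib sum_nonneg sum_distrib_right)
  finally show ?thesis
    by (rule power2_le_imp_le) (simp add: frob_norm_nonneg)
qed

text \<open>Multiplying the Penrose equations for \<open>C\<close> with those for \<open>D\<close> gives
  \<open>C = C B C = C B D = D B D = D\<close>: each step moves a factor across by symmetry.\<close>

lemma pseudoinverse_unique:
  assumes C: "is_pseudoinverse B C" and D: "is_pseudoinverse B D"
  shows "C = D"
proof -
  have BC: "B ** C = B ** D"
  proof -
    have "B ** C = transpose (B ** D ** B ** C)"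
      using C D unfolding is_pseudoinverse_def by metis
    also have "\<dots> = transpose (B ** C) ** transpose (B ** D)"
      by (metis matrix_mul_assoc matrix_transpose_mul)
    also have "\<dots> = B ** C ** B ** D"
      using C D unfolding is_pseudoinverse_def by (metis matrix_mul_assoc)
    finally show ?thesis using C unfolding is_pseudoinverse_def by metis
  qed
  have CB: "C ** B = D ** B"
  proof -
    have "C ** B = transpose (C ** (B ** D ** B))"
      using C D unfolding is_pseudoinverse_def by metis
    also have "\<dots> = transpose (D ** B) ** transpose (C ** B)"
      by (metis matrix_mul_assoc matrix_transpose_mul)
    also have "\<dots> = D ** (B ** C ** B)"
      using C D unfolding is_pseudoinverse_def by (metis matrix_mul_assoc)
    finally show ?thesis using C unfolding is_pseudoinverse_def by metis
  qed
  have "C = C ** (B ** C)" using C unfolding is_pseudoinverse_def by (metis matrix_mul_assoc)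
  also have "\<dots> = C ** B ** D" by (metis BC matrix_mul_assoc)
  also have "\<dots> = D ** B ** D" by (simp add: CB)
  also have "\<dots> = D" using D unfolding is_pseudoinverse_def by metis
  finally show ?thesis .
qed

text \<open>The sum of \<open>v v'\<close> over an orthonormal basis of \<open>S\<close>.\<close>

lemma orthogonal_projection_matrix_exists:
  fixes S :: "(real ^ 'n) set"
  assumes "subspace S"
  obtains P :: "real ^ 'n ^ 'n"
    where "transpose P = P" "\<And>x. P *v x \<in> S" "\<And>x. x \<in> S \<Longrightarrow> P *v x = x"
proof -
  obtain b where b: "b \<subseteq> S" "pairwise orthogonal b" "\<And>x. x \<in> b \<Longrightarrow> norm x = 1"
    "independent b" "span b = S"
    using orthonormal_basis_subspace[OF assms] by metis
  have fin: "finite b" using b(4) by (rule independent_imp_finite)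
  define P :: "real ^ 'n ^ 'n" where "P = (\<chi> i j. \<Sum>v\<in>b. v $ i * v $ j)"
  have Pv: "P *v x = (\<Sum>v\<in>b. (v \<bullet> x) *\<^sub>R v)" for x
  proof (unfold vec_eq_iff, rule allI)
    fix i
    have "(P *v x) $ i = (\<Sum>j\<in>UNIV. \<Sum>v\<in>b. v $ i * v $ j * x $ j)"
      by (simp add: P_def matrix_vector_mult_def sum_distrib_right)
    also have "\<dots> = (\<Sum>v\<in>b. \<Sum>j\<in>UNIV. v $ i * v $ j * x $ j)" by (rule sum.swap)
    also have "\<dots> = (\<Sum>v\<in>b. (v \<bullet> x) *\<^sub>R v) $ i"
      by (simp add: inner_vec_def sum_distrib_right sum_distrib_left mult_ac)
    finally show "(P *v x) $ i = (\<Sum>v\<in>b. (v \<bullet> x) *\<^sub>R v) $ i" .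
  qed
  show thesis
  proof
    show "transpose P = P" by (simp add: P_def transpose_def vec_eq_iff mult.commute)
    show "P *v x \<in> S" for x
      unfolding Pv using b(1) assms by (auto intro!: subspace_sum subspace_scale)
    show "P *v x = x" if "x \<in> S" for x
    proof -
      have "P *v v = v" if v: "v \<in> b" for v
      proof -
        have "(\<Sum>w\<in>b. (w \<bullet> v) *\<^sub>R w) = (\<Sum>w\<in>b. if w = v then v else 0)"
        proof (rule sum.cong)
          fix w assume w: "w \<in> b"
          show "(w \<bullet> v) *\<^sub>R w = (if w = v then v else 0)"
            using b(2,3) v w
            by (auto simp: pairwise_def orthogonal_def dot_square_norm)
        qed simp
        then show ?thesis unfolding Pv using v fin by simp
      qed
      then have "linear (\<lambda>x. P *v x)" "\<forall>v\<in>b. P *v v = v" by auto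
      moreover have "x \<in> span b" using that b(5) by simp
      ultimately show ?thesis
        using linear_eq_on[of "\<lambda>x. P *v x" "\<lambda>x. x" x b] linear_id by (auto simp: id_def)
    qed
  qed
qed

text \<open>For symmetric \<open>B\<close> the range is the orthogonal complement of the kernel. So if \<open>P\<close> projects
  onto the kernel, then \<open>B + P\<close> is invertible, and \<open>(B + P)\<inverse> - P\<close> inverts \<open>B\<close> on its range
  while annihilating the kernel.\<close>

lemma symmetric_pseudoinverse_exists:
  fixes B :: "real ^ 'n ^ 'n"
  assumes sym: "transpose B = B"
  shows "\<exists>C. is_pseudoinverse B C"
proof -
  have "subspace {x. B *v x = 0}"
    by (auto simp: subspace_def matrix_vector_right_distrib matrix_vector_mult_scaleR)
  then obtain P where P: "transpose P = P" "\<And>x. B *v (P *v x) = 0"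
    "\<And>x. B *v x = 0 \<Longrightarrow> P *v x = x"
    by (rule orthogonal_projection_matrix_exists) auto
  have BP: "B ** P = 0"
    using P(2) by (simp add: matrix_eq matrix_vector_mul_assoc)
  have PB: "P ** B = 0"
    using BP P(1) sym by (metis matrix_transpose_mul transpose_mat mat_0 transpose_transpose)
  have PP: "P ** P = P"
    using P(2,3) by (simp add: matrix_eq matrix_vector_mul_assoc[symmetric])
  have ker: "x = 0" if "(B + P) *v x = 0" for x
  proof -
    have s: "B *v x + P *v x = 0" using that by (simp add: matrix_vector_mult_add_rdistrib)
    then have "P *v (B *v x + P *v x) = 0" by simp
    then have "P *v x = 0"
      using PB PP by (simp add: matrix_vector_right_distrib matrix_vector_mul_assoc)
    with s P(3)[of x] show ?thesis by simp
  qed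
  then have "inj ((*v) (B + P))"
    by (metis matrix_left_invertible_injective matrix_left_invertible_ker)
  then have "invertible (B + P)"
    by (metis invertible_left_inverse matrix_left_invertible_injective)
  then obtain D where D: "(B + P) ** D = mat 1" "D ** (B + P) = mat 1"
    by (auto simp: invertible_def)
  have add_l: "(U + V) ** W = U ** W + V ** W" for U V W :: "real ^ 'n ^ 'n"
    by (simp add: matrix_matrix_mult_def vec_eq_iff distrib_right sum.distrib)
  have DP: "D ** P = P"
  proof -
    have "(B + P) ** P = P" by (simp add: add_l BP PP)
    then have "D ** ((B + P) ** P) = D ** P" by simp
    then show ?thesis by (simp add: matrix_mul_assoc D)
  qed
  have PD: "P ** D = P"
  proof -
    have "P ** (B + P) = P" by (simp add: matrix_add_ldistrib PB PP)
    then have "P ** (B + P) ** D = P ** D" by simp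
    then show ?thesis by (simp add: matrix_mul_assoc[symmetric] D)
  qed
  have DB: "D ** B = mat 1 - P"
    using D(2) DP by (simp add: matrix_add_ldistrib algebra_simps)
  have BD: "B ** D = mat 1 - P"
    using D(1) PD by (simp add: add_l algebra_simps)
  have sub_l: "(U - V) ** W = U ** W - V ** W" for U V W :: "real ^ 'n ^ 'n"
    by (simp add: matrix_matrix_mult_def vec_eq_iff left_diff_distrib sum_subtractf)
  have sub_r: "W ** (U - V) = W ** U - W ** V" for U V W :: "real ^ 'n ^ 'n"
    by (simp add: matrix_matrix_mult_def vec_eq_iff right_diff_distrib sum_subtractf)
  have tr: "transpose (mat 1 - P) = mat 1 - P"
    using P(1) by (simp add: transpose_def vec_eq_iff mat_def)
  have "is_pseudoinverse B (D - P)"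
    unfolding is_pseudoinverse_def
    by (simp add: sub_l sub_r BP PB BD DB tr PD DP PP)
  then show ?thesis ..
qed

lemma pseudoinverse_symmetric:
  assumes "transpose B = B"
  shows "B ** pseudoinverse B ** B = B"
proof -
  have "\<exists>!C. is_pseudoinverse B C"
    using symmetric_pseudoinverse_exists[OF assms] pseudoinverse_unique by metis
  then have "is_pseudoinverse B (pseudoinverse B)"
    unfolding pseudoinverse_def by (rule theI')
  then show ?thesis by (simp add: is_pseudoinverse_def)
qed

section \<open>From short intervals to long ones\<close>

text \<open>Cut the interval at the points of \<open>Q\<close>, then into short pieces. For inequalities between additive functions of intervals this does the work of summing over a
  partition.\<close>

lemma interval_chain:
  fixes R :: "real \<Rightarrow> real \<Rightarrow> bool"
  assumes fin: "finite Q" and \<delta>: "0 < \<delta>" and st: "s \<le> t"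
    and short: "\<And>a b. s \<le> a \<Longrightarrow> a \<le> b \<Longrightarrow> b \<le> t \<Longrightarrow> b - a \<le> \<delta> \<Longrightarrow> Q \<inter> {a<..<b} = {} \<Longrightarrow> R a b"
    and trans: "\<And>a b c. s \<le> a \<Longrightarrow> a \<le> b \<Longrightarrow> b \<le> c \<Longrightarrow> c \<le> t \<Longrightarrow> R a b \<Longrightarrow> R b c \<Longrightarrow> R a c"
  shows "R s t"
proof -
  have empty: "R a b" if "s \<le> a" "a \<le> b" "b \<le> t" "Q \<inter> {a<..<b} = {}" "b - a \<le> of_nat n * \<delta>" for a b n
    using that
  proof (induction n arbitrary: b)
    case 0
    then show ?case using \<delta> by (intro short) auto
  next
    case (Suc n)
    show ?case
    proof (cases "b - a \<le> \<delta>")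
      case True
      then show ?thesis using Suc by (intro short) auto
    next
      case False
      have "R a (b - \<delta>)"
        using Suc.prems False \<delta> by (intro Suc.IH) (auto simp: algebra_simps)
      moreover have "R (b - \<delta>) b"
        using Suc.prems False \<delta> by (intro short) auto
      ultimately show ?thesis
        using Suc.prems False \<delta> by (intro trans[of a "b - \<delta>" b]) auto
    qed
  qed
  have "R a b" if "s \<le> a" "a \<le> b" "b \<le> t" "card (Q \<inter> {a<..<b}) \<le> n" for a b n
    using that
  proof (induction n arbitrary: a b)
    case 0
    then have "Q \<inter> {a<..<b} = {}" using fin by auto
    moreover obtain k :: nat where "(b - a) / \<delta> \<le> of_nat k" by (metis real_arch_simple)
    then have "b - a \<le> of_nat k * \<delta>" using \<delta> by (simp add: field_simps)
    ultimately show ?case using 0 empty by blast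
  next
    case (Suc n)
    show ?case
    proof (cases "Q \<inter> {a<..<b} = {}")
      case True
      then show ?thesis using Suc by auto
    next
      case False
      then obtain q where q: "q \<in> Q" "a < q" "q < b" by auto
      have "Q \<inter> {a<..<q} \<subset> Q \<inter> {a<..<b}" "Q \<inter> {q<..<b} \<subset> Q \<inter> {a<..<b}" using q by force+
      then have "card (Q \<inter> {a<..<q}) < card (Q \<inter> {a<..<b})" "card (Q \<inter> {q<..<b}) < card (Q \<inter> {a<..<b})"
        using fin by (auto intro!: psubset_card_mono)
      then have "R a q" "R q b" using Suc.prems q by (auto intro!: Suc.IH)
      then show ?thesis using Suc.prems q by (intro trans[of a q b]) auto
    qed
  qed
  then show ?thesis using st by blast
qed

section \<open>Measurability of paths and vectors\<close>

lemma borel_measurable_vec_component [measurable (raw)]: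
  fixes f :: "'a \<Rightarrow> 'b::real_normed_vector ^ 'n"
  assumes "f \<in> borel_measurable M"
  shows "(\<lambda>x. f x $ i) \<in> borel_measurable M"
  using borel_measurable_continuous_onI[OF linear_continuous_on[OF bounded_linear_vec_nth]] assms
  by (rule measurable_compose[rotated])

text \<open>The values at times rounded up to multiples of \<open>1/n\<close> are jointly measurable, and they
  converge by right-continuity.\<close>

lemma right_continuous_jointly_measurable:
  fixes g :: "real \<Rightarrow> 'w \<Rightarrow> 'b::metric_space"
  assumes meas: "\<And>t. t \<in> {0..T} \<Longrightarrow> g t \<in> borel_measurable P"
    and cont: "\<And>\<omega> t. \<omega> \<in> space P \<Longrightarrow> t \<in> {0..T} \<Longrightarrow> continuous (at t within ({0..T} \<inter> {t..})) (\<lambda>t. g t \<omega>)"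
    and T: "0 \<le> T"
  shows "(\<lambda>p. g (fst p) (snd p)) \<in> borel_measurable (restrict_space lborel {0..T} \<Otimes>\<^sub>M P)"
proof (rule borel_measurable_LIMSEQ_metric)
  let ?L = "restrict_space lborel {0..T}"
  define r where "r n t = min T (max 0 ((of_int \<lfloor>real (Suc n) * t\<rfloor> + 1) / real (Suc n)))" for n t
  show "(\<lambda>p. g (r n (fst p)) (snd p)) \<in> borel_measurable (?L \<Otimes>\<^sub>M P)" for n
    unfolding r_def
  proof (rule measurable_compose_countable'[where I = UNIV and g = "\<lambda>p. \<lfloor>real (Suc n) * fst p\<rfloor>"
        and f = "\<lambda>k p. g (min T (max 0 ((of_int k + 1) / real (Suc n)))) (snd p)"])
    fix k :: int
    have "g (min T (max 0 ((of_int k + 1) / real (Suc n)))) \<in> borel_measurable P"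
      using T by (intro meas) auto
    then show "(\<lambda>p. g (min T (max 0 ((of_int k + 1) / real (Suc n)))) (snd p)) \<in> borel_measurable (?L \<Otimes>\<^sub>M P)"
      by measurable
    have [measurable]: "fst \<in> borel_measurable (?L \<Otimes>\<^sub>M P)"
      by (rule measurable_compose[OF measurable_fst]) (simp add: measurable_restrict_space1)
    show "(\<lambda>p. \<lfloor>real (Suc n) * fst p\<rfloor>) \<in> ?L \<Otimes>\<^sub>M P \<rightarrow>\<^sub>M count_space UNIV"
      by measurable
  qed auto
  fix p assume "p \<in> space (?L \<Otimes>\<^sub>M P)"
  then have t: "fst p \<in> {0..T}" and \<omega>: "snd p \<in> space P"
    by (auto simp: space_pair_measure space_restrict_space)
  have lower: "fst p \<le> r n (fst p)" and upper: "r n (fst p) \<le> fst p + 1 / real (Suc n)" for n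
  proof -
    let ?m = "real (Suc n)"
    have a: "?m * fst p \<le> of_int \<lfloor>?m * fst p\<rfloor> + 1" by linarith
    have b: "of_int \<lfloor>?m * fst p\<rfloor> \<le> ?m * fst p" by simp
    have "fst p = (?m * fst p) / ?m" by simp
    also have "\<dots> \<le> (of_int \<lfloor>?m * fst p\<rfloor> + 1) / ?m" using a by (intro divide_right_mono) auto
    finally show "fst p \<le> r n (fst p)" using t by (auto simp: r_def)
    have "(of_int \<lfloor>?m * fst p\<rfloor> + 1) / ?m \<le> (?m * fst p + 1) / ?m" using b by (intro divide_right_mono) auto
    also have "\<dots> = fst p + 1 / ?m" by (simp add: field_simps)
    finally have "(of_int \<lfloor>?m * fst p\<rfloor> + 1) / ?m \<le> fst p + 1 / ?m" .
    moreover have "0 \<le> fst p + 1 / ?m" using t by auto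
    ultimately show "r n (fst p) \<le> fst p + 1 / ?m"
      unfolding r_def by linarith
  qed
  have "(\<lambda>n. fst p + 1 / real (Suc n)) \<longlonglongrightarrow> fst p"
    using LIMSEQ_inverse_real_of_nat_add[of "fst p"] by (simp add: inverse_eq_divide)
  then have lim: "(\<lambda>n. r n (fst p)) \<longlonglongrightarrow> fst p"
    by (rule tendsto_sandwich[OF _ _ tendsto_const, rotated 2])
      (use lower upper in auto)
  have "r n (fst p) \<in> {0..T} \<inter> {fst p..}" for n
    using lower T by (auto simp: r_def)
  then show "(\<lambda>n. g (r n (fst p)) (snd p)) \<longlonglongrightarrow> g (fst p) (snd p)"
    by (rule continuous_within_tendsto_compose'[OF cont[OF \<omega> t] _ lim])
qed

section \<open>The chain on a finite horizon\<close>

locale chain_horizon = markov_chain P X A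
  for P :: "'w measure" and X :: "real \<Rightarrow> 'w \<Rightarrow> real ^ 'n" and A :: "real \<Rightarrow> real ^ 'n ^ 'n" +
  fixes T c :: real
  assumes T_pos: "0 < T"
    and c_pos: "0 < c"
    and rate_bound: "\<And>t i. 0 \<le> t \<Longrightarrow> (\<Sum>j\<in>UNIV. \<bar>A t $ j $ i\<bar>) \<le> c"
begin

abbreviation "F \<equiv> natural_filtration P X"
abbreviation "M \<equiv> chain_martingale X A"
abbreviation "L \<equiv> restrict_space lborel {0..T}"
abbreviation "Q \<equiv> L \<Otimes>\<^sub>M P"

text \<open>The chain jumps to \<open>e\<^sub>j\<close> at rate \<open>rate r \<omega> j\<close>, and \<open>jump C r \<omega> j\<close> is the jump that an integral with
  integrand \<open>C\<close> then makes. For the current state the rate is nonpositive, but the jump vanishes, so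
  that \<open>energy\<close> is a sum of nonnegative terms.\<close>

definition rate :: "real \<Rightarrow> 'w \<Rightarrow> 'n \<Rightarrow> real" where
  "rate r \<omega> j = (A r *v X r \<omega>) $ j"

definition jump :: "real ^ 'n \<Rightarrow> real \<Rightarrow> 'w \<Rightarrow> 'n \<Rightarrow> real" where
  "jump C r \<omega> j = C \<bullet> (axis j 1 - X r \<omega>)"

definition energy :: "real \<Rightarrow> 'w \<Rightarrow> real ^ 'n \<Rightarrow> real" where
  "energy r \<omega> C = (\<Sum>j\<in>UNIV. rate r \<omega> j * (jump C r \<omega> j)\<^sup>2)"

subsection \<open>The filtration\<close>

lemma space_F [simp]: "space (F t) = space P"
  unfolding natural_filtration_def by (subst space_measure_of) auto

lemma sets_F: "sets (F t) = sigma_sets (space P) {X s -` B \<inter> space P | s B. 0 \<le> s \<and> s \<le> t \<and> B \<in> sets borel}"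
  unfolding natural_filtration_def by (subst sets_measure_of) auto

lemma subalgebra_F: "subalgebra P (F t)"
  unfolding subalgebra_def sets_F
  by (auto intro!: sets.sigma_sets_subset measurable_sets[OF X_measurable])

lemma sets_F_mono: "s \<le> t \<Longrightarrow> sets (F s) \<subseteq> sets (F t)"
  unfolding sets_F by (intro sigma_sets_mono') (auto intro: order_trans)

lemma measurable_F_mono: "f \<in> borel_measurable (F s) \<Longrightarrow> s \<le> t \<Longrightarrow> f \<in> borel_measurable (F t)"
  using sets_F_mono by (auto simp: measurable_def)

lemma measurable_F_P: "f \<in> borel_measurable (F s) \<Longrightarrow> f \<in> borel_measurable P"
  by (rule measurable_from_subalg[OF subalgebra_F])

lemma X_adapted: "0 \<le> s \<Longrightarrow> X s \<in> borel_measurable (F s)"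
  by (rule measurableI) (auto simp: sets_F intro!: sigma_sets.Basic)

sublocale LP: pair_sigma_finite L P
proof -
  have "sigma_finite_measure L" by (intro sigma_finite_measure_restrict_space lborel.sigma_finite_measure_axioms) simp
  then show "pair_sigma_finite L P"
    unfolding pair_sigma_finite_def using sigma_finite_measure_axioms by auto
qed

lemma space_L [simp]: "space L = {0..T}"
  by (simp add: space_restrict_space)

lemma space_Q: "space Q = {0..T} \<times> space P"
  by (simp add: space_pair_measure)

lemma emeasure_L: "emeasure L (space L) = ennreal T"
  using T_pos by (simp add: emeasure_restrict_space)

sublocale L: finite_measure L
  by standard (use emeasure_L in simp)

sublocale Q: finite_measure Q
  by (intro finite_measure_pair_measure) (rule finite_measure_axioms, rule L.finite_measure_axioms)

lemma measurable_id_L: "(\<lambda>x. x) \<in> borel_measurable L"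
  by (simp add: measurable_restrict_space1)

lemma measurable_fst_Q [measurable]: "fst \<in> borel_measurable Q"
  by (rule measurable_compose[OF measurable_fst]) (simp add: measurable_restrict_space1)

lemma measurable_snd_Q: "f \<in> borel_measurable P \<Longrightarrow> (\<lambda>p. f (snd p)) \<in> borel_measurable Q"
  by (rule measurable_compose[OF measurable_snd])

lemma path_measurable:
  assumes "(\<lambda>p. g (fst p) (snd p)) \<in> borel_measurable Q" "\<omega> \<in> space P"
  shows "(\<lambda>r. g r \<omega>) \<in> borel_measurable L"
  using measurable_compose[OF measurable_Pair2'[OF assms(2)] assms(1)] by simp

lemma section_measurable:
  assumes "(\<lambda>p. g (fst p) (snd p)) \<in> borel_measurable Q" "r \<in> {0..T}"
  shows "g r \<in> borel_measurable P"
  using measurable_compose[OF measurable_Pair1' assms(1), of r] assms(2) by simp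

subsection \<open>States, rates and energy\<close>

lemma X_axis:
  assumes "0 \<le> r" "\<omega> \<in> space P"
  obtains i where "X r \<omega> = axis i 1"
  using X_states[OF assms] that by blast

lemma X_Q [measurable]: "(\<lambda>p. X (fst p) (snd p)) \<in> borel_measurable Q"
proof (rule right_continuous_jointly_measurable)
  fix \<omega> t assume "\<omega> \<in> space P" "t \<in> {0..T}"
  then have "continuous (at t within ({0..} \<inter> {t..})) (\<lambda>t. X t \<omega>)"
    using X_rcll[of \<omega>] by (auto simp: rcll_on_def)
  then show "continuous (at t within ({0..T} \<inter> {t..})) (\<lambda>t. X t \<omega>)"
    by (rule continuous_within_subset) auto
qed (use T_pos X_measurable in auto)

lemma A_L: "A \<in> borel_measurable L"
proof -
  have "set_borel_measurable borel {0..} A" using rates by (simp add: rate_matrix_def)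
  then have "(\<lambda>x. indicator {0..} x *\<^sub>R A x) \<in> borel_measurable lborel"
    by (simp add: set_borel_measurable_def)
  then have "(\<lambda>x. indicator {0..} x *\<^sub>R A x) \<in> borel_measurable L"
    by (rule measurable_restrict_space1)
  moreover have "(\<lambda>x. indicator {0..} x *\<^sub>R A x) \<in> borel_measurable L \<longleftrightarrow> A \<in> borel_measurable L"
    by (rule measurable_cong) (simp add: indicator_def)
  ultimately show ?thesis by simp
qed

lemma A_entry_L: "(\<lambda>r. A r $ i $ j) \<in> borel_measurable L"
  by (intro borel_measurable_vec_component A_L)

lemma rate_Q [measurable]: "(\<lambda>p. rate (fst p) (snd p) j) \<in> borel_measurable Q"
proof -
  have "(\<lambda>p. \<Sum>k\<in>UNIV. A (fst p) $ j $ k * X (fst p) (snd p) $ k) \<in> borel_measurable Q"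
    by (intro borel_measurable_sum borel_measurable_times borel_measurable_vec_component X_Q
        measurable_compose[OF measurable_fst A_entry_L])
  then show ?thesis by (simp add: rate_def matrix_vector_mult_def)
qed

lemma rate_axis: "X r \<omega> = axis i 1 \<Longrightarrow> rate r \<omega> j = A r $ j $ i"
  by (simp add: rate_def matrix_vector_mult_basis column_def)

lemma sum_abs_rate_le:
  assumes "0 \<le> r" "\<omega> \<in> space P"
  shows "(\<Sum>j\<in>UNIV. \<bar>rate r \<omega> j\<bar>) \<le> c"
proof -
  obtain i where "X r \<omega> = axis i 1" using X_axis[OF assms] .
  then show ?thesis using rate_bound[OF assms(1)] by (simp add: rate_axis)
qed

lemma rate_le: "0 \<le> r \<Longrightarrow> \<omega> \<in> space P \<Longrightarrow> \<bar>rate r \<omega> j\<bar> \<le> c"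
  using member_le_sum[of j UNIV "\<lambda>j. \<bar>rate r \<omega> j\<bar>"] sum_abs_rate_le[of r \<omega>] by simp

lemma sum_rate_abs_le:
  assumes "0 \<le> r" "\<omega> \<in> space P" "\<And>j. \<bar>v j\<bar> \<le> K"
  shows "\<bar>\<Sum>j\<in>UNIV. rate r \<omega> j * v j\<bar> \<le> c * K"
proof -
  have "\<bar>\<Sum>j\<in>UNIV. rate r \<omega> j * v j\<bar> \<le> (\<Sum>j\<in>UNIV. \<bar>rate r \<omega> j\<bar> * K)"
    using assms(3) by (intro order_trans[OF sum_abs] sum_mono) (simp add: abs_mult mult_left_mono)
  also have "\<dots> \<le> c * K"
    using sum_abs_rate_le[OF assms(1,2)] order_trans[OF abs_ge_zero assms(3)]
    by (simp add: sum_distrib_right[symmetric] mult_right_mono)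
  finally show ?thesis .
qed

lemma rate_nonneg:
  assumes "0 \<le> r" "\<omega> \<in> space P" "X r \<omega> \<noteq> axis j 1"
  shows "0 \<le> rate r \<omega> j"
proof -
  obtain i where i: "X r \<omega> = axis i 1" using X_axis[OF assms(1,2)] .
  with assms(3) have "j \<noteq> i" by auto
  then show ?thesis using rates assms(1) by (simp add: rate_axis[OF i] rate_matrix_def)
qed

lemma sum_rate:
  assumes "0 \<le> r" "\<omega> \<in> space P"
  shows "(\<Sum>j\<in>UNIV. rate r \<omega> j) = 0"
proof -
  obtain i where i: "X r \<omega> = axis i 1" using X_axis[OF assms] .
  then show ?thesis using rates assms(1) by (simp add: rate_axis[OF i] rate_matrix_def)
qed

lemma jump_self: "X r \<omega> = axis j 1 \<Longrightarrow> jump C r \<omega> j = 0"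
  by (simp add: jump_def)

lemma sum_rate_mono:
  assumes "0 \<le> r" "\<omega> \<in> space P" "\<And>j. X r \<omega> \<noteq> axis j 1 \<Longrightarrow> u j \<le> v j"
    and "\<And>j. X r \<omega> = axis j 1 \<Longrightarrow> u j = v j"
  shows "(\<Sum>j\<in>UNIV. rate r \<omega> j * u j) \<le> (\<Sum>j\<in>UNIV. rate r \<omega> j * v j)"
proof (rule sum_mono)
  fix j
  show "rate r \<omega> j * u j \<le> rate r \<omega> j * v j"
    using assms rate_nonneg[of r \<omega> j] by (cases "X r \<omega> = axis j 1") (auto intro: mult_left_mono)
qed

lemma energy_nonneg: "0 \<le> r \<Longrightarrow> \<omega> \<in> space P \<Longrightarrow> 0 \<le> energy r \<omega> C"
  using sum_rate_mono[of r \<omega> "\<lambda>_. 0" "\<lambda>j. (jump C r \<omega> j)\<^sup>2"] by (simp add: energy_def jump_self)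

lemma Psi_entry:
  assumes "0 \<le> r" "\<omega> \<in> space P"
  shows "Psi X A r \<omega> $ k $ l = (if k = l then rate r \<omega> k else 0)
      - X r \<omega> $ k * A r $ l $ k - A r $ k $ l * X r \<omega> $ l"
  by (simp add: Psi_def diag_mat_def matrix_matrix_mult_def transpose_def rate_def
      mult_delta_left mult_delta_right)

text \<open>For \<open>X = e\<^sub>i\<close> the quadratic form of \<open>\<Psi>\<close> is \<open>\<Sum>\<^sub>k a\<^sub>k (C\<^sub>k\<^sup>2 - 2 C\<^sub>k C\<^sub>i)\<close> with the entries \<open>a\<^sub>k\<close> of
  the column of \<open>A\<close> at \<open>e\<^sub>i\<close>; since these sum to zero, adding \<open>C\<^sub>i\<^sup>2\<close> completes the squares.\<close>

lemma chain_seminorm_eq: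
  assumes "0 \<le> r" "\<omega> \<in> space P"
  shows "chain_seminorm X A r \<omega> C = sqrt (energy r \<omega> C)"
proof -
  obtain i where i: "X r \<omega> = axis i 1" using X_axis[OF assms] .
  have X: "X r \<omega> $ k = (if k = i then 1 else 0)" for k by (simp add: i axis_def)
  have entry: "Psi X A r \<omega> $ k $ l = (if k = l then rate r \<omega> k else 0)
      - X r \<omega> $ k * A r $ l $ k - A r $ k $ l * X r \<omega> $ l" for k l
    by (rule Psi_entry[OF assms])
  have push: "(\<Sum>l\<in>UNIV. if b then u l else 0) = (if b then (\<Sum>l\<in>UNIV. u l) else 0)" for b and u :: "'n \<Rightarrow> real"
    by simp
  have "C \<bullet> (Psi X A r \<omega> *v C) = (\<Sum>k\<in>UNIV. \<Sum>l\<in>UNIV. C $ k * Psi X A r \<omega> $ k $ l * C $ l)"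
    by (simp add: inner_vec_def matrix_vector_mult_def sum_distrib_left mult_ac)
  also have "\<dots> = (\<Sum>k\<in>UNIV. \<Sum>l\<in>UNIV. (if k = l then rate r \<omega> k * (C $ k)\<^sup>2 else 0)
      - (if k = i then C $ i * rate r \<omega> l * C $ l else 0) - (if l = i then C $ k * rate r \<omega> k * C $ i else 0))"
    by (intro sum.cong refl) (auto simp: entry X rate_axis[OF i] algebra_simps power2_eq_square)
  also have "\<dots> = (\<Sum>k\<in>UNIV. rate r \<omega> k * (C $ k)\<^sup>2) - (\<Sum>l\<in>UNIV. C $ i * rate r \<omega> l * C $ l)
      - (\<Sum>k\<in>UNIV. C $ k * rate r \<omega> k * C $ i)"
    by (simp add: sum_subtractf push)
  also have "\<dots> = (\<Sum>k\<in>UNIV. rate r \<omega> k * (C $ k)\<^sup>2 - 2 * rate r \<omega> k * C $ k * C $ i + rate r \<omega> k * (C $ i)\<^sup>2)"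
    using sum_rate[OF assms]
    by (simp add: sum_subtractf sum.distrib sum_distrib_right[symmetric] mult_ac flip: sum_distrib_left)
      (simp add: sum_distrib_left mult_ac)
  also have "\<dots> = energy r \<omega> C"
    by (simp add: energy_def jump_def i inner_diff_right inner_axis power2_diff algebra_simps)
  finally show ?thesis by (simp add: chain_seminorm_def)
qed

section \<open>Integration over time and chance\<close>

text \<open>Space-time integrals, over \<open>(a, b] \<times> \<Omega>\<close>.\<close>

definition stint :: "real \<Rightarrow> real \<Rightarrow> (real \<Rightarrow> 'w \<Rightarrow> real) \<Rightarrow> real" where
  "stint a b g = (\<integral>p. indicator {a<..b} (fst p) * g (fst p) (snd p) \<partial>Q)"

abbreviation Q_integrable :: "(real \<Rightarrow> 'w \<Rightarrow> real) \<Rightarrow> bool" where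
  "Q_integrable g \<equiv> integrable Q (\<lambda>p. g (fst p) (snd p))"

lemma indicator_Q: "(\<lambda>p. indicator {a<..b} (fst p) :: real) \<in> borel_measurable Q"
  by (rule measurable_compose[OF measurable_fst_Q]) simp

lemma indicator_L: "(\<lambda>r. indicator {a<..b} r :: real) \<in> borel_measurable L"
  by (rule measurable_compose[OF measurable_id_L]) simp

lemma Q_integrable_indicator:
  assumes "Q_integrable g"
  shows "integrable Q (\<lambda>p. indicator {a<..b} (fst p) * g (fst p) (snd p))"
  by (rule Bochner_Integration.integrable_bound[OF assms])
    (use assms indicator_Q in \<open>auto simp: indicator_def intro!: borel_measurable_times\<close>)

lemma Q_integrable_bounded:
  assumes "Q_integrable f" "(\<lambda>p. g (fst p) (snd p)) \<in> borel_measurable Q"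
    and "\<And>r \<omega>. r \<in> {0..T} \<Longrightarrow> \<omega> \<in> space P \<Longrightarrow> \<bar>g r \<omega>\<bar> \<le> K * \<bar>f r \<omega>\<bar>"
  shows "Q_integrable g"
proof (rule Bochner_Integration.integrable_bound[OF _ assms(2)])
  show "integrable Q (\<lambda>p. K * f (fst p) (snd p))" using assms(1) by simp
  show "AE p in Q. norm (g (fst p) (snd p)) \<le> norm (K * f (fst p) (snd p))"
  proof (rule AE_I2)
    fix p assume "p \<in> space Q"
    then have "\<bar>g (fst p) (snd p)\<bar> \<le> K * \<bar>f (fst p) (snd p)\<bar>" using assms(3) by (auto simp: space_Q)
    also have "\<dots> \<le> \<bar>K\<bar> * \<bar>f (fst p) (snd p)\<bar>" by (intro mult_right_mono) auto
    finally show "norm (g (fst p) (snd p)) \<le> norm (K * f (fst p) (snd p))" by (simp add: abs_mult)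
  qed
qed

lemma integrable_lift:
  assumes "integrable P f"
  shows "Q_integrable (\<lambda>r. f)"
proof -
  have "integrable (L \<Otimes>\<^sub>M P) (\<lambda>(r, \<omega>). f \<omega>)"
    using assms by (intro LP.Fubini_integrable) (auto intro: borel_measurable_integrable measurable_compose[OF measurable_snd])
  then show ?thesis by (simp add: case_prod_beta')
qed

lemma integral_indicator_L:
  assumes "0 \<le> a" "a \<le> b" "b \<le> T"
  shows "(\<integral>r. indicator {a<..b} r \<partial>L) = (b - a :: real)"
proof -
  have "(\<integral>r. indicator {a<..b} r \<partial>L) = (\<integral>r. indicator {0..T} r *\<^sub>R (indicator {a<..b} r :: real) \<partial>lborel)"
    by (rule integral_restrict_space) simp
  also have "\<dots> = (\<integral>r. indicator {a<..b} r \<partial>lborel)"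
    using assms by (intro Bochner_Integration.integral_cong) (auto simp: indicator_def)
  also have "\<dots> = b - a" using assms by simp
  finally show ?thesis .
qed

lemma stint_split:
  assumes "Q_integrable g" "a \<le> b" "b \<le> d"
  shows "stint a d g = stint a b g + stint b d g"
proof -
  have "stint a d g = (\<integral>p. indicator {a<..b} (fst p) * g (fst p) (snd p)
      + indicator {b<..d} (fst p) * g (fst p) (snd p) \<partial>Q)"
    unfolding stint_def using assms(2,3)
    by (intro Bochner_Integration.integral_cong) (auto simp: indicator_def)
  then show ?thesis
    unfolding stint_def using Q_integrable_indicator[OF assms(1)] by simp
qed

lemma stint_add: "Q_integrable f \<Longrightarrow> Q_integrable g \<Longrightarrow> stint a b (\<lambda>r \<omega>. f r \<omega> + g r \<omega>) = stint a b f + stint a b g"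
  unfolding stint_def using Q_integrable_indicator[of f a b] Q_integrable_indicator[of g a b]
  by (simp add: distrib_left)

lemma stint_diff: "Q_integrable f \<Longrightarrow> Q_integrable g \<Longrightarrow> stint a b (\<lambda>r \<omega>. f r \<omega> - g r \<omega>) = stint a b f - stint a b g"
  unfolding stint_def using Q_integrable_indicator[of f a b] Q_integrable_indicator[of g a b]
  by (simp add: right_diff_distrib)

lemma stint_cmult: "stint a b (\<lambda>r \<omega>. k * f r \<omega>) = k * stint a b f"
  unfolding stint_def by (simp add: mult.left_commute)

lemma stint_mono_AE:
  assumes "Q_integrable f" "Q_integrable g" "AE p in Q. fst p \<in> {a<..b} \<longrightarrow> f (fst p) (snd p) \<le> g (fst p) (snd p)"
  shows "stint a b f \<le> stint a b g"
  unfolding stint_def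
  by (rule integral_mono_AE[OF Q_integrable_indicator[OF assms(1)] Q_integrable_indicator[OF assms(2)]])
    (use assms(3) in \<open>auto simp: indicator_def\<close>)

lemma stint_mono:
  assumes "Q_integrable f" "Q_integrable g"
    and "\<And>r \<omega>. r \<in> {0..T} \<Longrightarrow> a < r \<Longrightarrow> r \<le> b \<Longrightarrow> \<omega> \<in> space P \<Longrightarrow> f r \<omega> \<le> g r \<omega>"
  shows "stint a b f \<le> stint a b g"
  using assms by (intro stint_mono_AE AE_I2) (auto simp: space_Q)

lemma stint_nonneg:
  assumes "\<And>r \<omega>. r \<in> {0..T} \<Longrightarrow> \<omega> \<in> space P \<Longrightarrow> 0 \<le> g r \<omega>"
  shows "0 \<le> stint a b g"
  unfolding stint_def using assms by (intro Bochner_Integration.integral_nonneg) (auto simp: space_Q)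

lemma stint_le_horizon:
  assumes "Q_integrable g" "\<And>r \<omega>. r \<in> {0..T} \<Longrightarrow> \<omega> \<in> space P \<Longrightarrow> 0 \<le> g r \<omega>" "0 \<le> a" "a \<le> b" "b \<le> T"
  shows "stint a b g \<le> stint 0 T g"
  using stint_split[OF assms(1), of 0 a T] stint_split[OF assms(1), of a b T]
    stint_nonneg[of g 0 a] stint_nonneg[of g b T] assms by auto

lemma stint_expectation:
  assumes "Q_integrable g"
  shows "stint a b g = expectation (\<lambda>\<omega>. \<integral>r. indicator {a<..b} r * g r \<omega> \<partial>L)"
    and "integrable P (\<lambda>\<omega>. \<integral>r. indicator {a<..b} r * g r \<omega> \<partial>L)"
proof -
  have g: "integrable (L \<Otimes>\<^sub>M P) (\<lambda>(r, \<omega>). indicator {a<..b} r * g r \<omega>)"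
    using Q_integrable_indicator[OF assms] by (simp add: case_prod_beta')
  show "stint a b g = expectation (\<lambda>\<omega>. \<integral>r. indicator {a<..b} r * g r \<omega> \<partial>L)"
    using LP.integral_snd[OF g] by (simp add: stint_def case_prod_beta')
  show "integrable P (\<lambda>\<omega>. \<integral>r. indicator {a<..b} r * g r \<omega> \<partial>L)"
    using LP.integrable_snd[OF g] by simp
qed

lemma stint_time:
  assumes "Q_integrable g"
  shows "stint a b g = (\<integral>r. indicator {a<..b} r * expectation (g r) \<partial>L)"
    and "integrable L (\<lambda>r. indicator {a<..b} r * expectation (g r))"
proof -
  have g: "integrable (L \<Otimes>\<^sub>M P) (\<lambda>p. indicator {a<..b} (fst p) * g (fst p) (snd p))"
    using Q_integrable_indicator[OF assms] .
  show "stint a b g = (\<integral>r. indicator {a<..b} r * expectation (g r) \<partial>L)"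
    using LP.integral_fst'[OF g] by (simp add: stint_def)
  show "integrable L (\<lambda>r. indicator {a<..b} r * expectation (g r))"
    using LP.integrable_fst'[OF g] by simp
qed

lemma stint_le_const:
  assumes g: "Q_integrable g" and ab: "0 \<le> a" "a \<le> b" "b \<le> T"
    and le: "\<And>r. a < r \<Longrightarrow> r \<le> b \<Longrightarrow> expectation (g r) \<le> K"
  shows "stint a b g \<le> K * (b - a)"
proof -
  have "stint a b g \<le> (\<integral>r. K * indicator {a<..b} r \<partial>L)"
    unfolding stint_time(1)[OF g]
  proof (rule integral_mono[OF stint_time(2)[OF g]])
    show "integrable L (\<lambda>r. K * indicator {a<..b} r)"
      by (intro L.integrable_const_bound[of _ "\<bar>K\<bar>"] AE_I2 borel_measurable_times borel_measurable_const indicator_L)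
        (auto simp: indicator_def)
  qed (use le in \<open>auto simp: indicator_def\<close>)
  then show ?thesis using integral_indicator_L[OF ab] by simp
qed

lemma stint_static:
  assumes "integrable P f" "0 \<le> a" "a \<le> b" "b \<le> T"
  shows "stint a b (\<lambda>r. f) = (b - a) * expectation f"
  using stint_time(1)[OF integrable_lift[OF assms(1)]] integral_indicator_L[OF assms(2-4)]
  by simp

lemma AE_Q:
  assumes "AE \<omega> in P. \<forall>r\<in>{0..T}. R r \<omega>"
  shows "AE p in Q. R (fst p) (snd p)"
proof -
  obtain N where N: "N \<in> null_sets P" "{\<omega> \<in> space P. \<not> (\<forall>r\<in>{0..T}. R r \<omega>)} \<subseteq> N"
    using assms by (auto elim!: AE_E simp: null_sets_def)
  have "{0..T} \<times> N \<in> null_sets Q"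
  proof (rule null_setsI)
    have "emeasure Q (space L \<times> N) = emeasure L (space L) * emeasure P N"
      using N(1) by (intro emeasure_pair_measure_Times sets.top) auto
    then show "emeasure Q ({0..T} \<times> N) = 0" using N(1) by (simp add: null_setsD1)
    have "{0..T} \<in> sets L" by (metis sets.top space_L)
    then show "{0..T} \<times> N \<in> sets Q" using N(1) by (intro pair_measureI) auto
  qed
  then show ?thesis
  proof (rule AE_I')
    show "{p \<in> space Q. \<not> R (fst p) (snd p)} \<subseteq> {0..T} \<times> N"
      using N(2) unfolding space_Q by fastforce
  qed
qed

section \<open>The martingale part and one-step estimates\<close>

lemma abs_integral_L_le:
  assumes "\<And>r. r \<in> {0..T} \<Longrightarrow> a < r \<Longrightarrow> r \<le> b \<Longrightarrow> \<bar>g r\<bar> \<le> K" "0 \<le> a" "a \<le> b" "b \<le> T"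
  shows "\<bar>\<integral>r. indicator {a<..b} r * g r \<partial>L\<bar> \<le> K * (b - a)"
proof -
  have K: "0 \<le> K" if "a < b" using order_trans[OF abs_ge_zero assms(1)[of b]] assms that by auto
  have i: "integrable L (\<lambda>r. K * indicator {a<..b} r)"
    by (intro L.integrable_const_bound[of _ "\<bar>K\<bar>"] AE_I2 borel_measurable_times borel_measurable_const indicator_L)
      (auto simp: indicator_def)
  show ?thesis
  proof (cases "integrable L (\<lambda>r. indicator {a<..b} r * g r)")
    case True
    have "norm (\<integral>r. indicator {a<..b} r * g r \<partial>L) \<le> (\<integral>r. K * indicator {a<..b} r \<partial>L)"
      using assms(1) by (intro Bochner_Integration.integral_norm_bound_integral[OF True i]) (auto simp: indicator_def)
    then show ?thesis using integral_indicator_L[OF assms(2-4)] by simp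
  next
    case False
    then show ?thesis using K assms(3) by (cases "a = b") (auto simp: not_integrable_integral_eq)
  qed
qed

lemma rate_path_integrable:
  assumes \<omega>: "\<omega> \<in> space P"
  shows "integrable L (\<lambda>r. indicator {a<..b} r * rate r \<omega> j)"
proof (rule L.integrable_const_bound[of _ c])
  show "AE r in L. norm (indicator {a<..b} r * rate r \<omega> j) \<le> c"
    using \<omega> rate_le c_pos by (intro AE_I2) (simp add: indicator_def)
qed (intro borel_measurable_times path_measurable[OF rate_Q \<omega>] indicator_L)

lemma M_increment:
  assumes \<omega>: "\<omega> \<in> space P" and st: "0 \<le> s" "s \<le> t" "t \<le> T"
  shows "M t \<omega> $ j - M s \<omega> $ j = X t \<omega> $ j - X s \<omega> $ j - (\<integral>r. indicator {s<..t} r * rate r \<omega> j \<partial>L)"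
proof -
  have rate_m: "(\<lambda>r. rate r \<omega> j) \<in> borel_measurable L" for j
    by (rule path_measurable[OF rate_Q \<omega>])
  note int1 = rate_path_integrable[OF \<omega>]
  have comp: "(LINT r:{0..b}|lborel. A r *v X r \<omega>) $ j = (\<integral>r. indicator {0<..b} r * rate r \<omega> j \<partial>L)"
    if b: "0 \<le> b" "b \<le> T" for b
  proof -
    have bi: "integrable L (\<lambda>r. indicator {0..b} r *\<^sub>R (A r *v X r \<omega>))"
    proof (rule L.integrable_const_bound[of _ "real CARD('n) * c"])
      show "AE r in L. norm (indicator {0..b} r *\<^sub>R (A r *v X r \<omega>)) \<le> real CARD('n) * c"
      proof (rule AE_I2)
        fix r assume r: "r \<in> space L"
        have "norm (A r *v X r \<omega>) \<le> (\<Sum>j\<in>UNIV. \<bar>rate r \<omega> j\<bar>)"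
          unfolding rate_def by (rule norm_le_l1_cart)
        also have "\<dots> \<le> (\<Sum>j\<in>(UNIV::'n set). c)" using r \<omega> by (intro sum_mono rate_le) auto
        finally have "norm (A r *v X r \<omega>) \<le> real CARD('n) * c" by simp
        then show "norm (indicator {0..b} r *\<^sub>R (A r *v X r \<omega>)) \<le> real CARD('n) * c"
          using c_pos by (auto simp: indicator_def)
      qed
      have "(\<lambda>r. A r *v X r \<omega>) \<in> borel_measurable L"
        using rate_m unfolding rate_def
        by (subst borel_measurable_euclidean_space) (auto simp: Basis_vec_def inner_axis)
      moreover have "(\<lambda>r. indicator {0..b} r :: real) \<in> borel_measurable L"
        by (rule measurable_compose[OF measurable_id_L]) simp
      ultimately show "(\<lambda>r. indicator {0..b} r *\<^sub>R (A r *v X r \<omega>)) \<in> borel_measurable L"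
        by (rule borel_measurable_scaleR[rotated])
    qed
    have "(LINT r:{0..b}|lborel. A r *v X r \<omega>)
        = (\<integral>r. indicator {0..T} r *\<^sub>R (indicator {0..b} r *\<^sub>R (A r *v X r \<omega>)) \<partial>lborel)"
      unfolding set_lebesgue_integral_def using b
      by (intro Bochner_Integration.integral_cong) (auto simp: indicator_def)
    also have "\<dots> = (\<integral>r. indicator {0..b} r *\<^sub>R (A r *v X r \<omega>) \<partial>L)"
      by (rule integral_restrict_space[symmetric]) simp
    finally have "(LINT r:{0..b}|lborel. A r *v X r \<omega>) $ j
        = (\<integral>r. (indicator {0..b} r *\<^sub>R (A r *v X r \<omega>)) $ j \<partial>L)"
      using integral_bounded_linear[OF bounded_linear_vec_nth bi] by simp
    also have "\<dots> = (\<integral>r. indicator {0<..b} r * rate r \<omega> j \<partial>L)"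
    proof (rule integral_cong_AE)
      have "AE r in lborel. r \<noteq> (0::real)" by (rule AE_lborel_singleton)
      then have "AE r in lborel. r \<in> {0..T} \<longrightarrow> r \<noteq> 0" by (rule eventually_mono) simp
      then have "AE r in L. r \<noteq> 0" by (simp add: AE_restrict_space_iff)
      then show "AE r in L. (indicator {0..b} r *\<^sub>R (A r *v X r \<omega>)) $ j = indicator {0<..b} r * rate r \<omega> j"
        by eventually_elim (auto simp: indicator_def rate_def)
      show "(\<lambda>r. (indicator {0..b} r *\<^sub>R (A r *v X r \<omega>)) $ j) \<in> borel_measurable L"
        using bi by (intro borel_measurable_vec_component borel_measurable_integrable)
    qed (use int1 in \<open>rule borel_measurable_integrable\<close>)
    finally show ?thesis .
  qed
  have "(\<integral>r. indicator {0<..t} r * rate r \<omega> j \<partial>L)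
      = (\<integral>r. indicator {0<..s} r * rate r \<omega> j + indicator {s<..t} r * rate r \<omega> j \<partial>L)"
    using st by (intro Bochner_Integration.integral_cong) (auto simp: indicator_def)
  then have "(\<integral>r. indicator {0<..t} r * rate r \<omega> j \<partial>L)
      = (\<integral>r. indicator {0<..s} r * rate r \<omega> j \<partial>L) + (\<integral>r. indicator {s<..t} r * rate r \<omega> j \<partial>L)"
    by (simp add: int1)
  then show ?thesis
    using st by (simp add: chain_martingale_def comp)
qed

lemma M_0: "M 0 \<omega> = 0"
proof -
  have "(LINT s:{0..0}|lborel. A s *v X s \<omega>) = 0"
    unfolding set_lebesgue_integral_def
  proof (rule integral_eq_zero_AE)
    show "AE s in lborel. indicator {0..0} s *\<^sub>R (A s *v X s \<omega>) = 0"
      using AE_lborel_singleton[of "0::real"] by (rule eventually_mono) (simp add: indicator_def)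
  qed
  then show ?thesis by (simp add: chain_martingale_def)
qed

lemma X_component_bounds:
  assumes "0 \<le> r" "\<omega> \<in> space P"
  shows "0 \<le> X r \<omega> $ j" "X r \<omega> $ j \<le> 1"
proof -
  obtain i where i: "X r \<omega> = axis i 1" using X_axis[OF assms] .
  show "0 \<le> X r \<omega> $ j" "X r \<omega> $ j \<le> 1" by (auto simp: i axis_def)
qed

lemma M_increment_bound:
  assumes "\<omega> \<in> space P" "0 \<le> s" "s \<le> t" "t \<le> T"
  shows "\<bar>M t \<omega> $ j - M s \<omega> $ j\<bar> \<le> 2 + c * T"
proof -
  have "\<bar>\<integral>r. indicator {s<..t} r * rate r \<omega> j \<partial>L\<bar> \<le> c * (t - s)"
    using assms by (intro abs_integral_L_le rate_le) auto
  also have "\<dots> \<le> c * T" using assms c_pos by simp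
  finally show ?thesis
    using M_increment[OF assms, of j] X_component_bounds[of t \<omega> j] X_component_bounds[of s \<omega> j] assms by auto
qed

lemma M_measurable: "0 \<le> t \<Longrightarrow> M t \<in> borel_measurable (F t)"
  using martingale by (simp add: square_integrable_martingale_def)

lemma integrable_mult_bounded:
  fixes f g :: "'w \<Rightarrow> real"
  assumes "integrable P f" "g \<in> borel_measurable P" "\<And>\<omega>. \<omega> \<in> space P \<Longrightarrow> \<bar>g \<omega>\<bar> \<le> K"
  shows "integrable P (\<lambda>\<omega>. f \<omega> * g \<omega>)"
proof (rule Bochner_Integration.integrable_bound[of P "\<lambda>\<omega>. K * f \<omega>"])
  show "AE \<omega> in P. norm (f \<omega> * g \<omega>) \<le> norm (K * f \<omega>)"
  proof (rule AE_I2)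
    fix \<omega> assume "\<omega> \<in> space P"
    then have "\<bar>g \<omega>\<bar> \<le> \<bar>K\<bar>" using assms(3)[of \<omega>] by simp
    then show "norm (f \<omega> * g \<omega>) \<le> norm (K * f \<omega>)"
      using mult_left_mono[of "\<bar>g \<omega>\<bar>" "\<bar>K\<bar>" "\<bar>f \<omega>\<bar>"] by (simp add: abs_mult mult.commute)
  qed
qed (use assms(1,2) in auto)

text \<open>The increments of \<open>M\<close> are bounded, which admits all integrable coefficients.\<close>

lemma M_martingale:
  assumes st: "0 \<le> s" "s \<le> t" "t \<le> T"
    and \<eta>: "\<eta> \<in> borel_measurable (F s)" "integrable P \<eta>"
  shows "expectation (\<lambda>\<omega>. \<eta> \<omega> * (M t \<omega> $ j - M s \<omega> $ j)) = 0"
    and "integrable P (\<lambda>\<omega>. \<eta> \<omega> * (M t \<omega> $ j - M s \<omega> $ j))"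
proof -
  interpret fs: finite_measure_subalgebra P "F s"
    by standard (rule subalgebra_F)
  have M_P: "(\<lambda>\<omega>. M u \<omega> $ j) \<in> borel_measurable P" if "0 \<le> u" for u
    by (intro borel_measurable_vec_component measurable_F_P[OF M_measurable] that)
  have int: "integrable P (\<lambda>\<omega>. \<eta> \<omega> * M u \<omega> $ j)" if "0 \<le> u" "u \<le> T" for u
    using M_increment_bound[of _ 0 u] M_P that by (intro integrable_mult_bounded[OF \<eta>(2)]) (auto simp: M_0)
  show "integrable P (\<lambda>\<omega>. \<eta> \<omega> * (M t \<omega> $ j - M s \<omega> $ j))"
    using int[of s] int[of t] st by (simp add: right_diff_distrib)
  have "AE \<omega> in P. real_cond_exp P (F s) (\<lambda>\<omega>. M t \<omega> $ j) \<omega> = M s \<omega> $ j"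
    using martingale st by (simp add: square_integrable_martingale_def)
  then have "expectation (\<lambda>\<omega>. \<eta> \<omega> * M s \<omega> $ j)
      = expectation (\<lambda>\<omega>. \<eta> \<omega> * real_cond_exp P (F s) (\<lambda>\<omega>. M t \<omega> $ j) \<omega>)"
    using M_P[of s] measurable_F_P[OF \<eta>(1)] st
    by (intro integral_cong_AE) (auto elim: eventually_mono intro!: borel_measurable_times)
  also have "\<dots> = expectation (\<lambda>\<omega>. \<eta> \<omega> * M t \<omega> $ j)"
    using st by (intro fs.real_cond_exp_intg(2) int \<eta> M_P) auto
  finally show "expectation (\<lambda>\<omega>. \<eta> \<omega> * (M t \<omega> $ j - M s \<omega> $ j)) = 0"
    using int[of s] int[of t] st by (simp add: right_diff_distrib)
qed

text \<open>The difference between an increment of \<open>X\<close> and the integrated rates is an increment of \<open>M\<close>, which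
  is orthogonal to coefficients known at time \<open>s\<close>.\<close>

lemma compensator:
  assumes st: "0 \<le> s" "s \<le> t" "t \<le> T"
    and \<theta>: "\<And>j. \<theta> j \<in> borel_measurable (F s)" "\<And>j. integrable P (\<theta> j)"
  shows "expectation (\<lambda>\<omega>. \<Sum>j\<in>UNIV. \<theta> j \<omega> * (X t \<omega> $ j - X s \<omega> $ j))
      = stint s t (\<lambda>r \<omega>. \<Sum>j\<in>UNIV. \<theta> j \<omega> * rate r \<omega> j)"
    and "Q_integrable (\<lambda>r \<omega>. \<Sum>j\<in>UNIV. \<theta> j \<omega> * rate r \<omega> j)"
proof -
  have sj: "Q_integrable (\<lambda>r \<omega>. \<theta> j \<omega> * rate r \<omega> j)" for j
  proof (rule Q_integrable_bounded[OF integrable_lift[OF \<theta>(2)[of j]], of _ c])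
    show "(\<lambda>p. \<theta> j (snd p) * rate (fst p) (snd p) j) \<in> borel_measurable Q"
      using \<theta>(2)[of j] by (intro borel_measurable_times rate_Q measurable_snd_Q) auto
    show "\<bar>\<theta> j \<omega> * rate r \<omega> j\<bar> \<le> c * \<bar>\<theta> j \<omega>\<bar>" if "r \<in> {0..T}" "\<omega> \<in> space P" for r \<omega>
      using mult_left_mono[OF rate_le[of r \<omega> j], of "\<bar>\<theta> j \<omega>\<bar>"] that by (simp add: abs_mult mult.commute)
  qed
  then show Q_integrable: "Q_integrable (\<lambda>r \<omega>. \<Sum>j\<in>UNIV. \<theta> j \<omega> * rate r \<omega> j)"
    by (intro Bochner_Integration.integrable_sum) auto
  have X_int: "integrable P (\<lambda>\<omega>. \<theta> j \<omega> * (X t \<omega> $ j - X s \<omega> $ j))" for j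
  proof (rule integrable_mult_bounded[OF \<theta>(2), of _ 2])
    show "(\<lambda>\<omega>. X t \<omega> $ j - X s \<omega> $ j) \<in> borel_measurable P"
      using st X_measurable by (intro borel_measurable_diff borel_measurable_vec_component) auto
    show "\<bar>X t \<omega> $ j - X s \<omega> $ j\<bar> \<le> 2" if "\<omega> \<in> space P" for \<omega>
      using X_component_bounds[of t \<omega> j] X_component_bounds[of s \<omega> j] that st by auto
  qed
  have one: "expectation (\<lambda>\<omega>. \<theta> j \<omega> * (X t \<omega> $ j - X s \<omega> $ j)) = stint s t (\<lambda>r \<omega>. \<theta> j \<omega> * rate r \<omega> j)" for j
  proof -
    have "expectation (\<lambda>\<omega>. \<theta> j \<omega> * (X t \<omega> $ j - X s \<omega> $ j))
        = expectation (\<lambda>\<omega>. \<theta> j \<omega> * (X t \<omega> $ j - X s \<omega> $ j)) - expectation (\<lambda>\<omega>. \<theta> j \<omega> * (M t \<omega> $ j - M s \<omega> $ j))"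
      using M_martingale(1)[OF st \<theta>] by simp
    also have "\<dots> = expectation (\<lambda>\<omega>. \<theta> j \<omega> * (X t \<omega> $ j - X s \<omega> $ j) - \<theta> j \<omega> * (M t \<omega> $ j - M s \<omega> $ j))"
      using X_int M_martingale(2)[OF st \<theta>] by (rule Bochner_Integration.integral_diff[symmetric])
    also have "\<dots> = expectation (\<lambda>\<omega>. \<integral>r. indicator {s<..t} r * (\<theta> j \<omega> * rate r \<omega> j) \<partial>L)"
    proof (rule Bochner_Integration.integral_cong[OF refl])
      fix \<omega> assume \<omega>: "\<omega> \<in> space P"
      have "\<theta> j \<omega> * (X t \<omega> $ j - X s \<omega> $ j) - \<theta> j \<omega> * (M t \<omega> $ j - M s \<omega> $ j)
          = \<theta> j \<omega> * (\<integral>r. indicator {s<..t} r * rate r \<omega> j \<partial>L)"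
        unfolding M_increment[OF \<omega> st] by (simp add: algebra_simps)
      then show "\<theta> j \<omega> * (X t \<omega> $ j - X s \<omega> $ j) - \<theta> j \<omega> * (M t \<omega> $ j - M s \<omega> $ j)
          = (\<integral>r. indicator {s<..t} r * (\<theta> j \<omega> * rate r \<omega> j) \<partial>L)"
        by (simp add: mult.left_commute)
    qed
    also have "\<dots> = stint s t (\<lambda>r \<omega>. \<theta> j \<omega> * rate r \<omega> j)"
      using stint_expectation(1)[OF sj] by simp
    finally show ?thesis .
  qed
  have "stint s t (\<lambda>r \<omega>. \<Sum>j\<in>UNIV. \<theta> j \<omega> * rate r \<omega> j) = (\<Sum>j\<in>UNIV. stint s t (\<lambda>r \<omega>. \<theta> j \<omega> * rate r \<omega> j))"
    unfolding stint_def sum_distrib_left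
    by (rule Bochner_Integration.integral_sum) (rule Q_integrable_indicator[OF sj])
  then show "expectation (\<lambda>\<omega>. \<Sum>j\<in>UNIV. \<theta> j \<omega> * (X t \<omega> $ j - X s \<omega> $ j))
      = stint s t (\<lambda>r \<omega>. \<Sum>j\<in>UNIV. \<theta> j \<omega> * rate r \<omega> j)"
    using one X_int by simp
qed

definition moved :: "real \<Rightarrow> real \<Rightarrow> 'w \<Rightarrow> real" where
  "moved s r \<omega> = (if X s \<omega> = X r \<omega> then 0 else 1)"

lemma moved_inner:
  assumes "0 \<le> s" "0 \<le> r" "\<omega> \<in> space P"
  shows "moved s r \<omega> = 1 - (\<Sum>j\<in>UNIV. X s \<omega> $ j * X r \<omega> $ j)"
proof -
  obtain i where "X s \<omega> = axis i 1" using X_axis[OF assms(1,3)] .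
  moreover obtain k where "X r \<omega> = axis k 1" using X_axis[OF assms(2,3)] .
  ultimately show ?thesis
    by (auto simp: moved_def axis_def mult_delta_left vec_eq_iff)
qed

lemma moved_Q:
  assumes "0 \<le> s"
  shows "(\<lambda>p. moved s (fst p) (snd p)) \<in> borel_measurable Q"
proof -
  have "(\<lambda>p. 1 - (\<Sum>j\<in>UNIV. X s (snd p) $ j * X (fst p) (snd p) $ j)) \<in> borel_measurable Q"
    using assms X_Q X_measurable
    by (intro borel_measurable_diff borel_measurable_sum borel_measurable_times borel_measurable_vec_component
        measurable_snd_Q) auto
  moreover have "(\<lambda>p. 1 - (\<Sum>j\<in>UNIV. X s (snd p) $ j * X (fst p) (snd p) $ j)) \<in> borel_measurable Q
      \<longleftrightarrow> (\<lambda>p. moved s (fst p) (snd p)) \<in> borel_measurable Q"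
    using assms by (intro measurable_cong) (auto simp: moved_inner space_Q)
  ultimately show ?thesis by simp
qed

lemma moved_Q_integrable:
  assumes "0 \<le> s"
  shows "Q_integrable (moved s)"
  by (rule Q.integrable_const_bound[OF AE_I2 moved_Q[OF assms], of 1]) (auto simp: moved_def)

text \<open>The indicator of a move is \<open>\<Sum>\<^sub>j (1 - X\<^sub>s\<^sub>j) (X\<^sub>t\<^sub>j - X\<^sub>s\<^sub>j)\<close>, to which the compensator applies.\<close>

lemma expectation_moved_le:
  assumes "0 \<le> s" "s \<le> t" "t \<le> T"
  shows "expectation (moved s t) \<le> c * (t - s)"
proof -
  have \<theta>: "(\<lambda>\<omega>. 1 - X s \<omega> $ j) \<in> borel_measurable (F s)" for j
    using X_adapted[OF assms(1)] by (intro borel_measurable_diff borel_measurable_vec_component) auto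
  have bnd: "\<bar>1 - X s \<omega> $ j\<bar> \<le> 1" if \<omega>: "\<omega> \<in> space P" for \<omega> j
    using X_component_bounds[OF assms(1) \<omega>, of j] by auto
  have \<theta>_int: "integrable P (\<lambda>\<omega>. 1 - X s \<omega> $ j)" for j
    using bnd measurable_F_P[OF \<theta>] by (intro integrable_const_bound[of _ 1]) auto
  have "expectation (moved s t) = expectation (\<lambda>\<omega>. \<Sum>j\<in>UNIV. (1 - X s \<omega> $ j) * (X t \<omega> $ j - X s \<omega> $ j))"
  proof (rule Bochner_Integration.integral_cong[OF refl])
    fix \<omega> assume \<omega>: "\<omega> \<in> space P"
    obtain i where "X s \<omega> = axis i 1" using X_axis[OF assms(1) \<omega>] .
    moreover obtain k where "X t \<omega> = axis k 1" using X_axis[OF order_trans[OF assms(1,2)] \<omega>] .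
    ultimately show "moved s t \<omega> = (\<Sum>j\<in>UNIV. (1 - X s \<omega> $ j) * (X t \<omega> $ j - X s \<omega> $ j))"
      by (auto simp: moved_def axis_def vec_eq_iff algebra_simps sum.distrib sum_subtractf mult_delta_left)
  qed
  also have "\<dots> = stint s t (\<lambda>r \<omega>. \<Sum>j\<in>UNIV. (1 - X s \<omega> $ j) * rate r \<omega> j)"
    by (rule compensator(1)[OF assms \<theta> \<theta>_int])
  also have "\<dots> \<le> stint s t (\<lambda>r \<omega>. c)"
  proof (rule stint_mono)
    show "Q_integrable (\<lambda>r \<omega>. \<Sum>j\<in>UNIV. (1 - X s \<omega> $ j) * rate r \<omega> j)"
      by (rule compensator(2)[OF assms \<theta> \<theta>_int])
    fix r \<omega> assume r: "r \<in> {0..T}" "\<omega> \<in> space P"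
    then show "(\<Sum>j\<in>UNIV. (1 - X s \<omega> $ j) * rate r \<omega> j) \<le> c"
      using sum_rate_abs_le[of r \<omega> "\<lambda>j. 1 - X s \<omega> $ j" 1] bnd by (auto simp: mult.commute)
  qed (auto intro: Q.integrable_const)
  also have "\<dots> = c * (t - s)"
    using stint_static[of "\<lambda>_. c" s t] assms by (simp add: prob_space)
  finally show ?thesis .
qed

lemma stint_moved_le:
  assumes "0 \<le> a" "a \<le> b" "b \<le> T"
  shows "stint a b (moved a) \<le> c * (b - a)\<^sup>2"
proof -
  have "stint a b (moved a) \<le> c * (b - a) * (b - a)"
  proof (rule stint_le_const[OF moved_Q_integrable])
    fix r assume "a < r" "r \<le> b"
    then have "expectation (moved a r) \<le> c * (r - a)" using assms by (intro expectation_moved_le) auto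
    also have "\<dots> \<le> c * (b - a)" using \<open>r \<le> b\<close> c_pos by (intro mult_left_mono) auto
    finally show "expectation (moved a r) \<le> c * (b - a)" .
  qed (use assms in auto)
  then show ?thesis by (simp add: power2_eq_square mult.assoc)
qed

lemma jump_bound:
  assumes "0 \<le> r" "\<omega> \<in> space P" "norm C \<le> B"
  shows "\<bar>jump C r \<omega> j\<bar> \<le> 2 * B"
proof -
  obtain i where i: "X r \<omega> = axis i 1" using X_axis[OF assms(1,2)] .
  have "norm (axis j 1 - X r \<omega>) \<le> norm (axis j 1 :: real ^ 'n) + norm (X r \<omega>)" by (rule norm_triangle_ineq4)
  also have "\<dots> = 2" by (simp add: i norm_axis_1)
  finally have "norm C * norm (axis j 1 - X r \<omega>) \<le> B * 2"
    using assms(3) by (intro mult_mono) (auto intro: order_trans[OF norm_ge_zero])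
  then show ?thesis
    using Cauchy_Schwarz_ineq2[of C "axis j 1 - X r \<omega>"] by (simp add: jump_def)
qed

text \<open>For a short interval, the expected change of a function of the position is the integral of the
  transition rates against its values at the possible jumps. The rates are those of the current
  state while \<open>g\<close> sees the state at time \<open>s\<close>; replacing that by the current state costs only a
  second order term, since the chain rarely moves.\<close>

lemma one_step_compensator:
  fixes g :: "'w \<Rightarrow> real \<Rightarrow> real" and \<eta> :: "'w \<Rightarrow> real ^ 'n"
  assumes st: "0 \<le> s" "s \<le> t" "t \<le> T"
    and meas: "\<And>i j. (\<lambda>\<omega>. g \<omega> (\<eta> \<omega> \<bullet> (axis j 1 - axis i 1))) \<in> borel_measurable (F s)"
    and \<eta>: "\<And>\<omega>. \<omega> \<in> space P \<Longrightarrow> norm (\<eta> \<omega>) \<le> B"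
    and bnd: "\<And>\<omega> d. \<omega> \<in> space P \<Longrightarrow> \<bar>d\<bar> \<le> 2 * B \<Longrightarrow> \<bar>g \<omega> d\<bar> \<le> K"
    and zero: "\<And>\<omega>. \<omega> \<in> space P \<Longrightarrow> g \<omega> 0 = 0"
  shows "\<bar>expectation (\<lambda>\<omega>. g \<omega> (\<eta> \<omega> \<bullet> (X t \<omega> - X s \<omega>)))
      - stint s t (\<lambda>r \<omega>. \<Sum>j\<in>UNIV. rate r \<omega> j * g \<omega> (jump (\<eta> \<omega>) r \<omega> j))\<bar> \<le> 2 * c\<^sup>2 * K * (t - s)\<^sup>2" (is "\<bar>?E - ?S\<bar> \<le> _")
    and "Q_integrable (\<lambda>r \<omega>. \<Sum>j\<in>UNIV. rate r \<omega> j * g \<omega> (jump (\<eta> \<omega>) r \<omega> j))" (is "Q_integrable ?h")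
    and "integrable P (\<lambda>\<omega>. g \<omega> (\<eta> \<omega> \<bullet> (X t \<omega> - X s \<omega>)))"
proof -
  have expand: "g \<omega> (\<eta> \<omega> \<bullet> (x - X r \<omega>)) = (\<Sum>i\<in>UNIV. X r \<omega> $ i * g \<omega> (\<eta> \<omega> \<bullet> (x - axis i 1)))"
    if r: "0 \<le> r" and \<omega>: "\<omega> \<in> space P" for r \<omega> x
  proof -
    obtain i where i: "X r \<omega> = axis i 1" using X_axis[OF r \<omega>] .
    then show ?thesis by (simp add: axis_def mult_delta_left)
  qed
  \<comment> \<open>\<open>\<theta>\<^sub>j = g (\<eta> \<bullet> (e\<^sub>j - X\<^sub>s))\<close>, written as a sum over the states so that it is visibly known at time \<open>s\<close>\<close>
  define \<theta> where "\<theta> j \<omega> = (\<Sum>i\<in>UNIV. X s \<omega> $ i * g \<omega> (\<eta> \<omega> \<bullet> (axis j 1 - axis i 1)))" for j \<omega>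
  have \<theta>_eq: "\<theta> j \<omega> = g \<omega> (jump (\<eta> \<omega>) s \<omega> j)" if "\<omega> \<in> space P" for j \<omega>
    using expand[OF st(1) that] by (simp add: \<theta>_def jump_def)
  have \<theta>_meas: "\<theta> j \<in> borel_measurable (F s)" for j
    unfolding \<theta>_def using X_adapted[OF st(1)] meas
    by (intro borel_measurable_sum borel_measurable_times borel_measurable_vec_component)
  have g_le: "\<bar>g \<omega> (jump (\<eta> \<omega>) r \<omega> j)\<bar> \<le> K" if "0 \<le> r" "\<omega> \<in> space P" for r \<omega> j
    using that by (intro bnd jump_bound \<eta>)
  have \<theta>_int: "integrable P (\<theta> j)" for j
    using g_le[OF st(1)] measurable_F_P[OF \<theta>_meas] by (intro integrable_const_bound[of _ K] AE_I2) (auto simp: \<theta>_eq)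
  have E_eq: "?E = expectation (\<lambda>\<omega>. \<Sum>j\<in>UNIV. \<theta> j \<omega> * (X t \<omega> $ j - X s \<omega> $ j))"
  proof (rule Bochner_Integration.integral_cong[OF refl])
    fix \<omega> assume \<omega>: "\<omega> \<in> space P"
    obtain i where i: "X t \<omega> = axis i 1" using X_axis[OF order_trans[OF st(1,2)] \<omega>] .
    obtain k where k: "X s \<omega> = axis k 1" using X_axis[OF st(1) \<omega>] .
    have "(\<Sum>j\<in>UNIV. \<theta> j \<omega> * (X t \<omega> $ j - X s \<omega> $ j)) = \<theta> i \<omega> - \<theta> k \<omega>"
      by (simp add: i k axis_def right_diff_distrib sum_subtractf mult_delta_right)
    also have "\<dots> = g \<omega> (\<eta> \<omega> \<bullet> (X t \<omega> - X s \<omega>))"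
      using \<omega> by (simp add: \<theta>_eq jump_def i k zero)
    finally show "g \<omega> (\<eta> \<omega> \<bullet> (X t \<omega> - X s \<omega>)) = (\<Sum>j\<in>UNIV. \<theta> j \<omega> * (X t \<omega> $ j - X s \<omega> $ j))" by simp
  qed
  have hQ: "(\<lambda>p. ?h (fst p) (snd p)) \<in> borel_measurable Q"
  proof -
    have "(\<lambda>p. \<Sum>j\<in>UNIV. rate (fst p) (snd p) j * (\<Sum>i\<in>UNIV. X (fst p) (snd p) $ i * g (snd p) (\<eta> (snd p) \<bullet> (axis j 1 - axis i 1))))
        \<in> borel_measurable Q"
      by (intro borel_measurable_sum borel_measurable_times rate_Q borel_measurable_vec_component X_Q
          measurable_snd_Q[OF measurable_F_P[OF meas]])
    moreover have "(\<lambda>p. \<Sum>j\<in>UNIV. rate (fst p) (snd p) j * (\<Sum>i\<in>UNIV. X (fst p) (snd p) $ i * g (snd p) (\<eta> (snd p) \<bullet> (axis j 1 - axis i 1))))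
        \<in> borel_measurable Q \<longleftrightarrow> (\<lambda>p. ?h (fst p) (snd p)) \<in> borel_measurable Q"
      by (rule measurable_cong) (auto simp: space_Q jump_def expand)
    ultimately show ?thesis by simp
  qed
  show h_Q_integrable: "Q_integrable ?h"
  proof (rule Q.integrable_const_bound[OF AE_I2 hQ, of "c * K"])
    fix p assume "p \<in> space Q"
    then show "norm (?h (fst p) (snd p)) \<le> c * K"
      using sum_rate_abs_le[OF _ _ g_le, of "fst p" "snd p"] by (auto simp: space_Q)
  qed
  note comp = compensator[OF st \<theta>_meas \<theta>_int]
  show "integrable P (\<lambda>\<omega>. g \<omega> (\<eta> \<omega> \<bullet> (X t \<omega> - X s \<omega>)))"
  proof -
    have "(\<lambda>\<omega>. \<Sum>i\<in>UNIV. X t \<omega> $ i * \<theta> i \<omega>) \<in> borel_measurable P"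
      using st measurable_F_P[OF \<theta>_meas] X_measurable[of t]
      by (intro borel_measurable_sum borel_measurable_times borel_measurable_vec_component) auto
    moreover have "(\<lambda>\<omega>. \<Sum>i\<in>UNIV. X t \<omega> $ i * \<theta> i \<omega>) \<in> borel_measurable P \<longleftrightarrow>
        (\<lambda>\<omega>. g \<omega> (\<eta> \<omega> \<bullet> (X t \<omega> - X s \<omega>))) \<in> borel_measurable P"
    proof (rule measurable_cong)
      fix \<omega> assume \<omega>: "\<omega> \<in> space P"
      obtain i where i: "X t \<omega> = axis i 1" using X_axis[OF order_trans[OF st(1,2)] \<omega>] .
      then show "(\<Sum>i\<in>UNIV. X t \<omega> $ i * \<theta> i \<omega>) = g \<omega> (\<eta> \<omega> \<bullet> (X t \<omega> - X s \<omega>))"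
        using \<theta>_eq[OF \<omega>] by (simp add: i axis_def mult_delta_left jump_def)
    qed
    ultimately have m: "(\<lambda>\<omega>. g \<omega> (\<eta> \<omega> \<bullet> (X t \<omega> - X s \<omega>))) \<in> borel_measurable P" by simp
    show ?thesis
    proof (rule integrable_const_bound[OF AE_I2 m, of K])
      fix \<omega> assume \<omega>: "\<omega> \<in> space P"
      obtain i where i: "X t \<omega> = axis i 1" using X_axis[OF order_trans[OF st(1,2)] \<omega>] .
      show "norm (g \<omega> (\<eta> \<omega> \<bullet> (X t \<omega> - X s \<omega>))) \<le> K"
        using g_le[OF st(1) \<omega>, of i] by (simp add: i jump_def)
    qed
  qed
  have "\<bar>?E - ?S\<bar> = \<bar>stint s t (\<lambda>r \<omega>. (\<Sum>j\<in>UNIV. \<theta> j \<omega> * rate r \<omega> j) - ?h r \<omega>)\<bar>"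
    unfolding E_eq comp(1) using stint_diff[OF comp(2) h_Q_integrable, of s t] by simp
  also have "\<dots> \<le> stint s t (\<lambda>r \<omega>. 2 * c * K * moved s r \<omega>)"
  proof -
    have pt: "\<bar>(\<Sum>j\<in>UNIV. \<theta> j \<omega> * rate r \<omega> j) - ?h r \<omega>\<bar> \<le> 2 * c * K * moved s r \<omega>"
      if "r \<in> {0..T}" "\<omega> \<in> space P" for r \<omega>
    proof (cases "X s \<omega> = X r \<omega>")
      case True
      then show ?thesis using that by (simp add: \<theta>_eq jump_def moved_def mult.commute)
    next
      case False
      have "\<bar>(\<Sum>j\<in>UNIV. \<theta> j \<omega> * rate r \<omega> j) - ?h r \<omega>\<bar>
          \<le> \<bar>\<Sum>j\<in>UNIV. rate r \<omega> j * g \<omega> (jump (\<eta> \<omega>) s \<omega> j)\<bar> + \<bar>?h r \<omega>\<bar>"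
        using that by (simp add: \<theta>_eq mult.commute abs_triangle_ineq4)
      also have "\<dots> \<le> c * K + c * K"
        using that st by (intro add_mono sum_rate_abs_le g_le) auto
      finally show ?thesis using False by (simp add: moved_def algebra_simps)
    qed
    have s1: "Q_integrable (\<lambda>r \<omega>. (\<Sum>j\<in>UNIV. \<theta> j \<omega> * rate r \<omega> j) - ?h r \<omega>)"
      using comp(2) h_Q_integrable by (rule Bochner_Integration.integrable_diff)
    have s2: "Q_integrable (\<lambda>r \<omega>. 2 * c * K * moved s r \<omega>)"
      using moved_Q_integrable[OF st(1)] by simp
    have s1': "Q_integrable (\<lambda>r \<omega>. -1 * ((\<Sum>j\<in>UNIV. \<theta> j \<omega> * rate r \<omega> j) - ?h r \<omega>))"
      using s1 by (rule integrable_mult_right)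
    have "stint s t (\<lambda>r \<omega>. (\<Sum>j\<in>UNIV. \<theta> j \<omega> * rate r \<omega> j) - ?h r \<omega>) \<le> stint s t (\<lambda>r \<omega>. 2 * c * K * moved s r \<omega>)"
      using pt by (intro stint_mono s1 s2) (auto simp: abs_le_iff)
    moreover have "stint s t (\<lambda>r \<omega>. -1 * ((\<Sum>j\<in>UNIV. \<theta> j \<omega> * rate r \<omega> j) - ?h r \<omega>)) \<le> stint s t (\<lambda>r \<omega>. 2 * c * K * moved s r \<omega>)"
      using pt by (intro stint_mono s1' s2) (auto simp: abs_le_iff)
    ultimately show ?thesis
      unfolding stint_cmult[of s t "-1"] by simp
  qed
  also have "\<dots> \<le> 2 * c * K * (c * (t - s)\<^sup>2)"
  proof -
    obtain \<omega> where "\<omega> \<in> space P" using not_empty by auto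
    then have "0 \<le> K" by (rule order_trans[OF abs_ge_zero g_le[OF st(1)]])
    then show ?thesis
      unfolding stint_cmult using stint_moved_le[OF st] c_pos by (intro mult_left_mono) auto
  qed
  finally show "\<bar>?E - ?S\<bar> \<le> 2 * c\<^sup>2 * K * (t - s)\<^sup>2" by (simp add: power2_eq_square mult_ac)
qed

section \<open>Mean squares and the energy semi-norm\<close>

subsection \<open>Square-integrable random variables\<close>

abbreviation sq_int :: "('w \<Rightarrow> real) \<Rightarrow> bool" where
  "sq_int f \<equiv> f \<in> borel_measurable P \<and> integrable P (\<lambda>\<omega>. (f \<omega>)\<^sup>2)"

lemma sq_int_mult:
  assumes "sq_int f" "sq_int g"
  shows "integrable P (\<lambda>\<omega>. f \<omega> * g \<omega>)"
proof (rule Bochner_Integration.integrable_bound[of P "\<lambda>\<omega>. (f \<omega>)\<^sup>2 + (g \<omega>)\<^sup>2"])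
  have "\<bar>x * y\<bar> \<le> \<bar>x\<^sup>2 + y\<^sup>2\<bar>" for x y :: real
  proof -
    have "2 * (\<bar>x\<bar> * \<bar>y\<bar>) \<le> x\<^sup>2 + y\<^sup>2" using sum_squares_bound[of "\<bar>x\<bar>" "\<bar>y\<bar>"] by simp
    moreover have "0 \<le> \<bar>x\<bar> * \<bar>y\<bar>" by simp
    ultimately show ?thesis unfolding abs_mult by linarith
  qed
  then show "AE \<omega> in P. norm (f \<omega> * g \<omega>) \<le> norm ((f \<omega>)\<^sup>2 + (g \<omega>)\<^sup>2)" by simp
qed (use assms in auto)

lemma sq_int_bounded:
  assumes "f \<in> borel_measurable P" "\<And>\<omega>. \<omega> \<in> space P \<Longrightarrow> \<bar>f \<omega>\<bar> \<le> K"
  shows "sq_int f"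
proof -
  have "integrable P (\<lambda>\<omega>. (f \<omega>)\<^sup>2)"
  proof (rule integrable_const_bound[of _ "K\<^sup>2"])
    show "AE \<omega> in P. norm ((f \<omega>)\<^sup>2) \<le> K\<^sup>2"
    proof (rule AE_I2)
      fix \<omega> assume "\<omega> \<in> space P"
      then have "\<bar>f \<omega>\<bar>\<^sup>2 \<le> K\<^sup>2" using assms(2) by (intro power_mono) auto
      then show "norm ((f \<omega>)\<^sup>2) \<le> K\<^sup>2" by simp
    qed
  qed (use assms(1) in auto)
  then show ?thesis using assms(1) by simp
qed

lemma sq_int_const: "sq_int (\<lambda>\<omega>. k)"
  by (rule sq_int_bounded[of _ "\<bar>k\<bar>"]) auto

lemma sq_int_integrable: "sq_int f \<Longrightarrow> integrable P f"
  using sq_int_mult[of f, OF _ sq_int_const[of 1]] by simp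

lemma sq_int_add:
  assumes "sq_int f" "sq_int g"
  shows "sq_int (\<lambda>\<omega>. f \<omega> + g \<omega>)"
proof
  show "(\<lambda>\<omega>. f \<omega> + g \<omega>) \<in> borel_measurable P" using assms by (intro borel_measurable_add) auto
  have "integrable P (\<lambda>\<omega>. (f \<omega>)\<^sup>2 + (g \<omega>)\<^sup>2 + 2 * (f \<omega> * g \<omega>))"
    using assms sq_int_mult[OF assms] by (intro Bochner_Integration.integrable_add integrable_mult_right) auto
  then show "integrable P (\<lambda>\<omega>. (f \<omega> + g \<omega>)\<^sup>2)" by (simp add: power2_sum mult.assoc)
qed

lemma sq_int_cmult:
  assumes "sq_int f"
  shows "sq_int (\<lambda>\<omega>. k * f \<omega>)"
proof
  show "(\<lambda>\<omega>. k * f \<omega>) \<in> borel_measurable P" using assms by (intro borel_measurable_times) auto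
  show "integrable P (\<lambda>\<omega>. (k * f \<omega>)\<^sup>2)" using assms by (simp add: power_mult_distrib)
qed

lemma sq_int_diff: "sq_int f \<Longrightarrow> sq_int g \<Longrightarrow> sq_int (\<lambda>\<omega>. f \<omega> - g \<omega>)"
  using sq_int_add[OF _ sq_int_cmult[of g "-1"], of f] by simp

lemma sq_int_le:
  assumes "sq_int g" "f \<in> borel_measurable P" "AE \<omega> in P. \<bar>f \<omega>\<bar> \<le> \<bar>g \<omega>\<bar>"
  shows "sq_int f"
proof -
  have "integrable P (\<lambda>\<omega>. (f \<omega>)\<^sup>2)"
  proof (rule Bochner_Integration.integrable_bound[of P "\<lambda>\<omega>. (g \<omega>)\<^sup>2"])
    show "AE \<omega> in P. norm ((f \<omega>)\<^sup>2) \<le> norm ((g \<omega>)\<^sup>2)"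
      using assms(3) by eventually_elim (simp add: abs_le_square_iff)
  qed (use assms in auto)
  then show ?thesis using assms(2) by simp
qed

lemma square_sum_le: "(x + y)\<^sup>2 \<le> 2 * x\<^sup>2 + 2 * (y::real)\<^sup>2"
  using zero_le_power2[of "x - y"] by (simp add: power2_eq_square algebra_simps)

lemma square_diff_le: "(x - y)\<^sup>2 \<le> 2 * x\<^sup>2 + 2 * (y::real)\<^sup>2"
  using square_sum_le[of x "-y"] by simp

lemma square_three_le: "(x - y + z)\<^sup>2 \<le> 3 * x\<^sup>2 + 3 * y\<^sup>2 + 3 * (z::real)\<^sup>2"
  using zero_le_power2[of "x + y"] zero_le_power2[of "x - z"] zero_le_power2[of "y + z"]
  by (simp add: power2_eq_square algebra_simps)

lemma young_le:
  fixes x y :: real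
  assumes "0 < \<alpha>"
  shows "\<bar>x\<bar> * \<bar>y\<bar> \<le> \<alpha> * x\<^sup>2 + y\<^sup>2 / (4 * \<alpha>)"
proof -
  have "0 \<le> (2 * \<alpha> * \<bar>x\<bar> - \<bar>y\<bar>)\<^sup>2" by simp
  then have "4 * \<alpha> * (\<bar>x\<bar> * \<bar>y\<bar>) \<le> 4 * \<alpha> * (\<alpha> * x\<^sup>2) + y\<^sup>2"
    by (simp add: power2_diff power_mult_distrib power2_eq_square algebra_simps abs_mult_self_eq)
  then show ?thesis using assms by (simp add: field_simps)
qed

subsection \<open>The energy semi-norm\<close>

abbreviation enorm :: "real \<Rightarrow> 'w \<Rightarrow> real ^ 'n \<Rightarrow> real" where
  "enorm r \<omega> C \<equiv> sqrt (energy r \<omega> C)"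

lemma enorm_L2_set:
  assumes "0 \<le> r" "\<omega> \<in> space P"
  shows "enorm r \<omega> C = L2_set (\<lambda>j. sqrt \<bar>rate r \<omega> j\<bar> * jump C r \<omega> j) UNIV"
proof -
  have "rate r \<omega> j * (jump C r \<omega> j)\<^sup>2 = (sqrt \<bar>rate r \<omega> j\<bar> * jump C r \<omega> j)\<^sup>2" for j
    using rate_nonneg[OF assms, of j] by (cases "X r \<omega> = axis j 1") (auto simp: jump_self power_mult_distrib)
  then show ?thesis by (simp add: energy_def L2_set_def)
qed

lemma enorm_triangle:
  assumes "0 \<le> r" "\<omega> \<in> space P"
  shows "enorm r \<omega> (C + D) \<le> enorm r \<omega> C + enorm r \<omega> D"
  unfolding enorm_L2_set[OF assms]
  using L2_set_triangle_ineq[of "\<lambda>j. sqrt \<bar>rate r \<omega> j\<bar> * jump C r \<omega> j" "\<lambda>j. sqrt \<bar>rate r \<omega> j\<bar> * jump D r \<omega> j" UNIV]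
  by (simp add: jump_def inner_add_left distrib_left)

lemma enorm_minus: "enorm r \<omega> (- C) = enorm r \<omega> C"
  by (simp add: energy_def jump_def)

lemma energy_diff_le:
  assumes "0 \<le> r" "\<omega> \<in> space P"
  shows "energy r \<omega> (C - D) \<le> 2 * energy r \<omega> C + 2 * energy r \<omega> D"
proof -
  have "enorm r \<omega> (C - D) \<le> enorm r \<omega> C + enorm r \<omega> D"
    using enorm_triangle[OF assms, of C "- D"] by (simp add: enorm_minus)
  then have "(enorm r \<omega> (C - D))\<^sup>2 \<le> (enorm r \<omega> C + enorm r \<omega> D)\<^sup>2"
    using energy_nonneg[OF assms] by (intro power_mono) auto
  also have "\<dots> \<le> 2 * (enorm r \<omega> C)\<^sup>2 + 2 * (enorm r \<omega> D)\<^sup>2" by (rule square_sum_le)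
  finally show ?thesis using energy_nonneg[OF assms] by simp
qed

lemma energy_swap: "energy r \<omega> (C - D) = energy r \<omega> (D - C)"
  by (simp add: energy_def jump_def inner_diff_left power2_commute)

lemma energy_Q:
  assumes "(\<lambda>p. \<zeta> (fst p) (snd p)) \<in> borel_measurable Q"
  shows "(\<lambda>p. energy (fst p) (snd p) (\<zeta> (fst p) (snd p))) \<in> borel_measurable Q"
  unfolding energy_def jump_def
  by (intro borel_measurable_sum borel_measurable_times rate_Q borel_measurable_power borel_measurable_inner
      borel_measurable_diff borel_measurable_const assms X_Q)

lemma energy_Q_integrable_bounded:
  assumes "(\<lambda>p. \<zeta> (fst p) (snd p)) \<in> borel_measurable Q"
    and "\<And>r \<omega>. r \<in> {0..T} \<Longrightarrow> \<omega> \<in> space P \<Longrightarrow> norm (\<zeta> r \<omega>) \<le> B"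
  shows "Q_integrable (\<lambda>r \<omega>. energy r \<omega> (\<zeta> r \<omega>))"
proof (rule Q.integrable_const_bound[OF AE_I2 energy_Q[OF assms(1)], of "c * (2 * B)\<^sup>2"])
  fix p assume p: "p \<in> space Q"
  have "\<bar>(jump (\<zeta> (fst p) (snd p)) (fst p) (snd p) j)\<^sup>2\<bar> \<le> (2 * B)\<^sup>2" for j
  proof -
    have "\<bar>jump (\<zeta> (fst p) (snd p)) (fst p) (snd p) j\<bar> \<le> 2 * B"
      using p by (intro jump_bound assms(2)) (auto simp: space_Q)
    from power_mono[OF this, of 2] show ?thesis by simp
  qed
  then show "norm (energy (fst p) (snd p) (\<zeta> (fst p) (snd p))) \<le> c * (2 * B)\<^sup>2"
    unfolding energy_def real_norm_def using p by (intro sum_rate_abs_le) (auto simp: space_Q)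
qed

lemma energy_Q_integrable_diff:
  assumes "Q_integrable (\<lambda>r \<omega>. energy r \<omega> (\<zeta> r \<omega>))" "Q_integrable (\<lambda>r \<omega>. energy r \<omega> (\<xi> r \<omega>))"
    and "(\<lambda>p. \<zeta> (fst p) (snd p)) \<in> borel_measurable Q" "(\<lambda>p. \<xi> (fst p) (snd p)) \<in> borel_measurable Q"
  shows "Q_integrable (\<lambda>r \<omega>. energy r \<omega> (\<zeta> r \<omega> - \<xi> r \<omega>))"
proof (rule Q_integrable_bounded[where f = "\<lambda>r \<omega>. 2 * energy r \<omega> (\<zeta> r \<omega>) + 2 * energy r \<omega> (\<xi> r \<omega>)" and K = 1])
  show "Q_integrable (\<lambda>r \<omega>. 2 * energy r \<omega> (\<zeta> r \<omega>) + 2 * energy r \<omega> (\<xi> r \<omega>))"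
    using assms(1,2) by simp
  show "(\<lambda>p. energy (fst p) (snd p) (\<zeta> (fst p) (snd p) - \<xi> (fst p) (snd p))) \<in> borel_measurable Q"
    using assms(3,4) by (intro energy_Q borel_measurable_diff)
  show "\<bar>energy r \<omega> (\<zeta> r \<omega> - \<xi> r \<omega>)\<bar> \<le> 1 * \<bar>2 * energy r \<omega> (\<zeta> r \<omega>) + 2 * energy r \<omega> (\<xi> r \<omega>)\<bar>"
    if "r \<in> {0..T}" "\<omega> \<in> space P" for r \<omega>
    using energy_diff_le[of r \<omega> "\<zeta> r \<omega>" "\<xi> r \<omega>"] energy_nonneg[of r \<omega>] that by simp
qed

subsection \<open>Increments of a constant integrand\<close>

text \<open>\<open>one_step_compensator\<close> for the square function.\<close>

lemma position_square:
  assumes st: "0 \<le> s" "s \<le> t" "t \<le> T"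
    and meas: "\<eta> \<in> borel_measurable (F s)"
    and \<eta>: "\<And>\<omega>. \<omega> \<in> space P \<Longrightarrow> norm (\<eta> \<omega>) \<le> B"
  shows "expectation (\<lambda>\<omega>. (\<eta> \<omega> \<bullet> (X t \<omega> - X s \<omega>))\<^sup>2)
      \<le> stint s t (\<lambda>r \<omega>. energy r \<omega> (\<eta> \<omega>)) + 8 * (c * B * (t - s))\<^sup>2"
    and "integrable P (\<lambda>\<omega>. (\<eta> \<omega> \<bullet> (X t \<omega> - X s \<omega>))\<^sup>2)"
proof -
  have m: "(\<lambda>\<omega>. (\<eta> \<omega> \<bullet> v)\<^sup>2) \<in> borel_measurable (F s)" for v
    using meas by (intro borel_measurable_power borel_measurable_inner borel_measurable_const)
  have b: "\<bar>d\<^sup>2\<bar> \<le> (2 * B)\<^sup>2" if "\<bar>d\<bar> \<le> 2 * B" for d :: real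
    using power_mono[OF that, of 2] by simp
  note step = one_step_compensator[OF st, where g = "\<lambda>_ d. d\<^sup>2" and K = "(2 * B)\<^sup>2", OF m \<eta> b]
  show "integrable P (\<lambda>\<omega>. (\<eta> \<omega> \<bullet> (X t \<omega> - X s \<omega>))\<^sup>2)" by (rule step(3)) auto
  have "\<bar>expectation (\<lambda>\<omega>. (\<eta> \<omega> \<bullet> (X t \<omega> - X s \<omega>))\<^sup>2)
      - stint s t (\<lambda>r \<omega>. energy r \<omega> (\<eta> \<omega>))\<bar> \<le> 2 * c\<^sup>2 * (2 * B)\<^sup>2 * (t - s)\<^sup>2"
    unfolding energy_def by (rule step(1)) auto
  then show "expectation (\<lambda>\<omega>. (\<eta> \<omega> \<bullet> (X t \<omega> - X s \<omega>))\<^sup>2)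
      \<le> stint s t (\<lambda>r \<omega>. energy r \<omega> (\<eta> \<omega>)) + 8 * (c * B * (t - s))\<^sup>2"
    by (simp add: power_mult_distrib)
qed

lemma martingale_position_diff:
  assumes st: "0 \<le> s" "s \<le> t" "t \<le> T" and \<omega>: "\<omega> \<in> space P" and C: "norm C \<le> B"
  shows "\<bar>C \<bullet> (M t \<omega> - M s \<omega>) - C \<bullet> (X t \<omega> - X s \<omega>)\<bar> \<le> c * B * (t - s)"
proof -
  have "C $ j * (M t \<omega> $ j - M s \<omega> $ j) - C $ j * (X t \<omega> $ j - X s \<omega> $ j)
      = - (C $ j * (\<integral>r. indicator {s<..t} r * rate r \<omega> j \<partial>L))" for j
    unfolding M_increment[OF \<omega> st] by (simp add: right_diff_distrib)
  then have "C \<bullet> (M t \<omega> - M s \<omega>) - C \<bullet> (X t \<omega> - X s \<omega>)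
      = - (\<Sum>j\<in>UNIV. C $ j * (\<integral>r. indicator {s<..t} r * rate r \<omega> j \<partial>L))"
    unfolding inner_vec_def by (simp add: sum_subtractf[symmetric] sum_negf[symmetric])
  also have "(\<Sum>j\<in>UNIV. C $ j * (\<integral>r. indicator {s<..t} r * rate r \<omega> j \<partial>L))
      = (\<Sum>j\<in>UNIV. \<integral>r. C $ j * (indicator {s<..t} r * rate r \<omega> j) \<partial>L)" by simp
  also have "\<dots> = (\<integral>r. (\<Sum>j\<in>UNIV. C $ j * (indicator {s<..t} r * rate r \<omega> j)) \<partial>L)"
    by (rule Bochner_Integration.integral_sum[symmetric]) (intro integrable_mult_right rate_path_integrable[OF \<omega>])
  also have "\<dots> = (\<integral>r. indicator {s<..t} r * (\<Sum>j\<in>UNIV. rate r \<omega> j * C $ j) \<partial>L)"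
    by (simp add: sum_distrib_left mult_ac)
  finally have eq: "\<bar>C \<bullet> (M t \<omega> - M s \<omega>) - C \<bullet> (X t \<omega> - X s \<omega>)\<bar>
      = \<bar>\<integral>r. indicator {s<..t} r * (\<Sum>j\<in>UNIV. rate r \<omega> j * C $ j) \<partial>L\<bar>" by simp
  show ?thesis
    unfolding eq
  proof (rule abs_integral_L_le[OF _ st])
    fix r assume "r \<in> {0..T}"
    then show "\<bar>\<Sum>j\<in>UNIV. rate r \<omega> j * C $ j\<bar> \<le> c * B"
      using \<omega> order_trans[OF component_le_norm_cart C] by (intro sum_rate_abs_le) auto
  qed
qed

text \<open>The increment of \<open>M\<close> is that of \<open>X\<close> up to a term \<open>v\<close> of the order of the interval length \<open>t - s\<close>. The
  mixed term is of second order because \<open>X\<close> moves only with a probability of order \<open>t - s\<close>.\<close>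

lemma martingale_square:
  assumes st: "0 \<le> s" "s \<le> t" "t \<le> T"
    and meas: "\<eta> \<in> borel_measurable (F s)"
    and \<eta>: "\<And>\<omega>. \<omega> \<in> space P \<Longrightarrow> norm (\<eta> \<omega>) \<le> B"
  shows "expectation (\<lambda>\<omega>. (\<eta> \<omega> \<bullet> (M t \<omega> - M s \<omega>))\<^sup>2)
      \<le> stint s t (\<lambda>r \<omega>. energy r \<omega> (\<eta> \<omega>)) + 13 * (c * B * (t - s))\<^sup>2"
proof -
  let ?u = "\<lambda>\<omega>. \<eta> \<omega> \<bullet> (X t \<omega> - X s \<omega>)" and ?m = "\<lambda>\<omega>. \<eta> \<omega> \<bullet> (M t \<omega> - M s \<omega>)"
  let ?k = "c * B * (t - s)"
  obtain \<omega>0 where \<omega>0: "\<omega>0 \<in> space P" using not_empty by auto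
  have B: "0 \<le> B" using order_trans[OF norm_ge_zero \<eta>[OF \<omega>0]] .
  have k: "0 \<le> ?k" using B c_pos st by simp
  have moved_int: "integrable P (moved s t)"
  proof (rule integrable_const_bound[of _ 1])
    show "moved s t \<in> borel_measurable P"
      using section_measurable[OF moved_Q[OF st(1)], of t] st by auto
  qed (simp add: moved_def)
  have pt: "(?m \<omega>)\<^sup>2 \<le> (?u \<omega>)\<^sup>2 + 4 * B * ?k * moved s t \<omega> + ?k\<^sup>2" if \<omega>: "\<omega> \<in> space P" for \<omega>
  proof -
    define v where "v = ?m \<omega> - ?u \<omega>"
    have v: "\<bar>v\<bar> \<le> ?k" unfolding v_def by (rule martingale_position_diff[OF st \<omega> \<eta>[OF \<omega>]])
    obtain i where i: "X t \<omega> = axis i 1" using X_axis[OF order_trans[OF st(1,2)] \<omega>] .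
    have u: "\<bar>?u \<omega>\<bar> \<le> 2 * B * moved s t \<omega>"
      using jump_bound[OF st(1) \<omega> \<eta>[OF \<omega>], of i] by (auto simp: moved_def jump_def i)
    have "?u \<omega> * v \<le> \<bar>?u \<omega>\<bar> * \<bar>v\<bar>" by (metis abs_ge_self abs_mult)
    also have "\<dots> \<le> (2 * B * moved s t \<omega>) * ?k" using u v k B by (intro mult_mono) (auto simp: moved_def)
    finally have "?u \<omega> * v \<le> 2 * B * ?k * moved s t \<omega>" by (simp add: mult.assoc mult.commute[of _ "moved s t \<omega>"])
    moreover have "v\<^sup>2 \<le> ?k\<^sup>2" using power_mono[OF v, of 2] by simp
    moreover have "(?m \<omega>)\<^sup>2 = (?u \<omega>)\<^sup>2 + 2 * (?u \<omega> * v) + v\<^sup>2"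
      by (simp add: v_def power2_eq_square algebra_simps)
    ultimately show ?thesis by linarith
  qed
  have rhs_int: "integrable P (\<lambda>\<omega>. (?u \<omega>)\<^sup>2 + 4 * B * ?k * moved s t \<omega> + ?k\<^sup>2)"
    using position_square(2)[OF st meas \<eta>] moved_int by simp
  have "expectation (\<lambda>\<omega>. (?m \<omega>)\<^sup>2) \<le> expectation (\<lambda>\<omega>. (?u \<omega>)\<^sup>2 + 4 * B * ?k * moved s t \<omega> + ?k\<^sup>2)"
    by (rule integral_mono'[OF rhs_int pt order_trans[OF zero_le_power2 pt]])
  also have "\<dots> = expectation (\<lambda>\<omega>. (?u \<omega>)\<^sup>2) + 4 * B * ?k * expectation (moved s t) + ?k\<^sup>2"
    using position_square(2)[OF st meas \<eta>] moved_int by (simp add: prob_space)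
  also have "\<dots> \<le> (stint s t (\<lambda>r \<omega>. energy r \<omega> (\<eta> \<omega>)) + 8 * ?k\<^sup>2) + 4 * B * ?k * (c * (t - s)) + ?k\<^sup>2"
    using k B by (intro add_mono mult_left_mono position_square(1)[OF st meas \<eta>] expectation_moved_le st) auto
  also have "\<dots> = stint s t (\<lambda>r \<omega>. energy r \<omega> (\<eta> \<omega>)) + 13 * ?k\<^sup>2"
    by (simp add: power2_eq_square algebra_simps)
  finally show ?thesis .
qed

section \<open>Stochastic integrals as limits of elementary ones\<close>

definition constant_integrand_on ::
  "real \<Rightarrow> real \<Rightarrow> real \<Rightarrow> (real \<Rightarrow> 'w \<Rightarrow> real ^ 'n) \<Rightarrow> (real \<Rightarrow> 'w \<Rightarrow> real) \<Rightarrow> bool" where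
  "constant_integrand_on a b B \<zeta> J \<longleftrightarrow>
     (\<exists>\<eta>. \<eta> \<in> borel_measurable (F a) \<and> (\<forall>\<omega>\<in>space P. norm (\<eta> \<omega>) \<le> B \<and>
        (\<forall>r. a < r \<longrightarrow> r \<le> b \<longrightarrow> \<zeta> r \<omega> = \<eta> \<omega>) \<and> J b \<omega> - J a \<omega> = \<eta> \<omega> \<bullet> (M b \<omega> - M a \<omega>)))"

text \<open>A description of elementary integrals that, unlike a partition, does not have to be refined when
  two integrals are subtracted: away from finitely many times, \<open>\<zeta>\<close> is constant and \<open>J\<close> moves with
  the martingale.\<close>

definition elementary_pair :: "(real \<Rightarrow> 'w \<Rightarrow> real ^ 'n) \<Rightarrow> (real \<Rightarrow> 'w \<Rightarrow> real) \<Rightarrow> bool" where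
  "elementary_pair \<zeta> J \<longleftrightarrow>
     (\<lambda>p. \<zeta> (fst p) (snd p)) \<in> borel_measurable Q \<and>
     (\<forall>\<omega>\<in>space P. J 0 \<omega> = 0) \<and>
     (\<exists>S B. finite S \<and> (\<forall>r\<in>{0..T}. \<forall>\<omega>\<in>space P. norm (\<zeta> r \<omega>) \<le> B) \<and>
        (\<forall>a b. 0 \<le> a \<longrightarrow> a \<le> b \<longrightarrow> b \<le> T \<longrightarrow> S \<inter> {a<..<b} = {} \<longrightarrow> constant_integrand_on a b B \<zeta> J))"

lemma elementary_pair_diff:
  assumes "elementary_pair \<zeta> J" "elementary_pair \<zeta>' J'"
  shows "elementary_pair (\<lambda>r \<omega>. \<zeta> r \<omega> - \<zeta>' r \<omega>) (\<lambda>r \<omega>. J r \<omega> - J' r \<omega>)"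
proof -
  obtain S B where 1: "finite S" "\<And>r \<omega>. r \<in> {0..T} \<Longrightarrow> \<omega> \<in> space P \<Longrightarrow> norm (\<zeta> r \<omega>) \<le> B"
    "\<And>a b. 0 \<le> a \<Longrightarrow> a \<le> b \<Longrightarrow> b \<le> T \<Longrightarrow> S \<inter> {a<..<b} = {} \<Longrightarrow> constant_integrand_on a b B \<zeta> J"
    using assms(1) unfolding elementary_pair_def by blast
  obtain S' B' where 2: "finite S'" "\<And>r \<omega>. r \<in> {0..T} \<Longrightarrow> \<omega> \<in> space P \<Longrightarrow> norm (\<zeta>' r \<omega>) \<le> B'"
    "\<And>a b. 0 \<le> a \<Longrightarrow> a \<le> b \<Longrightarrow> b \<le> T \<Longrightarrow> S' \<inter> {a<..<b} = {} \<Longrightarrow> constant_integrand_on a b B' \<zeta>' J'"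
    using assms(2) unfolding elementary_pair_def by blast
  have "constant_integrand_on a b (B + B') (\<lambda>r \<omega>. \<zeta> r \<omega> - \<zeta>' r \<omega>) (\<lambda>r \<omega>. J r \<omega> - J' r \<omega>)"
    if ab: "0 \<le> a" "a \<le> b" "b \<le> T" "(S \<union> S') \<inter> {a<..<b} = {}" for a b
  proof -
    have "S \<inter> {a<..<b} = {}" "S' \<inter> {a<..<b} = {}" using ab(4) by auto
    then have "constant_integrand_on a b B \<zeta> J" "constant_integrand_on a b B' \<zeta>' J'"
      using 1(3) 2(3) ab(1-3) by auto
    then obtain \<eta> \<eta>' where \<eta>: "\<eta> \<in> borel_measurable (F a)" "\<eta>' \<in> borel_measurable (F a)"
      and \<eta>1: "\<forall>\<omega>\<in>space P. norm (\<eta> \<omega>) \<le> B \<and> (\<forall>r. a < r \<longrightarrow> r \<le> b \<longrightarrow> \<zeta> r \<omega> = \<eta> \<omega>) \<and> J b \<omega> - J a \<omega> = \<eta> \<omega> \<bullet> (M b \<omega> - M a \<omega>)"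
      and \<eta>2: "\<forall>\<omega>\<in>space P. norm (\<eta>' \<omega>) \<le> B' \<and> (\<forall>r. a < r \<longrightarrow> r \<le> b \<longrightarrow> \<zeta>' r \<omega> = \<eta>' \<omega>) \<and> J' b \<omega> - J' a \<omega> = \<eta>' \<omega> \<bullet> (M b \<omega> - M a \<omega>)"
      unfolding constant_integrand_on_def by blast
    have "norm (\<eta> \<omega> - \<eta>' \<omega>) \<le> B + B'" if "\<omega> \<in> space P" for \<omega>
      using \<eta>1 \<eta>2 that norm_triangle_ineq4[of "\<eta> \<omega>" "\<eta>' \<omega>"] by fastforce
    moreover have "(J b \<omega> - J' b \<omega>) - (J a \<omega> - J' a \<omega>) = (\<eta> \<omega> - \<eta>' \<omega>) \<bullet> (M b \<omega> - M a \<omega>)" if "\<omega> \<in> space P" for \<omega>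
    proof -
      have "(J b \<omega> - J' b \<omega>) - (J a \<omega> - J' a \<omega>) = (J b \<omega> - J a \<omega>) - (J' b \<omega> - J' a \<omega>)" by simp
      also have "\<dots> = (\<eta> \<omega> - \<eta>' \<omega>) \<bullet> (M b \<omega> - M a \<omega>)"
        using \<eta>1 \<eta>2 that by (simp add: inner_diff_left)
      finally show ?thesis .
    qed
    ultimately show ?thesis
      unfolding constant_integrand_on_def using \<eta>1 \<eta>2
      by (intro exI[of _ "\<lambda>\<omega>. \<eta> \<omega> - \<eta>' \<omega>"]) (simp add: borel_measurable_diff[OF \<eta>])
  qed
  moreover have "norm (\<zeta> r \<omega> - \<zeta>' r \<omega>) \<le> B + B'" if "r \<in> {0..T}" "\<omega> \<in> space P" for r \<omega>
    using 1(2)[OF that] 2(2)[OF that] norm_triangle_ineq4[of "\<zeta> r \<omega>" "\<zeta>' r \<omega>"] by linarith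
  moreover have "finite (S \<union> S')" using 1(1) 2(1) by simp
  ultimately have "\<exists>S B. finite S \<and> (\<forall>r\<in>{0..T}. \<forall>\<omega>\<in>space P. norm (\<zeta> r \<omega> - \<zeta>' r \<omega>) \<le> B) \<and>
        (\<forall>a b. 0 \<le> a \<longrightarrow> a \<le> b \<longrightarrow> b \<le> T \<longrightarrow> S \<inter> {a<..<b} = {} \<longrightarrow>
          constant_integrand_on a b B (\<lambda>r \<omega>. \<zeta> r \<omega> - \<zeta>' r \<omega>) (\<lambda>r \<omega>. J r \<omega> - J' r \<omega>))"
    by (intro exI[of _ "S \<union> S'"] exI[of _ "B + B'"]) blast
  moreover have "(\<lambda>p. \<zeta> (fst p) (snd p) - \<zeta>' (fst p) (snd p)) \<in> borel_measurable Q"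
    using assms unfolding elementary_pair_def by (intro borel_measurable_diff) auto
  ultimately show ?thesis
    using assms unfolding elementary_pair_def by simp
qed

text \<open>For a constant integrand these are properties of the increments of \<open>M\<close>, and each passes from two
  adjacent intervals to their union.\<close>

lemma elementary_increment:
  assumes el: "elementary_pair \<zeta> J" and st: "0 \<le> s" "s \<le> t" "t \<le> T"
  shows "(\<lambda>\<omega>. J t \<omega> - J s \<omega>) \<in> borel_measurable (F t)"
    and "\<exists>C. \<forall>\<omega>\<in>space P. \<bar>J t \<omega> - J s \<omega>\<bar> \<le> C"
    and "\<eta> \<in> borel_measurable (F s) \<Longrightarrow> integrable P \<eta> \<Longrightarrow> expectation (\<lambda>\<omega>. \<eta> \<omega> * (J t \<omega> - J s \<omega>)) = 0"
proof -
  obtain S B where SB: "finite S"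
    "\<And>a b. 0 \<le> a \<Longrightarrow> a \<le> b \<Longrightarrow> b \<le> T \<Longrightarrow> S \<inter> {a<..<b} = {} \<Longrightarrow> constant_integrand_on a b B \<zeta> J"
    using el unfolding elementary_pair_def by blast
  define R where "R a b \<longleftrightarrow> (\<lambda>\<omega>. J b \<omega> - J a \<omega>) \<in> borel_measurable (F b) \<and>
    (\<exists>C. \<forall>\<omega>\<in>space P. \<bar>J b \<omega> - J a \<omega>\<bar> \<le> C) \<and>
    (\<forall>\<eta>. \<eta> \<in> borel_measurable (F a) \<longrightarrow> integrable P \<eta> \<longrightarrow> expectation (\<lambda>\<omega>. \<eta> \<omega> * (J b \<omega> - J a \<omega>)) = 0)" for a b
  have "R s t"
  proof (rule interval_chain[OF SB(1) zero_less_one st(2)])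
    fix a b assume ab: "s \<le> a" "a \<le> b" "b \<le> t" "S \<inter> {a<..<b} = {}"
    then have ab': "0 \<le> a" "a \<le> b" "b \<le> T" using st by auto
    obtain \<eta> where \<eta>: "\<eta> \<in> borel_measurable (F a)" "\<And>\<omega>. \<omega> \<in> space P \<Longrightarrow> norm (\<eta> \<omega>) \<le> B"
      "\<And>\<omega>. \<omega> \<in> space P \<Longrightarrow> J b \<omega> - J a \<omega> = \<eta> \<omega> \<bullet> (M b \<omega> - M a \<omega>)"
      using SB(2)[OF ab' ab(4)] unfolding constant_integrand_on_def by blast
    have inner: "J b \<omega> - J a \<omega> = (\<Sum>j\<in>UNIV. \<eta> \<omega> $ j * (M b \<omega> $ j - M a \<omega> $ j))" if "\<omega> \<in> space P" for \<omega>
      by (simp add: \<eta>(3)[OF that] inner_vec_def)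
    have "(\<lambda>\<omega>. \<eta> \<omega> \<bullet> (M b \<omega> - M a \<omega>)) \<in> borel_measurable (F b)"
      using measurable_F_mono[OF \<eta>(1)] measurable_F_mono[OF M_measurable[of a]] M_measurable[of b] ab'
      by (intro borel_measurable_inner borel_measurable_diff) auto
    moreover have "(\<lambda>\<omega>. \<eta> \<omega> \<bullet> (M b \<omega> - M a \<omega>)) \<in> borel_measurable (F b)
        \<longleftrightarrow> (\<lambda>\<omega>. J b \<omega> - J a \<omega>) \<in> borel_measurable (F b)"
      by (rule measurable_cong) (simp add: \<eta>(3))
    ultimately have "(\<lambda>\<omega>. J b \<omega> - J a \<omega>) \<in> borel_measurable (F b)" by simp
    moreover have "\<bar>J b \<omega> - J a \<omega>\<bar> \<le> (\<Sum>j\<in>(UNIV::'n set). B * (2 + c * T))" if \<omega>: "\<omega> \<in> space P" for \<omega>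
      unfolding inner[OF \<omega>]
    proof (intro order_trans[OF sum_abs] sum_mono)
      fix j
      have "0 \<le> B" using order_trans[OF norm_ge_zero \<eta>(2)[OF \<omega>]] .
      then show "\<bar>\<eta> \<omega> $ j * (M b \<omega> $ j - M a \<omega> $ j)\<bar> \<le> B * (2 + c * T)"
        unfolding abs_mult
        by (intro mult_mono M_increment_bound[OF \<omega> ab'] order_trans[OF component_le_norm_cart \<eta>(2)[OF \<omega>]]) auto
    qed
    moreover have "expectation (\<lambda>\<omega>. \<theta> \<omega> * (J b \<omega> - J a \<omega>)) = 0"
      if \<theta>: "\<theta> \<in> borel_measurable (F a)" "integrable P \<theta>" for \<theta>
    proof -
      have \<theta>\<eta>: "(\<lambda>\<omega>. \<theta> \<omega> * \<eta> \<omega> $ j) \<in> borel_measurable (F a)" for j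
        using \<theta>(1) \<eta>(1) by (intro borel_measurable_times borel_measurable_vec_component)
      have \<theta>\<eta>i: "integrable P (\<lambda>\<omega>. \<theta> \<omega> * \<eta> \<omega> $ j)" for j
        using \<eta>(2) measurable_F_P[OF \<eta>(1)]
        by (intro integrable_mult_bounded[OF \<theta>(2)] borel_measurable_vec_component)
          (auto intro: order_trans[OF component_le_norm_cart])
      have "expectation (\<lambda>\<omega>. \<theta> \<omega> * (J b \<omega> - J a \<omega>))
          = expectation (\<lambda>\<omega>. \<Sum>j\<in>UNIV. \<theta> \<omega> * \<eta> \<omega> $ j * (M b \<omega> $ j - M a \<omega> $ j))"
        by (intro Bochner_Integration.integral_cong refl) (simp add: inner sum_distrib_left mult.assoc)
      also have "\<dots> = (\<Sum>j\<in>UNIV. expectation (\<lambda>\<omega>. \<theta> \<omega> * \<eta> \<omega> $ j * (M b \<omega> $ j - M a \<omega> $ j)))"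
        by (rule Bochner_Integration.integral_sum) (rule M_martingale(2)[OF ab' \<theta>\<eta> \<theta>\<eta>i])
      also have "\<dots> = 0" using M_martingale(1)[OF ab' \<theta>\<eta> \<theta>\<eta>i] by simp
      finally show ?thesis .
    qed
    ultimately show "R a b" unfolding R_def by blast
  next
    fix a b d assume abd: "s \<le> a" "a \<le> b" "b \<le> d" "d \<le> t" and R1: "R a b" and R2: "R b d"
    have m1: "(\<lambda>\<omega>. J b \<omega> - J a \<omega>) \<in> borel_measurable (F d)" and m2: "(\<lambda>\<omega>. J d \<omega> - J b \<omega>) \<in> borel_measurable (F d)"
      using R1 R2 abd unfolding R_def by (auto intro: measurable_F_mono)
    then have "(\<lambda>\<omega>. J d \<omega> - J a \<omega>) \<in> borel_measurable (F d)" using borel_measurable_add[OF m1 m2] by simp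
    moreover obtain C C' where C: "\<And>\<omega>. \<omega> \<in> space P \<Longrightarrow> \<bar>J b \<omega> - J a \<omega>\<bar> \<le> C" "\<And>\<omega>. \<omega> \<in> space P \<Longrightarrow> \<bar>J d \<omega> - J b \<omega>\<bar> \<le> C'"
      using R1 R2 unfolding R_def by blast
    moreover have "\<bar>J d \<omega> - J a \<omega>\<bar> \<le> C + C'" if "\<omega> \<in> space P" for \<omega>
      using C(1)[OF that] C(2)[OF that] by linarith
    moreover have "expectation (\<lambda>\<omega>. \<theta> \<omega> * (J d \<omega> - J a \<omega>)) = 0"
      if \<theta>: "\<theta> \<in> borel_measurable (F a)" "integrable P \<theta>" for \<theta>
    proof -
      have "expectation (\<lambda>\<omega>. \<theta> \<omega> * (J d \<omega> - J a \<omega>))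
          = expectation (\<lambda>\<omega>. \<theta> \<omega> * (J b \<omega> - J a \<omega>) + \<theta> \<omega> * (J d \<omega> - J b \<omega>))"
        by (simp add: algebra_simps)
      also have "\<dots> = expectation (\<lambda>\<omega>. \<theta> \<omega> * (J b \<omega> - J a \<omega>)) + expectation (\<lambda>\<omega>. \<theta> \<omega> * (J d \<omega> - J b \<omega>))"
        by (rule Bochner_Integration.integral_add[OF integrable_mult_bounded[OF \<theta>(2) measurable_F_P[OF m1] C(1)]
              integrable_mult_bounded[OF \<theta>(2) measurable_F_P[OF m2] C(2)]])
      also have "\<dots> = 0"
        using R1 R2 \<theta> measurable_F_mono[OF \<theta>(1) abd(2)] unfolding R_def by simp
      finally show ?thesis .
    qed
    ultimately show "R a d" unfolding R_def by blast
  qed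
  then show "(\<lambda>\<omega>. J t \<omega> - J s \<omega>) \<in> borel_measurable (F t)"
    and "\<exists>C. \<forall>\<omega>\<in>space P. \<bar>J t \<omega> - J s \<omega>\<bar> \<le> C"
    and "\<eta> \<in> borel_measurable (F s) \<Longrightarrow> integrable P \<eta> \<Longrightarrow> expectation (\<lambda>\<omega>. \<eta> \<omega> * (J t \<omega> - J s \<omega>)) = 0"
    unfolding R_def by blast+
qed

lemma elementary_sq_int:
  assumes "elementary_pair \<zeta> J" "t \<in> {0..T}"
  shows "sq_int (J t)"
proof -
  have J0: "J t \<omega> - J 0 \<omega> = J t \<omega>" if "\<omega> \<in> space P" for \<omega>
    using assms(1) that unfolding elementary_pair_def by simp
  have "(\<lambda>\<omega>. J t \<omega> - J 0 \<omega>) \<in> borel_measurable P"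
    using elementary_increment(1)[OF assms(1), of 0 t] assms(2) by (auto intro: measurable_F_P)
  moreover have "(\<lambda>\<omega>. J t \<omega> - J 0 \<omega>) \<in> borel_measurable P \<longleftrightarrow> J t \<in> borel_measurable P"
    by (rule measurable_cong) (rule J0)
  ultimately have "J t \<in> borel_measurable P" by simp
  moreover obtain C where "\<forall>\<omega>\<in>space P. \<bar>J t \<omega> - J 0 \<omega>\<bar> \<le> C"
    using elementary_increment(2)[OF assms(1), of 0 t] assms(2) by auto
  then have "\<bar>J t \<omega>\<bar> \<le> C" if "\<omega> \<in> space P" for \<omega> using J0 that by auto
  ultimately show ?thesis by (rule sq_int_bounded)
qed

lemma elementary_energy_Q_integrable:
  assumes "elementary_pair \<zeta> J"
  shows "Q_integrable (\<lambda>r \<omega>. energy r \<omega> (\<zeta> r \<omega>))"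
proof -
  obtain B where "\<And>r \<omega>. r \<in> {0..T} \<Longrightarrow> \<omega> \<in> space P \<Longrightarrow> norm (\<zeta> r \<omega>) \<le> B"
    using assms unfolding elementary_pair_def by blast
  then show ?thesis
    using assms unfolding elementary_pair_def by (intro energy_Q_integrable_bounded) auto
qed

text \<open>Half of the Ito isometry. Increments over disjoint intervals are orthogonal, so both sides are
  additive in the interval, and on short ones the estimate for a constant integrand applies.\<close>

lemma elementary_isometry:
  assumes el: "elementary_pair \<zeta> J" and st: "0 \<le> s" "s \<le> t" "t \<le> T"
  shows "expectation (\<lambda>\<omega>. (J t \<omega> - J s \<omega>)\<^sup>2) \<le> stint s t (\<lambda>r \<omega>. energy r \<omega> (\<zeta> r \<omega>))"
proof -
  obtain S B where SB: "finite S"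
    "\<And>a b. 0 \<le> a \<Longrightarrow> a \<le> b \<Longrightarrow> b \<le> T \<Longrightarrow> S \<inter> {a<..<b} = {} \<Longrightarrow> constant_integrand_on a b B \<zeta> J"
    using el unfolding elementary_pair_def by blast
  let ?q = "\<lambda>r \<omega>. energy r \<omega> (\<zeta> r \<omega>)"
  note q = elementary_energy_Q_integrable[OF el]
  have approx: "expectation (\<lambda>\<omega>. (J t \<omega> - J s \<omega>)\<^sup>2) \<le> stint s t ?q + 13 * (c * B)\<^sup>2 * \<delta> * (t - s)"
    if \<delta>: "0 < \<delta>" for \<delta>
  proof (rule interval_chain[OF SB(1) \<delta> st(2)])
    fix a b assume ab: "s \<le> a" "a \<le> b" "b \<le> t" "b - a \<le> \<delta>" "S \<inter> {a<..<b} = {}"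
    then have ab': "0 \<le> a" "a \<le> b" "b \<le> T" using st by auto
    obtain \<eta> where \<eta>: "\<eta> \<in> borel_measurable (F a)" "\<And>\<omega>. \<omega> \<in> space P \<Longrightarrow> norm (\<eta> \<omega>) \<le> B"
      "\<And>\<omega>. \<omega> \<in> space P \<Longrightarrow> J b \<omega> - J a \<omega> = \<eta> \<omega> \<bullet> (M b \<omega> - M a \<omega>)"
      "\<And>r \<omega>. \<omega> \<in> space P \<Longrightarrow> a < r \<Longrightarrow> r \<le> b \<Longrightarrow> \<zeta> r \<omega> = \<eta> \<omega>"
      using SB(2)[OF ab' ab(5)] unfolding constant_integrand_on_def by blast
    have "expectation (\<lambda>\<omega>. (J b \<omega> - J a \<omega>)\<^sup>2) = expectation (\<lambda>\<omega>. (\<eta> \<omega> \<bullet> (M b \<omega> - M a \<omega>))\<^sup>2)"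
      by (intro Bochner_Integration.integral_cong refl) (simp add: \<eta>(3))
    also have "\<dots> \<le> stint a b (\<lambda>r \<omega>. energy r \<omega> (\<eta> \<omega>)) + 13 * (c * B * (b - a))\<^sup>2"
      by (rule martingale_square[OF ab' \<eta>(1,2)])
    also have "stint a b (\<lambda>r \<omega>. energy r \<omega> (\<eta> \<omega>)) = stint a b ?q"
      unfolding stint_def by (intro Bochner_Integration.integral_cong refl) (auto simp: space_Q indicator_def \<eta>(4))
    also have "13 * (c * B * (b - a))\<^sup>2 \<le> 13 * (c * B)\<^sup>2 * \<delta> * (b - a)"
    proof -
      have "(b - a) * (b - a) \<le> \<delta> * (b - a)" using ab by (intro mult_right_mono) auto
      from mult_left_mono[OF this, of "13 * (c * B)\<^sup>2"] show ?thesis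
        by (simp add: power_mult_distrib power2_eq_square[of "b - a"] mult.assoc)
    qed
    finally show "expectation (\<lambda>\<omega>. (J b \<omega> - J a \<omega>)\<^sup>2) \<le> stint a b ?q + 13 * (c * B)\<^sup>2 * \<delta> * (b - a)" by simp
  next
    fix a b d assume abd: "s \<le> a" "a \<le> b" "b \<le> d" "d \<le> t"
      and 1: "expectation (\<lambda>\<omega>. (J b \<omega> - J a \<omega>)\<^sup>2) \<le> stint a b ?q + 13 * (c * B)\<^sup>2 * \<delta> * (b - a)"
      and 2: "expectation (\<lambda>\<omega>. (J d \<omega> - J b \<omega>)\<^sup>2) \<le> stint b d ?q + 13 * (c * B)\<^sup>2 * \<delta> * (d - b)"
    have sq: "sq_int (\<lambda>\<omega>. J b \<omega> - J a \<omega>)" "sq_int (\<lambda>\<omega>. J d \<omega> - J b \<omega>)"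
      using abd st by (auto intro!: sq_int_diff elementary_sq_int[OF el])
    have ab': "0 \<le> a" "a \<le> b" "b \<le> T" and bd': "0 \<le> b" "b \<le> d" "d \<le> T" using abd st by auto
    have orth: "expectation (\<lambda>\<omega>. (J b \<omega> - J a \<omega>) * (J d \<omega> - J b \<omega>)) = 0"
      by (rule elementary_increment(3)[OF el bd' elementary_increment(1)[OF el ab'] sq_int_integrable[OF sq(1)]])
    have "expectation (\<lambda>\<omega>. (J d \<omega> - J a \<omega>)\<^sup>2)
        = expectation (\<lambda>\<omega>. (J b \<omega> - J a \<omega>)\<^sup>2 + (J d \<omega> - J b \<omega>)\<^sup>2 + 2 * ((J b \<omega> - J a \<omega>) * (J d \<omega> - J b \<omega>)))"
      by (intro Bochner_Integration.integral_cong refl) (simp add: power2_eq_square algebra_simps)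
    also have "\<dots> = expectation (\<lambda>\<omega>. (J b \<omega> - J a \<omega>)\<^sup>2) + expectation (\<lambda>\<omega>. (J d \<omega> - J b \<omega>)\<^sup>2)"
      using sq sq_int_mult[OF sq] orth by simp
    finally show "expectation (\<lambda>\<omega>. (J d \<omega> - J a \<omega>)\<^sup>2) \<le> stint a d ?q + 13 * (c * B)\<^sup>2 * \<delta> * (d - a)"
      using 1 2 stint_split[OF q abd(2,3)] by (simp add: algebra_simps)
  qed
  show ?thesis
  proof (rule field_le_epsilon)
    fix e :: real assume e: "0 < e"
    let ?k = "13 * (c * B)\<^sup>2 * (t - s) + 1"
    have k: "0 < ?k" using st by (intro add_nonneg_pos mult_nonneg_nonneg) auto
    have "expectation (\<lambda>\<omega>. (J t \<omega> - J s \<omega>)\<^sup>2) \<le> stint s t ?q + 13 * (c * B)\<^sup>2 * (e / ?k) * (t - s)"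
      using e k by (intro approx divide_pos_pos)
    also have "13 * (c * B)\<^sup>2 * (e / ?k) * (t - s) = e * ((?k - 1) / ?k)" by simp
    also have "\<dots> \<le> e * 1" using e k by (intro mult_left_mono) auto
    finally show "expectation (\<lambda>\<omega>. (J t \<omega> - J s \<omega>)\<^sup>2) \<le> stint s t ?q + e" by simp
  qed
qed

text \<open>\<open>I\<close> is the stochastic integral of \<open>z\<close> at each time separately, as an \<open>L\<^sup>2\<close>-limit.\<close>

definition integral_process :: "(real \<Rightarrow> 'w \<Rightarrow> real ^ 'n) \<Rightarrow> (real \<Rightarrow> 'w \<Rightarrow> real) \<Rightarrow> bool" where
  "integral_process z I \<longleftrightarrow>
     (\<lambda>p. z (fst p) (snd p)) \<in> borel_measurable Q \<and> Q_integrable (\<lambda>r \<omega>. energy r \<omega> (z r \<omega>)) \<and>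
     (\<forall>t\<in>{0..T}. sq_int (I t)) \<and>
     (\<exists>\<zeta> J. (\<forall>j::nat. elementary_pair (\<zeta> j) (J j)) \<and>
        (\<lambda>j. stint 0 T (\<lambda>r \<omega>. energy r \<omega> (\<zeta> j r \<omega> - z r \<omega>))) \<longlonglongrightarrow> 0 \<and>
        (\<forall>t\<in>{0..T}. (\<lambda>j. expectation (\<lambda>\<omega>. (J j t \<omega> - I t \<omega>)\<^sup>2)) \<longlonglongrightarrow> 0))"

lemma elementary_integral_process:
  assumes "elementary_pair \<zeta> J"
  shows "integral_process \<zeta> J"
proof -
  have "(\<forall>j::nat. elementary_pair \<zeta> J) \<and> (\<lambda>j::nat. stint 0 T (\<lambda>r \<omega>. energy r \<omega> (\<zeta> r \<omega> - \<zeta> r \<omega>))) \<longlonglongrightarrow> 0 \<and>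
      (\<forall>t\<in>{0..T}. (\<lambda>j::nat. expectation (\<lambda>\<omega>. (J t \<omega> - J t \<omega>)\<^sup>2)) \<longlonglongrightarrow> 0)"
    using assms by (simp add: energy_def jump_def stint_def)
  then have "\<exists>\<zeta>' J'. (\<forall>j::nat. elementary_pair (\<zeta>' j) (J' j)) \<and>
        (\<lambda>j. stint 0 T (\<lambda>r \<omega>. energy r \<omega> (\<zeta>' j r \<omega> - \<zeta> r \<omega>))) \<longlonglongrightarrow> 0 \<and>
        (\<forall>t\<in>{0..T}. (\<lambda>j. expectation (\<lambda>\<omega>. (J' j t \<omega> - J t \<omega>)\<^sup>2)) \<longlonglongrightarrow> 0)"
    by (intro exI[of _ "\<lambda>_. \<zeta>"] exI[of _ "\<lambda>_. J"])
  then show ?thesis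
    unfolding integral_process_def
    using assms elementary_sq_int[OF assms] elementary_energy_Q_integrable[OF assms]
    unfolding elementary_pair_def by auto
qed

lemma integral_process_diff:
  assumes 1: "integral_process z I" and 2: "integral_process z' I'"
  shows "integral_process (\<lambda>r \<omega>. z r \<omega> - z' r \<omega>) (\<lambda>t \<omega>. I t \<omega> - I' t \<omega>)"
proof -
  obtain \<zeta> J where z: "(\<lambda>p. z (fst p) (snd p)) \<in> borel_measurable Q" "Q_integrable (\<lambda>r \<omega>. energy r \<omega> (z r \<omega>))"
    "\<And>t. t \<in> {0..T} \<Longrightarrow> sq_int (I t)"
    and \<zeta>: "\<And>j::nat. elementary_pair (\<zeta> j) (J j)"
    "(\<lambda>j. stint 0 T (\<lambda>r \<omega>. energy r \<omega> (\<zeta> j r \<omega> - z r \<omega>))) \<longlonglongrightarrow> 0"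
    "\<And>t. t \<in> {0..T} \<Longrightarrow> (\<lambda>j. expectation (\<lambda>\<omega>. (J j t \<omega> - I t \<omega>)\<^sup>2)) \<longlonglongrightarrow> 0"
    using 1 unfolding integral_process_def by blast
  obtain \<zeta>' J' where z': "(\<lambda>p. z' (fst p) (snd p)) \<in> borel_measurable Q" "Q_integrable (\<lambda>r \<omega>. energy r \<omega> (z' r \<omega>))"
    "\<And>t. t \<in> {0..T} \<Longrightarrow> sq_int (I' t)"
    and \<zeta>': "\<And>j::nat. elementary_pair (\<zeta>' j) (J' j)"
    "(\<lambda>j. stint 0 T (\<lambda>r \<omega>. energy r \<omega> (\<zeta>' j r \<omega> - z' r \<omega>))) \<longlonglongrightarrow> 0"
    "\<And>t. t \<in> {0..T} \<Longrightarrow> (\<lambda>j. expectation (\<lambda>\<omega>. (J' j t \<omega> - I' t \<omega>)\<^sup>2)) \<longlonglongrightarrow> 0"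
    using 2 unfolding integral_process_def by blast
  let ?\<zeta> = "\<lambda>j r \<omega>. \<zeta> j r \<omega> - \<zeta>' j r \<omega>" and ?J = "\<lambda>j t \<omega>. J j t \<omega> - J' j t \<omega>"
  have el: "elementary_pair (?\<zeta> j) (?J j)" for j by (rule elementary_pair_diff[OF \<zeta>(1) \<zeta>'(1)])
  have \<zeta>Q: "(\<lambda>p. \<zeta> j (fst p) (snd p)) \<in> borel_measurable Q" "(\<lambda>p. \<zeta>' j (fst p) (snd p)) \<in> borel_measurable Q" for j
    using \<zeta>(1)[of j] \<zeta>'(1)[of j] unfolding elementary_pair_def by auto
  have e1: "Q_integrable (\<lambda>r \<omega>. energy r \<omega> (\<zeta> j r \<omega> - z r \<omega>))" for j
    by (rule energy_Q_integrable_diff[OF elementary_energy_Q_integrable[OF \<zeta>(1)] z(2) \<zeta>Q(1) z(1)])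
  have e2: "Q_integrable (\<lambda>r \<omega>. energy r \<omega> (\<zeta>' j r \<omega> - z' r \<omega>))" for j
    by (rule energy_Q_integrable_diff[OF elementary_energy_Q_integrable[OF \<zeta>'(1)] z'(2) \<zeta>Q(2) z'(1)])
  have zz: "Q_integrable (\<lambda>r \<omega>. energy r \<omega> (z r \<omega> - z' r \<omega>))" by (rule energy_Q_integrable_diff[OF z(2) z'(2) z(1) z'(1)])
  have zzQ: "(\<lambda>p. z (fst p) (snd p) - z' (fst p) (snd p)) \<in> borel_measurable Q"
    by (rule borel_measurable_diff[OF z(1) z'(1)])
  have e: "Q_integrable (\<lambda>r \<omega>. energy r \<omega> (?\<zeta> j r \<omega> - (z r \<omega> - z' r \<omega>)))" for j
    by (rule energy_Q_integrable_diff[OF elementary_energy_Q_integrable[OF el] zz _ zzQ]) (rule borel_measurable_diff[OF \<zeta>Q])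
  have lim1: "(\<lambda>j. stint 0 T (\<lambda>r \<omega>. energy r \<omega> (?\<zeta> j r \<omega> - (z r \<omega> - z' r \<omega>)))) \<longlonglongrightarrow> 0"
  proof (rule tendsto_sandwich[OF always_eventually always_eventually tendsto_const])
    show "\<forall>j. 0 \<le> stint 0 T (\<lambda>r \<omega>. energy r \<omega> (?\<zeta> j r \<omega> - (z r \<omega> - z' r \<omega>)))"
      using energy_nonneg by (intro allI stint_nonneg) auto
    show "\<forall>j. stint 0 T (\<lambda>r \<omega>. energy r \<omega> (?\<zeta> j r \<omega> - (z r \<omega> - z' r \<omega>)))
        \<le> 2 * stint 0 T (\<lambda>r \<omega>. energy r \<omega> (\<zeta> j r \<omega> - z r \<omega>)) + 2 * stint 0 T (\<lambda>r \<omega>. energy r \<omega> (\<zeta>' j r \<omega> - z' r \<omega>))"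
    proof
      fix j
      have "stint 0 T (\<lambda>r \<omega>. energy r \<omega> (?\<zeta> j r \<omega> - (z r \<omega> - z' r \<omega>)))
          \<le> stint 0 T (\<lambda>r \<omega>. 2 * energy r \<omega> (\<zeta> j r \<omega> - z r \<omega>) + 2 * energy r \<omega> (\<zeta>' j r \<omega> - z' r \<omega>))"
      proof (rule stint_mono[OF e])
        show "Q_integrable (\<lambda>r \<omega>. 2 * energy r \<omega> (\<zeta> j r \<omega> - z r \<omega>) + 2 * energy r \<omega> (\<zeta>' j r \<omega> - z' r \<omega>))"
          using e1 e2 by simp
        fix r \<omega> assume r: "r \<in> {0..T}" "\<omega> \<in> space P"
        have eq: "?\<zeta> j r \<omega> - (z r \<omega> - z' r \<omega>) = (\<zeta> j r \<omega> - z r \<omega>) - (\<zeta>' j r \<omega> - z' r \<omega>)" by (simp add: algebra_simps)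
        show "energy r \<omega> (?\<zeta> j r \<omega> - (z r \<omega> - z' r \<omega>))
            \<le> 2 * energy r \<omega> (\<zeta> j r \<omega> - z r \<omega>) + 2 * energy r \<omega> (\<zeta>' j r \<omega> - z' r \<omega>)"
          unfolding eq using r by (intro energy_diff_le) auto
      qed
      then show "stint 0 T (\<lambda>r \<omega>. energy r \<omega> (?\<zeta> j r \<omega> - (z r \<omega> - z' r \<omega>)))
          \<le> 2 * stint 0 T (\<lambda>r \<omega>. energy r \<omega> (\<zeta> j r \<omega> - z r \<omega>)) + 2 * stint 0 T (\<lambda>r \<omega>. energy r \<omega> (\<zeta>' j r \<omega> - z' r \<omega>))"
        using e1[of j] e2[of j] by (simp add: stint_add stint_cmult)
    qed
    show "(\<lambda>j. 2 * stint 0 T (\<lambda>r \<omega>. energy r \<omega> (\<zeta> j r \<omega> - z r \<omega>))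
        + 2 * stint 0 T (\<lambda>r \<omega>. energy r \<omega> (\<zeta>' j r \<omega> - z' r \<omega>))) \<longlonglongrightarrow> 0"
      using tendsto_add[OF tendsto_mult_left[OF \<zeta>(2), of 2] tendsto_mult_left[OF \<zeta>'(2), of 2]] by simp
  qed
  have lim2: "(\<lambda>j. expectation (\<lambda>\<omega>. (?J j t \<omega> - (I t \<omega> - I' t \<omega>))\<^sup>2)) \<longlonglongrightarrow> 0" if t: "t \<in> {0..T}" for t
  proof (rule tendsto_sandwich[OF always_eventually always_eventually tendsto_const])
    show "\<forall>j. 0 \<le> expectation (\<lambda>\<omega>. (?J j t \<omega> - (I t \<omega> - I' t \<omega>))\<^sup>2)" by simp
    show "\<forall>j. expectation (\<lambda>\<omega>. (?J j t \<omega> - (I t \<omega> - I' t \<omega>))\<^sup>2)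
        \<le> 2 * expectation (\<lambda>\<omega>. (J j t \<omega> - I t \<omega>)\<^sup>2) + 2 * expectation (\<lambda>\<omega>. (J' j t \<omega> - I' t \<omega>)\<^sup>2)"
    proof
      fix j
      have s1: "sq_int (\<lambda>\<omega>. J j t \<omega> - I t \<omega>)" and s2: "sq_int (\<lambda>\<omega>. J' j t \<omega> - I' t \<omega>)"
        by (intro sq_int_diff elementary_sq_int[OF \<zeta>(1)] elementary_sq_int[OF \<zeta>'(1)] z(3) z'(3) t)+
      have "expectation (\<lambda>\<omega>. (?J j t \<omega> - (I t \<omega> - I' t \<omega>))\<^sup>2)
          \<le> expectation (\<lambda>\<omega>. 2 * (J j t \<omega> - I t \<omega>)\<^sup>2 + 2 * (J' j t \<omega> - I' t \<omega>)\<^sup>2)"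
      proof (rule integral_mono')
        show "integrable P (\<lambda>\<omega>. 2 * (J j t \<omega> - I t \<omega>)\<^sup>2 + 2 * (J' j t \<omega> - I' t \<omega>)\<^sup>2)" using s1 s2 by simp
        fix \<omega>
        show "(?J j t \<omega> - (I t \<omega> - I' t \<omega>))\<^sup>2 \<le> 2 * (J j t \<omega> - I t \<omega>)\<^sup>2 + 2 * (J' j t \<omega> - I' t \<omega>)\<^sup>2"
          using square_diff_le[of "J j t \<omega> - I t \<omega>" "J' j t \<omega> - I' t \<omega>"] by (simp add: algebra_simps)
      qed simp
      then show "expectation (\<lambda>\<omega>. (?J j t \<omega> - (I t \<omega> - I' t \<omega>))\<^sup>2)
          \<le> 2 * expectation (\<lambda>\<omega>. (J j t \<omega> - I t \<omega>)\<^sup>2) + 2 * expectation (\<lambda>\<omega>. (J' j t \<omega> - I' t \<omega>)\<^sup>2)"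
        using s1 s2 by simp
    qed
    show "(\<lambda>j. 2 * expectation (\<lambda>\<omega>. (J j t \<omega> - I t \<omega>)\<^sup>2) + 2 * expectation (\<lambda>\<omega>. (J' j t \<omega> - I' t \<omega>)\<^sup>2)) \<longlonglongrightarrow> 0"
      using tendsto_add[OF tendsto_mult_left[OF \<zeta>(3)[OF t], of 2] tendsto_mult_left[OF \<zeta>'(3)[OF t], of 2]] by simp
  qed
  have sq: "sq_int (\<lambda>\<omega>. I t \<omega> - I' t \<omega>)" if "t \<in> {0..T}" for t
    by (rule sq_int_diff[OF z(3)[OF that] z'(3)[OF that]])
  have "\<exists>\<zeta> J. (\<forall>j::nat. elementary_pair (\<zeta> j) (J j)) \<and>
        (\<lambda>j. stint 0 T (\<lambda>r \<omega>. energy r \<omega> (\<zeta> j r \<omega> - (z r \<omega> - z' r \<omega>)))) \<longlonglongrightarrow> 0 \<and>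
        (\<forall>t\<in>{0..T}. (\<lambda>j. expectation (\<lambda>\<omega>. (J j t \<omega> - (I t \<omega> - I' t \<omega>))\<^sup>2)) \<longlonglongrightarrow> 0)"
    using el lim1 lim2 by (intro exI[of _ ?\<zeta>] exI[of _ ?J]) blast
  then show ?thesis
    unfolding integral_process_def using zz zzQ sq by blast
qed

lemma integral_process_sq_int: "integral_process z I \<Longrightarrow> t \<in> {0..T} \<Longrightarrow> sq_int (I t)"
  unfolding integral_process_def by blast

text \<open>Orthogonality to the past passes from elementary integrals to their \<open>L\<^sup>2\<close>-limits by Young's inequality.\<close>

lemma integral_process_orthogonal:
  assumes I: "integral_process z I" and st: "0 \<le> s" "s \<le> t" "t \<le> T"
    and \<eta>: "\<eta> \<in> borel_measurable (F s)" "sq_int \<eta>"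
  shows "expectation (\<lambda>\<omega>. \<eta> \<omega> * (I t \<omega> - I s \<omega>)) = 0"
proof -
  obtain \<zeta> J where \<zeta>: "\<And>j::nat. elementary_pair (\<zeta> j) (J j)"
    "\<And>t. t \<in> {0..T} \<Longrightarrow> (\<lambda>j. expectation (\<lambda>\<omega>. (J j t \<omega> - I t \<omega>)\<^sup>2)) \<longlonglongrightarrow> 0"
    using I unfolding integral_process_def by blast
  have s: "s \<in> {0..T}" and t: "t \<in> {0..T}" using st by auto
  note Isq = integral_process_sq_int[OF I]
  let ?D = "\<lambda>j. 2 * expectation (\<lambda>\<omega>. (J j t \<omega> - I t \<omega>)\<^sup>2) + 2 * expectation (\<lambda>\<omega>. (J j s \<omega> - I s \<omega>)\<^sup>2)"
  have D: "?D \<longlonglongrightarrow> 0"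
    using tendsto_add[OF tendsto_mult_left[OF \<zeta>(2)[OF t], of 2] tendsto_mult_left[OF \<zeta>(2)[OF s], of 2]] by simp
  have bound: "\<bar>expectation (\<lambda>\<omega>. \<eta> \<omega> * (I t \<omega> - I s \<omega>))\<bar> \<le> \<alpha> * expectation (\<lambda>\<omega>. (\<eta> \<omega>)\<^sup>2) + ?D j / (4 * \<alpha>)"
    if \<alpha>: "0 < \<alpha>" for \<alpha> j
  proof -
    define d where "d \<omega> = (J j t \<omega> - I t \<omega>) - (J j s \<omega> - I s \<omega>)" for \<omega>
    have dt: "sq_int (\<lambda>\<omega>. J j t \<omega> - I t \<omega>)" and ds: "sq_int (\<lambda>\<omega>. J j s \<omega> - I s \<omega>)"
      by (intro sq_int_diff elementary_sq_int[OF \<zeta>(1)] Isq s t)+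
    have d: "sq_int d" unfolding d_def by (rule sq_int_diff[OF dt ds])
    have "expectation (\<lambda>\<omega>. (d \<omega>)\<^sup>2) \<le> expectation (\<lambda>\<omega>. 2 * (J j t \<omega> - I t \<omega>)\<^sup>2 + 2 * (J j s \<omega> - I s \<omega>)\<^sup>2)"
      unfolding d_def using dt ds by (intro integral_mono' square_diff_le) auto
    then have dD: "expectation (\<lambda>\<omega>. (d \<omega>)\<^sup>2) \<le> ?D j" using dt ds by simp
    have J: "expectation (\<lambda>\<omega>. \<eta> \<omega> * (J j t \<omega> - J j s \<omega>)) = 0"
      by (rule elementary_increment(3)[OF \<zeta>(1) st \<eta>(1) sq_int_integrable[OF \<eta>(2)]])
    have Ji: "integrable P (\<lambda>\<omega>. \<eta> \<omega> * (J j t \<omega> - J j s \<omega>))"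
      by (intro sq_int_mult[OF \<eta>(2)] sq_int_diff elementary_sq_int[OF \<zeta>(1)] s t)
    have di: "integrable P (\<lambda>\<omega>. \<eta> \<omega> * d \<omega>)" by (rule sq_int_mult[OF \<eta>(2) d])
    have "expectation (\<lambda>\<omega>. \<eta> \<omega> * (I t \<omega> - I s \<omega>)) = expectation (\<lambda>\<omega>. \<eta> \<omega> * (J j t \<omega> - J j s \<omega>) - \<eta> \<omega> * d \<omega>)"
      by (intro Bochner_Integration.integral_cong refl) (simp add: d_def algebra_simps)
    also have "\<dots> = - expectation (\<lambda>\<omega>. \<eta> \<omega> * d \<omega>)" using Ji di J by simp
    finally have "\<bar>expectation (\<lambda>\<omega>. \<eta> \<omega> * (I t \<omega> - I s \<omega>))\<bar> \<le> expectation (\<lambda>\<omega>. \<bar>\<eta> \<omega> * d \<omega>\<bar>)"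
      using integral_abs_bound[of P "\<lambda>\<omega>. \<eta> \<omega> * d \<omega>"] by simp
    also have "\<dots> \<le> expectation (\<lambda>\<omega>. \<alpha> * (\<eta> \<omega>)\<^sup>2 + (d \<omega>)\<^sup>2 / (4 * \<alpha>))"
      unfolding abs_mult using \<eta>(2) d \<alpha> by (intro integral_mono' young_le) auto
    also have "\<dots> = \<alpha> * expectation (\<lambda>\<omega>. (\<eta> \<omega>)\<^sup>2) + expectation (\<lambda>\<omega>. (d \<omega>)\<^sup>2) / (4 * \<alpha>)"
      using \<eta>(2) d by simp
    also have "\<dots> \<le> \<alpha> * expectation (\<lambda>\<omega>. (\<eta> \<omega>)\<^sup>2) + ?D j / (4 * \<alpha>)"
      using dD \<alpha> by (intro add_left_mono divide_right_mono) auto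
    finally show ?thesis .
  qed
  have lim: "\<bar>expectation (\<lambda>\<omega>. \<eta> \<omega> * (I t \<omega> - I s \<omega>))\<bar> \<le> \<alpha> * expectation (\<lambda>\<omega>. (\<eta> \<omega>)\<^sup>2)" if \<alpha>: "0 < \<alpha>" for \<alpha>
  proof (rule LIMSEQ_le_const)
    have "(\<lambda>j. \<alpha> * expectation (\<lambda>\<omega>. (\<eta> \<omega>)\<^sup>2) + ?D j / (4 * \<alpha>)) \<longlonglongrightarrow> \<alpha> * expectation (\<lambda>\<omega>. (\<eta> \<omega>)\<^sup>2) + 0 / (4 * \<alpha>)"
      by (rule tendsto_add[OF tendsto_const tendsto_divide[OF D tendsto_const]]) (use \<alpha> in simp)
    then show "(\<lambda>j. \<alpha> * expectation (\<lambda>\<omega>. (\<eta> \<omega>)\<^sup>2) + ?D j / (4 * \<alpha>)) \<longlonglongrightarrow> \<alpha> * expectation (\<lambda>\<omega>. (\<eta> \<omega>)\<^sup>2)" by simp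
  qed (use bound[OF \<alpha>] in auto)
  have "\<bar>expectation (\<lambda>\<omega>. \<eta> \<omega> * (I t \<omega> - I s \<omega>))\<bar> \<le> 0 + e" if e: "0 < e" for e
  proof -
    let ?k = "expectation (\<lambda>\<omega>. (\<eta> \<omega>)\<^sup>2)"
    have k: "0 \<le> ?k" by simp
    have "e / (?k + 1) * ?k \<le> e / (?k + 1) * (?k + 1)" using e k by (intro mult_left_mono) auto
    then have "e / (?k + 1) * ?k \<le> e" using k by simp
    moreover have "0 < e / (?k + 1)" using e k by (intro divide_pos_pos add_nonneg_pos) auto
    ultimately show ?thesis using lim[of "e / (?k + 1)"] by linarith
  qed
  then have "\<bar>expectation (\<lambda>\<omega>. \<eta> \<omega> * (I t \<omega> - I s \<omega>))\<bar> \<le> 0" by (rule field_le_epsilon)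
  then show ?thesis by simp
qed

text \<open>The isometry passes to the limit. Splitting off the approximation error on either side by
  \<open>(x + y)\<^sup>2 \<le> 2 x\<^sup>2 + 2 y\<^sup>2\<close> costs a factor 2 each time.\<close>

lemma integral_process_square:
  assumes I: "integral_process z I" and st: "0 \<le> s" "s \<le> t" "t \<le> T"
  shows "expectation (\<lambda>\<omega>. (I t \<omega> - I s \<omega>)\<^sup>2) \<le> 4 * stint s t (\<lambda>r \<omega>. energy r \<omega> (z r \<omega>))"
proof -
  obtain \<zeta> J where \<zeta>: "\<And>j::nat. elementary_pair (\<zeta> j) (J j)"
    "(\<lambda>j. stint 0 T (\<lambda>r \<omega>. energy r \<omega> (\<zeta> j r \<omega> - z r \<omega>))) \<longlonglongrightarrow> 0"
    "\<And>t. t \<in> {0..T} \<Longrightarrow> (\<lambda>j. expectation (\<lambda>\<omega>. (J j t \<omega> - I t \<omega>)\<^sup>2)) \<longlonglongrightarrow> 0"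
    and z: "(\<lambda>p. z (fst p) (snd p)) \<in> borel_measurable Q" "Q_integrable (\<lambda>r \<omega>. energy r \<omega> (z r \<omega>))"
    using I unfolding integral_process_def by blast
  have s: "s \<in> {0..T}" and t: "t \<in> {0..T}" using st by auto
  note Isq = integral_process_sq_int[OF I]
  let ?q = "\<lambda>r \<omega>. energy r \<omega> (z r \<omega>)" and ?e = "\<lambda>j r \<omega>. energy r \<omega> (\<zeta> j r \<omega> - z r \<omega>)"
  let ?R = "\<lambda>j. 4 * stint s t ?q + 4 * stint 0 T (?e j)
      + (4 * expectation (\<lambda>\<omega>. (J j t \<omega> - I t \<omega>)\<^sup>2) + 4 * expectation (\<lambda>\<omega>. (J j s \<omega> - I s \<omega>)\<^sup>2))"
  have "expectation (\<lambda>\<omega>. (I t \<omega> - I s \<omega>)\<^sup>2) \<le> ?R j" for j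
  proof -
    have dt: "sq_int (\<lambda>\<omega>. J j t \<omega> - I t \<omega>)" and ds: "sq_int (\<lambda>\<omega>. J j s \<omega> - I s \<omega>)"
      and dJ: "sq_int (\<lambda>\<omega>. J j t \<omega> - J j s \<omega>)"
      by (intro sq_int_diff elementary_sq_int[OF \<zeta>(1)] Isq s t)+
    have "expectation (\<lambda>\<omega>. (I t \<omega> - I s \<omega>)\<^sup>2)
        \<le> expectation (\<lambda>\<omega>. 2 * (J j t \<omega> - J j s \<omega>)\<^sup>2 + (4 * (J j t \<omega> - I t \<omega>)\<^sup>2 + 4 * (J j s \<omega> - I s \<omega>)\<^sup>2))"
    proof (rule integral_mono')
      fix \<omega>
      have "(I t \<omega> - I s \<omega>)\<^sup>2 = ((J j t \<omega> - J j s \<omega>) - ((J j t \<omega> - I t \<omega>) - (J j s \<omega> - I s \<omega>)))\<^sup>2"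
        by (simp add: algebra_simps)
      also have "\<dots> \<le> 2 * (J j t \<omega> - J j s \<omega>)\<^sup>2 + 2 * ((J j t \<omega> - I t \<omega>) - (J j s \<omega> - I s \<omega>))\<^sup>2"
        by (rule square_diff_le)
      also have "\<dots> \<le> 2 * (J j t \<omega> - J j s \<omega>)\<^sup>2 + (4 * (J j t \<omega> - I t \<omega>)\<^sup>2 + 4 * (J j s \<omega> - I s \<omega>)\<^sup>2)"
        using square_diff_le[of "J j t \<omega> - I t \<omega>" "J j s \<omega> - I s \<omega>"] by simp
      finally show "(I t \<omega> - I s \<omega>)\<^sup>2
        \<le> 2 * (J j t \<omega> - J j s \<omega>)\<^sup>2 + (4 * (J j t \<omega> - I t \<omega>)\<^sup>2 + 4 * (J j s \<omega> - I s \<omega>)\<^sup>2)" .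
    qed (use dt ds dJ in auto)
    also have "\<dots> = 2 * expectation (\<lambda>\<omega>. (J j t \<omega> - J j s \<omega>)\<^sup>2)
        + (4 * expectation (\<lambda>\<omega>. (J j t \<omega> - I t \<omega>)\<^sup>2) + 4 * expectation (\<lambda>\<omega>. (J j s \<omega> - I s \<omega>)\<^sup>2))"
      using dt ds dJ by simp
    finally have 1: "expectation (\<lambda>\<omega>. (I t \<omega> - I s \<omega>)\<^sup>2) \<le> 2 * expectation (\<lambda>\<omega>. (J j t \<omega> - J j s \<omega>)\<^sup>2)
        + (4 * expectation (\<lambda>\<omega>. (J j t \<omega> - I t \<omega>)\<^sup>2) + 4 * expectation (\<lambda>\<omega>. (J j s \<omega> - I s \<omega>)\<^sup>2))" .
    have \<zeta>Q: "(\<lambda>p. \<zeta> j (fst p) (snd p)) \<in> borel_measurable Q"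
      using \<zeta>(1)[of j] unfolding elementary_pair_def by auto
    have e: "Q_integrable (?e j)" by (rule energy_Q_integrable_diff[OF elementary_energy_Q_integrable[OF \<zeta>(1)] z(2) \<zeta>Q z(1)])
    have "expectation (\<lambda>\<omega>. (J j t \<omega> - J j s \<omega>)\<^sup>2) \<le> stint s t (\<lambda>r \<omega>. energy r \<omega> (\<zeta> j r \<omega>))"
      by (rule elementary_isometry[OF \<zeta>(1) st])
    also have "\<dots> \<le> stint s t (\<lambda>r \<omega>. 2 * ?e j r \<omega> + 2 * ?q r \<omega>)"
    proof (rule stint_mono[OF elementary_energy_Q_integrable[OF \<zeta>(1)]])
      show "Q_integrable (\<lambda>r \<omega>. 2 * ?e j r \<omega> + 2 * ?q r \<omega>)" using e z(2) by simp
      fix r \<omega> assume r: "r \<in> {0..T}" "\<omega> \<in> space P"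
      have "energy r \<omega> (- z r \<omega>) = energy r \<omega> (z r \<omega>)" by (simp add: energy_def jump_def)
      then show "energy r \<omega> (\<zeta> j r \<omega>) \<le> 2 * ?e j r \<omega> + 2 * ?q r \<omega>"
        using energy_diff_le[of r \<omega> "\<zeta> j r \<omega> - z r \<omega>" "- z r \<omega>"] r by auto
    qed
    also have "\<dots> = 2 * stint s t (?e j) + 2 * stint s t ?q"
      using e z(2) by (simp add: stint_add stint_cmult)
    also have "stint s t (?e j) \<le> stint 0 T (?e j)"
      using energy_nonneg by (intro stint_le_horizon[OF e _ st]) auto
    finally show ?thesis using 1 by simp
  qed
  moreover have "?R \<longlonglongrightarrow> 4 * stint s t ?q + 4 * 0 + (4 * 0 + 4 * 0)"
    by (intro tendsto_add tendsto_mult tendsto_const \<zeta> s t)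
  ultimately show ?thesis by (intro LIMSEQ_le_const[of ?R]) auto
qed

section \<open>Processes with a one-sided drift bound\<close>

lemma le_one_plus_square: "x \<le> 1 + (x::real)\<^sup>2"
  using zero_le_power2[of "x - 1 / 2"] by (simp add: power2_eq_square algebra_simps)

lemma AE_path_integrable:
  assumes "Q_integrable g"
  shows "AE \<omega> in P. \<forall>a b. integrable L (\<lambda>r. indicator {a<..b} r * g r \<omega>)"
proof -
  have "integrable (L \<Otimes>\<^sub>M P) (\<lambda>(r, \<omega>). g r \<omega>)" using assms by (simp add: case_prod_beta')
  then have "AE \<omega> in P. integrable L (\<lambda>r. g r \<omega>)" by (rule LP.AE_integrable_snd)
  then show ?thesis
  proof eventually_elim
    case (elim \<omega>)
    show ?case
    proof (intro allI)
      fix a b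
      show "integrable L (\<lambda>r. indicator {a<..b} r * g r \<omega>)"
        by (rule Bochner_Integration.integrable_bound[OF elim])
          (use elim indicator_L in \<open>auto simp: indicator_def intro!: borel_measurable_times\<close>)
    qed
  qed
qed

text \<open>Nonnegativity of the variance of \<open>g\<close> on the interval.\<close>

lemma Cauchy_Schwarz_interval:
  assumes g: "integrable L (\<lambda>r. indicator {a<..b} r * g r)" and g2: "integrable L (\<lambda>r. indicator {a<..b} r * (g r)\<^sup>2)"
    and ab: "0 \<le> a" "a \<le> b" "b \<le> T"
  shows "(\<integral>r. indicator {a<..b} r * g r \<partial>L)\<^sup>2 \<le> (b - a) * (\<integral>r. indicator {a<..b} r * (g r)\<^sup>2 \<partial>L)"
proof (cases "a = b")
  case True
  then show ?thesis by simp
next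
  case False
  let ?G = "\<integral>r. indicator {a<..b} r * g r \<partial>L" and ?G2 = "\<integral>r. indicator {a<..b} r * (g r)\<^sup>2 \<partial>L"
  define m where "m = ?G / (b - a)"
  have i: "integrable L (\<lambda>r. indicator {a<..b} r :: real)"
    by (rule L.integrable_const_bound[where B = 1, OF _ indicator_L]) (simp add: indicator_def)
  have "0 \<le> (\<integral>r. indicator {a<..b} r * (g r - m)\<^sup>2 \<partial>L)"
    by (rule Bochner_Integration.integral_nonneg) simp
  also have "\<dots> = (\<integral>r. indicator {a<..b} r * (g r)\<^sup>2 - 2 * m * (indicator {a<..b} r * g r) + m\<^sup>2 * indicator {a<..b} r \<partial>L)"
    by (intro Bochner_Integration.integral_cong refl) (simp add: power2_diff algebra_simps)
  also have "\<dots> = ?G2 - 2 * m * ?G + m\<^sup>2 * (b - a)"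
    using g g2 i integral_indicator_L[OF ab] by simp
  also have "\<dots> = ?G2 - ?G\<^sup>2 / (b - a)"
  proof -
    have "(b - a) * m = ?G" using False by (simp add: m_def)
    moreover have "m\<^sup>2 * (b - a) = m * ((b - a) * m)" by (simp add: power2_eq_square)
    moreover have "?G\<^sup>2 / (b - a) = m * ?G" by (simp add: m_def power2_eq_square)
    ultimately show ?thesis by simp
  qed
  finally show ?thesis using False ab by (simp add: field_simps)
qed

end

text \<open>The process \<open>y\<close> dominates \<open>y\<^sub>0\<close> minus the integrated drift bound \<open>l\<^sub>1 |y| + l\<^sub>2 |z|\<close> plus the
  stochastic integral of \<open>z\<close>. Adaptedness is available for \<open>y\<close> itself, joint measurability only for
  the indistinguishable process \<open>yb\<close>.\<close>

locale drift_inequality = chain_horizon P X A T c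
  for P :: "'w measure" and X :: "real \<Rightarrow> 'w \<Rightarrow> real ^ 'n" and A :: "real \<Rightarrow> real ^ 'n ^ 'n" and T c :: real +
  fixes y yb :: "real \<Rightarrow> 'w \<Rightarrow> real" and z :: "real \<Rightarrow> 'w \<Rightarrow> real ^ 'n" and I :: "real \<Rightarrow> 'w \<Rightarrow> real"
    and l1 l2 :: real
  assumes l_nonneg: "0 \<le> l1" "0 \<le> l2"
    and y_adapted: "\<And>t. t \<in> {0..T} \<Longrightarrow> y t \<in> borel_measurable (F t)"
    and y_start: "integrable P (\<lambda>\<omega>. (y 0 \<omega>)\<^sup>2)"
    and y_end: "integrable P (\<lambda>\<omega>. (y T \<omega>)\<^sup>2)"
    and yb_Q: "(\<lambda>p. yb (fst p) (snd p)) \<in> borel_measurable Q"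
    and yb_sq: "Q_integrable (\<lambda>r \<omega>. (yb r \<omega>)\<^sup>2)"
    and yb_eq: "AE \<omega> in P. \<forall>r\<in>{0..T}. yb r \<omega> = y r \<omega>"
    and I: "integral_process z I"
    and drift: "AE \<omega> in P. \<forall>a b. 0 \<le> a \<longrightarrow> a \<le> b \<longrightarrow> b \<le> T \<longrightarrow>
      y a \<omega> - (\<integral>r. indicator {a<..b} r * (l1 * \<bar>yb r \<omega>\<bar> + l2 * sqrt (energy r \<omega> (z r \<omega>))) \<partial>L)
        + (I b \<omega> - I a \<omega>) \<le> y b \<omega>"
begin

definition h :: "real \<Rightarrow> 'w \<Rightarrow> real" where
  "h r \<omega> = l1 * \<bar>yb r \<omega>\<bar> + l2 * enorm r \<omega> (z r \<omega>)"

definition H :: "real \<Rightarrow> real \<Rightarrow> 'w \<Rightarrow> real" where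
  "H a b \<omega> = (\<integral>r. indicator {a<..b} r * h r \<omega> \<partial>L)"

text \<open>By how much \<open>y\<close> grows beyond its lower bound. This is nonnegative and additive in the interval.\<close>

definition K :: "real \<Rightarrow> real \<Rightarrow> 'w \<Rightarrow> real" where
  "K a b \<omega> = y b \<omega> - y a \<omega> + H a b \<omega> - (I b \<omega> - I a \<omega>)"

text \<open>The mean square of \<open>K a b\<close> is not additive in the interval; this is, and it dominates the mean square
  because \<open>0 \<le> K a b \<le> K 0 T\<close>.\<close>

definition Kmass :: "real \<Rightarrow> real \<Rightarrow> real" where
  "Kmass a b = expectation (\<lambda>\<omega>. K 0 T \<omega> * K a b \<omega>)"

abbreviation zz :: "real \<Rightarrow> 'w \<Rightarrow> real" where
  "zz r \<omega> \<equiv> energy r \<omega> (z r \<omega>)"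

lemma z_Q: "(\<lambda>p. z (fst p) (snd p)) \<in> borel_measurable Q"
  and zz_Q_integrable: "Q_integrable zz"
  using I unfolding integral_process_def by auto

lemma zz_nonneg: "r \<in> {0..T} \<Longrightarrow> \<omega> \<in> space P \<Longrightarrow> 0 \<le> zz r \<omega>"
  using energy_nonneg by auto

lemma h_Q: "(\<lambda>p. h (fst p) (snd p)) \<in> borel_measurable Q"
  unfolding h_def
  by (intro borel_measurable_add borel_measurable_times borel_measurable_const borel_measurable_abs yb_Q
      measurable_compose[OF energy_Q[OF z_Q] borel_measurable_sqrt])

lemma h_nonneg: "r \<in> {0..T} \<Longrightarrow> \<omega> \<in> space P \<Longrightarrow> 0 \<le> h r \<omega>"
  unfolding h_def using l_nonneg energy_nonneg by auto

lemma h2_Q_integrable: "Q_integrable (\<lambda>r \<omega>. (h r \<omega>)\<^sup>2)"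
proof (rule Q_integrable_bounded[where f = "\<lambda>r \<omega>. 2 * l1\<^sup>2 * (yb r \<omega>)\<^sup>2 + 2 * l2\<^sup>2 * zz r \<omega>" and K = 1])
  show "Q_integrable (\<lambda>r \<omega>. 2 * l1\<^sup>2 * (yb r \<omega>)\<^sup>2 + 2 * l2\<^sup>2 * zz r \<omega>)"
    using yb_sq zz_Q_integrable by simp
  show "(\<lambda>p. (h (fst p) (snd p))\<^sup>2) \<in> borel_measurable Q" by (intro borel_measurable_power h_Q)
  show "\<bar>(h r \<omega>)\<^sup>2\<bar> \<le> 1 * \<bar>2 * l1\<^sup>2 * (yb r \<omega>)\<^sup>2 + 2 * l2\<^sup>2 * zz r \<omega>\<bar>" if "r \<in> {0..T}" "\<omega> \<in> space P" for r \<omega>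
    using square_sum_le[of "l1 * \<bar>yb r \<omega>\<bar>" "l2 * enorm r \<omega> (z r \<omega>)"] zz_nonneg[OF that]
    by (simp add: h_def power_mult_distrib)
qed

lemma h_Q_integrable: "Q_integrable h"
proof (rule Q_integrable_bounded[where f = "\<lambda>r \<omega>. 1 + (h r \<omega>)\<^sup>2" and K = 1, OF _ h_Q])
  show "Q_integrable (\<lambda>r \<omega>. 1 + (h r \<omega>)\<^sup>2)" using h2_Q_integrable by simp
  show "\<bar>h r \<omega>\<bar> \<le> 1 * \<bar>1 + (h r \<omega>)\<^sup>2\<bar>" for r \<omega>
    using le_one_plus_square[of "\<bar>h r \<omega>\<bar>"] by simp
qed

lemma enorm_z_Q_integrable: "Q_integrable (\<lambda>r \<omega>. enorm r \<omega> (z r \<omega>))"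
proof (rule Q_integrable_bounded[where f = "\<lambda>r \<omega>. 1 + zz r \<omega>" and K = 1])
  show "Q_integrable (\<lambda>r \<omega>. 1 + zz r \<omega>)" using zz_Q_integrable by simp
  show "(\<lambda>p. enorm (fst p) (snd p) (z (fst p) (snd p))) \<in> borel_measurable Q"
    by (rule measurable_compose[OF energy_Q[OF z_Q] borel_measurable_sqrt])
  show "\<bar>enorm r \<omega> (z r \<omega>)\<bar> \<le> 1 * \<bar>1 + zz r \<omega>\<bar>" if "r \<in> {0..T}" "\<omega> \<in> space P" for r \<omega>
    using le_one_plus_square[of "enorm r \<omega> (z r \<omega>)"] zz_nonneg[OF that] by simp
qed

lemma h2_nonneg: "r \<in> {0..T} \<Longrightarrow> \<omega> \<in> space P \<Longrightarrow> 0 \<le> (h r \<omega>)\<^sup>2"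
  by simp

lemma H_sq:
  assumes ab: "0 \<le> a" "a \<le> b" "b \<le> T"
  shows "sq_int (H a b)" and "expectation (\<lambda>\<omega>. (H a b \<omega>)\<^sup>2) \<le> (b - a) * stint a b (\<lambda>r \<omega>. (h r \<omega>)\<^sup>2)"
proof -
  have Hm: "H a b \<in> borel_measurable P"
    using stint_expectation(2)[OF h_Q_integrable, of a b] unfolding H_def by (rule borel_measurable_integrable)
  let ?G = "\<lambda>\<omega>. (b - a) * (\<integral>r. indicator {a<..b} r * (h r \<omega>)\<^sup>2 \<partial>L)"
  have G: "integrable P ?G" using stint_expectation(2)[OF h2_Q_integrable] by (rule integrable_mult_right)
  have le: "AE \<omega> in P. (H a b \<omega>)\<^sup>2 \<le> ?G \<omega>"
    using AE_path_integrable[OF h_Q_integrable] AE_path_integrable[OF h2_Q_integrable]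
    by eventually_elim (simp add: H_def Cauchy_Schwarz_interval[OF _ _ ab])
  have Hi: "integrable P (\<lambda>\<omega>. (H a b \<omega>)\<^sup>2)"
  proof (rule Bochner_Integration.integrable_bound[OF G])
    show "(\<lambda>\<omega>. (H a b \<omega>)\<^sup>2) \<in> borel_measurable P" by (intro borel_measurable_power Hm)
    show "AE \<omega> in P. norm ((H a b \<omega>)\<^sup>2) \<le> norm (?G \<omega>)"
      using le by (rule eventually_mono) (simp only: real_norm_def abs_of_nonneg[OF zero_le_power2] order_trans[OF _ abs_ge_self])
  qed
  then show "sq_int (H a b)" using Hm by simp
  have "expectation (\<lambda>\<omega>. (H a b \<omega>)\<^sup>2) \<le> expectation ?G" by (rule integral_mono_AE[OF Hi G le])
  then show "expectation (\<lambda>\<omega>. (H a b \<omega>)\<^sup>2) \<le> (b - a) * stint a b (\<lambda>r \<omega>. (h r \<omega>)\<^sup>2)"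
    by (simp add: stint_expectation(1)[OF h2_Q_integrable])
qed

lemma H_split: "AE \<omega> in P. \<forall>a b d. a \<le> b \<longrightarrow> b \<le> d \<longrightarrow> H a d \<omega> = H a b \<omega> + H b d \<omega>"
  using AE_path_integrable[OF h_Q_integrable]
proof eventually_elim
  case (elim \<omega>)
  show ?case
  proof (intro allI impI)
    fix a b d :: real assume abd: "a \<le> b" "b \<le> d"
    have "H a d \<omega> = (\<integral>r. indicator {a<..b} r * h r \<omega> + indicator {b<..d} r * h r \<omega> \<partial>L)"
      unfolding H_def using abd by (intro Bochner_Integration.integral_cong) (auto simp: indicator_def)
    then show "H a d \<omega> = H a b \<omega> + H b d \<omega>" unfolding H_def using elim by simp
  qed
qed

lemma K_nonneg: "AE \<omega> in P. \<forall>a b. 0 \<le> a \<longrightarrow> a \<le> b \<longrightarrow> b \<le> T \<longrightarrow> 0 \<le> K a b \<omega>"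
  using drift
proof eventually_elim
  case (elim \<omega>)
  show ?case
  proof (intro allI impI)
    fix a b assume "0 \<le> a" "a \<le> b" "b \<le> T"
    then have "y a \<omega> - H a b \<omega> + (I b \<omega> - I a \<omega>) \<le> y b \<omega>" using elim unfolding H_def h_def by blast
    then show "0 \<le> K a b \<omega>" unfolding K_def by linarith
  qed
qed

lemma K_split: "AE \<omega> in P. \<forall>a b d. a \<le> b \<longrightarrow> b \<le> d \<longrightarrow> K a d \<omega> = K a b \<omega> + K b d \<omega>"
  using H_split
proof eventually_elim
  case (elim \<omega>)
  show ?case
  proof (intro allI impI)
    fix a b d :: real assume "a \<le> b" "b \<le> d"
    then have "H a d \<omega> = H a b \<omega> + H b d \<omega>" using elim by blast
    then show "K a d \<omega> = K a b \<omega> + K b d \<omega>" unfolding K_def by simp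
  qed
qed

lemma K_mono: "AE \<omega> in P. \<forall>a b a' b'. 0 \<le> a' \<longrightarrow> a' \<le> a \<longrightarrow> a \<le> b \<longrightarrow> b \<le> b' \<longrightarrow> b' \<le> T \<longrightarrow> K a b \<omega> \<le> K a' b' \<omega>"
  using K_nonneg K_split
proof eventually_elim
  case (elim \<omega>)
  show ?case
  proof (intro allI impI)
    fix a b a' b' assume o: "0 \<le> a'" "a' \<le> a" "a \<le> b" "b \<le> b'" "b' \<le> T"
    have "K a' b' \<omega> = K a' a \<omega> + K a b' \<omega>" by (rule elim(2)[rule_format]) (use o in auto)
    moreover have "K a b' \<omega> = K a b \<omega> + K b b' \<omega>" by (rule elim(2)[rule_format]) (use o in auto)
    moreover have "0 \<le> K a' a \<omega>" by (rule elim(1)[rule_format]) (use o in auto)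
    moreover have "0 \<le> K b b' \<omega>" by (rule elim(1)[rule_format]) (use o in auto)
    ultimately show "K a b \<omega> \<le> K a' b' \<omega>" by linarith
  qed
qed

lemma I_sq: "t \<in> {0..T} \<Longrightarrow> sq_int (I t)"
  by (rule integral_process_sq_int[OF I])

lemma y_P: "t \<in> {0..T} \<Longrightarrow> y t \<in> borel_measurable P"
  using y_adapted by (rule measurable_F_P)

text \<open>Since the increments of \<open>K\<close> are nonnegative, square-integrability of \<open>y\<close> at both ends
  of the time interval carries over to all times.\<close>

lemma K_sq: "0 \<le> a \<Longrightarrow> a \<le> b \<Longrightarrow> b \<le> T \<Longrightarrow> sq_int (K a b)"
  and y_sq: "t \<in> {0..T} \<Longrightarrow> sq_int (y t)"
proof -
  have T: "0 \<in> {0..T}" "T \<in> {0..T}" using T_pos by auto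
  have "sq_int (y T)" "sq_int (y 0)" using y_P T y_start y_end by auto
  then have K0T: "sq_int (K 0 T)"
    unfolding K_def using I_sq T H_sq(1)[of 0 T] T_pos by (intro sq_int_diff sq_int_add) auto
  have K: "sq_int (K a b)" if ab: "0 \<le> a" "a \<le> b" "b \<le> T" for a b
  proof (rule sq_int_le[OF K0T])
    show "K a b \<in> borel_measurable P"
      unfolding K_def using ab I_sq H_sq(1)[OF ab]
      by (intro borel_measurable_add borel_measurable_diff y_P) auto
    show "AE \<omega> in P. \<bar>K a b \<omega>\<bar> \<le> \<bar>K 0 T \<omega>\<bar>"
      using K_mono K_nonneg
    proof eventually_elim
      case (elim \<omega>)
      then have "K a b \<omega> \<le> K 0 T \<omega>" "0 \<le> K a b \<omega>" using ab by auto
      then show ?case by simp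
    qed
  qed
  then show "0 \<le> a \<Longrightarrow> a \<le> b \<Longrightarrow> b \<le> T \<Longrightarrow> sq_int (K a b)" .
  assume t: "t \<in> {0..T}"
  have "sq_int (\<lambda>\<omega>. (K 0 t \<omega> + y 0 \<omega>) + ((I t \<omega> - I 0 \<omega>) - H 0 t \<omega>))"
    using t K[of 0 t] \<open>sq_int (y 0)\<close> I_sq T H_sq(1)[of 0 t] by (intro sq_int_add sq_int_diff) auto
  then show "sq_int (y t)" by (simp add: K_def algebra_simps)
qed

lemma Kmass_integrable:
  assumes "0 \<le> a" "a \<le> b" "b \<le> T"
  shows "integrable P (\<lambda>\<omega>. K 0 T \<omega> * K a b \<omega>)"
proof -
  have "sq_int (K 0 T)" using T_pos by (intro K_sq) auto
  then show ?thesis by (rule sq_int_mult) (rule K_sq[OF assms])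
qed

lemma Kmass_split:
  assumes "0 \<le> a" "a \<le> b" "b \<le> d" "d \<le> T"
  shows "Kmass a d = Kmass a b + Kmass b d"
proof -
  have i: "integrable P (\<lambda>\<omega>. K 0 T \<omega> * K a b \<omega>)" "integrable P (\<lambda>\<omega>. K 0 T \<omega> * K b d \<omega>)"
    "integrable P (\<lambda>\<omega>. K 0 T \<omega> * K a d \<omega>)"
    using assms by (auto intro!: Kmass_integrable)
  have "Kmass a d = expectation (\<lambda>\<omega>. K 0 T \<omega> * K a b \<omega> + K 0 T \<omega> * K b d \<omega>)"
    unfolding Kmass_def
  proof (rule integral_cong_AE)
    show "AE \<omega> in P. K 0 T \<omega> * K a d \<omega> = K 0 T \<omega> * K a b \<omega> + K 0 T \<omega> * K b d \<omega>"
      using K_split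
    proof eventually_elim
      case (elim \<omega>)
      then have "K a d \<omega> = K a b \<omega> + K b d \<omega>" using assms by blast
      then show ?case by (simp only: distrib_left)
    qed
  qed (intro borel_measurable_integrable Bochner_Integration.integrable_add i)+
  then show ?thesis unfolding Kmass_def using i by simp
qed

lemma K_square_le_Kmass:
  assumes "0 \<le> a" "a \<le> r" "r \<le> b" "b \<le> T"
  shows "expectation (\<lambda>\<omega>. (K a r \<omega>)\<^sup>2) \<le> Kmass a b"
  unfolding Kmass_def
proof (rule integral_mono_AE)
  have ar: "0 \<le> a" "a \<le> r" "r \<le> T" and ab: "0 \<le> a" "a \<le> b" "b \<le> T" using assms by auto
  show "integrable P (\<lambda>\<omega>. (K a r \<omega>)\<^sup>2)" using K_sq[OF ar] by (rule conjunct2)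
  show "integrable P (\<lambda>\<omega>. K 0 T \<omega> * K a b \<omega>)" by (rule Kmass_integrable[OF ab])
  show "AE \<omega> in P. (K a r \<omega>)\<^sup>2 \<le> K 0 T \<omega> * K a b \<omega>"
    using K_mono K_nonneg
  proof eventually_elim
    case (elim \<omega>)
    then have "K a r \<omega> \<le> K 0 T \<omega>" "K a r \<omega> \<le> K a b \<omega>" "0 \<le> K a r \<omega>" using assms by auto
    then show ?case unfolding power2_eq_square by (intro mult_mono) auto
  qed
qed

lemma Kmass_nonneg:
  assumes "0 \<le> a" "a \<le> b" "b \<le> T"
  shows "0 \<le> Kmass a b"
proof -
  have "0 \<le> expectation (\<lambda>\<omega>. (K a a \<omega>)\<^sup>2)" by simp
  also have "\<dots> \<le> Kmass a b" using assms by (intro K_square_le_Kmass) auto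
  finally show ?thesis .
qed

text \<open>Up to a constant, this additive function of intervals dominates the mean square increments of \<open>y\<close>. All error
  terms of second order are controlled by the length of an interval times this function.\<close>

definition \<mu> :: "real \<Rightarrow> real \<Rightarrow> real" where
  "\<mu> a b = (b - a) + stint a b (\<lambda>r \<omega>. (h r \<omega>)\<^sup>2) + Kmass a b + stint a b zz"

lemma \<mu>_split:
  assumes "0 \<le> a" "a \<le> b" "b \<le> d" "d \<le> T"
  shows "\<mu> a d = \<mu> a b + \<mu> b d"
  unfolding \<mu>_def using Kmass_split[OF assms] stint_split[OF h2_Q_integrable assms(2,3)] stint_split[OF zz_Q_integrable assms(2,3)]
  by simp

lemma \<mu>_parts:
  assumes "0 \<le> a" "a \<le> b" "b \<le> T"
  shows "b - a \<le> \<mu> a b" "stint a b (\<lambda>r \<omega>. (h r \<omega>)\<^sup>2) \<le> \<mu> a b" "0 \<le> \<mu> a b"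
  using assms Kmass_nonneg[OF assms] stint_nonneg[of "\<lambda>r \<omega>. (h r \<omega>)\<^sup>2" a b, OF h2_nonneg] stint_nonneg[of zz a b, OF zz_nonneg]
  unfolding \<mu>_def by auto

lemma y_increment:
  assumes "0 \<le> a" "a \<le> r" "r \<le> b" "b \<le> T"
  shows "expectation (\<lambda>\<omega>. (y r \<omega> - y a \<omega>)\<^sup>2) \<le> 12 * (1 + (b - a)) * \<mu> a b"
proof -
  have ar: "0 \<le> a" "a \<le> r" "r \<le> T" and ab: "0 \<le> a" "a \<le> b" "b \<le> T" using assms by auto
  have Isq: "sq_int (\<lambda>\<omega>. I r \<omega> - I a \<omega>)" using ar by (intro sq_int_diff I_sq) auto
  note Ksq = K_sq[OF ar] and Hsq = H_sq(1)[OF ar]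
  have "expectation (\<lambda>\<omega>. (y r \<omega> - y a \<omega>)\<^sup>2)
      \<le> expectation (\<lambda>\<omega>. 3 * (K a r \<omega>)\<^sup>2 + 3 * (H a r \<omega>)\<^sup>2 + 3 * (I r \<omega> - I a \<omega>)\<^sup>2)"
  proof (rule integral_mono')
    show "integrable P (\<lambda>\<omega>. 3 * (K a r \<omega>)\<^sup>2 + 3 * (H a r \<omega>)\<^sup>2 + 3 * (I r \<omega> - I a \<omega>)\<^sup>2)"
      using Ksq Hsq Isq by simp
    fix \<omega>
    have "y r \<omega> - y a \<omega> = K a r \<omega> - H a r \<omega> + (I r \<omega> - I a \<omega>)" by (simp add: K_def)
    then show "(y r \<omega> - y a \<omega>)\<^sup>2 \<le> 3 * (K a r \<omega>)\<^sup>2 + 3 * (H a r \<omega>)\<^sup>2 + 3 * (I r \<omega> - I a \<omega>)\<^sup>2"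
      using square_three_le by simp
  qed simp
  also have "\<dots> = 3 * expectation (\<lambda>\<omega>. (K a r \<omega>)\<^sup>2) + 3 * expectation (\<lambda>\<omega>. (H a r \<omega>)\<^sup>2)
      + 3 * expectation (\<lambda>\<omega>. (I r \<omega> - I a \<omega>)\<^sup>2)"
    using Ksq Hsq Isq by simp
  also have "\<dots> \<le> 3 * Kmass a b + 3 * ((b - a) * stint a b (\<lambda>r \<omega>. (h r \<omega>)\<^sup>2)) + 3 * (4 * stint a b zz)"
  proof (intro add_mono mult_left_mono)
    show "expectation (\<lambda>\<omega>. (K a r \<omega>)\<^sup>2) \<le> Kmass a b" by (rule K_square_le_Kmass[OF assms])
    have "stint a r (\<lambda>r \<omega>. (h r \<omega>)\<^sup>2) \<le> stint a b (\<lambda>r \<omega>. (h r \<omega>)\<^sup>2)"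
      using stint_split[OF h2_Q_integrable assms(2,3)] stint_nonneg[of "\<lambda>r \<omega>. (h r \<omega>)\<^sup>2" r b, OF h2_nonneg] by simp
    then have "(r - a) * stint a r (\<lambda>r \<omega>. (h r \<omega>)\<^sup>2) \<le> (b - a) * stint a b (\<lambda>r \<omega>. (h r \<omega>)\<^sup>2)"
      using assms stint_nonneg[of "\<lambda>r \<omega>. (h r \<omega>)\<^sup>2" a r, OF h2_nonneg] by (intro mult_mono) auto
    then show "expectation (\<lambda>\<omega>. (H a r \<omega>)\<^sup>2) \<le> (b - a) * stint a b (\<lambda>r \<omega>. (h r \<omega>)\<^sup>2)"
      using H_sq(2)[OF ar] by linarith
    have "stint a r zz \<le> stint a b zz"
      using stint_split[OF zz_Q_integrable assms(2,3)] stint_nonneg[of zz r b, OF zz_nonneg] by simp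
    then show "expectation (\<lambda>\<omega>. (I r \<omega> - I a \<omega>)\<^sup>2) \<le> 4 * stint a b zz"
      using integral_process_square[OF I ar] by simp
  qed auto
  also have "\<dots> \<le> 12 * (1 + (b - a)) * \<mu> a b"
  proof -
    let ?h2 = "stint a b (\<lambda>r \<omega>. (h r \<omega>)\<^sup>2)" and ?z2 = "stint a b zz" and ?k = "Kmass a b" and ?D = "b - a"
    have nn: "0 \<le> ?h2" "0 \<le> ?z2" "0 \<le> ?k" "0 \<le> ?D"
      using stint_nonneg[of "\<lambda>r \<omega>. (h r \<omega>)\<^sup>2" a b, OF h2_nonneg] stint_nonneg[of zz a b, OF zz_nonneg]
        Kmass_nonneg[OF ab] assms by auto
    have "3 * ?k + 3 * (?D * ?h2) + 3 * (4 * ?z2) \<le> 12 * \<mu> a b + 12 * (?D * ?h2)"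
      using nn mult_nonneg_nonneg[OF nn(4,1)] unfolding \<mu>_def by (simp add: algebra_simps)
    also have "?D * ?h2 \<le> ?D * \<mu> a b" using nn \<mu>_parts(2)[OF ab] by (intro mult_left_mono)
    finally show ?thesis by (simp add: algebra_simps)
  qed
  finally show ?thesis .
qed

lemma y_square_bounded: "\<exists>C. \<forall>t\<in>{0..T}. expectation (\<lambda>\<omega>. (y t \<omega>)\<^sup>2) \<le> C"
proof (intro exI ballI)
  fix t assume t: "t \<in> {0..T}"
  have 0: "sq_int (y 0)" and d: "sq_int (\<lambda>\<omega>. y t \<omega> - y 0 \<omega>)"
    using t T_pos by (auto intro!: sq_int_diff y_sq)
  have "expectation (\<lambda>\<omega>. (y t \<omega>)\<^sup>2) \<le> expectation (\<lambda>\<omega>. 2 * (y 0 \<omega>)\<^sup>2 + 2 * (y t \<omega> - y 0 \<omega>)\<^sup>2)"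
  proof (rule integral_mono')
    show "(y t \<omega>)\<^sup>2 \<le> 2 * (y 0 \<omega>)\<^sup>2 + 2 * (y t \<omega> - y 0 \<omega>)\<^sup>2" for \<omega>
      using square_sum_le[of "y 0 \<omega>" "y t \<omega> - y 0 \<omega>"] by simp
  qed (use 0 d in auto)
  also have "\<dots> = 2 * expectation (\<lambda>\<omega>. (y 0 \<omega>)\<^sup>2) + 2 * expectation (\<lambda>\<omega>. (y t \<omega> - y 0 \<omega>)\<^sup>2)"
    using 0 d by simp
  also have "\<dots> \<le> 2 * expectation (\<lambda>\<omega>. (y 0 \<omega>)\<^sup>2) + 2 * (12 * (1 + (T - 0)) * \<mu> 0 T)"
    using t y_increment[of 0 t T] by (intro add_left_mono mult_left_mono) auto
  finally show "expectation (\<lambda>\<omega>. (y t \<omega>)\<^sup>2) \<le> 2 * expectation (\<lambda>\<omega>. (y 0 \<omega>)\<^sup>2) + 2 * (12 * (1 + (T - 0)) * \<mu> 0 T)" .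
qed

end

section \<open>Monotonicity of weighted means of test functions\<close>

text \<open>A test function for which the jump part of the generator beats the drift bound, up to a multiple
  of the function itself that an exponential weight in time will absorb. The gain \<open>\<gamma> |C|\<close> controls \<open>z\<close>.
  Restricting the values of \<open>y\<close> to \<open>V\<close> allows test functions that are good on a half-line or at a
  single point.\<close>

locale drift_test = drift_inequality +
  fixes \<phi> \<phi>' :: "real \<Rightarrow> real" and Lc \<kappa> \<gamma> :: real and V :: "real set"
  assumes Lc_nonneg: "0 \<le> Lc" and \<gamma>_nonneg: "0 \<le> \<gamma>"
    and \<phi>_mono: "mono \<phi>"
    and \<phi>'_nonneg: "\<And>v. 0 \<le> \<phi>' v"
    and \<phi>'_lipschitz: "\<And>v w. \<bar>\<phi>' v - \<phi>' w\<bar> \<le> Lc * \<bar>v - w\<bar>"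
    and \<phi>_taylor: "\<And>v d. \<bar>\<phi> (v + d) - \<phi> v - \<phi>' v * d\<bar> \<le> Lc * d\<^sup>2"
    and y_values: "\<And>t. t \<in> {0..T} \<Longrightarrow> AE \<omega> in P. y t \<omega> \<in> V"
    and generator: "AE \<omega> in P. \<forall>r\<in>{0..T}. \<forall>v\<in>V. \<forall>C.
      \<gamma> * sqrt (energy r \<omega> C) - \<kappa> * \<phi> v
        \<le> (\<Sum>j\<in>UNIV. rate r \<omega> j * (\<phi> (v + jump C r \<omega> j) - \<phi> v - \<phi>' v * jump C r \<omega> j))
          - \<phi>' v * (l1 * \<bar>v\<bar> + l2 * sqrt (energy r \<omega> C))"
begin

definition rem :: "real \<Rightarrow> real \<Rightarrow> real" where
  "rem v d = \<phi> (v + d) - \<phi> v - \<phi>' v * d"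

definition mean :: "real \<Rightarrow> real" where
  "mean t = expectation (\<lambda>\<omega>. \<phi> (y t \<omega>))"

lemma \<phi>_borel: "\<phi> \<in> borel_measurable borel"
  by (rule borel_measurable_mono[OF \<phi>_mono])

lemma \<phi>'_borel: "\<phi>' \<in> borel_measurable borel"
proof (rule borel_measurable_continuous_onI)
  have "Lc-lipschitz_on UNIV \<phi>'"
    using \<phi>'_lipschitz Lc_nonneg by (auto simp: lipschitz_on_def dist_real_def)
  then show "continuous_on UNIV \<phi>'" by (rule lipschitz_on_continuous_on)
qed

lemma \<phi>'_growth: "\<bar>\<phi>' v\<bar> \<le> \<phi>' 0 + Lc * \<bar>v\<bar>"
  using \<phi>'_lipschitz[of v 0] \<phi>'_nonneg[of v] by auto

lemma \<phi>_growth: "\<bar>\<phi> v\<bar> \<le> \<bar>\<phi> 0\<bar> + \<phi>' 0 + (\<phi>' 0 + Lc) * v\<^sup>2"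
proof -
  have "\<bar>\<phi> v\<bar> \<le> \<bar>\<phi> 0\<bar> + \<bar>\<phi>' 0 * v\<bar> + Lc * v\<^sup>2" using \<phi>_taylor[of 0 v] by simp
  moreover have "\<bar>\<phi>' 0 * v\<bar> \<le> \<phi>' 0 * (1 + v\<^sup>2)"
    using mult_left_mono[OF le_one_plus_square[of "\<bar>v\<bar>"] \<phi>'_nonneg[of 0]] \<phi>'_nonneg[of 0] by (simp add: abs_mult)
  ultimately show ?thesis by (simp add: algebra_simps)
qed

lemma \<phi>'_y:
  assumes t: "t \<in> {0..T}"
  shows "(\<lambda>\<omega>. \<phi>' (y t \<omega>)) \<in> borel_measurable (F t)" and "sq_int (\<lambda>\<omega>. \<phi>' (y t \<omega>))"
proof -
  show m: "(\<lambda>\<omega>. \<phi>' (y t \<omega>)) \<in> borel_measurable (F t)"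
    by (rule measurable_compose[OF y_adapted[OF t] \<phi>'_borel])
  have "sq_int (\<lambda>\<omega>. \<bar>y t \<omega>\<bar>)" using y_sq[OF t] by (auto intro: borel_measurable_abs)
  then have "sq_int (\<lambda>\<omega>. \<phi>' 0 + Lc * \<bar>y t \<omega>\<bar>)" by (intro sq_int_add sq_int_const sq_int_cmult)
  then show "sq_int (\<lambda>\<omega>. \<phi>' (y t \<omega>))"
  proof (rule sq_int_le)
    show "AE \<omega> in P. \<bar>\<phi>' (y t \<omega>)\<bar> \<le> \<bar>\<phi>' 0 + Lc * \<bar>y t \<omega>\<bar>\<bar>"
      using \<phi>'_growth by (intro AE_I2) (rule order_trans[OF _ abs_ge_self])
  qed (rule measurable_F_P[OF m])
qed

lemma \<phi>_y_integrable:
  assumes t: "t \<in> {0..T}"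
  shows "integrable P (\<lambda>\<omega>. \<phi> (y t \<omega>))"
proof (rule Bochner_Integration.integrable_bound)
  show "integrable P (\<lambda>\<omega>. \<bar>\<phi> 0\<bar> + \<phi>' 0 + (\<phi>' 0 + Lc) * (y t \<omega>)\<^sup>2)" using y_sq[OF t] by simp
  show "AE \<omega> in P. norm (\<phi> (y t \<omega>)) \<le> norm (\<bar>\<phi> 0\<bar> + \<phi>' 0 + (\<phi>' 0 + Lc) * (y t \<omega>)\<^sup>2)"
    unfolding real_norm_def by (intro AE_I2 order_trans[OF \<phi>_growth abs_ge_self])
  show "(\<lambda>\<omega>. \<phi> (y t \<omega>)) \<in> borel_measurable P"
    by (rule measurable_compose[OF y_P[OF t] \<phi>_borel])
qed

lemma rem_bound: "\<bar>rem v d\<bar> \<le> Lc * d\<^sup>2"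
  using \<phi>_taylor by (simp add: rem_def)

text \<open>Expand first by \<open>u\<close>, keeping the exact remainder since \<open>u\<close> may be a large jump, then by the small
  rest \<open>R\<close>. The change of the derivative between the two points is absorbed by Young's inequality.\<close>

lemma taylor_two_steps:
  assumes \<alpha>: "0 < \<alpha>"
  shows "\<phi> v + \<phi>' v * (u + R) + rem v u - Lc * \<alpha> * u\<^sup>2 - Lc * (1 + 1 / (4 * \<alpha>)) * R\<^sup>2 \<le> \<phi> (v + (u + R))"
proof -
  have 1: "\<phi> (v + u) + \<phi>' (v + u) * R - Lc * R\<^sup>2 \<le> \<phi> (v + (u + R))"
    using \<phi>_taylor[of "v + u" R] by (simp add: add.assoc abs_le_iff)
  have "\<bar>(\<phi>' (v + u) - \<phi>' v) * R\<bar> \<le> Lc * \<bar>u\<bar> * \<bar>R\<bar>"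
    using \<phi>'_lipschitz[of "v + u" v] by (simp add: abs_mult mult_right_mono)
  also have "\<dots> \<le> Lc * (\<alpha> * u\<^sup>2 + R\<^sup>2 / (4 * \<alpha>))"
    using mult_left_mono[OF young_le[OF \<alpha>, of u R] Lc_nonneg] by (simp add: mult.assoc)
  finally have "\<phi>' v * R - Lc * (\<alpha> * u\<^sup>2 + R\<^sup>2 / (4 * \<alpha>)) \<le> \<phi>' (v + u) * R"
    by (simp add: abs_le_iff algebra_simps)
  with 1 show ?thesis by (simp add: rem_def algebra_simps add_divide_distrib)
qed

text \<open>Weight in the error term that is of first order in the length of the interval but has the
  arbitrarily small factor \<open>\<alpha>\<close>.\<close>

definition W :: "real \<Rightarrow> 'a \<Rightarrow> real" where
  "W t \<omega> = (\<gamma> + l2 * \<phi>' (y t \<omega>))\<^sup>2 + (l1 * \<phi>' (y t \<omega>))\<^sup>2"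

lemma W_integrable:
  assumes t: "t \<in> {0..T}"
  shows "integrable P (W t)"
proof -
  have "sq_int (\<lambda>\<omega>. \<gamma> + l2 * \<phi>' (y t \<omega>))" "sq_int (\<lambda>\<omega>. l1 * \<phi>' (y t \<omega>))"
    by (intro sq_int_add sq_int_const sq_int_cmult \<phi>'_y[OF t])+
  then show ?thesis unfolding W_def by simp
qed

lemma yb_increment:
  assumes ab: "0 \<le> a" "a \<le> b" "b \<le> T" "b - a \<le> 1"
  shows "Q_integrable (\<lambda>r \<omega>. (yb r \<omega> - y a \<omega>)\<^sup>2)"
    and "stint a b (\<lambda>r \<omega>. (yb r \<omega> - y a \<omega>)\<^sup>2) \<le> 24 * \<mu> a b * (b - a)"
proof -
  have a: "a \<in> {0..T}" using ab by auto
  have ya: "Q_integrable (\<lambda>r \<omega>. (y a \<omega>)\<^sup>2)" using y_sq[OF a] by (intro integrable_lift) simp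
  show s: "Q_integrable (\<lambda>r \<omega>. (yb r \<omega> - y a \<omega>)\<^sup>2)"
  proof (rule Q_integrable_bounded[where f = "\<lambda>r \<omega>. 2 * (yb r \<omega>)\<^sup>2 + 2 * (y a \<omega>)\<^sup>2" and K = 1])
    show "Q_integrable (\<lambda>r \<omega>. 2 * (yb r \<omega>)\<^sup>2 + 2 * (y a \<omega>)\<^sup>2)" using yb_sq ya by simp
    show "(\<lambda>p. (yb (fst p) (snd p) - y a (snd p))\<^sup>2) \<in> borel_measurable Q"
      by (intro borel_measurable_power borel_measurable_diff yb_Q measurable_snd_Q y_P a)
    show "\<bar>(yb r \<omega> - y a \<omega>)\<^sup>2\<bar> \<le> 1 * \<bar>2 * (yb r \<omega>)\<^sup>2 + 2 * (y a \<omega>)\<^sup>2\<bar>" for r \<omega>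
      using square_diff_le[of "yb r \<omega>" "y a \<omega>"] by simp
  qed
  show "stint a b (\<lambda>r \<omega>. (yb r \<omega> - y a \<omega>)\<^sup>2) \<le> 24 * \<mu> a b * (b - a)"
  proof (rule stint_le_const[OF s ab(1-3)])
    fix r assume r: "a < r" "r \<le> b"
    then have r': "r \<in> {0..T}" using ab by auto
    have "expectation (\<lambda>\<omega>. (yb r \<omega> - y a \<omega>)\<^sup>2) = expectation (\<lambda>\<omega>. (y r \<omega> - y a \<omega>)\<^sup>2)"
    proof (rule integral_cong_AE)
      show "AE \<omega> in P. (yb r \<omega> - y a \<omega>)\<^sup>2 = (y r \<omega> - y a \<omega>)\<^sup>2"
        using yb_eq by (rule eventually_mono) (use r' in simp)
      show "(\<lambda>\<omega>. (yb r \<omega> - y a \<omega>)\<^sup>2) \<in> borel_measurable P"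
        using section_measurable[OF yb_Q r'] y_P[OF a] by (intro borel_measurable_power borel_measurable_diff)
      show "(\<lambda>\<omega>. (y r \<omega> - y a \<omega>)\<^sup>2) \<in> borel_measurable P"
        by (intro borel_measurable_power borel_measurable_diff y_P a r')
    qed
    also have "\<dots> \<le> 12 * (1 + (b - a)) * \<mu> a b" using r ab by (intro y_increment) auto
    also have "\<dots> \<le> 12 * 2 * \<mu> a b"
      using ab \<mu>_parts(3)[OF ab(1-3)] by (intro mult_right_mono mult_left_mono) auto
    finally show "expectation (\<lambda>\<omega>. (yb r \<omega> - y a \<omega>)\<^sup>2) \<le> 24 * \<mu> a b" by simp
  qed
qed

lemma drift_term:
  assumes ab: "0 \<le> a" "a \<le> b" "b \<le> T"
  shows "Q_integrable (\<lambda>r \<omega>. \<phi>' (y a \<omega>) * h r \<omega>)"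
    and "expectation (\<lambda>\<omega>. \<phi>' (y a \<omega>) * H a b \<omega>) = stint a b (\<lambda>r \<omega>. \<phi>' (y a \<omega>) * h r \<omega>)"
proof -
  have a: "a \<in> {0..T}" using ab by auto
  show s: "Q_integrable (\<lambda>r \<omega>. \<phi>' (y a \<omega>) * h r \<omega>)"
  proof (rule Q_integrable_bounded[where f = "\<lambda>r \<omega>. (\<phi>' (y a \<omega>))\<^sup>2 + (h r \<omega>)\<^sup>2" and K = 1])
    have "Q_integrable (\<lambda>r \<omega>. (\<phi>' (y a \<omega>))\<^sup>2)" using \<phi>'_y(2)[OF a] by (intro integrable_lift) simp
    then show "Q_integrable (\<lambda>r \<omega>. (\<phi>' (y a \<omega>))\<^sup>2 + (h r \<omega>)\<^sup>2)" using h2_Q_integrable by simp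
    show "(\<lambda>p. \<phi>' (y a (snd p)) * h (fst p) (snd p)) \<in> borel_measurable Q"
      using \<phi>'_y(2)[OF a] by (intro borel_measurable_times h_Q measurable_snd_Q) simp
    show "\<bar>\<phi>' (y a \<omega>) * h r \<omega>\<bar> \<le> 1 * \<bar>(\<phi>' (y a \<omega>))\<^sup>2 + (h r \<omega>)\<^sup>2\<bar>" for r \<omega>
    proof -
      have "\<bar>\<phi>' (y a \<omega>) * h r \<omega>\<bar> \<le> (\<phi>' (y a \<omega>))\<^sup>2 + (h r \<omega>)\<^sup>2 / 4"
        using young_le[of 1 "\<phi>' (y a \<omega>)" "h r \<omega>"] by (simp add: abs_mult)
      also have "\<dots> \<le> (\<phi>' (y a \<omega>))\<^sup>2 + (h r \<omega>)\<^sup>2" by simp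
      finally show ?thesis by simp
    qed
  qed
  show "expectation (\<lambda>\<omega>. \<phi>' (y a \<omega>) * H a b \<omega>) = stint a b (\<lambda>r \<omega>. \<phi>' (y a \<omega>) * h r \<omega>)"
    unfolding stint_expectation(1)[OF s] H_def by (simp add: mult.left_commute)
qed

text \<open>The generator condition, transferred from the state \<open>y a\<close> and the constant integrand \<open>\<eta>\<close> to the
  current values of \<open>y\<close> and \<open>z\<close> at the cost of mean square errors.\<close>

lemma generator_term:
  assumes ab: "0 \<le> a" "a \<le> b" "b \<le> T" and D: "b - a \<le> 1" and \<alpha>: "0 < \<alpha>"
    and e_Q_integrable: "Q_integrable (\<lambda>r \<omega>. energy r \<omega> (z r \<omega> - \<zeta> r \<omega>))"
    and \<eta>: "\<And>r \<omega>. \<omega> \<in> space P \<Longrightarrow> a < r \<Longrightarrow> r \<le> b \<Longrightarrow> \<zeta> r \<omega> = \<eta> \<omega>"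
    and G_Q_integrable: "Q_integrable (\<lambda>r \<omega>. \<Sum>j\<in>UNIV. rate r \<omega> j * rem (y a \<omega>) (jump (\<eta> \<omega>) r \<omega> j))" (is "Q_integrable ?G")
  shows "\<gamma> * stint a b (\<lambda>r \<omega>. enorm r \<omega> (z r \<omega>)) - \<kappa> * (b - a) * mean a - \<alpha> * (b - a) * expectation (W a)
      - stint a b (\<lambda>r \<omega>. energy r \<omega> (z r \<omega> - \<zeta> r \<omega>)) / (4 * \<alpha>) - 6 / \<alpha> * (b - a) * \<mu> a b
    \<le> stint a b ?G - stint a b (\<lambda>r \<omega>. \<phi>' (y a \<omega>) * h r \<omega>)"
proof -
  have a: "a \<in> {0..T}" using ab by auto
  let ?e = "\<lambda>r \<omega>. energy r \<omega> (z r \<omega> - \<zeta> r \<omega>)" and ?d = "\<lambda>r \<omega>. (yb r \<omega> - y a \<omega>)\<^sup>2"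
  let ?s = "\<lambda>\<omega>. \<kappa> * \<phi> (y a \<omega>) + \<alpha> * W a \<omega>"
  note d = yb_increment[OF ab D]
  have s_int: "integrable P ?s" using \<phi>_y_integrable[OF a] W_integrable[OF a] by simp
  have s1: "Q_integrable (\<lambda>r \<omega>. \<gamma> * enorm r \<omega> (z r \<omega>))" using enorm_z_Q_integrable by simp
  have s2: "Q_integrable (\<lambda>r. ?s)" by (rule integrable_lift[OF s_int])
  have s3: "Q_integrable (\<lambda>r \<omega>. 1 / (4 * \<alpha>) * (?e r \<omega> + ?d r \<omega>))" using e_Q_integrable d(1) by simp
  have s12: "Q_integrable (\<lambda>r \<omega>. \<gamma> * enorm r \<omega> (z r \<omega>) - ?s \<omega>)" by (rule Bochner_Integration.integrable_diff[OF s1 s2])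
  have s123: "Q_integrable (\<lambda>r \<omega>. \<gamma> * enorm r \<omega> (z r \<omega>) - ?s \<omega> - 1 / (4 * \<alpha>) * (?e r \<omega> + ?d r \<omega>))"
    by (rule Bochner_Integration.integrable_diff[OF s12 s3])
  have AE: "AE p in Q. y a (snd p) \<in> V \<and> (\<forall>v\<in>V. \<forall>C. \<gamma> * enorm (fst p) (snd p) C - \<kappa> * \<phi> v
        \<le> (\<Sum>j\<in>UNIV. rate (fst p) (snd p) j * rem v (jump C (fst p) (snd p) j))
          - \<phi>' v * (l1 * \<bar>v\<bar> + l2 * enorm (fst p) (snd p) C))"
  proof (rule AE_Q)
    show "AE \<omega> in P. \<forall>r\<in>{0..T}. y a \<omega> \<in> V \<and> (\<forall>v\<in>V. \<forall>C. \<gamma> * enorm r \<omega> C - \<kappa> * \<phi> v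
        \<le> (\<Sum>j\<in>UNIV. rate r \<omega> j * rem v (jump C r \<omega> j)) - \<phi>' v * (l1 * \<bar>v\<bar> + l2 * enorm r \<omega> C))"
      using y_values[OF a] generator
    proof eventually_elim
      case (elim \<omega>)
      then show ?case unfolding rem_def by blast
    qed
  qed
  have "stint a b (\<lambda>r \<omega>. \<gamma> * enorm r \<omega> (z r \<omega>) - ?s \<omega> - 1 / (4 * \<alpha>) * (?e r \<omega> + ?d r \<omega>))
      \<le> stint a b (\<lambda>r \<omega>. ?G r \<omega> - \<phi>' (y a \<omega>) * h r \<omega>)"
  proof (rule stint_mono_AE[OF s123])
    show "Q_integrable (\<lambda>r \<omega>. ?G r \<omega> - \<phi>' (y a \<omega>) * h r \<omega>)"
      by (rule Bochner_Integration.integrable_diff[OF G_Q_integrable drift_term(1)[OF ab]])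
    show "AE p in Q. fst p \<in> {a<..b} \<longrightarrow>
        \<gamma> * enorm (fst p) (snd p) (z (fst p) (snd p)) - ?s (snd p) - 1 / (4 * \<alpha>) * (?e (fst p) (snd p) + ?d (fst p) (snd p))
        \<le> ?G (fst p) (snd p) - \<phi>' (y a (snd p)) * h (fst p) (snd p)"
      using AE AE_space
    proof eventually_elim
      case (elim p)
      show ?case
      proof
      assume p: "fst p \<in> {a<..b}"
      define r \<omega> where "r = fst p" and "\<omega> = snd p"
      have r: "0 \<le> r" "a < r" "r \<le> b" and \<omega>: "\<omega> \<in> space P"
        using elim p by (auto simp: r_def \<omega>_def space_Q)
      define f where "f = \<phi>' (y a \<omega>)"
      define n\<eta> nz ne where "n\<eta> = enorm r \<omega> (\<eta> \<omega>)" and "nz = enorm r \<omega> (z r \<omega>)" and "ne = enorm r \<omega> (z r \<omega> - \<eta> \<omega>)"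
      define u where "u = \<bar>yb r \<omega> - y a \<omega>\<bar>"
      have f: "0 \<le> f" unfolding f_def by (rule \<phi>'_nonneg)
      have ne: "0 \<le> ne" unfolding ne_def using energy_nonneg[OF r(1) \<omega>] by simp
      have tri: "nz \<le> n\<eta> + ne"
        using enorm_triangle[OF r(1) \<omega>, of "\<eta> \<omega>" "z r \<omega> - \<eta> \<omega>"] by (simp add: nz_def n\<eta>_def ne_def)
      have gen: "\<gamma> * n\<eta> - \<kappa> * \<phi> (y a \<omega>) \<le> ?G r \<omega> - f * (l1 * \<bar>y a \<omega>\<bar> + l2 * n\<eta>)"
        using elim(1) unfolding r_def[symmetric] \<omega>_def[symmetric] n\<eta>_def f_def by blast
      have 1: "\<gamma> * nz \<le> \<gamma> * n\<eta> + \<gamma> * ne" using mult_left_mono[OF tri \<gamma>_nonneg] by (simp add: distrib_left)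
      have 2: "f * (l2 * nz) \<le> f * (l2 * n\<eta>) + f * (l2 * ne)"
        using mult_left_mono[OF mult_left_mono[OF tri l_nonneg(2)] f] by (simp add: distrib_left)
      have "\<bar>yb r \<omega>\<bar> \<le> \<bar>y a \<omega>\<bar> + u" unfolding u_def by linarith
      from mult_left_mono[OF mult_left_mono[OF this l_nonneg(1)] f]
      have 3: "f * (l1 * \<bar>yb r \<omega>\<bar>) \<le> f * (l1 * \<bar>y a \<omega>\<bar>) + f * (l1 * u)" by (simp add: distrib_left)
      have "\<bar>\<gamma> + l2 * f\<bar> * \<bar>ne\<bar> \<le> \<alpha> * (\<gamma> + l2 * f)\<^sup>2 + ne\<^sup>2 / (4 * \<alpha>)" by (rule young_le[OF \<alpha>])
      then have 4: "\<gamma> * ne + f * (l2 * ne) \<le> \<alpha> * (\<gamma> + l2 * f)\<^sup>2 + ne\<^sup>2 / (4 * \<alpha>)"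
        using ne f l_nonneg \<gamma>_nonneg by (simp add: algebra_simps)
      have "\<bar>l1 * f\<bar> * \<bar>u\<bar> \<le> \<alpha> * (l1 * f)\<^sup>2 + u\<^sup>2 / (4 * \<alpha>)" by (rule young_le[OF \<alpha>])
      then have 5: "f * (l1 * u) \<le> \<alpha> * (l1 * f)\<^sup>2 + u\<^sup>2 / (4 * \<alpha>)"
        using f l_nonneg by (simp add: u_def abs_mult mult_ac)
      have e: "?e r \<omega> = ne\<^sup>2" unfolding ne_def using energy_nonneg[OF r(1) \<omega>] \<eta>[OF \<omega> r(2,3)] by simp
      have dd: "?d r \<omega> = u\<^sup>2" by (simp add: u_def)
      have h: "f * h r \<omega> = f * (l1 * \<bar>yb r \<omega>\<bar>) + f * (l2 * nz)" by (simp add: h_def nz_def distrib_left)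
      have W: "\<alpha> * W a \<omega> = \<alpha> * (\<gamma> + l2 * f)\<^sup>2 + \<alpha> * (l1 * f)\<^sup>2" by (simp add: W_def f_def distrib_left)
      have "\<gamma> * nz - (\<kappa> * \<phi> (y a \<omega>) + \<alpha> * W a \<omega>) - 1 / (4 * \<alpha>) * (?e r \<omega> + ?d r \<omega>) \<le> ?G r \<omega> - f * h r \<omega>"
        using gen 1 2 3 4 5 unfolding e dd h W by (simp add: add_divide_distrib distrib_left)
      then show "\<gamma> * enorm (fst p) (snd p) (z (fst p) (snd p)) - ?s (snd p) - 1 / (4 * \<alpha>) * (?e (fst p) (snd p) + ?d (fst p) (snd p))
        \<le> ?G (fst p) (snd p) - \<phi>' (y a (snd p)) * h (fst p) (snd p)"
        unfolding nz_def f_def r_def \<omega>_def .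
      qed
    qed
  qed
  then have "\<gamma> * stint a b (\<lambda>r \<omega>. enorm r \<omega> (z r \<omega>)) - (b - a) * (\<kappa> * mean a + \<alpha> * expectation (W a))
      - 1 / (4 * \<alpha>) * (stint a b ?e + stint a b ?d)
      \<le> stint a b ?G - stint a b (\<lambda>r \<omega>. \<phi>' (y a \<omega>) * h r \<omega>)"
    unfolding stint_diff[OF G_Q_integrable drift_term(1)[OF ab]] stint_diff[OF s12 s3] stint_diff[OF s1 s2]
      stint_static[OF s_int ab] stint_cmult stint_add[OF e_Q_integrable d(1)] mean_def
    using \<phi>_y_integrable[OF a] W_integrable[OF a] by simp
  moreover have "1 / (4 * \<alpha>) * stint a b ?d \<le> 1 / (4 * \<alpha>) * (24 * \<mu> a b * (b - a))"
    using \<alpha> d(2) by (intro mult_left_mono) auto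
  moreover have "1 / (4 * \<alpha>) * (24 * \<mu> a b * (b - a)) = 6 / \<alpha> * (b - a) * \<mu> a b" by simp
  moreover have "1 / (4 * \<alpha>) * (stint a b ?e + stint a b ?d) = stint a b ?e / (4 * \<alpha>) + 1 / (4 * \<alpha>) * stint a b ?d"
    by (simp add: add_divide_distrib)
  moreover have "(b - a) * (\<kappa> * mean a + \<alpha> * expectation (W a)) = \<kappa> * (b - a) * mean a + \<alpha> * (b - a) * expectation (W a)"
    by (simp add: algebra_simps)
  ultimately show ?thesis by linarith
qed

text \<open>Factors of the energy of \<open>z - \<zeta>\<close> and of \<open>(b - a) \<mu> a b\<close> in the one-step inequality. Both blow up as
  \<open>\<alpha>\<close> tends to zero, and \<open>C3\<close> grows with the bound \<open>B\<close> of \<open>\<zeta>\<close>, which fixes the order of the limits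
  below.\<close>

definition C2 :: "real \<Rightarrow> real" where
  "C2 \<alpha> = 12 * Lc * (1 + 1 / (4 * \<alpha>)) + 1 / (4 * \<alpha>)"

definition C3 :: "real \<Rightarrow> real \<Rightarrow> real" where
  "C3 \<alpha> B = (c * B)\<^sup>2 * Lc * (8 + 8 * \<alpha> + 3 * (1 + 1 / (4 * \<alpha>))) + 3 * Lc * (1 + 1 / (4 * \<alpha>)) + 6 / \<alpha>"

text \<open>Expand \<open>\<phi> (y b)\<close> around \<open>y a\<close>. The increment of \<open>y\<close> is at least \<open>\<eta> \<bullet> (X b - X a)\<close> plus a small
  rest; the first part is a jump that need not be small and is evaluated by the compensator, the
  rest enters through its mean square. The first-order term is a martingale increment minus the
  drift.\<close>

lemma one_step:
  assumes el: "elementary_pair \<zeta> J" and con: "constant_integrand_on a b B \<zeta> J"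
    and ab: "0 \<le> a" "a \<le> b" "b \<le> T" and D: "b - a \<le> 1" and \<alpha>: "0 < \<alpha>"
  shows "(1 - \<kappa> * (b - a)) * mean a + \<gamma> * stint a b (\<lambda>r \<omega>. enorm r \<omega> (z r \<omega>))
    \<le> mean b + (\<alpha> * (b - a) * expectation (W a) + Lc * \<alpha> * stint a b (\<lambda>r \<omega>. energy r \<omega> (\<zeta> r \<omega>))
      + C2 \<alpha> * stint a b (\<lambda>r \<omega>. energy r \<omega> (z r \<omega> - \<zeta> r \<omega>)) + C3 \<alpha> B * (b - a) * \<mu> a b)"
proof -
  have a: "a \<in> {0..T}" and b: "b \<in> {0..T}" using ab by auto
  obtain \<eta> where \<eta>: "\<eta> \<in> borel_measurable (F a)" "\<And>\<omega>. \<omega> \<in> space P \<Longrightarrow> norm (\<eta> \<omega>) \<le> B"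
    "\<And>\<omega>. \<omega> \<in> space P \<Longrightarrow> J b \<omega> - J a \<omega> = \<eta> \<omega> \<bullet> (M b \<omega> - M a \<omega>)"
    "\<And>r \<omega>. \<omega> \<in> space P \<Longrightarrow> a < r \<Longrightarrow> r \<le> b \<Longrightarrow> \<zeta> r \<omega> = \<eta> \<omega>"
    using con unfolding constant_integrand_on_def by blast
  define u where "u \<omega> = \<eta> \<omega> \<bullet> (X b \<omega> - X a \<omega>)" for \<omega>
  define k where "k = c * B * (b - a)"
  define \<beta> where "\<beta> = 1 + 1 / (4 * \<alpha>)"
  define de where "de \<omega> = (I b \<omega> - J b \<omega>) - (I a \<omega> - J a \<omega>)" for \<omega>
  define Se where "Se = stint a b (\<lambda>r \<omega>. energy r \<omega> (z r \<omega> - \<zeta> r \<omega>))"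
  define S\<zeta> where "S\<zeta> = stint a b (\<lambda>r \<omega>. energy r \<omega> (\<zeta> r \<omega>))"
  define Sh where "Sh = stint a b (\<lambda>r \<omega>. (h r \<omega>)\<^sup>2)"
  define Sd where "Sd = stint a b (\<lambda>r \<omega>. \<phi>' (y a \<omega>) * h r \<omega>)"
  define SG where "SG = stint a b (\<lambda>r \<omega>. \<Sum>j\<in>UNIV. rate r \<omega> j * rem (y a \<omega>) (jump (\<eta> \<omega>) r \<omega> j))"
  have \<beta>: "1 \<le> \<beta>" using \<alpha> by (simp add: \<beta>_def)
  define rs where "rs \<omega> = 3 * (de \<omega>)\<^sup>2 + 3 * (H a b \<omega>)\<^sup>2 + 3 * k\<^sup>2" for \<omega>
  have rest: "((I b \<omega> - I a \<omega>) - H a b \<omega> - u \<omega>)\<^sup>2 \<le> 3 * (de \<omega>)\<^sup>2 + 3 * (H a b \<omega>)\<^sup>2 + 3 * k\<^sup>2"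
    if \<omega>: "\<omega> \<in> space P" for \<omega>
  proof -
    define v where "v = \<eta> \<omega> \<bullet> (M b \<omega> - M a \<omega>) - u \<omega>"
    have "\<bar>v\<bar> \<le> k" unfolding v_def u_def k_def by (rule martingale_position_diff[OF ab \<omega> \<eta>(2)[OF \<omega>]])
    from power_mono[OF this, of 2] have v: "v\<^sup>2 \<le> k\<^sup>2" by simp
    have eq: "(I b \<omega> - I a \<omega>) - H a b \<omega> - u \<omega> = de \<omega> - H a b \<omega> + v"
      unfolding v_def \<eta>(3)[OF \<omega>, symmetric] de_def by simp
    show ?thesis unfolding eq using square_three_le[of "de \<omega>" "H a b \<omega>" v] v by linarith
  qed
  have path: "AE \<omega> in P. \<phi> (y a \<omega>) + (\<phi>' (y a \<omega>) * (I b \<omega> - I a \<omega>) - \<phi>' (y a \<omega>) * H a b \<omega>) + rem (y a \<omega>) (u \<omega>)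
      - Lc * \<alpha> * (u \<omega>)\<^sup>2 - Lc * \<beta> * rs \<omega> \<le> \<phi> (y b \<omega>)"
    using drift AE_space
  proof eventually_elim
    case (elim \<omega>)
    let ?R = "(I b \<omega> - I a \<omega>) - H a b \<omega> - u \<omega>"
    have "y a \<omega> - H a b \<omega> + (I b \<omega> - I a \<omega>) \<le> y b \<omega>"
      using elim(1) ab unfolding H_def h_def by blast
    then have "\<phi> (y a \<omega> + (u \<omega> + ?R)) \<le> \<phi> (y b \<omega>)" by (intro monoD[OF \<phi>_mono]) simp
    moreover have "\<phi> (y a \<omega>) + \<phi>' (y a \<omega>) * (u \<omega> + ?R) + rem (y a \<omega>) (u \<omega>) - Lc * \<alpha> * (u \<omega>)\<^sup>2 - Lc * \<beta> * ?R\<^sup>2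
        \<le> \<phi> (y a \<omega> + (u \<omega> + ?R))"
      unfolding \<beta>_def by (rule taylor_two_steps[OF \<alpha>])
    moreover have "Lc * \<beta> * ?R\<^sup>2 \<le> Lc * \<beta> * rs \<omega>"
      using rest[OF elim(2)] Lc_nonneg \<beta> unfolding rs_def by (intro mult_left_mono) auto
    moreover have "\<phi>' (y a \<omega>) * (u \<omega> + ?R) = \<phi>' (y a \<omega>) * (I b \<omega> - I a \<omega>) - \<phi>' (y a \<omega>) * H a b \<omega>"
      by (simp add: algebra_simps)
    ultimately show ?case by linarith
  qed
  have rem_meas: "(\<lambda>\<omega>. rem (y a \<omega>) (\<eta> \<omega> \<bullet> v)) \<in> borel_measurable (F a)" for v
  proof -
    have \<eta>v: "(\<lambda>\<omega>. \<eta> \<omega> \<bullet> v) \<in> borel_measurable (F a)" by (intro borel_measurable_inner \<eta>(1) borel_measurable_const)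
    show ?thesis
      unfolding rem_def
      by (intro borel_measurable_diff borel_measurable_times \<eta>v \<phi>'_y(1)[OF a] measurable_compose[OF y_adapted[OF a] \<phi>_borel]
          measurable_compose[OF borel_measurable_add[OF y_adapted[OF a] \<eta>v] \<phi>_borel])
  qed
  have rem_le: "\<bar>rem v d\<bar> \<le> Lc * (2 * B)\<^sup>2" if "\<bar>d\<bar> \<le> 2 * B" for v d
  proof -
    have "d\<^sup>2 \<le> (2 * B)\<^sup>2" using power_mono[OF that abs_ge_zero, of 2] by simp
    then show ?thesis by (rule order_trans[OF rem_bound mult_left_mono[OF _ Lc_nonneg]])
  qed
  have rem_0: "rem v 0 = 0" for v by (simp add: rem_def)
  note comp = one_step_compensator[OF ab, where g = "\<lambda>\<omega>. rem (y a \<omega>)" and \<eta> = \<eta>, OF rem_meas \<eta>(2) rem_le rem_0]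
  have i_rem: "integrable P (\<lambda>\<omega>. rem (y a \<omega>) (u \<omega>))" unfolding u_def by (rule comp(3))
  have i_u: "integrable P (\<lambda>\<omega>. (u \<omega>)\<^sup>2)" unfolding u_def by (rule position_square(2)[OF ab \<eta>(1,2)])
  have e_process: "integral_process (\<lambda>r \<omega>. z r \<omega> - \<zeta> r \<omega>) (\<lambda>t \<omega>. I t \<omega> - J t \<omega>)"
    by (rule integral_process_diff[OF I elementary_integral_process[OF el]])
  have sq_de: "sq_int de"
    unfolding de_def by (rule sq_int_diff[OF integral_process_sq_int[OF e_process b] integral_process_sq_int[OF e_process a]])
  note sq_H = H_sq(1)[OF ab]
  have sq_dI: "sq_int (\<lambda>\<omega>. I b \<omega> - I a \<omega>)" by (rule sq_int_diff[OF I_sq[OF b] I_sq[OF a]])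
  have i_dI: "integrable P (\<lambda>\<omega>. \<phi>' (y a \<omega>) * (I b \<omega> - I a \<omega>))" by (rule sq_int_mult[OF \<phi>'_y(2)[OF a] sq_dI])
  have i_H: "integrable P (\<lambda>\<omega>. \<phi>' (y a \<omega>) * H a b \<omega>)" by (rule sq_int_mult[OF \<phi>'_y(2)[OF a] sq_H])
  have i_rest: "integrable P rs" unfolding rs_def using sq_de sq_H by simp
  have E_rest: "expectation rs
      = 3 * expectation (\<lambda>\<omega>. (de \<omega>)\<^sup>2) + 3 * expectation (\<lambda>\<omega>. (H a b \<omega>)\<^sup>2) + 3 * k\<^sup>2"
    unfolding rs_def using sq_de sq_H by (simp add: prob_space)
  note i_\<phi> = \<phi>_y_integrable[OF a]
  have "expectation (\<lambda>\<omega>. \<phi> (y a \<omega>) + (\<phi>' (y a \<omega>) * (I b \<omega> - I a \<omega>) - \<phi>' (y a \<omega>) * H a b \<omega>) + rem (y a \<omega>) (u \<omega>)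
      - Lc * \<alpha> * (u \<omega>)\<^sup>2 - Lc * \<beta> * rs \<omega>) \<le> mean b"
    unfolding mean_def
    using i_\<phi> i_dI i_H i_rem i_u i_rest
    by (intro integral_mono_AE[OF _ \<phi>_y_integrable[OF b] path] Bochner_Integration.integrable_diff
        Bochner_Integration.integrable_add integrable_mult_right)
  also have "expectation (\<lambda>\<omega>. \<phi> (y a \<omega>) + (\<phi>' (y a \<omega>) * (I b \<omega> - I a \<omega>) - \<phi>' (y a \<omega>) * H a b \<omega>) + rem (y a \<omega>) (u \<omega>)
      - Lc * \<alpha> * (u \<omega>)\<^sup>2 - Lc * \<beta> * rs \<omega>)
    = mean a + (expectation (\<lambda>\<omega>. \<phi>' (y a \<omega>) * (I b \<omega> - I a \<omega>)) - expectation (\<lambda>\<omega>. \<phi>' (y a \<omega>) * H a b \<omega>))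
      + expectation (\<lambda>\<omega>. rem (y a \<omega>) (u \<omega>)) - Lc * \<alpha> * expectation (\<lambda>\<omega>. (u \<omega>)\<^sup>2)
      - Lc * \<beta> * expectation rs"
    unfolding mean_def using i_\<phi> i_dI i_H i_rem i_u i_rest
    by (simp only: Bochner_Integration.integral_add Bochner_Integration.integral_diff Bochner_Integration.integrable_add
        Bochner_Integration.integrable_diff integrable_mult_right integral_mult_right_zero)
  finally have main: "mean a + (0 - Sd) + expectation (\<lambda>\<omega>. rem (y a \<omega>) (u \<omega>)) - Lc * \<alpha> * expectation (\<lambda>\<omega>. (u \<omega>)\<^sup>2)
      - Lc * \<beta> * (3 * expectation (\<lambda>\<omega>. (de \<omega>)\<^sup>2) + 3 * expectation (\<lambda>\<omega>. (H a b \<omega>)\<^sup>2) + 3 * k\<^sup>2) \<le> mean b"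
    unfolding E_rest integral_process_orthogonal[OF I ab \<phi>'_y[OF a]] drift_term(2)[OF ab] Sd_def .
  have b1: "SG - 2 * c\<^sup>2 * (Lc * (2 * B)\<^sup>2) * (b - a)\<^sup>2 \<le> expectation (\<lambda>\<omega>. rem (y a \<omega>) (u \<omega>))"
    using comp(1) unfolding SG_def u_def by linarith
  have "expectation (\<lambda>\<omega>. (u \<omega>)\<^sup>2) \<le> stint a b (\<lambda>r \<omega>. energy r \<omega> (\<eta> \<omega>)) + 8 * k\<^sup>2"
    unfolding u_def k_def by (rule position_square(1)[OF ab \<eta>(1,2)])
  also have "stint a b (\<lambda>r \<omega>. energy r \<omega> (\<eta> \<omega>)) = S\<zeta>"
    unfolding stint_def S\<zeta>_def by (intro Bochner_Integration.integral_cong refl) (auto simp: space_Q indicator_def \<eta>(4))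
  finally have b2: "Lc * \<alpha> * expectation (\<lambda>\<omega>. (u \<omega>)\<^sup>2) \<le> Lc * \<alpha> * (S\<zeta> + 8 * k\<^sup>2)"
    using Lc_nonneg \<alpha> by (intro mult_left_mono) auto
  have "expectation (\<lambda>\<omega>. (de \<omega>)\<^sup>2) \<le> 4 * Se"
    unfolding de_def Se_def by (rule integral_process_square[OF e_process ab])
  moreover have "expectation (\<lambda>\<omega>. (H a b \<omega>)\<^sup>2) \<le> (b - a) * Sh" unfolding Sh_def by (rule H_sq(2)[OF ab])
  ultimately have b3: "Lc * \<beta> * (3 * expectation (\<lambda>\<omega>. (de \<omega>)\<^sup>2) + 3 * expectation (\<lambda>\<omega>. (H a b \<omega>)\<^sup>2) + 3 * k\<^sup>2)
      \<le> Lc * \<beta> * (12 * Se + 3 * ((b - a) * Sh) + 3 * k\<^sup>2)"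
    using Lc_nonneg \<beta> by (intro mult_left_mono) auto
  have b4: "\<gamma> * stint a b (\<lambda>r \<omega>. enorm r \<omega> (z r \<omega>)) - \<kappa> * (b - a) * mean a - \<alpha> * (b - a) * expectation (W a)
      - Se / (4 * \<alpha>) - 6 / \<alpha> * (b - a) * \<mu> a b \<le> SG - Sd"
    unfolding Se_def SG_def Sd_def
  proof (rule generator_term[OF ab D \<alpha>])
    show "Q_integrable (\<lambda>r \<omega>. energy r \<omega> (z r \<omega> - \<zeta> r \<omega>))" using e_process unfolding integral_process_def by blast
    show "Q_integrable (\<lambda>r \<omega>. \<Sum>j\<in>UNIV. rate r \<omega> j * rem (y a \<omega>) (jump (\<eta> \<omega>) r \<omega> j))" by (rule comp(2))
  qed (rule \<eta>(4))
  have D2: "(b - a)\<^sup>2 \<le> (b - a) * \<mu> a b"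
    unfolding power2_eq_square using ab \<mu>_parts(1)[OF ab] by (intro mult_left_mono) auto
  have DS: "(b - a) * Sh \<le> (b - a) * \<mu> a b"
    unfolding Sh_def using ab \<mu>_parts(2)[OF ab] by (intro mult_left_mono) auto
  have kk: "k\<^sup>2 = (c * B)\<^sup>2 * (b - a)\<^sup>2" by (simp add: k_def power_mult_distrib)
  define m where "m = (b - a) * \<mu> a b"
  have k2: "k\<^sup>2 \<le> (c * B)\<^sup>2 * m" unfolding kk m_def using D2 by (intro mult_left_mono) auto
  have c1: "2 * c\<^sup>2 * (Lc * (2 * B)\<^sup>2) * (b - a)\<^sup>2 \<le> (c * B)\<^sup>2 * Lc * 8 * m"
  proof -
    have "2 * c\<^sup>2 * (Lc * (2 * B)\<^sup>2) * (b - a)\<^sup>2 = Lc * 8 * k\<^sup>2" by (simp add: kk power_mult_distrib)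
    also have "\<dots> \<le> Lc * 8 * ((c * B)\<^sup>2 * m)" using k2 Lc_nonneg by (intro mult_left_mono) auto
    finally show ?thesis by (simp add: mult_ac)
  qed
  have c2: "Lc * \<alpha> * (8 * k\<^sup>2) \<le> (c * B)\<^sup>2 * Lc * (8 * \<alpha>) * m"
  proof -
    have "Lc * \<alpha> * (8 * k\<^sup>2) \<le> Lc * \<alpha> * (8 * ((c * B)\<^sup>2 * m))"
      using k2 Lc_nonneg \<alpha> by (intro mult_left_mono) auto
    then show ?thesis by (simp add: mult_ac)
  qed
  have c3: "Lc * \<beta> * (3 * ((b - a) * Sh)) \<le> 3 * Lc * \<beta> * m"
  proof -
    have "3 * ((b - a) * Sh) \<le> 3 * m" unfolding m_def using DS by linarith
    then have "Lc * \<beta> * (3 * ((b - a) * Sh)) \<le> Lc * \<beta> * (3 * m)"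
      by (rule mult_left_mono) (use Lc_nonneg \<beta> in simp)
    then show ?thesis by (simp add: mult_ac)
  qed
  have c4: "Lc * \<beta> * (3 * k\<^sup>2) \<le> (c * B)\<^sup>2 * Lc * (3 * \<beta>) * m"
  proof -
    have "Lc * \<beta> * (3 * k\<^sup>2) \<le> Lc * \<beta> * (3 * ((c * B)\<^sup>2 * m))"
      using k2 Lc_nonneg \<beta> by (intro mult_left_mono) auto
    then show ?thesis by (simp add: mult_ac)
  qed
  have e1: "C3 \<alpha> B * (b - a) * \<mu> a b = (c * B)\<^sup>2 * Lc * 8 * m + (c * B)\<^sup>2 * Lc * (8 * \<alpha>) * m
      + (c * B)\<^sup>2 * Lc * (3 * \<beta>) * m + 3 * Lc * \<beta> * m + 6 / \<alpha> * (b - a) * \<mu> a b"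
    unfolding C3_def m_def \<beta>_def[symmetric] by (simp only: distrib_left distrib_right mult.assoc)
  have e2: "C2 \<alpha> * Se = Lc * \<beta> * (12 * Se) + Se / (4 * \<alpha>)"
    unfolding C2_def \<beta>_def[symmetric] by (simp add: distrib_right)
  have e3: "Lc * \<beta> * (12 * Se + 3 * ((b - a) * Sh) + 3 * k\<^sup>2)
      = Lc * \<beta> * (12 * Se) + Lc * \<beta> * (3 * ((b - a) * Sh)) + Lc * \<beta> * (3 * k\<^sup>2)" by (simp only: distrib_left)
  have e4: "Lc * \<alpha> * (S\<zeta> + 8 * k\<^sup>2) = Lc * \<alpha> * S\<zeta> + Lc * \<alpha> * (8 * k\<^sup>2)" by (simp only: distrib_left)
  have e5: "(1 - \<kappa> * (b - a)) * mean a = mean a - \<kappa> * (b - a) * mean a" by (simp add: algebra_simps)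
  show ?thesis
    unfolding Se_def[symmetric] S\<zeta>_def[symmetric] e5 e1 e2
    using main b1 b2 b3 b4 c1 c2 c3 c4 unfolding e3 e4 by linarith
qed

lemma W_bounded: "\<exists>C\<ge>0. \<forall>t\<in>{0..T}. expectation (W t) \<le> C"
  and mean_bounded: "\<exists>C\<ge>0. \<forall>t\<in>{0..T}. \<bar>mean t\<bar> \<le> C"
proof -
  obtain Cy where Cy: "\<And>t. t \<in> {0..T} \<Longrightarrow> expectation (\<lambda>\<omega>. (y t \<omega>)\<^sup>2) \<le> Cy" using y_square_bounded by blast
  have "0 \<in> {0..T}" using T_pos by auto
  have Cy0: "0 \<le> Cy" by (rule order_trans[OF _ Cy[OF \<open>0 \<in> {0..T}\<close>]]) simp
  let ?p = "2 * l2\<^sup>2 + l1\<^sup>2"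
  let ?A = "2 * \<gamma>\<^sup>2 + ?p * (2 * (\<phi>' 0)\<^sup>2)" and ?B = "?p * (2 * Lc\<^sup>2)"
  have p: "0 \<le> ?p" by simp
  have Wpt: "W t \<omega> \<le> ?A + ?B * (y t \<omega>)\<^sup>2" for t \<omega>
  proof -
    let ?f = "\<phi>' (y t \<omega>)"
    have "?f\<^sup>2 \<le> (\<phi>' 0 + Lc * \<bar>y t \<omega>\<bar>)\<^sup>2"
      using power_mono[OF \<phi>'_growth[of "y t \<omega>"] abs_ge_zero, of 2] by simp
    also have "\<dots> \<le> 2 * (\<phi>' 0)\<^sup>2 + 2 * (Lc * \<bar>y t \<omega>\<bar>)\<^sup>2" by (rule square_sum_le)
    also have "(Lc * \<bar>y t \<omega>\<bar>)\<^sup>2 = Lc\<^sup>2 * (y t \<omega>)\<^sup>2" by (simp add: power_mult_distrib)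
    finally have f: "?p * ?f\<^sup>2 \<le> ?p * (2 * (\<phi>' 0)\<^sup>2 + 2 * (Lc\<^sup>2 * (y t \<omega>)\<^sup>2))" by (rule mult_left_mono[OF _ p])
    have "W t \<omega> \<le> (2 * \<gamma>\<^sup>2 + 2 * (l2 * ?f)\<^sup>2) + (l1 * ?f)\<^sup>2"
      unfolding W_def by (intro add_right_mono square_sum_le)
    also have "\<dots> = 2 * \<gamma>\<^sup>2 + ?p * ?f\<^sup>2" by (simp add: power_mult_distrib algebra_simps)
    finally show ?thesis using f by (simp add: algebra_simps)
  qed
  have "expectation (W t) \<le> ?A + ?B * Cy" if t: "t \<in> {0..T}" for t
  proof -
    have "expectation (W t) \<le> expectation (\<lambda>\<omega>. ?A + ?B * (y t \<omega>)\<^sup>2)"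
      using y_sq[OF t] by (intro integral_mono[OF W_integrable[OF t]] Wpt) simp
    also have "\<dots> = ?A + ?B * expectation (\<lambda>\<omega>. (y t \<omega>)\<^sup>2)"
      using y_sq[OF t] by (simp add: prob_space)
    also have "\<dots> \<le> ?A + ?B * Cy" using Cy[OF t] by (intro add_left_mono mult_left_mono) auto
    finally show ?thesis .
  qed
  moreover have "0 \<le> ?A + ?B * Cy" using Cy0 by simp
  ultimately show "\<exists>C\<ge>0. \<forall>t\<in>{0..T}. expectation (W t) \<le> C" by blast
  let ?A' = "\<bar>\<phi> 0\<bar> + \<phi>' 0" and ?B' = "\<phi>' 0 + Lc"
  have "\<bar>mean t\<bar> \<le> ?A' + ?B' * Cy" if t: "t \<in> {0..T}" for t
  proof -
    have "\<bar>mean t\<bar> \<le> expectation (\<lambda>\<omega>. \<bar>\<phi> (y t \<omega>)\<bar>)"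
      unfolding mean_def by (rule integral_abs_bound)
    also have "\<dots> \<le> expectation (\<lambda>\<omega>. ?A' + ?B' * (y t \<omega>)\<^sup>2)"
      using y_sq[OF t] \<phi>_y_integrable[OF t] by (intro integral_mono \<phi>_growth) auto
    also have "\<dots> = ?A' + ?B' * expectation (\<lambda>\<omega>. (y t \<omega>)\<^sup>2)"
      using y_sq[OF t] by (simp add: prob_space)
    also have "\<dots> \<le> ?A' + ?B' * Cy"
      using Cy[OF t] \<phi>'_nonneg[of 0] Lc_nonneg by (intro add_left_mono mult_left_mono) auto
    finally show ?thesis .
  qed
  moreover have "0 \<le> ?A' + ?B' * Cy" using Cy0 \<phi>'_nonneg[of 0] Lc_nonneg by simp
  ultimately show "\<exists>C\<ge>0. \<forall>t\<in>{0..T}. \<bar>mean t\<bar> \<le> C" by blast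
qed

lemma exp_times_linear:
  fixes x :: real
  assumes "\<bar>x\<bar> \<le> 1"
  shows "\<bar>exp x * (1 - x) - 1\<bar> \<le> x\<^sup>2"
proof -
  have "exp x * (1 - x) \<le> exp x * exp (- x)" using exp_ge_add_one_self[of "-x"] by (intro mult_left_mono) auto
  then have "exp x * (1 - x) \<le> 1" by (simp add: exp_minus)
  moreover have "(1 + x) * (1 - x) \<le> exp x * (1 - x)"
    using exp_ge_add_one_self[of x] assms by (intro mult_right_mono) auto
  then have "1 - x\<^sup>2 \<le> exp x * (1 - x)" by (simp add: power2_eq_square algebra_simps)
  ultimately show ?thesis by simp
qed

text \<open>Multiplied by \<open>exp (\<kappa> b)\<close>, the one-step inequality becomes one between additive functions of
  intervals and can be chained. The second order terms vanish as the intervals shrink, then the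
  approximation of \<open>z\<close> by elementary integrands removes the energy of the difference, and finally
  \<open>\<alpha>\<close> tends to zero.\<close>

theorem weighted_mean_increases:
  assumes st: "0 \<le> s" "s \<le> t" "t \<le> T"
  shows "exp (\<kappa> * s) * mean s + exp (- \<bar>\<kappa>\<bar> * T) * \<gamma> * stint s t (\<lambda>r \<omega>. enorm r \<omega> (z r \<omega>)) \<le> exp (\<kappa> * t) * mean t"
proof -
  obtain CW where CW: "0 \<le> CW" "\<And>t. t \<in> {0..T} \<Longrightarrow> expectation (W t) \<le> CW" using W_bounded by blast
  obtain CF where CF: "0 \<le> CF" "\<And>t. t \<in> {0..T} \<Longrightarrow> \<bar>mean t\<bar> \<le> CF" using mean_bounded by blast
  define G where "G = exp (\<bar>\<kappa>\<bar> * T)"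
  have G: "1 \<le> G" using T_pos by (simp add: G_def)
  have eG: "exp (\<kappa> * r) \<le> G" "exp (- \<bar>\<kappa>\<bar> * T) \<le> exp (\<kappa> * r)" if "r \<in> {0..T}" for r
  proof -
    have "\<bar>\<kappa> * r\<bar> \<le> \<bar>\<kappa>\<bar> * T" using that by (simp add: abs_mult mult_left_mono)
    then show "exp (\<kappa> * r) \<le> G" "exp (- \<bar>\<kappa>\<bar> * T) \<le> exp (\<kappa> * r)" unfolding G_def by auto
  qed
  let ?N = "\<lambda>a b. stint a b (\<lambda>r \<omega>. enorm r \<omega> (z r \<omega>))"
  let ?lhs = "exp (\<kappa> * s) * mean s + exp (- \<bar>\<kappa>\<bar> * T) * \<gamma> * ?N s t"
  obtain \<zeta> J where \<zeta>: "\<And>j::nat. elementary_pair (\<zeta> j) (J j)"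
    "(\<lambda>j. stint 0 T (\<lambda>r \<omega>. energy r \<omega> (\<zeta> j r \<omega> - z r \<omega>))) \<longlonglongrightarrow> 0"
    using I unfolding integral_process_def by blast
  have N_nonneg: "0 \<le> ?N a b" for a b
    using energy_nonneg by (intro stint_nonneg) auto
  have fixed: "?lhs \<le> exp (\<kappa> * t) * mean t + G * (\<alpha> * CW * (t - s) + Lc * \<alpha> * stint s t (\<lambda>r \<omega>. energy r \<omega> (\<zeta> j r \<omega>))
      + C2 \<alpha> * stint s t (\<lambda>r \<omega>. energy r \<omega> (z r \<omega> - \<zeta> j r \<omega>)))" if \<alpha>: "0 < \<alpha>" for \<alpha> j
  proof -
    let ?\<zeta> = "\<lambda>r \<omega>. energy r \<omega> (\<zeta> j r \<omega>)" and ?e = "\<lambda>r \<omega>. energy r \<omega> (z r \<omega> - \<zeta> j r \<omega>)"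
    have s\<zeta>: "Q_integrable ?\<zeta>" by (rule elementary_energy_Q_integrable[OF \<zeta>(1)])
    have \<zeta>Q: "(\<lambda>p. \<zeta> j (fst p) (snd p)) \<in> borel_measurable Q" using \<zeta>(1)[of j] unfolding elementary_pair_def by blast
    have se: "Q_integrable ?e" by (rule energy_Q_integrable_diff[OF zz_Q_integrable s\<zeta> z_Q \<zeta>Q])
    obtain S B where SB: "finite S"
      "\<And>a b. 0 \<le> a \<Longrightarrow> a \<le> b \<Longrightarrow> b \<le> T \<Longrightarrow> S \<inter> {a<..<b} = {} \<Longrightarrow> constant_integrand_on a b B (\<zeta> j) (J j)"
      using \<zeta>(1)[of j] unfolding elementary_pair_def by blast
    define C4 where "C4 = G * (\<kappa>\<^sup>2 * CF + C3 \<alpha> B)"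
    have C3: "0 \<le> C3 \<alpha> B" unfolding C3_def using Lc_nonneg \<alpha> by (intro add_nonneg_nonneg mult_nonneg_nonneg) auto
    have C4: "0 \<le> C4" unfolding C4_def using G CF(1) C3 by simp
    define err where "err a b = \<alpha> * CW * (b - a) + Lc * \<alpha> * stint a b ?\<zeta> + C2 \<alpha> * stint a b ?e" for a b
    have C2: "0 \<le> C2 \<alpha>" unfolding C2_def using Lc_nonneg \<alpha> by simp
    have err_nonneg: "0 \<le> err a b" if "a \<le> b" for a b
      unfolding err_def using that \<alpha> CW(1) Lc_nonneg C2 energy_nonneg
      by (intro add_nonneg_nonneg mult_nonneg_nonneg stint_nonneg) auto
    have summed: "?lhs \<le> exp (\<kappa> * t) * mean t + G * err s t + \<delta> * C4 * \<mu> s t"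
      if \<delta>: "0 < \<delta>" "\<delta> \<le> 1" "\<bar>\<kappa>\<bar> * \<delta> \<le> 1" for \<delta>
    proof (rule interval_chain[OF SB(1) \<delta>(1) st(2), where R = "\<lambda>a b. exp (\<kappa> * a) * mean a + exp (- \<bar>\<kappa>\<bar> * T) * \<gamma> * ?N a b
          \<le> exp (\<kappa> * b) * mean b + G * err a b + \<delta> * C4 * \<mu> a b"])
      fix a b assume o: "s \<le> a" "a \<le> b" "b \<le> t" "b - a \<le> \<delta>" "S \<inter> {a<..<b} = {}"
      then have ab: "0 \<le> a" "a \<le> b" "b \<le> T" using st by auto
      have a: "a \<in> {0..T}" and b: "b \<in> {0..T}" using ab by auto
      define D where "D = b - a"
      have D: "0 \<le> D" "D \<le> \<delta>" "D \<le> 1" using o \<delta> by (auto simp: D_def)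
      have \<mu>: "D \<le> \<mu> a b" "0 \<le> \<mu> a b" using \<mu>_parts[OF ab] by (auto simp: D_def)
      have "(1 - \<kappa> * D) * mean a + \<gamma> * ?N a b \<le> mean b + (\<alpha> * D * expectation (W a) + Lc * \<alpha> * stint a b ?\<zeta>
          + C2 \<alpha> * stint a b ?e + C3 \<alpha> B * D * \<mu> a b)"
        unfolding D_def using D(3) by (intro one_step[OF \<zeta>(1) SB(2)[OF ab o(5)] ab _ \<alpha>]) (simp add: D_def)
      also have "\<alpha> * D * expectation (W a) \<le> \<alpha> * D * CW"
        using CW(2)[OF a] D \<alpha> by (intro mult_left_mono) auto
      finally have "(1 - \<kappa> * D) * mean a + \<gamma> * ?N a b \<le> mean b + (err a b + C3 \<alpha> B * D * \<mu> a b)"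
        unfolding err_def D_def by (simp add: mult_ac)
      from mult_left_mono[OF this, of "exp (\<kappa> * b)"]
      have step: "exp (\<kappa> * b) * ((1 - \<kappa> * D) * mean a) + exp (\<kappa> * b) * (\<gamma> * ?N a b)
          \<le> exp (\<kappa> * b) * mean b + exp (\<kappa> * b) * (err a b + C3 \<alpha> B * D * \<mu> a b)"
        by (simp add: distrib_left)
      have E: "0 \<le> err a b + C3 \<alpha> B * D * \<mu> a b"
        using err_nonneg[OF ab(2)] C3 D \<mu> by (intro add_nonneg_nonneg mult_nonneg_nonneg) auto
      have 1: "exp (\<kappa> * b) * (err a b + C3 \<alpha> B * D * \<mu> a b) \<le> G * (err a b + C3 \<alpha> B * D * \<mu> a b)"
        by (rule mult_right_mono[OF eG(1)[OF b] E])
      have 2: "exp (- \<bar>\<kappa>\<bar> * T) * \<gamma> * ?N a b \<le> exp (\<kappa> * b) * (\<gamma> * ?N a b)"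
        unfolding mult.assoc using eG(2)[OF b] \<gamma>_nonneg N_nonneg by (intro mult_right_mono mult_nonneg_nonneg)
      \<comment> \<open>the exponential weight compensates the factor \<open>1 - \<kappa> D\<close> up to second order\<close>
      have 3: "exp (\<kappa> * a) * mean a - G * (\<kappa>\<^sup>2 * CF * (D * \<mu> a b)) \<le> exp (\<kappa> * b) * ((1 - \<kappa> * D) * mean a)"
      proof -
        have "exp (\<kappa> * b) = exp (\<kappa> * a) * exp (\<kappa> * D)" by (simp add: D_def exp_add[symmetric] algebra_simps)
        then have eq: "exp (\<kappa> * b) * ((1 - \<kappa> * D) * mean a) - exp (\<kappa> * a) * mean a
            = exp (\<kappa> * a) * ((exp (\<kappa> * D) * (1 - \<kappa> * D) - 1) * mean a)" by (simp add: algebra_simps)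
        have kD: "\<bar>\<kappa> * D\<bar> \<le> 1"
          using mult_left_mono[OF D(2), of "\<bar>\<kappa>\<bar>"] \<delta>(3) D(1) by (simp add: abs_mult)
        have "\<bar>exp (\<kappa> * a) * ((exp (\<kappa> * D) * (1 - \<kappa> * D) - 1) * mean a)\<bar> \<le> G * ((\<kappa> * D)\<^sup>2 * CF)"
          unfolding abs_mult using eG(1)[OF a] exp_times_linear[OF kD] CF(2)[OF a] G
          by (intro mult_mono) auto
        also have "\<dots> \<le> G * (\<kappa>\<^sup>2 * CF * (D * \<mu> a b))"
        proof -
          have "D * D \<le> D * \<mu> a b" using D \<mu> by (intro mult_left_mono)
          then have "\<kappa>\<^sup>2 * CF * (D * D) \<le> \<kappa>\<^sup>2 * CF * (D * \<mu> a b)"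
            by (rule mult_left_mono) (use CF(1) in simp)
          then show ?thesis using G by (intro mult_left_mono) (auto simp: power_mult_distrib power2_eq_square mult_ac)
        qed
        finally show ?thesis using eq by linarith
      qed
      have 4: "G * (\<kappa>\<^sup>2 * CF * (D * \<mu> a b)) + G * (C3 \<alpha> B * D * \<mu> a b) \<le> \<delta> * C4 * \<mu> a b"
      proof -
        have "G * (\<kappa>\<^sup>2 * CF * (D * \<mu> a b)) + G * (C3 \<alpha> B * D * \<mu> a b) = D * (C4 * \<mu> a b)"
          by (simp add: C4_def algebra_simps)
        also have "\<dots> \<le> \<delta> * (C4 * \<mu> a b)" using D C4 \<mu> by (intro mult_right_mono mult_nonneg_nonneg)
        finally show ?thesis by simp
      qed
      show "exp (\<kappa> * a) * mean a + exp (- \<bar>\<kappa>\<bar> * T) * \<gamma> * ?N a b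
          \<le> exp (\<kappa> * b) * mean b + G * err a b + \<delta> * C4 * \<mu> a b"
        using step 1 2 3 4 by (simp add: distrib_left)
    next
      fix a b d assume o: "s \<le> a" "a \<le> b" "b \<le> d" "d \<le> t"
        and 1: "exp (\<kappa> * a) * mean a + exp (- \<bar>\<kappa>\<bar> * T) * \<gamma> * ?N a b \<le> exp (\<kappa> * b) * mean b + G * err a b + \<delta> * C4 * \<mu> a b"
        and 2: "exp (\<kappa> * b) * mean b + exp (- \<bar>\<kappa>\<bar> * T) * \<gamma> * ?N b d \<le> exp (\<kappa> * d) * mean d + G * err b d + \<delta> * C4 * \<mu> b d"
      have "?N a d = ?N a b + ?N b d" by (rule stint_split[OF enorm_z_Q_integrable o(2,3)])
      moreover have "err a d = err a b + err b d"
        unfolding err_def stint_split[OF s\<zeta> o(2,3)] stint_split[OF se o(2,3)] by (simp add: algebra_simps)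
      moreover have "\<mu> a d = \<mu> a b + \<mu> b d" using o st by (intro \<mu>_split) auto
      ultimately show "exp (\<kappa> * a) * mean a + exp (- \<bar>\<kappa>\<bar> * T) * \<gamma> * ?N a d
          \<le> exp (\<kappa> * d) * mean d + G * err a d + \<delta> * C4 * \<mu> a d"
        using 1 2 by (simp only: distrib_left)
    qed
    have "?lhs \<le> exp (\<kappa> * t) * mean t + G * err s t"
    proof (rule LIMSEQ_le_const)
      have "(\<lambda>n. exp (\<kappa> * t) * mean t + G * err s t + inverse (real (Suc n)) * (C4 * \<mu> s t))
          \<longlonglongrightarrow> exp (\<kappa> * t) * mean t + G * err s t + 0 * (C4 * \<mu> s t)"
        by (rule tendsto_add[OF tendsto_const tendsto_mult[OF LIMSEQ_inverse_real_of_nat tendsto_const]])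
      then show "(\<lambda>n. exp (\<kappa> * t) * mean t + G * err s t + inverse (real (Suc n)) * (C4 * \<mu> s t))
          \<longlonglongrightarrow> exp (\<kappa> * t) * mean t + G * err s t" by simp
      obtain n0 :: nat where n0: "\<bar>\<kappa>\<bar> \<le> real n0" by (metis real_arch_simple)
      show "\<exists>N. \<forall>n\<ge>N. ?lhs \<le> exp (\<kappa> * t) * mean t + G * err s t + inverse (real (Suc n)) * (C4 * \<mu> s t)"
      proof (intro exI allI impI)
        fix n assume "n0 \<le> n"
        then have "\<bar>\<kappa>\<bar> \<le> real (Suc n)" using n0 by linarith
        then have "\<bar>\<kappa>\<bar> * inverse (real (Suc n)) \<le> 1" by (simp add: field_simps)
        moreover have "inverse (real (Suc n)) \<le> 1" by (simp add: field_simps)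
        ultimately show "?lhs \<le> exp (\<kappa> * t) * mean t + G * err s t + inverse (real (Suc n)) * (C4 * \<mu> s t)"
          using summed[of "inverse (real (Suc n))"] by (simp add: mult.assoc)
      qed
    qed
    then show ?thesis unfolding err_def .
  qed
  define Ez where "Ez = stint 0 T zz"
  have fixed2: "?lhs \<le> exp (\<kappa> * t) * mean t + \<alpha> * (G * (CW * (t - s) + Lc * (2 * Ez)))" if \<alpha>: "0 < \<alpha>" for \<alpha>
  proof (rule LIMSEQ_le_const)
    let ?d = "\<lambda>j. stint 0 T (\<lambda>r \<omega>. energy r \<omega> (\<zeta> j r \<omega> - z r \<omega>))"
    let ?R = "\<lambda>j. exp (\<kappa> * t) * mean t + G * (\<alpha> * CW * (t - s) + Lc * \<alpha> * (2 * Ez + 2 * ?d j) + C2 \<alpha> * ?d j)"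
    have "?R \<longlonglongrightarrow> exp (\<kappa> * t) * mean t + G * (\<alpha> * CW * (t - s) + Lc * \<alpha> * (2 * Ez + 2 * 0) + C2 \<alpha> * 0)"
      by (intro tendsto_add tendsto_mult tendsto_const \<zeta>(2))
    then show "?R \<longlonglongrightarrow> exp (\<kappa> * t) * mean t + \<alpha> * (G * (CW * (t - s) + Lc * (2 * Ez)))"
      by (simp add: algebra_simps)
    show "\<exists>N. \<forall>j\<ge>N. ?lhs \<le> ?R j"
    proof (intro exI allI impI)
      fix j :: nat
      have s\<zeta>: "Q_integrable (\<lambda>r \<omega>. energy r \<omega> (\<zeta> j r \<omega>))" by (rule elementary_energy_Q_integrable[OF \<zeta>(1)])
      have \<zeta>Q: "(\<lambda>p. \<zeta> j (fst p) (snd p)) \<in> borel_measurable Q" using \<zeta>(1)[of j] unfolding elementary_pair_def by blast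
      have se: "Q_integrable (\<lambda>r \<omega>. energy r \<omega> (\<zeta> j r \<omega> - z r \<omega>))" by (rule energy_Q_integrable_diff[OF s\<zeta> zz_Q_integrable \<zeta>Q z_Q])
      have nn: "0 \<le> energy r \<omega> C" if "r \<in> {0..T}" "\<omega> \<in> space P" for r \<omega> C
        using that energy_nonneg by auto
      have "stint s t (\<lambda>r \<omega>. energy r \<omega> (\<zeta> j r \<omega>)) \<le> stint 0 T (\<lambda>r \<omega>. energy r \<omega> (\<zeta> j r \<omega>))"
        by (rule stint_le_horizon[OF s\<zeta> nn st])
      also have "\<dots> \<le> stint 0 T (\<lambda>r \<omega>. 2 * zz r \<omega> + 2 * energy r \<omega> (\<zeta> j r \<omega> - z r \<omega>))"
      proof (rule stint_mono[OF s\<zeta>])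
        show "Q_integrable (\<lambda>r \<omega>. 2 * zz r \<omega> + 2 * energy r \<omega> (\<zeta> j r \<omega> - z r \<omega>))" using zz_Q_integrable se by simp
        fix r \<omega> assume r: "r \<in> {0..T}" "\<omega> \<in> space P"
        have "energy r \<omega> (z r \<omega> - (z r \<omega> - \<zeta> j r \<omega>)) \<le> 2 * zz r \<omega> + 2 * energy r \<omega> (z r \<omega> - \<zeta> j r \<omega>)"
          using r by (intro energy_diff_le) auto
        then show "energy r \<omega> (\<zeta> j r \<omega>) \<le> 2 * zz r \<omega> + 2 * energy r \<omega> (\<zeta> j r \<omega> - z r \<omega>)"
          by (simp add: energy_swap[of r \<omega> "\<zeta> j r \<omega>" "z r \<omega>"])
      qed
      also have "\<dots> = 2 * Ez + 2 * ?d j" using zz_Q_integrable se by (simp add: stint_add stint_cmult Ez_def)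
      finally have 1: "stint s t (\<lambda>r \<omega>. energy r \<omega> (\<zeta> j r \<omega>)) \<le> 2 * Ez + 2 * ?d j" .
      have "stint s t (\<lambda>r \<omega>. energy r \<omega> (z r \<omega> - \<zeta> j r \<omega>)) = stint s t (\<lambda>r \<omega>. energy r \<omega> (\<zeta> j r \<omega> - z r \<omega>))"
        by (simp add: energy_swap)
      also have "\<dots> \<le> ?d j" by (rule stint_le_horizon[OF se nn st])
      finally have 2: "stint s t (\<lambda>r \<omega>. energy r \<omega> (z r \<omega> - \<zeta> j r \<omega>)) \<le> ?d j" .
      have C2: "0 \<le> C2 \<alpha>" unfolding C2_def using Lc_nonneg \<alpha> by simp
      have "G * (\<alpha> * CW * (t - s) + Lc * \<alpha> * stint s t (\<lambda>r \<omega>. energy r \<omega> (\<zeta> j r \<omega>))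
          + C2 \<alpha> * stint s t (\<lambda>r \<omega>. energy r \<omega> (z r \<omega> - \<zeta> j r \<omega>)))
        \<le> G * (\<alpha> * CW * (t - s) + Lc * \<alpha> * (2 * Ez + 2 * ?d j) + C2 \<alpha> * ?d j)"
        using 1 2 C2 G Lc_nonneg \<alpha> by (intro mult_left_mono add_mono order_refl mult_nonneg_nonneg) auto
      then show "?lhs \<le> ?R j" using fixed[OF \<alpha>, of j] by linarith
    qed
  qed
  show ?thesis
  proof (rule LIMSEQ_le_const)
    let ?k = "G * (CW * (t - s) + Lc * (2 * Ez))"
    have "(\<lambda>n. exp (\<kappa> * t) * mean t + inverse (real (Suc n)) * ?k) \<longlonglongrightarrow> exp (\<kappa> * t) * mean t + 0 * ?k"
      by (rule tendsto_add[OF tendsto_const tendsto_mult[OF LIMSEQ_inverse_real_of_nat tendsto_const]])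
    then show "(\<lambda>n. exp (\<kappa> * t) * mean t + inverse (real (Suc n)) * ?k) \<longlonglongrightarrow> exp (\<kappa> * t) * mean t" by simp
    show "\<exists>N. \<forall>n\<ge>N. ?lhs \<le> exp (\<kappa> * t) * mean t + inverse (real (Suc n)) * ?k"
      using fixed2 by auto
  qed
qed

end

section \<open>Two test functions\<close>

subsection \<open>The smoothed square root\<close>

text \<open>The square root, continued below \<open>e\<close> by its tangent. It is concave and has a Lipschitz derivative.\<close>

definition root_below :: "real \<Rightarrow> real \<Rightarrow> real" where
  "root_below e w = sqrt (max w e) + (w - max w e) / (2 * sqrt (max w e))"

definition root_slope :: "real \<Rightarrow> real \<Rightarrow> real" where
  "root_slope e w = 1 / (2 * sqrt (max w e))"

text \<open>Concavity. For \<open>w \<ge> e\<close> it is the inequality between the geometric and the arithmetic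
  mean of \<open>w\<close> and \<open>n\<close>.\<close>

lemma root_below_tangent:
  assumes e: "0 < e" and n: "e \<le> n"
  shows "root_below e w \<le> sqrt n + (w - n) / (2 * sqrt n)"
proof -
  define m where "m = max w e"
  have m: "0 < m" "w \<le> m" using e by (auto simp: m_def)
  have sm: "0 < sqrt m" and sn: "0 < sqrt n" using m e n by auto
  have "2 * (sqrt m * sqrt n) \<le> (sqrt m)\<^sup>2 + (sqrt n)\<^sup>2"
    using sum_squares_bound[of "sqrt m" "sqrt n"] by (simp add: mult.assoc)
  then have "sqrt m * (2 * sqrt n) \<le> m + n" using m e n by (simp add: mult_ac)
  then have "sqrt m \<le> (m + n) / (2 * sqrt n)" using sn by (simp add: pos_le_divide_eq)
  also have "\<dots> = sqrt n + (m - n) / (2 * sqrt n)"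
  proof -
    have "sqrt n = n / sqrt n" using real_div_sqrt[of n] e n by simp
    then have "sqrt n = 2 * n / (2 * sqrt n)" by simp
    then have "sqrt n + (m - n) / (2 * sqrt n) = (2 * n + (m - n)) / (2 * sqrt n)" by (metis add_divide_distrib)
    then show ?thesis by (simp add: add.commute)
  qed
  finally have 1: "sqrt m \<le> sqrt n + (m - n) / (2 * sqrt n)" .
  have 2: "(w - m) / (2 * sqrt m) \<le> (w - m) / (2 * sqrt n)"
  proof (cases "e \<le> w")
    case True
    then show ?thesis by (simp add: m_def)
  next
    case False
    then have "m = e" by (simp add: m_def)
    then have "sqrt m \<le> sqrt n" using n by simp
    then show ?thesis using m(2) sm sn by (intro divide_left_mono_neg) auto
  qed
  have "(m - n) / (2 * sqrt n) + (w - m) / (2 * sqrt n) = (w - n) / (2 * sqrt n)"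
    by (simp add: add_divide_distrib[symmetric])
  with 1 2 show ?thesis unfolding root_below_def m_def[symmetric] by linarith
qed

lemma root_below_concave:
  assumes e: "0 < e"
  shows "root_below e w' \<le> root_below e w + root_slope e w * (w' - w)"
proof -
  let ?m = "max w e"
  have "root_below e w' \<le> sqrt ?m + (w' - ?m) / (2 * sqrt ?m)" by (rule root_below_tangent[OF e]) simp
  also have "(w' - ?m) / (2 * sqrt ?m) = (w - ?m) / (2 * sqrt ?m) + (w' - w) / (2 * sqrt ?m)"
    by (simp add: add_divide_distrib[symmetric])
  finally show ?thesis by (simp add: root_below_def root_slope_def)
qed

lemma root_slope_pos: "0 < e \<Longrightarrow> 0 < root_slope e w"
  by (simp add: root_slope_def less_max_iff_disj)

lemma root_below_mono: "0 < e \<Longrightarrow> w \<le> w' \<Longrightarrow> root_below e w \<le> root_below e w'"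
  using root_below_concave[of e w w'] mult_nonneg_nonpos[of "root_slope e w'" "w - w'"] root_slope_pos[of e w']
  by simp

lemma root_slope_lipschitz:
  assumes e: "0 < e"
  shows "\<bar>root_slope e w - root_slope e w'\<bar> \<le> 1 / (4 * (e * sqrt e)) * \<bar>w - w'\<bar>"
proof -
  define x y s where "x = sqrt (max w e)" and "y = sqrt (max w' e)" and "s = sqrt e"
  have s: "0 < s" and xs: "s \<le> x" and ys: "s \<le> y" using e by (auto simp: x_def y_def s_def)
  have x2: "x\<^sup>2 = max w e" and y2: "y\<^sup>2 = max w' e" using e by (auto simp: x_def y_def less_max_iff_disj)
  have s3: "e * sqrt e = s ^ 3" using e by (simp add: s_def power3_eq_cube)
  have pos: "0 < x" "0 < y" using s xs ys by auto
  have "s ^ 3 * 4 \<le> 2 * x * y * (x + y)"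
  proof -
    have "s * s * (s + s) \<le> x * y * (x + y)" using s xs ys by (intro mult_mono add_mono) auto
    then show ?thesis by (simp add: power3_eq_cube algebra_simps)
  qed
  then have frac: "1 / (2 * x * y * (x + y)) \<le> 1 / (4 * s ^ 3)" using s pos by (intro divide_left_mono) auto
  have "root_slope e w - root_slope e w' = (y - x) / (2 * x * y)"
    unfolding root_slope_def x_def[symmetric] y_def[symmetric] using pos by (simp add: field_simps)
  also have "\<dots> = ((y - x) * (x + y)) / ((2 * x * y) * (x + y))" using pos by simp
  also have "\<dots> = (y\<^sup>2 - x\<^sup>2) * (1 / (2 * x * y * (x + y)))"
  proof -
    have "(y - x) * (x + y) = y\<^sup>2 - x\<^sup>2" by (simp add: power2_eq_square algebra_simps)
    then show ?thesis by simp
  qed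
  finally have "\<bar>root_slope e w - root_slope e w'\<bar> = \<bar>max w' e - max w e\<bar> * (1 / (2 * x * y * (x + y)))"
    using pos by (simp add: x2 y2 abs_mult)
  also have "\<dots> \<le> \<bar>w - w'\<bar> * (1 / (4 * s ^ 3))"
    using frac pos by (intro mult_mono) auto
  finally show ?thesis unfolding s3 by (simp add: mult.commute)
qed

text \<open>Up to a multiple of \<open>sqrt w\<close>, the concave function \<open>root_below (\<epsilon> / 4)\<close> stays below its tangent at
  \<open>w\<close> even when that is bent down by nine tenths of the slope in both directions: to the right use the
  tangent at \<open>100 w\<close>, whose slope is a tenth of that at \<open>w\<close>, to the left the tangent at \<open>w / 4\<close>, whose
  slope is twice as large. The latter is why the square root is continued linearly only below
  \<open>\<epsilon> / 4 \<le> w / 4\<close>.\<close>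

lemma root_below_kink:
  assumes \<epsilon>: "0 < \<epsilon>" and w: "\<epsilon> \<le> w"
  shows "1 / (2 * sqrt w) * (9 / 10) * \<bar>d\<bar> - 5 * sqrt w
    \<le> sqrt w - root_below (\<epsilon> / 4) (w - d) - 1 / (2 * sqrt w) * d"
proof -
  define s where "s = sqrt w"
  have s: "0 < s" and w2: "w = s * s" using \<epsilon> w by (auto simp: s_def)
  have e: "0 < \<epsilon> / 4" using \<epsilon> by simp
  show ?thesis
  proof (cases "d < 0")
    case True
    have "sqrt (100 * w) = 10 * s" by (simp add: s_def real_sqrt_mult)
    then have "root_below (\<epsilon> / 4) (w - d) \<le> 10 * s + ((w - d) - 100 * w) / (2 * (10 * s))"
      using root_below_tangent[OF e, of "100 * w" "w - d"] \<epsilon> w by simp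
    also have "\<dots> = 10 * s - 99 / 20 * s - d / (20 * s)"
      using s by (simp add: w2 field_simps)
    also have "d / (20 * s) = 1 / 20 * (d / s)" by simp
    finally have le: "root_below (\<epsilon> / 4) (w - d) \<le> 10 * s - 99 / 20 * s - 1 / 20 * (d / s)" .
    have eq: "1 / (2 * s) * (9 / 10) * \<bar>d\<bar> = - (9 / 20) * (d / s)" "1 / (2 * s) * d = 1 / 2 * (d / s)"
      using True by simp_all
    show ?thesis
      unfolding s_def[symmetric] eq using le s by linarith
  next
    case False
    have root: "sqrt (w / 4) = s / 2" by (simp add: s_def real_sqrt_divide)
    have "root_below (\<epsilon> / 4) (w - d) \<le> s / 2 + ((w - d) - w / 4) / (2 * (s / 2))"
      using root_below_tangent[OF e, of "w / 4" "w - d"] w unfolding root by simp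
    also have "\<dots> = s / 2 + 3 / 4 * s - d / s" using s by (simp add: w2 field_simps)
    finally have "root_below (\<epsilon> / 4) (w - d) \<le> 5 / 4 * s - d / s" by simp
    moreover have "1 / (2 * s) * (9 / 10) * \<bar>d\<bar> + 1 / (2 * s) * d \<le> d / s"
      using False s by (simp add: field_simps)
    ultimately show ?thesis
      unfolding s_def[symmetric] using s by linarith
  qed
qed

subsection \<open>Drift dominated by the jumps\<close>

text \<open>\<open>l\<^sub>2 |C|\<close> is dominated by the sum of the jump sizes weighted with their rates, with room to spare
  on both sides: a test function need only gain nine tenths of each jump, and the tenth of
  \<open>l\<^sub>2 |C|\<close> in excess controls \<open>z\<close>.\<close>

locale dominated_drift = drift_inequality +
  assumes dominated: "AE \<omega> in P. \<forall>r\<in>{0..T}. \<forall>C.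
      11 / 10 * l2 * sqrt (energy r \<omega> C) \<le> 9 / 10 * (\<Sum>j\<in>UNIV. rate r \<omega> j * \<bar>jump C r \<omega> j\<bar>)"
    and y_end_nonpos: "AE \<omega> in P. y T \<omega> \<le> 0"
begin

text \<open>If every jump gains the fraction 9/10 of \<open>p |jump|\<close> up to \<open>k\<close>, then the total gain per unit of time
  covers the drift term \<open>p l\<^sub>2 |C|\<close>, since the total rate of jumping is at most \<open>c\<close>.\<close>

lemma jump_sum_lower:
  assumes r: "r \<in> {0..T}" and \<omega>: "\<omega> \<in> space P"
    and dom: "11 / 10 * l2 * enorm r \<omega> C \<le> 9 / 10 * (\<Sum>j\<in>UNIV. rate r \<omega> j * \<bar>jump C r \<omega> j\<bar>)"
    and p: "0 \<le> p" and k: "0 \<le> k"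
    and w: "\<And>j. p * (9 / 10) * \<bar>jump C r \<omega> j\<bar> - k \<le> w j"
    and w0: "\<And>j. X r \<omega> = axis j 1 \<Longrightarrow> w j = 0"
  shows "p * (l2 * enorm r \<omega> C) + p * (1 / 10 * l2 * enorm r \<omega> C) - c * k \<le> (\<Sum>j\<in>UNIV. rate r \<omega> j * w j)"
proof -
  have r0: "0 \<le> r" using r by simp
  define n where "n j = (if X r \<omega> = axis j 1 then 0 else k)" for j
  have "\<bar>\<Sum>j\<in>UNIV. rate r \<omega> j * n j\<bar> \<le> c * k"
    using k by (intro sum_rate_abs_le[OF r0 \<omega>]) (simp add: n_def)
  moreover have "p * (11 / 10 * l2 * enorm r \<omega> C) \<le> p * (9 / 10 * (\<Sum>j\<in>UNIV. rate r \<omega> j * \<bar>jump C r \<omega> j\<bar>))"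
    by (rule mult_left_mono[OF dom p])
  moreover have "p * (9 / 10 * (\<Sum>j\<in>UNIV. rate r \<omega> j * \<bar>jump C r \<omega> j\<bar>)) - (\<Sum>j\<in>UNIV. rate r \<omega> j * n j)
      = (\<Sum>j\<in>UNIV. rate r \<omega> j * (p * (9 / 10) * \<bar>jump C r \<omega> j\<bar> - n j))"
    by (simp add: sum_distrib_left sum_subtractf right_diff_distrib mult_ac)
  moreover have "\<dots> \<le> (\<Sum>j\<in>UNIV. rate r \<omega> j * w j)"
    using w w0 by (intro sum_rate_mono[OF r0 \<omega>]) (auto simp: n_def jump_self)
  moreover have "p * (11 / 10 * l2 * enorm r \<omega> C) = p * (l2 * enorm r \<omega> C) + p * (1 / 10 * l2 * enorm r \<omega> C)"
    by (simp add: algebra_simps)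
  ultimately show ?thesis by linarith
qed

text \<open>Comparison: test with the square of the positive part, for which the jump part of the generator
  absorbs the drift bound up to a multiple of the function itself.\<close>

theorem nonpositive:
  assumes t: "t \<in> {0..T}"
  shows "AE \<omega> in P. y t \<omega> \<le> 0"
proof -
  interpret pos: drift_test P X A T c y yb z I l1 l2 "\<lambda>v. (max 0 v)\<^sup>2" "\<lambda>v. 2 * max 0 v" 2 "2 * l1 + c" 0 UNIV
  proof
    show "mono (\<lambda>v::real. (max 0 v)\<^sup>2)" by (intro monoI power_mono) auto
    show "\<bar>2 * max 0 v - 2 * max 0 w\<bar> \<le> 2 * \<bar>v - w\<bar>" for v w :: real
      by (cases "v \<le> 0"; cases "w \<le> 0") (auto simp: max_def abs_if)
    show "\<bar>(max 0 (v + d))\<^sup>2 - (max 0 v)\<^sup>2 - 2 * max 0 v * d\<bar> \<le> 2 * d\<^sup>2" for v d :: real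
    proof -
      have "0 \<le> (max 0 (v + d))\<^sup>2 - (max 0 v)\<^sup>2 - 2 * max 0 v * d"
        and "(max 0 (v + d))\<^sup>2 - (max 0 v)\<^sup>2 - 2 * max 0 v * d \<le> d\<^sup>2"
      proof -
        have "(max 0 (v + d))\<^sup>2 - (max 0 v)\<^sup>2 - 2 * max 0 v * d
            = (max 0 (v + d) - max 0 v)\<^sup>2 + 2 * max 0 v * (max 0 (v + d) - (max 0 v + d))"
          by (simp add: power2_eq_square algebra_simps)
        moreover have "0 \<le> 2 * max 0 v * (max 0 (v + d) - (max 0 v + d))"
          by (cases "v \<le> 0") auto
        ultimately show "0 \<le> (max 0 (v + d))\<^sup>2 - (max 0 v)\<^sup>2 - 2 * max 0 v * d" by simp
        show "(max 0 (v + d))\<^sup>2 - (max 0 v)\<^sup>2 - 2 * max 0 v * d \<le> d\<^sup>2"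
        proof (cases "v \<le> 0")
          case True
          then have "\<bar>max 0 (v + d)\<bar> \<le> \<bar>d\<bar>" by auto
          from power_mono[OF this, of 2] show ?thesis using True by simp
        next
          case False
          have "(max 0 (v + d))\<^sup>2 \<le> \<bar>v + d\<bar>\<^sup>2" by (rule power_mono) auto
          then show ?thesis using False by (simp add: power2_eq_square algebra_simps)
        qed
      qed
      then show ?thesis by simp
    qed
    show "AE \<omega> in P. \<forall>r\<in>{0..T}. \<forall>v\<in>UNIV. \<forall>C. 0 * sqrt (energy r \<omega> C) - (2 * l1 + c) * (max 0 v)\<^sup>2
        \<le> (\<Sum>j\<in>UNIV. rate r \<omega> j * ((max 0 (v + jump C r \<omega> j))\<^sup>2 - (max 0 v)\<^sup>2 - 2 * max 0 v * jump C r \<omega> j))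
          - 2 * max 0 v * (l1 * \<bar>v\<bar> + l2 * sqrt (energy r \<omega> C))"
      using dominated AE_space
    proof eventually_elim
      case (elim \<omega>)
      show ?case
      proof (intro ballI allI)
        fix r v C assume r: "r \<in> {0..T}"
        \<comment> \<open>a jump of a positive \<open>v\<close> gains \<open>d\<^sup>2\<close>, or \<open>2 v |d| - v\<^sup>2\<close> if it leads below zero\<close>
        have key: "2 * max 0 v * (9 / 10) * \<bar>d\<bar> - (max 0 v)\<^sup>2 \<le> (max 0 (v + d))\<^sup>2 - (max 0 v)\<^sup>2 - 2 * max 0 v * d" for d :: real
        proof (cases "v \<le> 0")
          case True
          then show ?thesis by simp
        next
          case v: False
          show ?thesis
          proof (cases "0 \<le> v + d")
            case True
            have "0 \<le> (\<bar>d\<bar> - 9 / 10 * v)\<^sup>2 + 19 / 100 * v\<^sup>2" by simp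
            then show ?thesis using True v by (simp add: power2_eq_square algebra_simps)
          next
            case False
            then have d: "\<bar>d\<bar> = - d" using v by simp
            have "0 \<le> v * (- d)" using False v by (intro mult_nonneg_nonneg) auto
            then show ?thesis using False v unfolding d by (simp add: power2_eq_square algebra_simps)
          qed
        qed
        have n: "0 \<le> enorm r \<omega> C" using energy_nonneg[of r \<omega> C] r elim(2) by simp
        have "2 * max 0 v * (l2 * enorm r \<omega> C) + 2 * max 0 v * (1 / 10 * l2 * enorm r \<omega> C) - c * (max 0 v)\<^sup>2
            \<le> (\<Sum>j\<in>UNIV. rate r \<omega> j * ((max 0 (v + jump C r \<omega> j))\<^sup>2 - (max 0 v)\<^sup>2 - 2 * max 0 v * jump C r \<omega> j))"
          using elim(1) r by (intro jump_sum_lower[OF r elim(2)] key) (auto simp: jump_self)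
        moreover have "0 \<le> 2 * max 0 v * (1 / 10 * l2 * enorm r \<omega> C)" using l_nonneg n by simp
        moreover have "2 * max 0 v * (l1 * \<bar>v\<bar>) = 2 * l1 * (max 0 v)\<^sup>2" by (simp add: max_def power2_eq_square)
        ultimately show "0 * sqrt (energy r \<omega> C) - (2 * l1 + c) * (max 0 v)\<^sup>2
          \<le> (\<Sum>j\<in>UNIV. rate r \<omega> j * ((max 0 (v + jump C r \<omega> j))\<^sup>2 - (max 0 v)\<^sup>2 - 2 * max 0 v * jump C r \<omega> j))
          - 2 * max 0 v * (l1 * \<bar>v\<bar> + l2 * sqrt (energy r \<omega> C))"
          unfolding distrib_left distrib_right by linarith
      qed
    qed
  qed auto
  have "pos.mean T = expectation (\<lambda>\<omega>. 0)"
    unfolding pos.mean_def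
    by (rule integral_cong_AE) (use y_end_nonpos pos.\<phi>_y_integrable[of T] T_pos in \<open>auto elim: eventually_mono\<close>)
  moreover have "exp ((2 * l1 + c) * t) * pos.mean t + exp (- \<bar>2 * l1 + c\<bar> * T) * 0 * stint t T (\<lambda>r \<omega>. enorm r \<omega> (z r \<omega>))
      \<le> exp ((2 * l1 + c) * T) * pos.mean T"
    using t by (intro pos.weighted_mean_increases) auto
  ultimately have "exp ((2 * l1 + c) * t) * pos.mean t \<le> 0" by simp
  then have "pos.mean t \<le> 0" by (simp add: mult_le_0_iff)
  moreover have "0 \<le> pos.mean t" unfolding pos.mean_def by simp
  ultimately have "expectation (\<lambda>\<omega>. (max 0 (y t \<omega>))\<^sup>2) = 0" unfolding pos.mean_def by simp
  then have "AE \<omega> in P. (max 0 (y t \<omega>))\<^sup>2 = 0"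
    by (subst (asm) integral_nonneg_eq_0_iff_AE[OF pos.\<phi>_y_integrable[OF t]]) auto
  then show ?thesis by (rule eventually_mono) (simp add: max_def split: if_splits)
qed

text \<open>The test function \<open>- sqrt (\<epsilon> - v)\<close> on \<open>v \<le> 0\<close>. Its \<open>\<kappa>\<close> does not depend on \<open>\<epsilon>\<close>. The tenth
  of \<open>l\<^sub>2 |C|\<close> that the domination has in excess, times the slope, is what \<open>\<gamma> |C|\<close> may use up.\<close>

lemma root_test:
  assumes \<epsilon>: "0 < \<epsilon>" and \<gamma>: "0 \<le> \<gamma>"
    and V: "\<And>v. v \<in> V \<Longrightarrow> v \<le> 0" and gain: "\<And>v. v \<in> V \<Longrightarrow> \<gamma> \<le> l2 / (20 * sqrt (\<epsilon> - v))"
    and yV: "\<And>t. t \<in> {0..T} \<Longrightarrow> AE \<omega> in P. y t \<omega> \<in> V"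
  shows "drift_test P X A T c y yb z I l1 l2 (\<lambda>v. - root_below (\<epsilon> / 4) (\<epsilon> - v)) (\<lambda>v. root_slope (\<epsilon> / 4) (\<epsilon> - v))
    (1 / (4 * (\<epsilon> / 4 * sqrt (\<epsilon> / 4)))) (- (5 * c + l1 / 2)) \<gamma> V"
proof -
  let ?e = "\<epsilon> / 4" and ?Lc = "1 / (4 * (\<epsilon> / 4 * sqrt (\<epsilon> / 4)))"
  have e: "0 < ?e" using \<epsilon> by simp
  show ?thesis
  proof
    show "0 \<le> ?Lc" using e by simp
    show "0 \<le> \<gamma>" by (rule \<gamma>)
    show "mono (\<lambda>v. - root_below ?e (\<epsilon> - v))" using root_below_mono[OF e] by (intro monoI) simp
    show "0 \<le> root_slope ?e (\<epsilon> - v)" for v using root_slope_pos[OF e] by (rule less_imp_le)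
    show lip: "\<bar>root_slope ?e (\<epsilon> - v) - root_slope ?e (\<epsilon> - w)\<bar> \<le> ?Lc * \<bar>v - w\<bar>" for v w
      using root_slope_lipschitz[OF e, of "\<epsilon> - v" "\<epsilon> - w"] by (simp add: abs_minus_commute)
    show "\<bar>- root_below ?e (\<epsilon> - (v + d)) - - root_below ?e (\<epsilon> - v) - root_slope ?e (\<epsilon> - v) * d\<bar> \<le> ?Lc * d\<^sup>2" for v d
    proof -
      let ?w = "\<epsilon> - v" and ?w' = "\<epsilon> - (v + d)"
      have 1: "root_below ?e ?w' \<le> root_below ?e ?w - root_slope ?e ?w * d"
        using root_below_concave[OF e, of ?w' ?w] by simp
      have 2: "root_below ?e ?w \<le> root_below ?e ?w' + root_slope ?e ?w' * d"
        using root_below_concave[OF e, of ?w ?w'] by simp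
      have "(root_slope ?e ?w' - root_slope ?e ?w) * d \<le> \<bar>root_slope ?e ?w' - root_slope ?e ?w\<bar> * \<bar>d\<bar>"
        by (metis abs_ge_self abs_mult)
      also have "\<dots> \<le> (?Lc * \<bar>d\<bar>) * \<bar>d\<bar>" using lip[of "v + d" v] by (intro mult_right_mono) auto
      also have "\<dots> = ?Lc * d\<^sup>2" by (simp only: mult.assoc abs_mult_self_eq power2_eq_square)
      finally have "root_slope ?e ?w' * d - root_slope ?e ?w * d \<le> ?Lc * d\<^sup>2" by (simp only: left_diff_distrib)
      with 1 2 show ?thesis by (intro abs_leI) linarith+
    qed
    show "AE \<omega> in P. y t \<omega> \<in> V" if "t \<in> {0..T}" for t by (rule yV[OF that])
    show "AE \<omega> in P. \<forall>r\<in>{0..T}. \<forall>v\<in>V. \<forall>C. \<gamma> * sqrt (energy r \<omega> C) - - (5 * c + l1 / 2) * - root_below ?e (\<epsilon> - v)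
        \<le> (\<Sum>j\<in>UNIV. rate r \<omega> j * (- root_below ?e (\<epsilon> - (v + jump C r \<omega> j)) - - root_below ?e (\<epsilon> - v)
            - root_slope ?e (\<epsilon> - v) * jump C r \<omega> j))
          - root_slope ?e (\<epsilon> - v) * (l1 * \<bar>v\<bar> + l2 * sqrt (energy r \<omega> C))"
      using dominated AE_space
    proof eventually_elim
      case (elim \<omega>)
      show ?case
      proof (intro ballI allI)
        fix r v C assume r: "r \<in> {0..T}" and v: "v \<in> V"
        define w where "w = \<epsilon> - v"
        have w: "\<epsilon> \<le> w" "0 < w" using V[OF v] \<epsilon> by (auto simp: w_def)
        have mx: "max w ?e = w" using w \<epsilon> by simp
        define p where "p = 1 / (2 * sqrt w)"
        have p: "0 < p" using w by (simp add: p_def)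
        have slope: "root_slope ?e w = p" and val: "root_below ?e w = sqrt w"
          by (simp_all add: root_slope_def root_below_def mx p_def)
        have n: "0 \<le> enorm r \<omega> C" using energy_nonneg[of r \<omega> C] r elim(2) by simp
        let ?S = "\<Sum>j\<in>UNIV. rate r \<omega> j * (sqrt w - root_below ?e (w - jump C r \<omega> j) - p * jump C r \<omega> j)"
        have S: "p * (l2 * enorm r \<omega> C) + p * (1 / 10 * l2 * enorm r \<omega> C) - c * (5 * sqrt w) \<le> ?S"
        proof (rule jump_sum_lower[OF r elim(2)])
          show "11 / 10 * l2 * enorm r \<omega> C \<le> 9 / 10 * (\<Sum>j\<in>UNIV. rate r \<omega> j * \<bar>jump C r \<omega> j\<bar>)"
            using elim(1) r by blast
          show "p * (9 / 10) * \<bar>jump C r \<omega> j\<bar> - 5 * sqrt w \<le> sqrt w - root_below ?e (w - jump C r \<omega> j) - p * jump C r \<omega> j" for j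
            unfolding p_def by (rule root_below_kink[OF \<epsilon> w(1)])
          show "sqrt w - root_below ?e (w - jump C r \<omega> j) - p * jump C r \<omega> j = 0" if "X r \<omega> = axis j 1" for j
            by (simp add: jump_self[OF that] val)
        qed (use p w in auto)
        have "\<gamma> * enorm r \<omega> C \<le> l2 / (20 * sqrt (\<epsilon> - v)) * enorm r \<omega> C" by (rule mult_right_mono[OF gain[OF v] n])
        also have "l2 / (20 * sqrt (\<epsilon> - v)) = p * (1 / 10 * l2)" by (simp add: p_def w_def)
        finally have g: "\<gamma> * enorm r \<omega> C \<le> p * (1 / 10 * l2 * enorm r \<omega> C)" by (simp only: mult.assoc)
        have "\<bar>v\<bar> \<le> w" using V[OF v] \<epsilon> by (simp add: w_def)
        then have "p * (l1 * \<bar>v\<bar>) \<le> p * (l1 * w)" using p l_nonneg by (intro mult_left_mono) auto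
        also have "\<dots> = l1 / 2 * (w / sqrt w)" by (simp add: p_def)
        also have "w / sqrt w = sqrt w" using w by (simp add: real_div_sqrt)
        finally have l: "p * (l1 * \<bar>v\<bar>) \<le> l1 / 2 * sqrt w" .
        have arg: "\<epsilon> - (v + jump C r \<omega> j) = w - jump C r \<omega> j" for j by (simp add: w_def)
        show "\<gamma> * sqrt (energy r \<omega> C) - - (5 * c + l1 / 2) * - root_below ?e (\<epsilon> - v)
        \<le> (\<Sum>j\<in>UNIV. rate r \<omega> j * (- root_below ?e (\<epsilon> - (v + jump C r \<omega> j)) - - root_below ?e (\<epsilon> - v)
            - root_slope ?e (\<epsilon> - v) * jump C r \<omega> j))
          - root_slope ?e (\<epsilon> - v) * (l1 * \<bar>v\<bar> + l2 * sqrt (energy r \<omega> C))"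
          unfolding arg w_def[symmetric] slope val
          using S g l by (simp add: algebra_simps)
      qed
    qed
  qed
qed

lemma mean_root:
  assumes "0 < \<epsilon>" "t \<in> {0..T}"
  shows "expectation (\<lambda>\<omega>. - root_below (\<epsilon> / 4) (\<epsilon> - y t \<omega>)) = - expectation (\<lambda>\<omega>. sqrt (\<epsilon> - y t \<omega>))"
proof -
  have m: "(\<lambda>\<omega>. sqrt (\<epsilon> - y t \<omega>)) \<in> borel_measurable P"
    using y_P[OF assms(2)] by (intro measurable_compose[OF _ borel_measurable_sqrt] borel_measurable_diff) auto
  have m': "(\<lambda>\<omega>. - root_below (\<epsilon> / 4) (\<epsilon> - y t \<omega>)) \<in> borel_measurable P"
  proof -
    have "mono (root_below (\<epsilon> / 4))" using root_below_mono[of "\<epsilon> / 4"] assms(1) by (intro monoI) simp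
    then have "root_below (\<epsilon> / 4) \<in> borel_measurable borel" by (rule borel_measurable_mono)
    then show ?thesis
      using y_P[OF assms(2)] by (intro borel_measurable_uminus measurable_compose[OF _ \<open>root_below (\<epsilon> / 4) \<in> _\<close>] borel_measurable_diff) auto
  qed
  have "expectation (\<lambda>\<omega>. - root_below (\<epsilon> / 4) (\<epsilon> - y t \<omega>)) = expectation (\<lambda>\<omega>. - sqrt (\<epsilon> - y t \<omega>))"
  proof (rule integral_cong_AE[OF m'])
    show "(\<lambda>\<omega>. - sqrt (\<epsilon> - y t \<omega>)) \<in> borel_measurable P" by (rule borel_measurable_uminus[OF m])
    show "AE \<omega> in P. - root_below (\<epsilon> / 4) (\<epsilon> - y t \<omega>) = - sqrt (\<epsilon> - y t \<omega>)"
      using nonpositive[OF assms(2)]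
    proof eventually_elim
      case (elim \<omega>)
      then have "max (\<epsilon> - y t \<omega>) (\<epsilon> / 4) = \<epsilon> - y t \<omega>" using assms(1) by simp
      then show ?case by (simp add: root_below_def)
    qed
  qed
  then show ?thesis by simp
qed

text \<open>Strict comparison: if \<open>y\<close> starts at zero, testing with \<open>- sqrt (\<epsilon> - y)\<close> bounds the mean of
  \<open>sqrt (\<epsilon> - y\<^sub>t)\<close> by a multiple of \<open>sqrt \<epsilon>\<close> that does not depend on \<open>\<epsilon>\<close>.\<close>

lemma zero_if_zero_at_start:
  assumes y0: "AE \<omega> in P. y 0 \<omega> = 0" and t: "t \<in> {0..T}"
  shows "AE \<omega> in P. y t \<omega> = 0"
proof -
  let ?\<kappa> = "- (5 * c + l1 / 2)"
  have bound: "expectation (\<lambda>\<omega>. sqrt (\<epsilon> - y t \<omega>)) \<le> exp (- ?\<kappa> * t) * sqrt \<epsilon>" if \<epsilon>: "0 < \<epsilon>" for \<epsilon>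
  proof -
    interpret neg: drift_test P X A T c y yb z I l1 l2 "\<lambda>v. - root_below (\<epsilon> / 4) (\<epsilon> - v)" "\<lambda>v. root_slope (\<epsilon> / 4) (\<epsilon> - v)"
      "1 / (4 * (\<epsilon> / 4 * sqrt (\<epsilon> / 4)))" ?\<kappa> 0 "{..0}"
      using nonpositive l_nonneg \<epsilon> by (intro root_test) auto
    have "exp (?\<kappa> * 0) * neg.mean 0 + exp (- \<bar>?\<kappa>\<bar> * T) * 0 * stint 0 t (\<lambda>r \<omega>. enorm r \<omega> (z r \<omega>)) \<le> exp (?\<kappa> * t) * neg.mean t"
      using t by (intro neg.weighted_mean_increases) auto
    then have 1: "neg.mean 0 \<le> exp (?\<kappa> * t) * neg.mean t" by simp
    have T0: "0 \<in> {0..T}" using T_pos by simp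
    have "expectation (\<lambda>\<omega>. sqrt (\<epsilon> - y 0 \<omega>)) = expectation (\<lambda>\<omega>. sqrt \<epsilon>)"
      using y0 y_P[OF T0]
      by (intro integral_cong_AE measurable_compose[OF _ borel_measurable_sqrt] borel_measurable_diff)
        (auto elim: eventually_mono)
    then have 0: "neg.mean 0 = - sqrt \<epsilon>" unfolding neg.mean_def mean_root[OF \<epsilon> T0] by (simp add: prob_space)
    have "neg.mean t = - expectation (\<lambda>\<omega>. sqrt (\<epsilon> - y t \<omega>))" unfolding neg.mean_def by (rule mean_root[OF \<epsilon> t])
    with 1 0 have "exp (?\<kappa> * t) * expectation (\<lambda>\<omega>. sqrt (\<epsilon> - y t \<omega>)) \<le> sqrt \<epsilon>" by simp
    moreover have "a \<le> exp (- u * t) * b" if "exp (u * t) * a \<le> b" for u a b :: real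
      using that by (simp add: exp_minus field_simps)
    ultimately show ?thesis by blast
  qed
  have int: "integrable P (\<lambda>\<omega>. sqrt (\<epsilon> + \<bar>y t \<omega>\<bar>))" if "0 \<le> \<epsilon>" for \<epsilon>
  proof (rule Bochner_Integration.integrable_bound)
    show "integrable P (\<lambda>\<omega>. 1 + \<epsilon> + \<bar>y t \<omega>\<bar>)" using sq_int_integrable[OF y_sq[OF t]] by simp
    show "(\<lambda>\<omega>. sqrt (\<epsilon> + \<bar>y t \<omega>\<bar>)) \<in> borel_measurable P"
      using y_P[OF t] by (intro measurable_compose[OF _ borel_measurable_sqrt] borel_measurable_add borel_measurable_abs) auto
    have "sqrt x \<le> 1 + x" if "0 \<le> x" for x
      using le_one_plus_square[of "sqrt x"] that by simp
    then show "AE \<omega> in P. norm (sqrt (\<epsilon> + \<bar>y t \<omega>\<bar>)) \<le> norm (1 + \<epsilon> + \<bar>y t \<omega>\<bar>)"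
      using that by (intro AE_I2) (simp add: add.assoc)
  qed
  have le: "expectation (\<lambda>\<omega>. sqrt \<bar>y t \<omega>\<bar>) \<le> exp (- ?\<kappa> * t) * sqrt \<epsilon>" if \<epsilon>: "0 < \<epsilon>" for \<epsilon>
  proof -
    have "expectation (\<lambda>\<omega>. sqrt \<bar>y t \<omega>\<bar>) \<le> expectation (\<lambda>\<omega>. sqrt (\<epsilon> + \<bar>y t \<omega>\<bar>))"
      using int[of 0] int[of \<epsilon>] \<epsilon> by (intro integral_mono) auto
    also have "\<dots> = expectation (\<lambda>\<omega>. sqrt (\<epsilon> - y t \<omega>))"
    proof (rule integral_cong_AE)
      show "AE \<omega> in P. sqrt (\<epsilon> + \<bar>y t \<omega>\<bar>) = sqrt (\<epsilon> - y t \<omega>)"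
        using nonpositive[OF t] by (rule eventually_mono) simp
      show "(\<lambda>\<omega>. sqrt (\<epsilon> + \<bar>y t \<omega>\<bar>)) \<in> borel_measurable P" using int[of \<epsilon>] \<epsilon> by (intro borel_measurable_integrable) auto
      show "(\<lambda>\<omega>. sqrt (\<epsilon> - y t \<omega>)) \<in> borel_measurable P"
        using y_P[OF t] by (intro measurable_compose[OF _ borel_measurable_sqrt] borel_measurable_diff) auto
    qed
    also have "\<dots> \<le> exp (- ?\<kappa> * t) * sqrt \<epsilon>" by (rule bound[OF \<epsilon>])
    finally show ?thesis .
  qed
  have "expectation (\<lambda>\<omega>. sqrt \<bar>y t \<omega>\<bar>) \<le> 0"
  proof (rule field_le_epsilon)
    fix e :: real assume e: "0 < e"
    let ?K = "exp (- ?\<kappa> * t)"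
    have "expectation (\<lambda>\<omega>. sqrt \<bar>y t \<omega>\<bar>) \<le> ?K * sqrt ((e / ?K)\<^sup>2)" using e by (intro le) simp
    also have "\<dots> = e" using e by simp
    finally show "expectation (\<lambda>\<omega>. sqrt \<bar>y t \<omega>\<bar>) \<le> 0 + e" by simp
  qed
  moreover have "0 \<le> expectation (\<lambda>\<omega>. sqrt \<bar>y t \<omega>\<bar>)" by simp
  ultimately have "expectation (\<lambda>\<omega>. sqrt \<bar>y t \<omega>\<bar>) = 0" by simp
  moreover have "integrable P (\<lambda>\<omega>. sqrt \<bar>y t \<omega>\<bar>)" using int[of 0] by simp
  ultimately have "AE \<omega> in P. sqrt \<bar>y t \<omega>\<bar> = 0"
    by (subst (asm) integral_nonneg_eq_0_iff_AE) auto
  then show ?thesis by simp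
qed

text \<open>Once \<open>y\<close> vanishes, the slack in the domination is a gain of order \<open>1 / sqrt \<epsilon>\<close> against a defect
  of order \<open>sqrt \<epsilon>\<close>, which forces the energy of \<open>z\<close> to vanish. Then the drift bound vanishes, and so
  does the nonnegative \<open>K\<close>, whose mean is zero because the stochastic integral is a martingale.\<close>

theorem rigid_if_zero_at_start:
  assumes y0: "AE \<omega> in P. y 0 \<omega> = 0" and l2: "0 < l2"
  shows "AE \<omega> in P. H 0 T \<omega> = 0" and "AE \<omega> in P. K 0 T \<omega> = 0"
proof -
  let ?\<kappa> = "- (5 * c + l1 / 2)" and ?N = "stint 0 T (\<lambda>r \<omega>. enorm r \<omega> (z r \<omega>))"
  have T0: "0 \<in> {0..T}" and TT: "T \<in> {0..T}" using T_pos by auto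
  note zero = zero_if_zero_at_start[OF y0]
  have bound: "exp (- \<bar>?\<kappa>\<bar> * T) * (l2 / (20 * sqrt \<epsilon>)) * ?N \<le> sqrt \<epsilon>" if \<epsilon>: "0 < \<epsilon>" for \<epsilon>
  proof -
    interpret neg: drift_test P X A T c y yb z I l1 l2 "\<lambda>v. - root_below (\<epsilon> / 4) (\<epsilon> - v)" "\<lambda>v. root_slope (\<epsilon> / 4) (\<epsilon> - v)"
      "1 / (4 * (\<epsilon> / 4 * sqrt (\<epsilon> / 4)))" ?\<kappa> "l2 / (20 * sqrt \<epsilon>)" "{0}"
      using zero l2 \<epsilon> by (intro root_test) auto
    have le: "exp (?\<kappa> * 0) * neg.mean 0 + exp (- \<bar>?\<kappa>\<bar> * T) * (l2 / (20 * sqrt \<epsilon>)) * ?N \<le> exp (?\<kappa> * T) * neg.mean T"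
      using T_pos by (intro neg.weighted_mean_increases) auto
    have mean: "neg.mean t = - sqrt \<epsilon>" if t: "t \<in> {0..T}" for t
    proof -
      have "expectation (\<lambda>\<omega>. sqrt (\<epsilon> - y t \<omega>)) = expectation (\<lambda>\<omega>. sqrt \<epsilon>)"
        using zero[OF t] y_P[OF t]
        by (intro integral_cong_AE measurable_compose[OF _ borel_measurable_sqrt] borel_measurable_diff)
          (auto elim: eventually_mono)
      then show ?thesis unfolding neg.mean_def mean_root[OF \<epsilon> t] by (simp add: prob_space)
    qed
    have "exp (?\<kappa> * T) * neg.mean T \<le> 0" using \<epsilon> by (simp add: mean[OF TT])
    then show ?thesis using le by (simp add: mean[OF T0])
  qed
  have N_le: "?N \<le> 0"
  proof (rule field_le_epsilon)
    fix e :: real assume e: "0 < e"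
    define k where "k = exp (- \<bar>?\<kappa>\<bar> * T) * l2 / 20"
    have k: "0 < k" using l2 by (simp add: k_def)
    have ke: "0 < k * e" using k e by simp
    have "exp (- \<bar>?\<kappa>\<bar> * T) * (l2 / (20 * sqrt (k * e))) * ?N = k * ?N / sqrt (k * e)"
      by (simp add: k_def)
    with bound[OF ke] have "k * ?N / sqrt (k * e) \<le> sqrt (k * e)" by simp
    then have "k * ?N \<le> sqrt (k * e) * sqrt (k * e)" using ke by (simp add: pos_divide_le_eq)
    then have "k * ?N \<le> k * e" using ke by simp
    then show "?N \<le> 0 + e" using k by simp
  qed
  have yb_zero: "expectation (\<lambda>\<omega>. \<bar>yb r \<omega>\<bar>) = 0" if r: "r \<in> {0..T}" for r
  proof -
    have "expectation (\<lambda>\<omega>. \<bar>yb r \<omega>\<bar>) = expectation (\<lambda>\<omega>. 0)"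
    proof (rule integral_cong_AE)
      show "AE \<omega> in P. \<bar>yb r \<omega>\<bar> = 0"
        using yb_eq zero[OF r] by eventually_elim (use r in simp)
      show "(\<lambda>\<omega>. \<bar>yb r \<omega>\<bar>) \<in> borel_measurable P"
        by (intro borel_measurable_abs section_measurable[OF yb_Q r])
    qed simp
    then show ?thesis by simp
  qed
  have yb_Q_integrable: "Q_integrable (\<lambda>r \<omega>. \<bar>yb r \<omega>\<bar>)"
  proof (rule Q_integrable_bounded[where f = "\<lambda>r \<omega>. 1 + (yb r \<omega>)\<^sup>2" and K = 1])
    show "Q_integrable (\<lambda>r \<omega>. 1 + (yb r \<omega>)\<^sup>2)" using yb_sq by simp
    show "(\<lambda>p. \<bar>yb (fst p) (snd p)\<bar>) \<in> borel_measurable Q" by (intro borel_measurable_abs yb_Q)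
    show "\<bar>\<bar>yb r \<omega>\<bar>\<bar> \<le> 1 * \<bar>1 + (yb r \<omega>)\<^sup>2\<bar>" for r \<omega> using le_one_plus_square[of "\<bar>yb r \<omega>\<bar>"] by simp
  qed
  have "stint 0 T (\<lambda>r \<omega>. \<bar>yb r \<omega>\<bar>) \<le> 0 * (T - 0)"
    using T_pos yb_zero by (intro stint_le_const[OF yb_Q_integrable]) auto
  then have "l1 * stint 0 T (\<lambda>r \<omega>. \<bar>yb r \<omega>\<bar>) \<le> 0" using l_nonneg by (simp add: mult_nonneg_nonpos)
  moreover have "l2 * ?N \<le> 0" using N_le l2 by (simp add: mult_nonneg_nonpos)
  moreover have "stint 0 T h = l1 * stint 0 T (\<lambda>r \<omega>. \<bar>yb r \<omega>\<bar>) + l2 * ?N"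
    unfolding h_def using yb_Q_integrable enorm_z_Q_integrable by (subst stint_add) (simp_all add: stint_cmult)
  ultimately have "stint 0 T h \<le> 0" by simp
  then have EH: "expectation (H 0 T) \<le> 0" unfolding stint_expectation(1)[OF h_Q_integrable] H_def .
  have H_sq0: "sq_int (H 0 T)" using H_sq(1)[of 0 T] T_pos by simp
  have H_nonneg: "0 \<le> H 0 T \<omega>" if "\<omega> \<in> space P" for \<omega>
    unfolding H_def using h_nonneg that by (intro Bochner_Integration.integral_nonneg) auto
  have "expectation (H 0 T) = 0"
  proof (rule antisym[OF EH])
    show "0 \<le> expectation (H 0 T)" using H_nonneg by (intro Bochner_Integration.integral_nonneg) auto
  qed
  then show H0: "AE \<omega> in P. H 0 T \<omega> = 0"
    using integral_nonneg_eq_0_iff_AE[OF sq_int_integrable[OF H_sq0] AE_I2[OF H_nonneg]] by simp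
  have sqK: "sq_int (K 0 T)" using K_sq[of 0 T] T_pos by simp
  have sqI: "sq_int (\<lambda>\<omega>. I T \<omega> - I 0 \<omega>)" by (rule sq_int_diff[OF I_sq[OF TT] I_sq[OF T0]])
  have "expectation (\<lambda>\<omega>. 1 * (I T \<omega> - I 0 \<omega>)) = 0"
    using T_pos by (intro integral_process_orthogonal[OF I] sq_int_const) auto
  then have EI: "expectation (\<lambda>\<omega>. - (I T \<omega> - I 0 \<omega>)) = 0" unfolding Bochner_Integration.integral_minus by simp
  have "expectation (K 0 T) = expectation (\<lambda>\<omega>. - (I T \<omega> - I 0 \<omega>))"
  proof (rule integral_cong_AE)
    show "AE \<omega> in P. K 0 T \<omega> = - (I T \<omega> - I 0 \<omega>)"
      using H0 zero[OF T0] zero[OF TT] by eventually_elim (simp add: K_def)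
    show "K 0 T \<in> borel_measurable P" using sqK by simp
    show "(\<lambda>\<omega>. - (I T \<omega> - I 0 \<omega>)) \<in> borel_measurable P" using sqI by (intro borel_measurable_uminus) simp
  qed
  then have "expectation (K 0 T) = 0" using EI by simp
  moreover have "AE \<omega> in P. 0 \<le> K 0 T \<omega>" using K_nonneg by (rule eventually_mono) (use T_pos in simp)
  ultimately show "AE \<omega> in P. K 0 T \<omega> = 0"
    using integral_nonneg_eq_0_iff_AE[OF sq_int_integrable[OF sqK]] by simp
qed

end

section \<open>The smallness condition bounds the jump rates from below\<close>

context chain_horizon
begin

text \<open>If the chain can jump to the state \<open>e\<^sub>j\<close> with rate \<open>a\<close>, then \<open>\<Psi> e\<^sub>j = a v\<close> with
  \<open>v = e\<^sub>j - X\<close>, and evaluating \<open>\<Psi> \<Psi>\<^sup>\<dagger> \<Psi> = \<Psi>\<close> at \<open>e\<^sub>j\<close> gives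
  \<open>a = a\<^sup>2 (v \<bullet> \<Psi>\<^sup>\<dagger> v) \<le> 2 a\<^sup>2 |\<Psi>\<^sup>\<dagger>|\<close>.\<close>

lemma rate_pseudoinverse:
  assumes r: "0 \<le> r" and \<omega>: "\<omega> \<in> space P" and j: "X r \<omega> \<noteq> axis j 1" and a: "0 < rate r \<omega> j"
  shows "1 \<le> 2 * rate r \<omega> j * frob_norm (pseudoinverse (Psi X A r \<omega>))"
proof -
  obtain i where i: "X r \<omega> = axis i 1" using X_axis[OF r \<omega>] .
  with j have ij: "i \<noteq> j" by auto
  define \<Psi> where "\<Psi> = Psi X A r \<omega>"
  define C where "C = pseudoinverse \<Psi>"
  define a where "a = rate r \<omega> j"
  define e where "e = (axis j 1 :: real ^ 'n)"
  define v where "v = e - X r \<omega>"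
  have entry: "\<Psi> $ k $ l = (if k = l then rate r \<omega> k else 0) - X r \<omega> $ k * A r $ l $ k - A r $ k $ l * X r \<omega> $ l" for k l
    unfolding \<Psi>_def by (rule Psi_entry[OF r \<omega>])
  have sym: "transpose \<Psi> = \<Psi>"
    by (simp add: transpose_def vec_eq_iff entry mult.commute)
  have col: "\<Psi> *v e = a *\<^sub>R v"
  proof (unfold vec_eq_iff, rule allI)
    fix k
    have "(\<Psi> *v e) $ k = \<Psi> $ k $ j" by (simp add: e_def matrix_vector_mult_basis column_def)
    also have "\<dots> = (a *\<^sub>R v) $ k"
      using ij rate_axis[OF i, of j] by (auto simp: entry a_def v_def e_def i axis_def)
    finally show "(\<Psi> *v e) $ k = (a *\<^sub>R v) $ k" .
  qed
  have vv: "norm v * norm v = 2"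
  proof -
    have "v \<bullet> v = 2"
      using ij by (simp add: v_def e_def i inner_diff_left inner_diff_right inner_axis_axis)
    then show ?thesis by (simp add: dot_square_norm power2_eq_square)
  qed
  have ev: "e \<bullet> v = 1" using ij by (simp add: v_def e_def i inner_diff_right inner_axis_axis)
  have "a = e \<bullet> (\<Psi> *v e)" by (simp add: col ev)
  also have "\<Psi> *v e = \<Psi> *v (C *v (\<Psi> *v e))"
  proof -
    have "\<Psi> *v (C *v (\<Psi> *v e)) = (\<Psi> ** C ** \<Psi>) *v e"
      by (simp only: matrix_vector_mul_assoc matrix_mul_assoc)
    also have "\<Psi> ** C ** \<Psi> = \<Psi>" unfolding C_def by (rule pseudoinverse_symmetric[OF sym])
    finally show ?thesis by simp
  qed
  also have "e \<bullet> (\<Psi> *v (C *v (\<Psi> *v e))) = (\<Psi> *v e) \<bullet> (C *v (\<Psi> *v e))"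
    by (simp add: inner_matrix_vector_transpose sym)
  also have "\<dots> = a * a * (v \<bullet> (C *v v))" by (simp add: col matrix_vector_mult_scaleR)
  also have "\<dots> \<le> a * a * (norm v * (frob_norm C * norm v))"
  proof (rule mult_left_mono)
    have "v \<bullet> (C *v v) \<le> norm v * norm (C *v v)" by (rule norm_cauchy_schwarz)
    also have "\<dots> \<le> norm v * (frob_norm C * norm v)"
      by (intro mult_left_mono matrix_vector_norm_le_frob_norm) simp
    finally show "v \<bullet> (C *v v) \<le> norm v * (frob_norm C * norm v)" .
  qed simp
  also have "\<dots> = a * (a * (frob_norm C * (norm v * norm v)))" by (simp add: mult_ac)
  also have "\<dots> = a * (2 * a * frob_norm C)" by (simp add: vv)
  finally have "a * 1 \<le> a * (2 * a * frob_norm C)" by simp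
  then show ?thesis using \<open>0 < rate r \<omega> j\<close> unfolding a_def C_def \<Psi>_def by (simp only: mult_le_cancel_left_pos)
qed

text \<open>Hence \<open>l\<^sub>2 \<le> sqrt (2 / 3 a)\<close> for every positive jump rate \<open>a \<le> m\<close>, and the Euclidean norm in the
  energy semi-norm is at most the sum of absolute values.\<close>

lemma small_imp_dominated:
  assumes r: "r \<in> {0..T}" and \<omega>: "\<omega> \<in> space P" and m: "0 < m" "frob_norm (A r) \<le> m" and l2: "0 < l2"
    and small: "l2 * frob_norm (pseudoinverse (Psi X A r \<omega>)) * sqrt (6 * m) \<le> 1"
  shows "11 / 10 * l2 * enorm r \<omega> C \<le> 9 / 10 * (\<Sum>j\<in>UNIV. rate r \<omega> j * \<bar>jump C r \<omega> j\<bar>)"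
proof -
  have r0: "0 \<le> r" using r by simp
  have term_le: "11 / 10 * l2 * \<bar>sqrt \<bar>rate r \<omega> j\<bar> * jump C r \<omega> j\<bar> \<le> 9 / 10 * (rate r \<omega> j * \<bar>jump C r \<omega> j\<bar>)" for j
  proof (cases "X r \<omega> = axis j 1 \<or> rate r \<omega> j = 0")
    case True
    then show ?thesis by (auto simp: jump_self)
  next
    case False
    define a where "a = rate r \<omega> j"
    have a: "0 < a" using False rate_nonneg[OF r0 \<omega>, of j] by (simp add: a_def)
    have am: "a \<le> m"
    proof -
      obtain i where "X r \<omega> = axis i 1" using X_axis[OF r0 \<omega>] .
      then have "a = A r $ j $ i" by (simp add: a_def rate_axis)
      then show ?thesis using entry_le_frob_norm[of "A r" j i] m(2) by simp
    qed
    let ?F = "frob_norm (pseudoinverse (Psi X A r \<omega>))"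
    have F: "1 \<le> 2 * a * ?F" using False a rate_pseudoinverse[OF r0 \<omega>, of j] by (simp add: a_def)
    have "l2 * sqrt (6 * m) * 1 \<le> l2 * sqrt (6 * m) * (2 * a * ?F)"
      using F l2 m by (intro mult_left_mono) auto
    also have "\<dots> = 2 * a * (l2 * ?F * sqrt (6 * m))" by (simp add: mult_ac)
    also have "\<dots> \<le> 2 * a * 1" using small a by (intro mult_left_mono) auto
    finally have "l2 * sqrt (6 * m) \<le> 2 * a" by simp
    from power_mono[OF this, of 2] have "l2\<^sup>2 * (6 * m) \<le> 4 * a\<^sup>2"
      using l2 m by (simp add: power_mult_distrib)
    also have "\<dots> \<le> 4 * (a * m)" using a am by (simp add: power2_eq_square)
    finally have "m * (l2\<^sup>2 * 6) \<le> m * (4 * a)" by (simp add: mult_ac)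
    then have l2a: "l2\<^sup>2 * 6 \<le> 4 * a" using m by (simp only: mult_le_cancel_left_pos)
    have "11 / 10 * l2 * sqrt a \<le> 9 / 10 * a"
    proof (rule power2_le_imp_le)
      have "(11 / 10 * l2 * sqrt a)\<^sup>2 = 121 / 600 * (l2\<^sup>2 * 6) * a"
        using a by (simp add: power_mult_distrib power2_eq_square)
      also have "\<dots> \<le> 121 / 600 * (4 * a) * a" using l2a a by (intro mult_right_mono mult_left_mono) auto
      also have "\<dots> \<le> (9 / 10 * a)\<^sup>2" by (simp add: power2_eq_square)
      finally show "(11 / 10 * l2 * sqrt a)\<^sup>2 \<le> (9 / 10 * a)\<^sup>2" .
    qed (use a in simp)
    from mult_right_mono[OF this abs_ge_zero[of "jump C r \<omega> j"]] show ?thesis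
      unfolding a_def[symmetric] using a by (simp add: abs_mult mult.assoc)
  qed
  have "11 / 10 * l2 * enorm r \<omega> C \<le> 11 / 10 * l2 * (\<Sum>j\<in>UNIV. \<bar>sqrt \<bar>rate r \<omega> j\<bar> * jump C r \<omega> j\<bar>)"
    unfolding enorm_L2_set[OF r0 \<omega>] using l2 by (intro mult_left_mono L2_set_le_sum_abs) auto
  also have "\<dots> \<le> 9 / 10 * (\<Sum>j\<in>UNIV. rate r \<omega> j * \<bar>jump C r \<omega> j\<bar>)"
    unfolding sum_distrib_left by (intro sum_mono term_le)
  finally show ?thesis .
qed

section \<open>Regular versions and Ito integrals\<close>

text \<open>A random variable known at time zero is a function of the initial state, and there are finitely
  many states.\<close>

lemma F_0_bounded:
  fixes f :: "'w \<Rightarrow> real"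
  assumes f: "f \<in> borel_measurable (F 0)"
  shows "\<exists>C. \<forall>\<omega>\<in>space P. \<bar>f \<omega>\<bar> \<le> C"
proof -
  have pre: "\<exists>B. S = X 0 -` B \<inter> space P" if "S \<in> sets (F 0)" for S
    using that unfolding sets_F
  proof induction
    case (Basic a)
    then obtain s B where "0 \<le> s" "s \<le> 0" "a = X s -` B \<inter> space P" by auto
    then show ?case by (intro exI[of _ B]) simp
  next
    case Empty
    show ?case by (intro exI[of _ "{}"]) simp
  next
    case (Compl a)
    then obtain B where "a = X 0 -` B \<inter> space P" by auto
    then show ?case by (intro exI[of _ "- B"]) auto
  next
    case (Union a)
    then obtain B where "\<And>i. a i = X 0 -` B i \<inter> space P" by metis
    then show ?case by (intro exI[of _ "\<Union>i. B i"]) auto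
  qed
  have const: "f \<omega> = f \<omega>'" if \<omega>: "\<omega> \<in> space P" "\<omega>' \<in> space P" "X 0 \<omega> = X 0 \<omega>'" for \<omega> \<omega>'
  proof -
    have "f -` {f \<omega>} \<inter> space P \<in> sets (F 0)" using measurable_sets[OF f, of "{f \<omega>}"] by simp
    from pre[OF this] obtain B where B: "f -` {f \<omega>} \<inter> space P = X 0 -` B \<inter> space P" ..
    have "\<omega> \<in> f -` {f \<omega>} \<inter> space P" using \<omega> by simp
    then have "\<omega> \<in> X 0 -` B \<inter> space P" by (simp only: B)
    then have "\<omega>' \<in> X 0 -` B \<inter> space P" using \<omega> by simp
    then have "\<omega>' \<in> f -` {f \<omega>} \<inter> space P" by (simp only: B)
    then show ?thesis by simp
  qed
  have "finite (f ` space P)"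
  proof (rule finite_subset)
    define g where "g i = f (SOME \<omega>. \<omega> \<in> space P \<and> X 0 \<omega> = axis i 1)" for i
    show "f ` space P \<subseteq> g ` UNIV"
    proof
      fix x assume "x \<in> f ` space P"
      then obtain \<omega> where \<omega>: "\<omega> \<in> space P" "x = f \<omega>" by auto
      obtain i where i: "X 0 \<omega> = axis i 1" using X_axis[OF order_refl \<omega>(1)] .
      have "\<exists>\<omega>. \<omega> \<in> space P \<and> X 0 \<omega> = axis i 1" using \<omega> i by blast
      from someI_ex[OF this] have "g i = f \<omega>" unfolding g_def using \<omega> i by (intro const) auto
      then show "x \<in> g ` UNIV" using \<omega>(2) rangeI[of g i] by simp
    qed
  qed simp
  then have "finite (abs ` f ` space P)" by simp
  then show ?thesis by (intro exI[of _ "Max (abs ` f ` space P)"]) auto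
qed

text \<open>Setting an adapted process to zero on the null set where its paths are irregular destroys
  adaptedness, since the filtration is not completed, but makes it jointly measurable.\<close>

lemma rcll_version:
  fixes Y :: "real \<Rightarrow> 'w \<Rightarrow> real"
  assumes Y: "\<And>t. t \<in> {0..T} \<Longrightarrow> Y t \<in> borel_measurable (F t)"
    and rcll: "AE \<omega> in P. rcll_on {0..T} (\<lambda>t. Y t \<omega>)"
    and fin: "(\<integral>\<^sup>+\<omega>. (\<integral>\<^sup>+s\<in>{0..T}. ennreal (\<bar>Y s \<omega>\<bar>\<^sup>2) \<partial>lborel) \<partial>P) < \<infinity>"
  obtains Yb where "(\<lambda>p. Yb (fst p) (snd p)) \<in> borel_measurable Q"
    "AE \<omega> in P. \<forall>r\<in>{0..T}. Yb r \<omega> = Y r \<omega>" "Q_integrable (\<lambda>r \<omega>. (Yb r \<omega>)\<^sup>2)"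
proof -
  obtain N where N: "N \<in> null_sets P" "{\<omega> \<in> space P. \<not> rcll_on {0..T} (\<lambda>t. Y t \<omega>)} \<subseteq> N"
    using rcll by (auto elim!: AE_E simp: null_sets_def)
  define Yb where "Yb r \<omega> = (if \<omega> \<in> N then 0 else Y r \<omega>)" for r \<omega>
  have meas: "(\<lambda>p. Yb (fst p) (snd p)) \<in> borel_measurable Q"
  proof (rule right_continuous_jointly_measurable)
    fix t assume "t \<in> {0..T}"
    then have "Y t \<in> borel_measurable P" by (rule measurable_F_P[OF Y])
    moreover have "N \<in> sets P" using N(1) by auto
    ultimately show "Yb t \<in> borel_measurable P"
      unfolding Yb_def by (intro measurable_If_set) auto
  next
    fix \<omega> t assume \<omega>: "\<omega> \<in> space P" and t: "t \<in> {0..T}"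
    show "continuous (at t within {0..T} \<inter> {t..}) (\<lambda>t. Yb t \<omega>)"
    proof (cases "\<omega> \<in> N")
      case True
      then show ?thesis by (simp add: Yb_def)
    next
      case False
      then have "rcll_on {0..T} (\<lambda>t. Y t \<omega>)" using N(2) \<omega> by blast
      then show ?thesis using t False by (simp add: Yb_def rcll_on_def)
    qed
  qed (use T_pos in simp)
  have eq: "AE \<omega> in P. \<forall>r\<in>{0..T}. Yb r \<omega> = Y r \<omega>"
    using AE_not_in[OF N(1)] by (rule eventually_mono) (simp add: Yb_def)
  have m2: "(\<lambda>p. ennreal ((Yb (fst p) (snd p))\<^sup>2)) \<in> borel_measurable (L \<Otimes>\<^sub>M P)"
    by (rule measurable_compose[OF borel_measurable_power[OF meas] measurable_ennreal])
  have "(\<integral>\<^sup>+p. ennreal ((Yb (fst p) (snd p))\<^sup>2) \<partial>Q) = (\<integral>\<^sup>+\<omega>. (\<integral>\<^sup>+r. ennreal ((Yb r \<omega>)\<^sup>2) \<partial>L) \<partial>P)"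
    using LP.nn_integral_snd[OF m2] by simp
  also have "\<dots> = (\<integral>\<^sup>+\<omega>. (\<integral>\<^sup>+s\<in>{0..T}. ennreal (\<bar>Y s \<omega>\<bar>\<^sup>2) \<partial>lborel) \<partial>P)"
  proof (rule nn_integral_cong_AE)
    show "AE \<omega> in P. (\<integral>\<^sup>+r. ennreal ((Yb r \<omega>)\<^sup>2) \<partial>L) = (\<integral>\<^sup>+s\<in>{0..T}. ennreal (\<bar>Y s \<omega>\<bar>\<^sup>2) \<partial>lborel)"
      using eq
    proof eventually_elim
      case (elim \<omega>)
      have "(\<integral>\<^sup>+r. ennreal ((Yb r \<omega>)\<^sup>2) \<partial>L) = (\<integral>\<^sup>+s\<in>{0..T}. ennreal ((Yb s \<omega>)\<^sup>2) \<partial>lborel)"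
        by (rule nn_integral_restrict_space) simp
      also have "\<dots> = (\<integral>\<^sup>+s\<in>{0..T}. ennreal (\<bar>Y s \<omega>\<bar>\<^sup>2) \<partial>lborel)"
        using elim by (intro nn_integral_cong) (simp add: indicator_def)
      finally show ?case .
    qed
  qed
  also note fin
  finally have "(\<integral>\<^sup>+p. ennreal (norm ((Yb (fst p) (snd p))\<^sup>2)) \<partial>Q) < \<infinity>" by simp
  then have "Q_integrable (\<lambda>r \<omega>. (Yb r \<omega>)\<^sup>2)"
    using borel_measurable_power[OF meas] by (intro integrableI_bounded)
  then show thesis using that meas eq by blast
qed

lemma identity_predictable: "(\<lambda>p. p) \<in> Q \<rightarrow>\<^sub>M predictable_sigma P F T"
proof -
  have rect: "S \<times> B \<in> sets Q" if "S = {0} \<or> (\<exists>s t. S = {s<..t} \<and> 0 \<le> s \<and> t \<le> T)" "B \<in> sets (F u)" for S B u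
  proof (rule pair_measureI)
    have "S \<in> sets borel" "S \<subseteq> {0..T}" using that(1) T_pos by auto
    then show "S \<in> sets L" by (simp add: sets_restrict_space_iff)
    show "B \<in> sets P" using that(2) subalgebra_F[of u] unfolding subalgebra_def by auto
  qed
  show ?thesis
    unfolding predictable_sigma_def
  proof (rule measurable_measure_of)
    show "{{0} \<times> B | B. B \<in> sets (F 0)} \<union> {{s<..t} \<times> B | s t B. 0 \<le> s \<and> s \<le> t \<and> t \<le> T \<and> B \<in> sets (F s)}
        \<subseteq> Pow ({0..T} \<times> space P)"
      using T_pos sets.sets_into_space[where M = "F _"] by fastforce
    show "(\<lambda>p. p) \<in> space Q \<rightarrow> {0..T} \<times> space P" by (simp add: space_Q)
    fix S assume "S \<in> {{0} \<times> B | B. B \<in> sets (F 0)} \<union> {{s<..t} \<times> B | s t B. 0 \<le> s \<and> s \<le> t \<and> t \<le> T \<and> B \<in> sets (F s)}"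
    then have "S \<in> sets Q" using rect by blast
    then show "(\<lambda>p. p) -` S \<inter> space Q \<in> sets Q" by (simp add: sets.Int)
  qed
qed

lemma predictable_Q:
  assumes "predictable_process P F T Z"
  shows "(\<lambda>p. Z (fst p) (snd p)) \<in> borel_measurable Q"
proof -
  have "(\<lambda>(t, \<omega>). Z t \<omega>) \<in> borel_measurable (predictable_sigma P F T)"
    using assms by (simp add: predictable_process_def)
  with identity_predictable have "(\<lambda>p. (\<lambda>(t, \<omega>). Z t \<omega>) p) \<in> borel_measurable Q" by (rule measurable_compose)
  then show ?thesis by (simp add: case_prod_beta')
qed

text \<open>The mean energy is an integral over \<open>Q\<close>, by Tonelli.\<close>

lemma mean_energy_eq:
  assumes "(\<lambda>p. Z (fst p) (snd p)) \<in> borel_measurable Q"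
  shows "mean_energy P X A T Z = (\<integral>\<^sup>+p. ennreal (energy (fst p) (snd p) (Z (fst p) (snd p))) \<partial>Q)"
proof -
  have m: "(\<lambda>p. ennreal (energy (fst p) (snd p) (Z (fst p) (snd p)))) \<in> borel_measurable (L \<Otimes>\<^sub>M P)"
    by (rule measurable_compose[OF energy_Q[OF assms] measurable_ennreal])
  have "(\<integral>\<^sup>+s\<in>{0..T}. ennreal ((chain_seminorm X A s \<omega> (Z s \<omega>))\<^sup>2) \<partial>lborel)
      = (\<integral>\<^sup>+r. ennreal (energy r \<omega> (Z r \<omega>)) \<partial>L)" if \<omega>: "\<omega> \<in> space P" for \<omega>
  proof -
    have "(\<integral>\<^sup>+s\<in>{0..T}. ennreal ((chain_seminorm X A s \<omega> (Z s \<omega>))\<^sup>2) \<partial>lborel)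
        = (\<integral>\<^sup>+s\<in>{0..T}. ennreal (energy s \<omega> (Z s \<omega>)) \<partial>lborel)"
      using \<omega> energy_nonneg by (intro nn_integral_cong) (simp add: indicator_def chain_seminorm_eq)
    also have "\<dots> = (\<integral>\<^sup>+r. ennreal (energy r \<omega> (Z r \<omega>)) \<partial>L)"
      by (rule nn_integral_restrict_space[symmetric]) simp
    finally show ?thesis .
  qed
  then have "mean_energy P X A T Z = (\<integral>\<^sup>+\<omega>. (\<integral>\<^sup>+r. ennreal (energy r \<omega> (Z r \<omega>)) \<partial>L) \<partial>P)"
    unfolding mean_energy_def by (intro nn_integral_cong) simp
  also have "\<dots> = (\<integral>\<^sup>+p. ennreal (energy (fst p) (snd p) (Z (fst p) (snd p))) \<partial>Q)"
    using LP.nn_integral_snd[OF m] by simp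
  finally show ?thesis .
qed

lemma mean_energy_Q_integrable:
  assumes Z: "(\<lambda>p. Z (fst p) (snd p)) \<in> borel_measurable Q" and fin: "mean_energy P X A T Z < \<infinity>"
  shows "Q_integrable (\<lambda>r \<omega>. energy r \<omega> (Z r \<omega>))"
proof (rule integrableI_bounded[OF energy_Q[OF Z]])
  have "(\<integral>\<^sup>+p. ennreal (norm (energy (fst p) (snd p) (Z (fst p) (snd p)))) \<partial>Q)
      = (\<integral>\<^sup>+p. ennreal (energy (fst p) (snd p) (Z (fst p) (snd p))) \<partial>Q)"
    using energy_nonneg by (intro nn_integral_cong) (auto simp: space_Q)
  then show "(\<integral>\<^sup>+p. ennreal (norm (energy (fst p) (snd p) (Z (fst p) (snd p)))) \<partial>Q) < \<infinity>"
    using fin unfolding mean_energy_eq[OF Z] by simp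
qed

lemma stint_le_mean_energy:
  assumes Z: "(\<lambda>p. Z (fst p) (snd p)) \<in> borel_measurable Q"
    and s: "Q_integrable (\<lambda>r \<omega>. energy r \<omega> (Z r \<omega>))"
  shows "ennreal (stint 0 T (\<lambda>r \<omega>. energy r \<omega> (Z r \<omega>))) \<le> mean_energy P X A T Z"
proof -
  have nn: "0 \<le> energy (fst p) (snd p) (Z (fst p) (snd p))" if "p \<in> space Q" for p
    using that energy_nonneg by (auto simp: space_Q)
  have "stint 0 T (\<lambda>r \<omega>. energy r \<omega> (Z r \<omega>)) \<le> (\<integral>p. energy (fst p) (snd p) (Z (fst p) (snd p)) \<partial>Q)"
    unfolding stint_def using nn
    by (intro Bochner_Integration.integral_mono[OF Q_integrable_indicator[OF s] s]) (simp add: indicator_def)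
  then have "ennreal (stint 0 T (\<lambda>r \<omega>. energy r \<omega> (Z r \<omega>)))
      \<le> ennreal (\<integral>p. energy (fst p) (snd p) (Z (fst p) (snd p)) \<partial>Q)" by (rule ennreal_leI)
  also have "\<dots> = mean_energy P X A T Z"
    unfolding mean_energy_eq[OF Z] using nn by (intro nn_integral_eq_integral[symmetric] s AE_I2)
  finally show ?thesis .
qed

text \<open>On an interval \<open>(u, v]\<close> without grid points inside, the elementary process has the constant value that
  it takes at \<open>v\<close>, and that value is known at time \<open>u\<close>.\<close>

lemma elementary_data_pair:
  assumes data: "elementary_data F T n p \<zeta>"
  shows "elementary_pair (elementary_process n p \<zeta>) (elementary_integral M n p \<zeta>)"
proof -
  have p0: "0 \<le> p 0" and pn: "p n \<le> T" and step: "\<And>k. k < n \<Longrightarrow> p k \<le> p (Suc k)"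
    and \<zeta>: "\<And>k. k < n \<Longrightarrow> \<zeta> k \<in> borel_measurable (F (p k))"
    and "\<forall>k. \<exists>c. k < n \<longrightarrow> (\<forall>\<omega>\<in>space P. norm (\<zeta> k \<omega>) \<le> c)"
    using data unfolding elementary_data_def space_F by blast+
  then obtain b where b: "\<And>k \<omega>. k < n \<Longrightarrow> \<omega> \<in> space P \<Longrightarrow> norm (\<zeta> k \<omega>) \<le> b k" by metis
  have p_nonneg: "0 \<le> p k" if "k \<le> n" for k
    using that
  proof (induction k)
    case (Suc k)
    then show ?case using step[of k] by simp
  qed (rule p0)
  define B where "B = (\<Sum>k<n. \<bar>b k\<bar>)"
  let ?Z = "elementary_process n p \<zeta>" and ?J = "elementary_integral M n p \<zeta>"
  have Z_le: "norm (?Z t \<omega>) \<le> B" if \<omega>: "\<omega> \<in> space P" for t \<omega>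
    unfolding elementary_process_def B_def
  proof (rule order_trans[OF norm_sum sum_mono])
    fix k assume "k \<in> {..<n}"
    then have "norm (\<zeta> k \<omega>) \<le> \<bar>b k\<bar>" using b[of k \<omega>] \<omega> by auto
    then show "norm (indicat_real {p k<..p (Suc k)} t *\<^sub>R \<zeta> k \<omega>) \<le> \<bar>b k\<bar>" by (simp add: indicator_def)
  qed
  have Z_Q: "(\<lambda>q. ?Z (fst q) (snd q)) \<in> borel_measurable Q"
    unfolding elementary_process_def
  proof (rule borel_measurable_sum)
    fix k assume "k \<in> {..<n}"
    then show "(\<lambda>q. indicat_real {p k<..p (Suc k)} (fst q) *\<^sub>R \<zeta> k (snd q)) \<in> borel_measurable Q"
      by (intro borel_measurable_scaleR indicator_Q measurable_compose[OF measurable_snd measurable_F_P[OF \<zeta>]]) simp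
  qed
  have J0: "?J 0 \<omega> = 0" for \<omega>
    unfolding elementary_integral_def using p_nonneg by (intro sum.neutral) simp
  have const: "constant_integrand_on u v B ?Z ?J"
    if uv: "0 \<le> u" "u \<le> v" "v \<le> T" "p ` {..n} \<inter> {u<..<v} = {}" for u v
  proof -
    have gap: "p k \<le> u \<or> v \<le> p k" if "k \<le> n" for k
    proof -
      have "p k \<notin> {u<..<v}" using uv(4) that by blast
      then show ?thesis by auto
    qed
    have meas: "?Z v \<in> borel_measurable (F u)"
      unfolding elementary_process_def
    proof (rule borel_measurable_sum)
      fix k assume k: "k \<in> {..<n}"
      show "(\<lambda>\<omega>. indicat_real {p k<..p (Suc k)} v *\<^sub>R \<zeta> k \<omega>) \<in> borel_measurable (F u)"
      proof (cases "v \<in> {p k<..p (Suc k)}")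
        case True
        then have "p k \<le> u" using gap[of k] k by auto
        then have "\<zeta> k \<in> borel_measurable (F u)" using measurable_F_mono[OF \<zeta>] k by auto
        then show ?thesis using True by simp
      qed simp
    qed
    have "?Z r \<omega> = ?Z v \<omega>" if r: "u < r" "r \<le> v" for r \<omega>
      unfolding elementary_process_def
    proof (rule sum.cong[OF refl])
      fix k assume "k \<in> {..<n}"
      then show "indicat_real {p k<..p (Suc k)} r *\<^sub>R \<zeta> k \<omega> = indicat_real {p k<..p (Suc k)} v *\<^sub>R \<zeta> k \<omega>"
        using gap[of k] gap[of "Suc k"] r by (auto simp: indicator_def)
    qed
    moreover have "?J v \<omega> - ?J u \<omega> = ?Z v \<omega> \<bullet> (M v \<omega> - M u \<omega>)" for \<omega>
    proof (cases "u = v")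
      case False
      then have lt: "u < v" using uv by simp
      show ?thesis
        unfolding elementary_integral_def elementary_process_def inner_sum_left sum_subtractf[symmetric]
      proof (rule sum.cong[OF refl])
        fix k assume "k \<in> {..<n}"
        then have k: "p k \<le> u \<or> v \<le> p k" "p (Suc k) \<le> u \<or> v \<le> p (Suc k)" "p k \<le> p (Suc k)"
          using gap[of k] gap[of "Suc k"] step[of k] by auto
        consider "v \<le> p k" | "p k \<le> u" "p (Suc k) \<le> u" | "p k \<le> u" "v \<le> p (Suc k)" using k by blast
        then show "\<zeta> k \<omega> \<bullet> (M (min v (p (Suc k))) \<omega> - M (min v (p k)) \<omega>)
            - \<zeta> k \<omega> \<bullet> (M (min u (p (Suc k))) \<omega> - M (min u (p k)) \<omega>)
            = indicat_real {p k<..p (Suc k)} v *\<^sub>R \<zeta> k \<omega> \<bullet> (M v \<omega> - M u \<omega>)"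
        proof cases
          case 1
          then show ?thesis using k lt by (simp add: min_def)
        next
          case 2
          then show ?thesis using lt by (simp add: min_def)
        next
          case 3
          then have "min v (p (Suc k)) = v" "min v (p k) = p k" "min u (p (Suc k)) = u" "min u (p k) = p k"
            using lt by auto
          then show ?thesis using 3 lt by (simp add: inner_diff_right)
        qed
      qed
    qed simp
    ultimately show ?thesis
      unfolding constant_integrand_on_def using meas Z_le by blast
  qed
  have "finite (p ` {..n})" by simp
  moreover have "\<forall>r\<in>{0..T}. \<forall>\<omega>\<in>space P. norm (?Z r \<omega>) \<le> B" using Z_le by blast
  moreover have "\<forall>u v. 0 \<le> u \<longrightarrow> u \<le> v \<longrightarrow> v \<le> T \<longrightarrow> p ` {..n} \<inter> {u<..<v} = {} \<longrightarrow> constant_integrand_on u v B ?Z ?J"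
    using const by blast
  ultimately show ?thesis
    unfolding elementary_pair_def using Z_Q J0 by blast
qed

lemma stochastic_integral_process:
  assumes I: "is_stochastic_integral P X A T Z I" and Z: "predictable_process P F T Z"
    and fin: "mean_energy P X A T Z < \<infinity>"
  shows "integral_process Z I"
proof -
  obtain n p \<zeta> where I_meas: "\<And>t. t \<in> {0..T} \<Longrightarrow> I t \<in> borel_measurable P"
    and data: "\<And>j. elementary_data F T (n j) (p j) (\<zeta> j)"
    and lim: "(\<lambda>j. mean_energy P X A T (\<lambda>t \<omega>. elementary_process (n j) (p j) (\<zeta> j) t \<omega> - Z t \<omega>)) \<longlonglongrightarrow> 0"
    and limI: "\<And>t. t \<in> {0..T} \<Longrightarrow> (\<lambda>j. \<integral>\<^sup>+\<omega>. ennreal ((elementary_integral M (n j) (p j) (\<zeta> j) t \<omega> - I t \<omega>)\<^sup>2) \<partial>P) \<longlonglongrightarrow> 0"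
    using I unfolding is_stochastic_integral_def by blast
  let ?Z = "\<lambda>j. elementary_process (n j) (p j) (\<zeta> j)" and ?J = "\<lambda>j. elementary_integral M (n j) (p j) (\<zeta> j)"
  have el: "elementary_pair (?Z j) (?J j)" for j by (rule elementary_data_pair[OF data])
  note ZQ = predictable_Q[OF Z]
  note Zs = mean_energy_Q_integrable[OF ZQ fin]
  have elQ: "(\<lambda>q. ?Z j (fst q) (snd q)) \<in> borel_measurable Q" for j
    using el[of j] unfolding elementary_pair_def by blast
  have ds: "Q_integrable (\<lambda>r \<omega>. energy r \<omega> (?Z j r \<omega> - Z r \<omega>))" for j
    by (rule energy_Q_integrable_diff[OF elementary_energy_Q_integrable[OF el] Zs elQ ZQ])
  have real_lim: "x \<longlonglongrightarrow> 0" if "\<And>j. 0 \<le> x j" "\<And>j. ennreal (x j) \<le> w j" "w \<longlonglongrightarrow> 0" for x :: "nat \<Rightarrow> real" and w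
  proof -
    have "(\<lambda>j. ennreal (x j)) \<longlonglongrightarrow> 0"
      by (rule tendsto_sandwich[OF always_eventually always_eventually tendsto_const that(3)]) (use that(2) in auto)
    then have "(\<lambda>j. ennreal (x j)) \<longlonglongrightarrow> ennreal 0" by simp
    then show ?thesis using that(1) by (subst (asm) tendsto_ennreal_iff) auto
  qed
  have lim1: "(\<lambda>j. stint 0 T (\<lambda>r \<omega>. energy r \<omega> (?Z j r \<omega> - Z r \<omega>))) \<longlonglongrightarrow> 0"
  proof (rule real_lim[OF _ _ lim])
    show "0 \<le> stint 0 T (\<lambda>r \<omega>. energy r \<omega> (?Z j r \<omega> - Z r \<omega>))" for j
      using energy_nonneg by (intro stint_nonneg) auto
    show "ennreal (stint 0 T (\<lambda>r \<omega>. energy r \<omega> (?Z j r \<omega> - Z r \<omega>))) \<le> mean_energy P X A T (\<lambda>t \<omega>. ?Z j t \<omega> - Z t \<omega>)" for j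
      by (rule stint_le_mean_energy[OF borel_measurable_diff[OF elQ ZQ] ds])
  qed
  have I_sq: "sq_int (I t)" if t: "t \<in> {0..T}" for t
  proof -
    have "\<forall>\<^sub>F j in sequentially. (\<integral>\<^sup>+\<omega>. ennreal ((?J j t \<omega> - I t \<omega>)\<^sup>2) \<partial>P) < 1"
      using limI[OF t] by (rule order_tendstoD) simp
    then obtain j where j: "(\<integral>\<^sup>+\<omega>. ennreal ((?J j t \<omega> - I t \<omega>)\<^sup>2) \<partial>P) < 1"
      by (auto simp: eventually_sequentially)
    have Jsq: "sq_int (?J j t)" by (rule elementary_sq_int[OF el t])
    have m: "(\<lambda>\<omega>. ?J j t \<omega> - I t \<omega>) \<in> borel_measurable P" using Jsq I_meas[OF t] by (intro borel_measurable_diff) auto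
    have "integrable P (\<lambda>\<omega>. (?J j t \<omega> - I t \<omega>)\<^sup>2)"
    proof (rule integrableI_bounded)
      show "(\<integral>\<^sup>+\<omega>. ennreal (norm ((?J j t \<omega> - I t \<omega>)\<^sup>2)) \<partial>P) < \<infinity>"
        using order_less_trans[OF j ennreal_one_less_top] by simp
    qed (intro borel_measurable_power m)
    then have "sq_int (\<lambda>\<omega>. ?J j t \<omega> - I t \<omega>)" using m by simp
    from sq_int_diff[OF Jsq this] show ?thesis by simp
  qed
  have lim2: "(\<lambda>j. expectation (\<lambda>\<omega>. (?J j t \<omega> - I t \<omega>)\<^sup>2)) \<longlonglongrightarrow> 0" if t: "t \<in> {0..T}" for t
  proof (rule real_lim[OF _ _ limI[OF t]])
    show "ennreal (expectation (\<lambda>\<omega>. (?J j t \<omega> - I t \<omega>)\<^sup>2)) \<le> (\<integral>\<^sup>+\<omega>. ennreal ((?J j t \<omega> - I t \<omega>)\<^sup>2) \<partial>P)" for j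
    proof -
      have "sq_int (\<lambda>\<omega>. ?J j t \<omega> - I t \<omega>)" by (rule sq_int_diff[OF elementary_sq_int[OF el t] I_sq[OF t]])
      then show ?thesis by (subst nn_integral_eq_integral) auto
    qed
  qed simp
  have "\<exists>\<zeta> J. (\<forall>j::nat. elementary_pair (\<zeta> j) (J j)) \<and>
        (\<lambda>j. stint 0 T (\<lambda>r \<omega>. energy r \<omega> (\<zeta> j r \<omega> - Z r \<omega>))) \<longlonglongrightarrow> 0 \<and>
        (\<forall>t\<in>{0..T}. (\<lambda>j. expectation (\<lambda>\<omega>. (J j t \<omega> - I t \<omega>)\<^sup>2)) \<longlonglongrightarrow> 0)"
    using el lim1 lim2 by (intro exI[of _ ?Z] exI[of _ ?J]) blast
  then show ?thesis
    unfolding integral_process_def using ZQ Zs I_sq by blast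
qed

lemma rcll_nonpos_everywhere:
  fixes g :: "real \<Rightarrow> real"
  assumes cont: "\<And>t. t \<in> {0..T} \<Longrightarrow> continuous (at t within ({0..T} \<inter> {t..})) g"
    and rat: "\<And>q. q \<in> \<rat> \<Longrightarrow> q \<in> {0..T} \<Longrightarrow> g q \<le> 0" and last: "g T \<le> 0" and t: "t \<in> {0..T}"
  shows "g t \<le> 0"
proof (rule ccontr)
  assume "\<not> g t \<le> 0"
  then have pos: "0 < g t" by simp
  then have "t \<noteq> T" using last by auto
  then have tT: "t < T" using t by simp
  obtain d where d: "0 < d" "\<And>s. s \<in> {0..T} \<inter> {t..} \<Longrightarrow> dist s t < d \<Longrightarrow> dist (g s) (g t) < g t"
    using cont[OF t] pos unfolding continuous_within_eps_delta by metis
  obtain q where q: "q \<in> \<rat>" "t < q" "q < min T (t + d)"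
    using Rats_dense_in_real[of t "min T (t + d)"] tT d by auto
  then have "dist (g q) (g t) < g t" using t by (intro d(2)) (auto simp: dist_real_def)
  moreover have "g q \<le> 0" using q t by (intro rat) auto
  ultimately show False by (simp add: dist_real_def)
qed

lemma LINT_tail_eq:
  fixes g :: "real \<Rightarrow> real"
  assumes t: "t \<in> {0..T}" and g: "set_integrable lborel {0..T} g"
  shows "(LINT s:{t..T}|lborel. g s) = (\<integral>r. indicator {t<..T} r * g r \<partial>L)"
proof -
  have gt: "set_integrable lborel {t..T} g" using t by (intro set_integrable_subset[OF g]) auto
  have gt': "set_integrable lborel {t<..T} g" using t by (intro set_integrable_subset[OF g]) auto
  have "(LINT s:{t..T}|lborel. g s) = (\<integral>r. indicator {t<..T} r *\<^sub>R g r \<partial>lborel)"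
    unfolding set_lebesgue_integral_def
  proof (rule integral_cong_AE)
    show "AE s in lborel. indicator {t..T} s *\<^sub>R g s = indicator {t<..T} s *\<^sub>R g s"
      using AE_lborel_singleton[of t] by (rule eventually_mono) (auto simp: indicator_def)
  qed (use gt gt' in \<open>auto simp: set_integrable_def intro: borel_measurable_integrable\<close>)
  also have "\<dots> = (\<integral>r. indicator {0..T} r *\<^sub>R (indicator {t<..T} r * g r) \<partial>lborel)"
    using t by (intro Bochner_Integration.integral_cong) (auto simp: indicator_def)
  also have "\<dots> = (\<integral>r. indicator {t<..T} r * g r \<partial>L)"
    by (rule integral_restrict_space[symmetric]) simp
  finally show ?thesis .
qed

section \<open>Comparison of backward equations\<close>

lemma AE_L_iff: "(AE r in L. R r) \<longleftrightarrow> (AE r in lborel. r \<in> {0..T} \<longrightarrow> R r)"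
  by (rule AE_restrict_space_iff) simp

lemma bsde_increments:
  assumes sol: "bsde_solution P X A T f \<xi> Y Z"
  obtains I where "integral_process Z I" "AE \<omega> in P. Y T \<omega> = \<xi> \<omega>"
    "AE \<omega> in P. \<forall>a b. 0 \<le> a \<longrightarrow> a \<le> b \<longrightarrow> b \<le> T \<longrightarrow>
      integrable L (\<lambda>r. indicator {a<..b} r * f \<omega> r (Y r \<omega>) (Z r \<omega>)) \<and>
      Y b \<omega> = Y a \<omega> - (\<integral>r. indicator {a<..b} r * f \<omega> r (Y r \<omega>) (Z r \<omega>) \<partial>L) + (I b \<omega> - I a \<omega>)"
proof -
  obtain I where I: "is_stochastic_integral P X A T Z I"
    and eq: "AE \<omega> in P. \<forall>t\<in>{0..T}. Y t \<omega> = \<xi> \<omega> + (LINT s:{t..T}|lborel. f \<omega> s (Y s \<omega>) (Z s \<omega>)) - (I T \<omega> - I t \<omega>)"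
    using sol unfolding bsde_solution_def by blast
  have int: "AE \<omega> in P. set_integrable lborel {0..T} (\<lambda>s. f \<omega> s (Y s \<omega>) (Z s \<omega>))"
    and pred: "predictable_process P F T Z" and fin: "mean_energy P X A T Z < \<infinity>"
    using sol unfolding bsde_solution_def by blast+
  have TT: "T \<in> {0..T}" using T_pos by auto
  show thesis
  proof
    show "integral_process Z I" by (rule stochastic_integral_process[OF I pred fin])
    show "AE \<omega> in P. Y T \<omega> = \<xi> \<omega>"
      using eq int
    proof eventually_elim
      case (elim \<omega>)
      have "(LINT s:{T..T}|lborel. f \<omega> s (Y s \<omega>) (Z s \<omega>)) = (\<integral>r. indicator {T<..T} r * f \<omega> r (Y r \<omega>) (Z r \<omega>) \<partial>L)"
        by (rule LINT_tail_eq[OF TT elim(2)])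
      also have "\<dots> = 0" by simp
      finally show ?case using elim(1) TT by simp
    qed
    show "AE \<omega> in P. \<forall>a b. 0 \<le> a \<longrightarrow> a \<le> b \<longrightarrow> b \<le> T \<longrightarrow>
      integrable L (\<lambda>r. indicator {a<..b} r * f \<omega> r (Y r \<omega>) (Z r \<omega>)) \<and>
      Y b \<omega> = Y a \<omega> - (\<integral>r. indicator {a<..b} r * f \<omega> r (Y r \<omega>) (Z r \<omega>) \<partial>L) + (I b \<omega> - I a \<omega>)"
      using eq int
    proof eventually_elim
      case (elim \<omega>)
      let ?g = "\<lambda>r. f \<omega> r (Y r \<omega>) (Z r \<omega>)"
      have gL: "integrable L ?g"
        using elim(2) by (simp add: integrable_restrict_space set_integrable_def)
      have gi: "integrable L (\<lambda>r. indicator {a<..b} r * ?g r)" for a b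
        by (rule Bochner_Integration.integrable_bound[OF gL])
          (use gL indicator_L in \<open>auto simp: indicator_def intro!: borel_measurable_times\<close>)
      show ?case
      proof (intro allI impI conjI gi)
        fix a b assume ab: "0 \<le> a" "a \<le> b" "b \<le> T"
        then have a: "a \<in> {0..T}" and b: "b \<in> {0..T}" by auto
        have "(\<integral>r. indicator {a<..T} r * ?g r \<partial>L) = (\<integral>r. indicator {a<..b} r * ?g r + indicator {b<..T} r * ?g r \<partial>L)"
          using ab by (intro Bochner_Integration.integral_cong) (auto simp: indicator_def)
        then have split: "(\<integral>r. indicator {a<..T} r * ?g r \<partial>L)
            = (\<integral>r. indicator {a<..b} r * ?g r \<partial>L) + (\<integral>r. indicator {b<..T} r * ?g r \<partial>L)"
          by (simp add: gi)
        have "Y a \<omega> = \<xi> \<omega> + (\<integral>r. indicator {a<..T} r * ?g r \<partial>L) - (I T \<omega> - I a \<omega>)"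
          using elim(1) a unfolding LINT_tail_eq[OF a elim(2), symmetric] by blast
        moreover have "Y b \<omega> = \<xi> \<omega> + (\<integral>r. indicator {b<..T} r * ?g r \<partial>L) - (I T \<omega> - I b \<omega>)"
          using elim(1) b unfolding LINT_tail_eq[OF b elim(2), symmetric] by blast
        ultimately show "Y b \<omega> = Y a \<omega> - (\<integral>r. indicator {a<..b} r * ?g r \<partial>L) + (I b \<omega> - I a \<omega>)"
          using split by linarith
      qed
    qed
  qed
qed

text \<open>The difference of the two solutions is a process with a one-sided drift bound: the Lipschitz
  condition compares the drivers at the two solutions, and the sign condition at the second one
  can be dropped.\<close>

lemma bsde_difference:
  assumes sol1: "bsde_solution P X A T f1 \<xi>1 Y1 Z1" and sol2: "bsde_solution P X A T f2 \<xi>2 Y2 Z2"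
    and xi1: "integrable P (\<lambda>\<omega>. \<bar>\<xi>1 \<omega>\<bar>\<^sup>2)" and xi2: "integrable P (\<lambda>\<omega>. \<bar>\<xi>2 \<omega>\<bar>\<^sup>2)"
    and m: "0 < m" "\<And>t. t \<in> {0..T} \<Longrightarrow> frob_norm (A t) \<le> m"
    and l: "0 < l1" "0 < l2"
    and lipschitz: "AE \<omega> in P. \<forall>t\<in>{0..T}. \<forall>y1 y2 z1 z2.
          \<bar>f1 \<omega> t y1 z1 - f1 \<omega> t y2 z2\<bar> \<le> l1 * \<bar>y1 - y2\<bar> + l2 * chain_seminorm X A t \<omega> (z1 - z2)"
    and small: "AE \<omega> in P. \<forall>t\<in>{0..T}. l2 * frob_norm (pseudoinverse (Psi X A t \<omega>)) * sqrt (6 * m) \<le> 1"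
    and xi_le: "AE \<omega> in P. \<xi>1 \<omega> \<le> \<xi>2 \<omega>"
    and f_le: "AE \<omega> in P. AE t in lborel. t \<in> {0..T} \<longrightarrow>
          f1 \<omega> t (Y2 t \<omega>) (Z2 t \<omega>) \<le> f2 \<omega> t (Y2 t \<omega>) (Z2 t \<omega>)"
  obtains yb I where
    "dominated_drift P X A T c (\<lambda>t \<omega>. Y1 t \<omega> - Y2 t \<omega>) yb (\<lambda>r \<omega>. Z1 r \<omega> - Z2 r \<omega>) I l1 l2"
    "AE \<omega> in P. integrable L (\<lambda>r. indicator {0<..T} r * (f1 \<omega> r (Y1 r \<omega>) (Z1 r \<omega>) - f2 \<omega> r (Y2 r \<omega>) (Z2 r \<omega>))) \<and>
      (Y1 T \<omega> - Y2 T \<omega>) - (Y1 0 \<omega> - Y2 0 \<omega>)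
        = - (\<integral>r. indicator {0<..T} r * (f1 \<omega> r (Y1 r \<omega>) (Z1 r \<omega>) - f2 \<omega> r (Y2 r \<omega>) (Z2 r \<omega>)) \<partial>L) + (I T \<omega> - I 0 \<omega>)"
    "AE \<omega> in P. AE r in L. f1 \<omega> r (Y1 r \<omega>) (Z1 r \<omega>) - f2 \<omega> r (Y2 r \<omega>) (Z2 r \<omega>)
        \<le> l1 * \<bar>yb r \<omega>\<bar> + l2 * sqrt (energy r \<omega> (Z1 r \<omega> - Z2 r \<omega>)) \<and>
      \<bar>f1 \<omega> r (Y1 r \<omega>) (Z1 r \<omega>) - f1 \<omega> r (Y2 r \<omega>) (Z2 r \<omega>)\<bar>
        \<le> l1 * \<bar>yb r \<omega>\<bar> + l2 * sqrt (energy r \<omega> (Z1 r \<omega> - Z2 r \<omega>))"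
    "AE \<omega> in P. Y1 T \<omega> - Y2 T \<omega> = \<xi>1 \<omega> - \<xi>2 \<omega>"
proof -
  have T0: "0 \<in> {0..T}" and TT: "T \<in> {0..T}" using T_pos by auto
  have Y1: "\<And>t. t \<in> {0..T} \<Longrightarrow> Y1 t \<in> borel_measurable (F t)" "AE \<omega> in P. rcll_on {0..T} (\<lambda>t. Y1 t \<omega>)"
    "(\<integral>\<^sup>+\<omega>. (\<integral>\<^sup>+s\<in>{0..T}. ennreal (\<bar>Y1 s \<omega>\<bar>\<^sup>2) \<partial>lborel) \<partial>P) < \<infinity>"
    using sol1 unfolding bsde_solution_def by blast+
  have Y2: "\<And>t. t \<in> {0..T} \<Longrightarrow> Y2 t \<in> borel_measurable (F t)" "AE \<omega> in P. rcll_on {0..T} (\<lambda>t. Y2 t \<omega>)"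
    "(\<integral>\<^sup>+\<omega>. (\<integral>\<^sup>+s\<in>{0..T}. ennreal (\<bar>Y2 s \<omega>\<bar>\<^sup>2) \<partial>lborel) \<partial>P) < \<infinity>"
    using sol2 unfolding bsde_solution_def by blast+
  obtain Yb1 where Yb1: "(\<lambda>p. Yb1 (fst p) (snd p)) \<in> borel_measurable Q"
    "AE \<omega> in P. \<forall>r\<in>{0..T}. Yb1 r \<omega> = Y1 r \<omega>" "Q_integrable (\<lambda>r \<omega>. (Yb1 r \<omega>)\<^sup>2)"
    using rcll_version[OF Y1] .
  obtain Yb2 where Yb2: "(\<lambda>p. Yb2 (fst p) (snd p)) \<in> borel_measurable Q"
    "AE \<omega> in P. \<forall>r\<in>{0..T}. Yb2 r \<omega> = Y2 r \<omega>" "Q_integrable (\<lambda>r \<omega>. (Yb2 r \<omega>)\<^sup>2)"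
    using rcll_version[OF Y2] .
  obtain I1 where I1: "integral_process Z1 I1" "AE \<omega> in P. Y1 T \<omega> = \<xi>1 \<omega>"
    "AE \<omega> in P. \<forall>a b. 0 \<le> a \<longrightarrow> a \<le> b \<longrightarrow> b \<le> T \<longrightarrow>
      integrable L (\<lambda>r. indicator {a<..b} r * f1 \<omega> r (Y1 r \<omega>) (Z1 r \<omega>)) \<and>
      Y1 b \<omega> = Y1 a \<omega> - (\<integral>r. indicator {a<..b} r * f1 \<omega> r (Y1 r \<omega>) (Z1 r \<omega>) \<partial>L) + (I1 b \<omega> - I1 a \<omega>)"
    using bsde_increments[OF sol1] .
  obtain I2 where I2: "integral_process Z2 I2" "AE \<omega> in P. Y2 T \<omega> = \<xi>2 \<omega>"
    "AE \<omega> in P. \<forall>a b. 0 \<le> a \<longrightarrow> a \<le> b \<longrightarrow> b \<le> T \<longrightarrow>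
      integrable L (\<lambda>r. indicator {a<..b} r * f2 \<omega> r (Y2 r \<omega>) (Z2 r \<omega>)) \<and>
      Y2 b \<omega> = Y2 a \<omega> - (\<integral>r. indicator {a<..b} r * f2 \<omega> r (Y2 r \<omega>) (Z2 r \<omega>) \<partial>L) + (I2 b \<omega> - I2 a \<omega>)"
    using bsde_increments[OF sol2] .
  define yb where "yb r \<omega> = Yb1 r \<omega> - Yb2 r \<omega>" for r \<omega>
  define I where "I t \<omega> = I1 t \<omega> - I2 t \<omega>" for t \<omega>
  define z where "z r \<omega> = Z1 r \<omega> - Z2 r \<omega>" for r \<omega>
  define g where "g r \<omega> = f1 \<omega> r (Y1 r \<omega>) (Z1 r \<omega>) - f2 \<omega> r (Y2 r \<omega>) (Z2 r \<omega>)" for r \<omega>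
  define h where "h r \<omega> = l1 * \<bar>yb r \<omega>\<bar> + l2 * sqrt (energy r \<omega> (z r \<omega>))" for r \<omega>
  have I: "integral_process z I"
    using integral_process_diff[OF I1(1) I2(1)] unfolding z_def[abs_def] I_def[abs_def] .
  have yb_Q: "(\<lambda>p. yb (fst p) (snd p)) \<in> borel_measurable Q"
    unfolding yb_def by (rule borel_measurable_diff[OF Yb1(1) Yb2(1)])
  have yb_eq: "AE \<omega> in P. \<forall>r\<in>{0..T}. yb r \<omega> = Y1 r \<omega> - Y2 r \<omega>"
    using Yb1(2) Yb2(2) by eventually_elim (simp add: yb_def)
  have yb_sq: "Q_integrable (\<lambda>r \<omega>. (yb r \<omega>)\<^sup>2)"
  proof (rule Q_integrable_bounded[where f = "\<lambda>r \<omega>. 2 * (Yb1 r \<omega>)\<^sup>2 + 2 * (Yb2 r \<omega>)\<^sup>2" and K = 1])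
    show "Q_integrable (\<lambda>r \<omega>. 2 * (Yb1 r \<omega>)\<^sup>2 + 2 * (Yb2 r \<omega>)\<^sup>2)" using Yb1(3) Yb2(3) by simp
    show "(\<lambda>p. (yb (fst p) (snd p))\<^sup>2) \<in> borel_measurable Q" by (rule borel_measurable_power[OF yb_Q])
    show "\<bar>(yb r \<omega>)\<^sup>2\<bar> \<le> 1 * \<bar>2 * (Yb1 r \<omega>)\<^sup>2 + 2 * (Yb2 r \<omega>)\<^sup>2\<bar>" for r \<omega>
      using square_diff_le[of "Yb1 r \<omega>" "Yb2 r \<omega>"] by (simp add: yb_def)
  qed
  have z_Q: "(\<lambda>p. z (fst p) (snd p)) \<in> borel_measurable Q" and z_Q_integrable: "Q_integrable (\<lambda>r \<omega>. energy r \<omega> (z r \<omega>))"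
    using I unfolding integral_process_def by blast+
  have h_Q_integrable: "Q_integrable h"
  proof (rule Q_integrable_bounded[where f = "\<lambda>r \<omega>. l1 * (1 + (yb r \<omega>)\<^sup>2) + l2 * (1 + energy r \<omega> (z r \<omega>))" and K = 1])
    show "Q_integrable (\<lambda>r \<omega>. l1 * (1 + (yb r \<omega>)\<^sup>2) + l2 * (1 + energy r \<omega> (z r \<omega>)))" using yb_sq z_Q_integrable by simp
    show "(\<lambda>p. h (fst p) (snd p)) \<in> borel_measurable Q"
      unfolding h_def
      by (intro borel_measurable_add borel_measurable_times borel_measurable_const borel_measurable_abs yb_Q
          measurable_compose[OF energy_Q[OF z_Q] borel_measurable_sqrt])
    show "\<bar>h r \<omega>\<bar> \<le> 1 * \<bar>l1 * (1 + (yb r \<omega>)\<^sup>2) + l2 * (1 + energy r \<omega> (z r \<omega>))\<bar>" if "r \<in> {0..T}" "\<omega> \<in> space P" for r \<omega>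
    proof -
      have e: "0 \<le> energy r \<omega> (z r \<omega>)" using that energy_nonneg by auto
      have "l1 * \<bar>yb r \<omega>\<bar> \<le> l1 * (1 + (yb r \<omega>)\<^sup>2)"
        using le_one_plus_square[of "\<bar>yb r \<omega>\<bar>"] l by simp
      moreover have "l2 * sqrt (energy r \<omega> (z r \<omega>)) \<le> l2 * (1 + energy r \<omega> (z r \<omega>))"
        using le_one_plus_square[of "sqrt (energy r \<omega> (z r \<omega>))"] l e by simp
      moreover have "0 \<le> h r \<omega>" unfolding h_def using l e by simp
      ultimately show ?thesis unfolding h_def by simp
    qed
  qed
  have increments: "AE \<omega> in P. \<forall>a b. 0 \<le> a \<longrightarrow> a \<le> b \<longrightarrow> b \<le> T \<longrightarrow>
      integrable L (\<lambda>r. indicator {a<..b} r * g r \<omega>) \<and>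
      Y1 b \<omega> - Y2 b \<omega> = (Y1 a \<omega> - Y2 a \<omega>) - (\<integral>r. indicator {a<..b} r * g r \<omega> \<partial>L) + (I b \<omega> - I a \<omega>)"
    using I1(3) I2(3)
  proof eventually_elim
    case (elim \<omega>)
    show ?case
    proof (intro allI impI)
      fix a b assume ab: "0 \<le> a" "a \<le> b" "b \<le> T"
      let ?g1 = "\<lambda>r. indicator {a<..b} r * f1 \<omega> r (Y1 r \<omega>) (Z1 r \<omega>)" and ?g2 = "\<lambda>r. indicator {a<..b} r * f2 \<omega> r (Y2 r \<omega>) (Z2 r \<omega>)"
      have 1: "integrable L ?g1" "Y1 b \<omega> = Y1 a \<omega> - (\<integral>r. ?g1 r \<partial>L) + (I1 b \<omega> - I1 a \<omega>)"
        using elim(1) ab by blast+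
      have 2: "integrable L ?g2" "Y2 b \<omega> = Y2 a \<omega> - (\<integral>r. ?g2 r \<partial>L) + (I2 b \<omega> - I2 a \<omega>)"
        using elim(2) ab by blast+
      have gg: "(\<lambda>r. indicator {a<..b} r * g r \<omega>) = (\<lambda>r. ?g1 r - ?g2 r)"
        by (simp add: g_def right_diff_distrib)
      have "(\<integral>r. indicator {a<..b} r * g r \<omega> \<partial>L) = (\<integral>r. ?g1 r \<partial>L) - (\<integral>r. ?g2 r \<partial>L)"
        unfolding gg by (rule Bochner_Integration.integral_diff[OF 1(1) 2(1)])
      moreover have "integrable L (\<lambda>r. indicator {a<..b} r * g r \<omega>)"
        unfolding gg by (rule Bochner_Integration.integrable_diff[OF 1(1) 2(1)])
      ultimately show "integrable L (\<lambda>r. indicator {a<..b} r * g r \<omega>) \<and>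
        Y1 b \<omega> - Y2 b \<omega> = (Y1 a \<omega> - Y2 a \<omega>) - (\<integral>r. indicator {a<..b} r * g r \<omega> \<partial>L) + (I b \<omega> - I a \<omega>)"
        using 1(2) 2(2) unfolding I_def by linarith
    qed
  qed
  have bounds: "AE \<omega> in P. AE r in L. g r \<omega> \<le> h r \<omega> \<and> \<bar>f1 \<omega> r (Y1 r \<omega>) (Z1 r \<omega>) - f1 \<omega> r (Y2 r \<omega>) (Z2 r \<omega>)\<bar> \<le> h r \<omega>"
    using lipschitz f_le yb_eq AE_space
  proof eventually_elim
    case (elim \<omega>)
    have "AE r in lborel. r \<in> {0..T} \<longrightarrow> g r \<omega> \<le> h r \<omega> \<and> \<bar>f1 \<omega> r (Y1 r \<omega>) (Z1 r \<omega>) - f1 \<omega> r (Y2 r \<omega>) (Z2 r \<omega>)\<bar> \<le> h r \<omega>"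
      using elim(2)
    proof (rule eventually_mono, intro impI)
      fix r assume le: "r \<in> {0..T} \<longrightarrow> f1 \<omega> r (Y2 r \<omega>) (Z2 r \<omega>) \<le> f2 \<omega> r (Y2 r \<omega>) (Z2 r \<omega>)" and r: "r \<in> {0..T}"
      have "\<bar>f1 \<omega> r (Y1 r \<omega>) (Z1 r \<omega>) - f1 \<omega> r (Y2 r \<omega>) (Z2 r \<omega>)\<bar>
          \<le> l1 * \<bar>Y1 r \<omega> - Y2 r \<omega>\<bar> + l2 * chain_seminorm X A r \<omega> (Z1 r \<omega> - Z2 r \<omega>)"
        using elim(1) r by blast
      also have "\<dots> = h r \<omega>"
        using elim(3,4) r by (simp add: h_def z_def chain_seminorm_eq)
      finally have "\<bar>f1 \<omega> r (Y1 r \<omega>) (Z1 r \<omega>) - f1 \<omega> r (Y2 r \<omega>) (Z2 r \<omega>)\<bar> \<le> h r \<omega>" .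
      then show "g r \<omega> \<le> h r \<omega> \<and> \<bar>f1 \<omega> r (Y1 r \<omega>) (Z1 r \<omega>) - f1 \<omega> r (Y2 r \<omega>) (Z2 r \<omega>)\<bar> \<le> h r \<omega>"
        using le r unfolding g_def by linarith
    qed
    then show ?case by (simp only: AE_L_iff)
  qed
  have xi: "AE \<omega> in P. Y1 T \<omega> - Y2 T \<omega> = \<xi>1 \<omega> - \<xi>2 \<omega>"
    using I1(2) I2(2) by eventually_elim simp
  have YT_sq: "sq_int (\<lambda>\<omega>. Y1 T \<omega> - Y2 T \<omega>)"
  proof -
    have sq: "sq_int V" if V: "V \<in> borel_measurable (F T)" and eq: "AE \<omega> in P. V \<omega> = \<xi> \<omega>" and i: "integrable P (\<lambda>\<omega>. \<bar>\<xi> \<omega>\<bar>\<^sup>2)"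
      for V \<xi> :: "'w \<Rightarrow> real"
    proof -
      have m: "V \<in> borel_measurable P" by (rule measurable_F_P[OF V])
      have "integrable P (\<lambda>\<omega>. (V \<omega>)\<^sup>2)"
      proof (rule Bochner_Integration.integrable_bound[OF i])
        show "AE \<omega> in P. norm ((V \<omega>)\<^sup>2) \<le> norm (\<bar>\<xi> \<omega>\<bar>\<^sup>2)" using eq by eventually_elim simp
      qed (rule borel_measurable_power[OF m])
      then show ?thesis using m by simp
    qed
    have "sq_int (Y1 T)" by (rule sq[OF Y1(1)[OF TT] I1(2) xi1])
    moreover have "sq_int (Y2 T)" by (rule sq[OF Y2(1)[OF TT] I2(2) xi2])
    ultimately show ?thesis by (rule sq_int_diff)
  qed
  have Y0_sq: "sq_int (\<lambda>\<omega>. Y1 0 \<omega> - Y2 0 \<omega>)"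
  proof -
    have m: "(\<lambda>\<omega>. Y1 0 \<omega> - Y2 0 \<omega>) \<in> borel_measurable (F 0)" by (rule borel_measurable_diff[OF Y1(1)[OF T0] Y2(1)[OF T0]])
    obtain C where "\<forall>\<omega>\<in>space P. \<bar>Y1 0 \<omega> - Y2 0 \<omega>\<bar> \<le> C" using F_0_bounded[OF m] by blast
    then show ?thesis by (intro sq_int_bounded[OF measurable_F_P[OF m]]) blast
  qed
  have "dominated_drift P X A T c (\<lambda>t \<omega>. Y1 t \<omega> - Y2 t \<omega>) yb z I l1 l2"
  proof
    show "0 \<le> l1" "0 \<le> l2" using l by auto
    show "(\<lambda>\<omega>. Y1 t \<omega> - Y2 t \<omega>) \<in> borel_measurable (F t)" if "t \<in> {0..T}" for t
      by (rule borel_measurable_diff[OF Y1(1)[OF that] Y2(1)[OF that]])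
    show "integrable P (\<lambda>\<omega>. (Y1 0 \<omega> - Y2 0 \<omega>)\<^sup>2)" using Y0_sq by simp
    show "integrable P (\<lambda>\<omega>. (Y1 T \<omega> - Y2 T \<omega>)\<^sup>2)" using YT_sq by simp
    show "(\<lambda>p. yb (fst p) (snd p)) \<in> borel_measurable Q" by (rule yb_Q)
    show "Q_integrable (\<lambda>r \<omega>. (yb r \<omega>)\<^sup>2)" by (rule yb_sq)
    show "AE \<omega> in P. \<forall>r\<in>{0..T}. yb r \<omega> = Y1 r \<omega> - Y2 r \<omega>" by (rule yb_eq)
    show "integral_process z I" by (rule I)
    show "AE \<omega> in P. Y1 T \<omega> - Y2 T \<omega> \<le> 0"
      using xi xi_le by eventually_elim simp
    show "AE \<omega> in P. \<forall>r\<in>{0..T}. \<forall>C. 11 / 10 * l2 * sqrt (energy r \<omega> C) \<le> 9 / 10 * (\<Sum>j\<in>UNIV. rate r \<omega> j * \<bar>jump C r \<omega> j\<bar>)"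
      using small AE_space
    proof eventually_elim
      case (elim \<omega>)
      show ?case
      proof (intro ballI allI)
        fix r C assume r: "r \<in> {0..T}"
        have "l2 * frob_norm (pseudoinverse (Psi X A r \<omega>)) * sqrt (6 * m) \<le> 1" using elim(1) r by blast
        then show "11 / 10 * l2 * sqrt (energy r \<omega> C) \<le> 9 / 10 * (\<Sum>j\<in>UNIV. rate r \<omega> j * \<bar>jump C r \<omega> j\<bar>)"
          by (rule small_imp_dominated[OF r elim(2) m(1) m(2)[OF r] l(2)])
      qed
    qed
    show "AE \<omega> in P. \<forall>a b. 0 \<le> a \<longrightarrow> a \<le> b \<longrightarrow> b \<le> T \<longrightarrow>
      Y1 a \<omega> - Y2 a \<omega> - (\<integral>r. indicator {a<..b} r * (l1 * \<bar>yb r \<omega>\<bar> + l2 * sqrt (energy r \<omega> (z r \<omega>))) \<partial>L)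
        + (I b \<omega> - I a \<omega>) \<le> Y1 b \<omega> - Y2 b \<omega>"
      using increments bounds AE_path_integrable[OF h_Q_integrable]
    proof eventually_elim
      case (elim \<omega>)
      show ?case
      proof (intro allI impI)
        fix a b assume ab: "0 \<le> a" "a \<le> b" "b \<le> T"
        have gi: "integrable L (\<lambda>r. indicator {a<..b} r * g r \<omega>)"
          and eq: "Y1 b \<omega> - Y2 b \<omega> = (Y1 a \<omega> - Y2 a \<omega>) - (\<integral>r. indicator {a<..b} r * g r \<omega> \<partial>L) + (I b \<omega> - I a \<omega>)"
          using elim(1) ab by blast+
        have hi: "integrable L (\<lambda>r. indicator {a<..b} r * h r \<omega>)" using elim(3) by blast
        have "(\<integral>r. indicator {a<..b} r * g r \<omega> \<partial>L) \<le> (\<integral>r. indicator {a<..b} r * h r \<omega> \<partial>L)"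
        proof (rule integral_mono_AE[OF gi hi])
          show "AE r in L. indicator {a<..b} r * g r \<omega> \<le> indicator {a<..b} r * h r \<omega>"
            using elim(2) by (rule eventually_mono) (simp add: indicator_def)
        qed
        then show "Y1 a \<omega> - Y2 a \<omega> - (\<integral>r. indicator {a<..b} r * (l1 * \<bar>yb r \<omega>\<bar> + l2 * sqrt (energy r \<omega> (z r \<omega>))) \<partial>L)
          + (I b \<omega> - I a \<omega>) \<le> Y1 b \<omega> - Y2 b \<omega>"
          using eq unfolding h_def by linarith
      qed
    qed
  qed
  moreover have "AE \<omega> in P. integrable L (\<lambda>r. indicator {0<..T} r * g r \<omega>) \<and>
      (Y1 T \<omega> - Y2 T \<omega>) - (Y1 0 \<omega> - Y2 0 \<omega>) = - (\<integral>r. indicator {0<..T} r * g r \<omega> \<partial>L) + (I T \<omega> - I 0 \<omega>)"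
    using increments
  proof eventually_elim
    case (elim \<omega>)
    have "integrable L (\<lambda>r. indicator {0<..T} r * g r \<omega>) \<and>
      Y1 T \<omega> - Y2 T \<omega> = (Y1 0 \<omega> - Y2 0 \<omega>) - (\<integral>r. indicator {0<..T} r * g r \<omega> \<partial>L) + (I T \<omega> - I 0 \<omega>)"
      using elim T_pos by simp
    then show ?case by simp
  qed
  ultimately show thesis
    using that[of yb I] bounds xi unfolding z_def[abs_def] g_def h_def by blast
qed

text \<open>The process \<open>Y1 - Y2\<close> is nonpositive at each time, hence at all rational times, hence everywhere by
  right-continuity. If it starts at zero, it vanishes together with the drift bound \<open>h\<close> and the
  defect \<open>K\<close>; then the drift \<open>f1 (Y1, Z1) - f2 (Y2, Z2)\<close> vanishes, and so does the Lipschitz bound for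
  \<open>f1 (Y1, Z1) - f1 (Y2, Z2)\<close>.\<close>

theorem bsde_comparison:
  assumes sol1: "bsde_solution P X A T f1 \<xi>1 Y1 Z1" and sol2: "bsde_solution P X A T f2 \<xi>2 Y2 Z2"
    and xi1: "integrable P (\<lambda>\<omega>. \<bar>\<xi>1 \<omega>\<bar>\<^sup>2)" and xi2: "integrable P (\<lambda>\<omega>. \<bar>\<xi>2 \<omega>\<bar>\<^sup>2)"
    and m: "0 < m" "\<And>t. t \<in> {0..T} \<Longrightarrow> frob_norm (A t) \<le> m"
    and l: "0 < l1" "0 < l2"
    and lipschitz: "AE \<omega> in P. \<forall>t\<in>{0..T}. \<forall>y1 y2 z1 z2.
          \<bar>f1 \<omega> t y1 z1 - f1 \<omega> t y2 z2\<bar> \<le> l1 * \<bar>y1 - y2\<bar> + l2 * chain_seminorm X A t \<omega> (z1 - z2)"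
    and small: "AE \<omega> in P. \<forall>t\<in>{0..T}. l2 * frob_norm (pseudoinverse (Psi X A t \<omega>)) * sqrt (6 * m) \<le> 1"
    and xi_le: "AE \<omega> in P. \<xi>1 \<omega> \<le> \<xi>2 \<omega>"
    and f_le: "AE \<omega> in P. AE t in lborel. t \<in> {0..T} \<longrightarrow>
          f1 \<omega> t (Y2 t \<omega>) (Z2 t \<omega>) \<le> f2 \<omega> t (Y2 t \<omega>) (Z2 t \<omega>)"
  shows "AE \<omega> in P. \<forall>t\<in>{0..T}. Y1 t \<omega> \<le> Y2 t \<omega>"
    and "AE \<omega> in P. Y1 0 \<omega> = Y2 0 \<omega> \<Longrightarrow>
      (AE \<omega> in P. AE t in lborel. t \<in> {0..T} \<longrightarrow> f1 \<omega> t (Y2 t \<omega>) (Z2 t \<omega>) = f2 \<omega> t (Y2 t \<omega>) (Z2 t \<omega>)) \<and>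
      (AE \<omega> in P. \<xi>1 \<omega> = \<xi>2 \<omega>)"
proof -
  obtain yb I where dom: "dominated_drift P X A T c (\<lambda>t \<omega>. Y1 t \<omega> - Y2 t \<omega>) yb (\<lambda>r \<omega>. Z1 r \<omega> - Z2 r \<omega>) I l1 l2"
    and total: "AE \<omega> in P. integrable L (\<lambda>r. indicator {0<..T} r * (f1 \<omega> r (Y1 r \<omega>) (Z1 r \<omega>) - f2 \<omega> r (Y2 r \<omega>) (Z2 r \<omega>))) \<and>
      (Y1 T \<omega> - Y2 T \<omega>) - (Y1 0 \<omega> - Y2 0 \<omega>)
        = - (\<integral>r. indicator {0<..T} r * (f1 \<omega> r (Y1 r \<omega>) (Z1 r \<omega>) - f2 \<omega> r (Y2 r \<omega>) (Z2 r \<omega>)) \<partial>L) + (I T \<omega> - I 0 \<omega>)"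
    and bounds: "AE \<omega> in P. AE r in L. f1 \<omega> r (Y1 r \<omega>) (Z1 r \<omega>) - f2 \<omega> r (Y2 r \<omega>) (Z2 r \<omega>)
        \<le> l1 * \<bar>yb r \<omega>\<bar> + l2 * sqrt (energy r \<omega> (Z1 r \<omega> - Z2 r \<omega>)) \<and>
      \<bar>f1 \<omega> r (Y1 r \<omega>) (Z1 r \<omega>) - f1 \<omega> r (Y2 r \<omega>) (Z2 r \<omega>)\<bar>
        \<le> l1 * \<bar>yb r \<omega>\<bar> + l2 * sqrt (energy r \<omega> (Z1 r \<omega> - Z2 r \<omega>))"
    and xi: "AE \<omega> in P. Y1 T \<omega> - Y2 T \<omega> = \<xi>1 \<omega> - \<xi>2 \<omega>"
    using bsde_difference[OF assms] .
  interpret d: dominated_drift P X A T c "\<lambda>t \<omega>. Y1 t \<omega> - Y2 t \<omega>" yb "\<lambda>r \<omega>. Z1 r \<omega> - Z2 r \<omega>" I l1 l2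
    by (rule dom)
  have TT: "T \<in> {0..T}" using T_pos by auto
  have rcll1: "AE \<omega> in P. rcll_on {0..T} (\<lambda>t. Y1 t \<omega>)" and rcll2: "AE \<omega> in P. rcll_on {0..T} (\<lambda>t. Y2 t \<omega>)"
    using sol1 sol2 unfolding bsde_solution_def by blast+
  have rat: "AE \<omega> in P. \<forall>q\<in>\<rat> \<inter> {0..T}. Y1 q \<omega> - Y2 q \<omega> \<le> 0"
    using d.nonpositive by (subst AE_ball_countable) (auto intro: countable_subset[OF _ countable_rat])
  show "AE \<omega> in P. \<forall>t\<in>{0..T}. Y1 t \<omega> \<le> Y2 t \<omega>"
    using rcll1 rcll2 rat d.nonpositive[OF TT]
  proof eventually_elim
    case (elim \<omega>)
    show ?case
    proof
      fix t assume t: "t \<in> {0..T}"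
      have "(\<lambda>t. Y1 t \<omega> - Y2 t \<omega>) t \<le> 0"
      proof (rule rcll_nonpos_everywhere[OF _ _ _ t])
        show "continuous (at u within {0..T} \<inter> {u..}) (\<lambda>t. Y1 t \<omega> - Y2 t \<omega>)" if "u \<in> {0..T}" for u
          using elim(1,2) that unfolding rcll_on_def by (intro continuous_diff) auto
        show "Y1 q \<omega> - Y2 q \<omega> \<le> 0" if "q \<in> \<rat>" "q \<in> {0..T}" for q using elim(3) that by blast
        show "Y1 T \<omega> - Y2 T \<omega> \<le> 0" by (rule elim(4))
      qed
      then show "Y1 t \<omega> \<le> Y2 t \<omega>" by simp
    qed
  qed
  assume "AE \<omega> in P. Y1 0 \<omega> = Y2 0 \<omega>"
  then have y0: "AE \<omega> in P. Y1 0 \<omega> - Y2 0 \<omega> = 0" by eventually_elim simp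
  have "AE \<omega> in P. \<xi>1 \<omega> = \<xi>2 \<omega>"
    using d.zero_if_zero_at_start[OF y0 TT] xi by eventually_elim simp
  moreover have "AE \<omega> in P. AE t in lborel. t \<in> {0..T} \<longrightarrow> f1 \<omega> t (Y2 t \<omega>) (Z2 t \<omega>) = f2 \<omega> t (Y2 t \<omega>) (Z2 t \<omega>)"
    using d.rigid_if_zero_at_start[OF y0 l(2)] total bounds AE_path_integrable[OF d.h_Q_integrable] AE_space
  proof eventually_elim
    case (elim \<omega>)
    let ?g = "\<lambda>r. f1 \<omega> r (Y1 r \<omega>) (Z1 r \<omega>) - f2 \<omega> r (Y2 r \<omega>) (Z2 r \<omega>)"
    let ?ind = "\<lambda>r. indicator {0<..T} r :: real"
    have hi: "integrable L (\<lambda>r. ?ind r * d.h r \<omega>)" using elim(5) by blast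
    have gi: "integrable L (\<lambda>r. ?ind r * ?g r)" using elim(3) by blast
    have H0: "(\<integral>r. ?ind r * d.h r \<omega> \<partial>L) = 0" using elim(1) unfolding d.H_def .
    have h_nonneg: "AE r in L. 0 \<le> ?ind r * d.h r \<omega>"
      using d.h_nonneg elim(6) by (intro AE_I2 mult_nonneg_nonneg) auto
    have h0: "AE r in L. ?ind r * d.h r \<omega> = 0"
      using integral_nonneg_eq_0_iff_AE[OF hi h_nonneg] H0 by simp
    have le: "AE r in L. ?g r \<le> d.h r \<omega> \<and> \<bar>f1 \<omega> r (Y1 r \<omega>) (Z1 r \<omega>) - f1 \<omega> r (Y2 r \<omega>) (Z2 r \<omega>)\<bar> \<le> d.h r \<omega>"
      using elim(4) unfolding d.h_def .
    \<comment> \<open>\<open>K\<close> measures how far the drift stays below its bound; both \<open>K\<close> and the bound vanish\<close>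
    have "(\<integral>r. ?ind r * d.h r \<omega> - ?ind r * ?g r \<partial>L) = d.K 0 T \<omega>"
      using elim(3) hi gi unfolding d.K_def d.H_def by simp
    then have K0: "(\<integral>r. ?ind r * d.h r \<omega> - ?ind r * ?g r \<partial>L) = 0" using elim(2) by simp
    have k_nonneg: "AE r in L. 0 \<le> ?ind r * d.h r \<omega> - ?ind r * ?g r"
      using le by eventually_elim (simp add: indicator_def)
    have k0: "AE r in L. ?ind r * d.h r \<omega> - ?ind r * ?g r = 0"
      using integral_nonneg_eq_0_iff_AE[OF Bochner_Integration.integrable_diff[OF hi gi] k_nonneg] K0 by simp
    have "AE r in lborel. r \<noteq> (0::real)" by (rule AE_lborel_singleton)
    then have "AE r in L. r \<noteq> 0" unfolding AE_L_iff by (rule eventually_mono) simp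
    with h0 k0 le AE_space have "AE r in L. f1 \<omega> r (Y2 r \<omega>) (Z2 r \<omega>) = f2 \<omega> r (Y2 r \<omega>) (Z2 r \<omega>)"
    proof eventually_elim
      case (elim r)
      then have "?ind r = 1" by (auto simp: indicator_def)
      then have "d.h r \<omega> = 0" "?g r = 0" using elim(1,2) by simp_all
      then show ?case using elim(3) by simp
    qed
    then show ?case by (simp only: AE_L_iff)
  qed
  ultimately show "(AE \<omega> in P. AE t in lborel. t \<in> {0..T} \<longrightarrow> f1 \<omega> t (Y2 t \<omega>) (Z2 t \<omega>) = f2 \<omega> t (Y2 t \<omega>) (Z2 t \<omega>)) \<and>
      (AE \<omega> in P. \<xi>1 \<omega> = \<xi>2 \<omega>)" by blast
qed

text \<open>A driver that agrees with \<open>f2\<close> along the solution may replace it. Measurability of the path of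
  \<open>f1\<close> does not follow from almost everywhere equality and is where predictability of the driver
  enters.\<close>

lemma bsde_solution_cong:
  assumes sol: "bsde_solution P X A T f2 \<xi>2 Y Z" and pred: "predictable_driver P F T f1"
    and f: "AE \<omega> in P. AE t in lborel. t \<in> {0..T} \<longrightarrow> f1 \<omega> t (Y t \<omega>) (Z t \<omega>) = f2 \<omega> t (Y t \<omega>) (Z t \<omega>)"
    and xi: "AE \<omega> in P. \<xi>1 \<omega> = \<xi>2 \<omega>"
  shows "bsde_solution P X A T f1 \<xi>1 Y Z"
proof -
  have Y: "\<And>t. t \<in> {0..T} \<Longrightarrow> Y t \<in> borel_measurable (F t)" "AE \<omega> in P. rcll_on {0..T} (\<lambda>t. Y t \<omega>)"
    "(\<integral>\<^sup>+\<omega>. (\<integral>\<^sup>+s\<in>{0..T}. ennreal (\<bar>Y s \<omega>\<bar>\<^sup>2) \<partial>lborel) \<partial>P) < \<infinity>"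
    and Z: "predictable_process P F T Z"
    and int: "AE \<omega> in P. set_integrable lborel {0..T} (\<lambda>s. f2 \<omega> s (Y s \<omega>) (Z s \<omega>))"
    using sol unfolding bsde_solution_def by blast+
  obtain I where I: "is_stochastic_integral P X A T Z I"
    and eq: "AE \<omega> in P. \<forall>t\<in>{0..T}. Y t \<omega> = \<xi>2 \<omega> + (LINT s:{t..T}|lborel. f2 \<omega> s (Y s \<omega>) (Z s \<omega>)) - (I T \<omega> - I t \<omega>)"
    using sol unfolding bsde_solution_def by blast
  obtain Yb where Yb: "(\<lambda>p. Yb (fst p) (snd p)) \<in> borel_measurable Q" "AE \<omega> in P. \<forall>r\<in>{0..T}. Yb r \<omega> = Y r \<omega>"
    using rcll_version[OF Y] .
  have int1: "AE \<omega> in P. set_integrable lborel {0..T} (\<lambda>s. f1 \<omega> s (Y s \<omega>) (Z s \<omega>))"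
    using int f Yb(2) AE_space
  proof eventually_elim
    case (elim \<omega>)
    have Y_path: "(\<lambda>s. Y s \<omega>) \<in> borel_measurable L"
    proof -
      have "(\<lambda>s. Yb s \<omega>) \<in> borel_measurable L" by (rule path_measurable[OF Yb(1) elim(4)])
      moreover have "(\<lambda>s. Yb s \<omega>) \<in> borel_measurable L \<longleftrightarrow> (\<lambda>s. Y s \<omega>) \<in> borel_measurable L"
        using elim(3) by (intro measurable_cong) simp
      ultimately show ?thesis by simp
    qed
    have Z_path: "(\<lambda>s. Z s \<omega>) \<in> borel_measurable L" by (rule path_measurable[OF predictable_Q[OF Z] elim(4)])
    have "(\<lambda>s. (s, \<omega>)) \<in> L \<rightarrow>\<^sub>M predictable_sigma P F T"
      using measurable_compose[OF measurable_Pair2'[OF elim(4)] identity_predictable] .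
    then have "(\<lambda>s. ((s, \<omega>), Y s \<omega>, Z s \<omega>)) \<in> L \<rightarrow>\<^sub>M predictable_sigma P F T \<Otimes>\<^sub>M (borel \<Otimes>\<^sub>M borel)"
      using Y_path Z_path by (intro measurable_Pair)
    from measurable_compose[OF this pred[unfolded predictable_driver_def]]
    have "(\<lambda>s. f1 \<omega> s (Y s \<omega>) (Z s \<omega>)) \<in> borel_measurable L" by simp
    then have m: "(\<lambda>s. indicator {0..T} s *\<^sub>R f1 \<omega> s (Y s \<omega>) (Z s \<omega>)) \<in> borel_measurable lborel"
      by (subst (asm) borel_measurable_restrict_space_iff) auto
    show ?case
      unfolding set_integrable_def
    proof (rule integrable_cong_AE_imp[OF _ m])
      show "integrable lborel (\<lambda>s. indicator {0..T} s *\<^sub>R f2 \<omega> s (Y s \<omega>) (Z s \<omega>))"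
        using elim(1) unfolding set_integrable_def .
      show "AE s in lborel. indicator {0..T} s *\<^sub>R f2 \<omega> s (Y s \<omega>) (Z s \<omega>) = indicator {0..T} s *\<^sub>R f1 \<omega> s (Y s \<omega>) (Z s \<omega>)"
        using elim(2) by (rule eventually_mono) (simp add: indicator_def)
    qed
  qed
  have "AE \<omega> in P. \<forall>t\<in>{0..T}. Y t \<omega> = \<xi>1 \<omega> + (LINT s:{t..T}|lborel. f1 \<omega> s (Y s \<omega>) (Z s \<omega>)) - (I T \<omega> - I t \<omega>)"
    using eq int int1 f xi
  proof eventually_elim
    case (elim \<omega>)
    show ?case
    proof
      fix t assume t: "t \<in> {0..T}"
      have "set_integrable lborel {t..T} (\<lambda>s. f1 \<omega> s (Y s \<omega>) (Z s \<omega>))" "set_integrable lborel {t..T} (\<lambda>s. f2 \<omega> s (Y s \<omega>) (Z s \<omega>))"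
        using t by (auto intro!: set_integrable_subset[OF elim(2)] set_integrable_subset[OF elim(3)])
      then have "(LINT s:{t..T}|lborel. f1 \<omega> s (Y s \<omega>) (Z s \<omega>)) = (LINT s:{t..T}|lborel. f2 \<omega> s (Y s \<omega>) (Z s \<omega>))"
        unfolding set_lebesgue_integral_def set_integrable_def
      proof (intro integral_cong_AE borel_measurable_integrable)
        show "AE s in lborel. indicator {t..T} s *\<^sub>R f1 \<omega> s (Y s \<omega>) (Z s \<omega>) = indicator {t..T} s *\<^sub>R f2 \<omega> s (Y s \<omega>) (Z s \<omega>)"
          using elim(4) by (rule eventually_mono) (use t in \<open>simp add: indicator_def\<close>)
      qed
      then show "Y t \<omega> = \<xi>1 \<omega> + (LINT s:{t..T}|lborel. f1 \<omega> s (Y s \<omega>) (Z s \<omega>)) - (I T \<omega> - I t \<omega>)"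
        using elim(1,5) t by simp
    qed
  qed
  then show ?thesis
    using sol int1 I unfolding bsde_solution_def by blast
qed

end

lemma markov_chain_horizon:
  fixes P :: "'w measure" and X :: "real \<Rightarrow> 'w \<Rightarrow> real ^ 'n" and A :: "real \<Rightarrow> real ^ 'n ^ 'n"
  assumes chain: "markov_chain P X A" and T: "0 < T"
  obtains c where "chain_horizon P X A T c"
proof -
  have "\<exists>b. \<forall>t\<ge>0. \<forall>i j. \<bar>A t $ i $ j\<bar> \<le> b"
    using markov_chain.rates[OF chain] unfolding rate_matrix_def by (elim conjE)
  then obtain b where b: "\<forall>t\<ge>0. \<forall>i j. \<bar>A t $ i $ j\<bar> \<le> b" by (elim exE)
  have bound: "(\<Sum>j\<in>UNIV. \<bar>A t $ j $ i\<bar>) \<le> real CARD('n) * \<bar>b\<bar> + 1" if "0 \<le> t" for t :: real and i :: 'n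
  proof -
    have "(\<Sum>j\<in>UNIV. \<bar>A t $ j $ i\<bar>) \<le> (\<Sum>j\<in>(UNIV :: 'n set). \<bar>b\<bar>)"
      by (rule sum_mono) (rule order_trans[OF b[rule_format, OF that] abs_ge_self])
    then show ?thesis by simp
  qed
  have pos: "0 < real CARD('n) * \<bar>b\<bar> + 1" by (simp add: add_nonneg_pos)
  have "chain_horizon P X A T (real CARD('n) * \<bar>b\<bar> + 1)"
    by (rule chain_horizon.intro[OF chain], rule chain_horizon_axioms.intro[OF T pos bound])
  then show thesis by (rule that)
qed

theorem theorem3p3:
  fixes P :: "'w measure"
    and X :: "real \<Rightarrow> 'w \<Rightarrow> real ^ 'n"
    and A :: "real \<Rightarrow> real ^ 'n ^ 'n"
    and T m l1 l2 :: real
    and \<xi>1 \<xi>2 :: "'w \<Rightarrow> real"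
    and f1 f2 :: "'w \<Rightarrow> real \<Rightarrow> real \<Rightarrow> real ^ 'n \<Rightarrow> real"
    and Y1 Y2 :: "real \<Rightarrow> 'w \<Rightarrow> real"
    and Z1 Z2 :: "real \<Rightarrow> 'w \<Rightarrow> real ^ 'n"
  assumes chain: "markov_chain P X A"
    and T: "0 < T"
    and m: "0 < m" "\<forall>t\<in>{0..T}. frob_norm (A t) \<le> m"
    and xi1: "\<xi>1 \<in> borel_measurable (natural_filtration P X T)" "integrable P (\<lambda>\<omega>. \<bar>\<xi>1 \<omega>\<bar>\<^sup>2)"
    and xi2: "\<xi>2 \<in> borel_measurable (natural_filtration P X T)" "integrable P (\<lambda>\<omega>. \<bar>\<xi>2 \<omega>\<bar>\<^sup>2)"
    and drivers: "predictable_driver P (natural_filtration P X) T f1"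
                 "predictable_driver P (natural_filtration P X) T f2"
    and sol1: "bsde_unique_solution P X A T f1 \<xi>1 Y1 Z1"
    and sol2: "bsde_unique_solution P X A T f2 \<xi>2 Y2 Z2"
    and l: "0 < l1" "0 < l2"
    and lipschitz: "AE \<omega> in P. \<forall>t\<in>{0..T}. \<forall>y1 y2 z1 z2.
          \<bar>f1 \<omega> t y1 z1 - f1 \<omega> t y2 z2\<bar>
            \<le> l1 * \<bar>y1 - y2\<bar> + l2 * chain_seminorm X A t \<omega> (z1 - z2)"
    and small: "AE \<omega> in P. \<forall>t\<in>{0..T}.
          l2 * frob_norm (pseudoinverse (Psi X A t \<omega>)) * sqrt (6 * m) \<le> 1"
    and xi_le: "AE \<omega> in P. \<xi>1 \<omega> \<le> \<xi>2 \<omega>"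
    and f_le: "AE \<omega> in P. AE t in lborel. t \<in> {0..T} \<longrightarrow>
          f1 \<omega> t (Y2 t \<omega>) (Z2 t \<omega>) \<le> f2 \<omega> t (Y2 t \<omega>) (Z2 t \<omega>)"
  shows "(AE \<omega> in P. \<forall>t\<in>{0..T}. Y1 t \<omega> \<le> Y2 t \<omega>) \<and>
         ((AE \<omega> in P. \<forall>t\<in>{0..T}.
             l2 * frob_norm (pseudoinverse (Psi X A t \<omega>)) * sqrt (6 * m) < 1) \<longrightarrow>
          ((AE \<omega> in P. Y1 0 \<omega> = Y2 0 \<omega>) \<longleftrightarrow>
           (AE \<omega> in P. AE t in lborel. t \<in> {0..T} \<longrightarrow>
              f1 \<omega> t (Y2 t \<omega>) (Z2 t \<omega>) = f2 \<omega> t (Y2 t \<omega>) (Z2 t \<omega>)) \<and>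
           (AE \<omega> in P. \<xi>1 \<omega> = \<xi>2 \<omega>)))"
proof -
  obtain c where "chain_horizon P X A T c" using markov_chain_horizon[OF chain T] .
  then interpret chain_horizon P X A T c .
  have s1: "bsde_solution P X A T f1 \<xi>1 Y1 Z1" and s2: "bsde_solution P X A T f2 \<xi>2 Y2 Z2"
    using sol1 sol2 unfolding bsde_unique_solution_def by blast+
  note comparison = bsde_comparison[OF s1 s2 xi1(2) xi2(2) m(1) m(2)[rule_format] l lipschitz small xi_le f_le]
  let ?f = "AE \<omega> in P. AE t in lborel. t \<in> {0..T} \<longrightarrow>
              f1 \<omega> t (Y2 t \<omega>) (Z2 t \<omega>) = f2 \<omega> t (Y2 t \<omega>) (Z2 t \<omega>)"
  have converse: "AE \<omega> in P. Y1 0 \<omega> = Y2 0 \<omega>" if f: ?f and xi: "AE \<omega> in P. \<xi>1 \<omega> = \<xi>2 \<omega>"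
  proof -
    have "bsde_solution P X A T f1 \<xi>1 Y2 Z2" by (rule bsde_solution_cong[OF s2 drivers(1) f xi])
    then have "AE \<omega> in P. \<forall>t\<in>{0..T}. Y2 t \<omega> = Y1 t \<omega>"
      using sol1 unfolding bsde_unique_solution_def by blast
    then show ?thesis by eventually_elim (use T in simp)
  qed
  show ?thesis
  proof (intro conjI impI iffI)
    show "AE \<omega> in P. \<forall>t\<in>{0..T}. Y1 t \<omega> \<le> Y2 t \<omega>" by (rule comparison(1))
  next
    assume "AE \<omega> in P. Y1 0 \<omega> = Y2 0 \<omega>"
    then have equal: "?f \<and> (AE \<omega> in P. \<xi>1 \<omega> = \<xi>2 \<omega>)" by (rule comparison(2)[rotated])
    show ?f by (rule equal[THEN conjunct1])
    show "AE \<omega> in P. \<xi>1 \<omega> = \<xi>2 \<omega>" by (rule equal[THEN conjunct2])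
  next
    assume "?f \<and> (AE \<omega> in P. \<xi>1 \<omega> = \<xi>2 \<omega>)"
    then show "AE \<omega> in P. Y1 0 \<omega> = Y2 0 \<omega>" by (elim conjE) (rule converse)
  qed
qed

end
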